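(* Let $X[-]:(\Delta D)^{\mathrm{op}}\to\mathrm{Sets}$ be a dihedral set. Then the geometric realization $|X[-]|$, as a set, is given by the filtered colimit $$\operatorname{colim}_{F\in\mathcal{F}'}\widetilde{X}[\pi_0(\mathbb{R}/\mathbb{Z}\setminus F)],$$ i.e. the canonical map from $|X[-]|$ to this colimit is a bijection. In particular, the group $\operatorname{Homeo}\mathbb{R}/\mathbb{Z}$ of all homeomorphisms of the circle $\mathbb{R}/\mathbb{Z}$ (including orientation-reversing ones) acts continuously on $|X[-]|$, the action of $\alpha$ being the map $\rho_\alpha$ determined on the colimit by $\rho_\alpha\circ\mathrm{in}_F=\mathrm{in}_{\alpha(F)}\circ\widetilde{X}[\alpha_F^{-1}]$ for all $F\in\mathcal{F}'$.
   Context: **$\mathbb{Z}_+$-categories.** Let $\mathbb{Z}_+$ be the additive monoid of non-negative integers. A $\mathbb{Z}_+$-category is a category $\mathcal{C}$ with a nontrivial monoid map $\mathbb{Z}_+\to\operatorname{End}(\operatorname{id}_{\mathcal{C}})$, i.e. a non-identity endomorphism $1_c:c\to c$ for each object $c$ with $f\circ 1_{c_1}=1_{c_2}\circ f$ for every $f:c_1\to c_2$. A (covariant) $\mathbb{Z}_+$-functor is a functor preserving the structural endomorphisms. $\mathcal{C}^{\mathrm{op}}$ is a $\mathbb{Z}_+$-category with $1_c=(1_c)^{\mathrm{op}}$; a contravariant $\mathbb{Z}_+$-functor $\mathcal{C}\to\mathcal{D}$ is a $\mathbb{Z}_+$-functor $\mathcal{C}\to\mathcal{D}^{\mathrm{op}}$.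 The circle $\mathbb{R}/\mathbb{Z}$ is a $\mathbb{Z}_+$-category: objects are points; morphisms $x\to y$ are homotopy classes of paths from $x$ to $y$ of the form $[0,1]\to\mathbb{R}\to\mathbb{R}/\mathbb{Z}$, with the first map continuous non-decreasing and the second the projection; $1_x$ is the class of degree 1 loops at $x$. For a finite subset $F\subset\mathbb{R}/\mathbb{Z}$, $\pi_0(\mathbb{R}/\mathbb{Z}\setminus F)$ is the $\mathbb{Z}_+$-category whose objects are the connected components, with $\operatorname{Hom}(c,d)=\operatorname{Hom}_{\mathbb{R}/\mathbb{Z}}(x_c,x_d)$ for chosen $x_c\in c$, $x_d\in d$. For $F\subset G$ there is an evident $\mathbb{Z}_+$-functor $\pi_0(\mathbb{R}/\mathbb{Z}\setminus G)\to\pi_0(\mathbb{R}/\mathbb{Z}\setminus F)$. For a finite nonempty linearly ordered set $\mathcal{A}=\{a_0<\dots<a_n\}$, $\mathcal{A}_{\mathrm{cyc}}$ is the $\mathbb{Z}_+$-category with objects those of $\mathcal{A}$ and morphisms generated by those of $\mathcal{A}$ and one new generator $a_n\to a_0$, with $1_{a_i}:a_i\to a_n\to a_0\to a_i$. It is functorial for order-preserving maps. With $[n]=\{0<\dots<n\}$, $[n]_{\mathrm{cyc}}$ is identified with the full subcategory of $\mathbb{R}/\mathbb{Z}$ on $0,\tfrac1{n+1},\dots,\tfrac n{n+1}$. If $F\subset[0,1]$ is finite and contains $0$ or $1$, with image $\overline F\subset\mathbb{R}/\mathbb{Z}$, then $\pi_0([0,1]\setminus F)_{\mathrm{cyc}}=\pi_0(\mathbb{R}/\mathbb{Z}\setminus\overline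 F)$, where $\pi_0([0,1]\setminus F)$ is ordered by $[x]\le[y]$ if $x\le y$. **Dihedral sets.** $\Delta D$ (resp. $\Delta_{\mathrm{big}}D$) is the category whose objects are the $[n]_{\mathrm{cyc}}$, $n\ge0$ (resp. all small $\mathbb{Z}_+$-categories isomorphic to some $[n]_{\mathrm{cyc}}$), and whose morphism sets are the disjoint unions of the sets of covariant and of contravariant $\mathbb{Z}_+$-functors (no functor counts as both); composition is composition of functors, with the composite of two functors of the same variance covariant and of different variances contravariant. A dihedral set is a functor $X[-]:(\Delta D)^{\mathrm{op}}\to\mathrm{Sets}$. $\widetilde X[-]:(\Delta_{\mathrm{big}}D)^{\mathrm{op}}\to\mathrm{Sets}$ is its extension along the equivalence $\Delta D\subset\Delta_{\mathrm{big}}D$ (unique up to unique isomorphism restricting to the identity). **Realization.** Let $\Delta$ be the category of the $[n]$ and order-preserving maps, embedded in $\Delta D$ by $[n]\mapsto[n]_{\mathrm{cyc}}$, $f\mapsto f_{\mathrm{cyc}}$. $|X[-]|$ is the geometric realization of the underlying simplicial set, $\coprod_n X[n]\times\Delta[n]/\sim$, where $\Delta[n]=\{(z_0,\dots,z_n)\in[0,1]^{n+1}\mid\sum z_i=1\}$, $X[n]$ is discrete, and $\sim$ is generated by $(x,\theta_*z)\sim(\theta^*x,z)$. **Index category and canonical map.** $\mathcal{F}'$ is the set of finite subsets of $\mathbb{R}/\mathbb{Z}$, viewed as a category by inclusions; $\mathrm{in}_F$ is the canonical map $\widetilde X[\pi_0(\mathbb{R}/\mathbb{Z}\setminus F)]\to\operatorname{colim}$.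 The canonical map sends the class of $(\xi,z)\in X[n]\times\Delta[n]$ to $\mathrm{in}_{\overline F}(\widetilde X[f_{\mathrm{cyc}}](\xi))$, where $x_0=0$, $x_i=z_0+\dots+z_{i-1}$ (so $x_{n+1}=1$), $F=\{x_0,\dots,x_{n+1}\}$, and $f:\pi_0([0,1]\setminus F)\to[n]$ sends the component $(x_i,x_{i+1})$ (when nonempty) to $i$. **Action.** A homeomorphism $\alpha$ of $\mathbb{R}/\mathbb{Z}$ induces a covariant (if orientation-preserving) or contravariant (if orientation-reversing) $\mathbb{Z}_+$-isomorphism $\alpha_F:\pi_0(\mathbb{R}/\mathbb{Z}\setminus F)\to\pi_0(\mathbb{R}/\mathbb{Z}\setminus\alpha(F))$. **Continuity.** $\mathcal{K}$ is the category of $k$-spaces (spaces in which all compactly open subsets are open). $\operatorname{Homeo}\mathbb{R}/\mathbb{Z}$ has the subspace topology in $\operatorname{Hom}_{\mathcal{K}}(\mathbb{R}/\mathbb{Z},\mathbb{R}/\mathbb{Z})$ with its standard $k$-space (compact-open) topology. The action is continuous if $\operatorname{Homeo}\mathbb{R}/\mathbb{Z}\times|X[-]|\to|X[-]|$ is a continuous map of $k$-spaces, the product being taken in $\mathcal{K}$.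
   Formalization: The index set F' is taken to be the nonempty finite subsets of R/Z: for F = ∅ there are no compatible transition functors π_0(R/Z∖G) → π_0(R/Z), since {a} ⊂ {a,b} ⊃ {b} would force contradictory degrees, so the diagram is undefined there. *)

theory Defs
  imports "HOL-Analysis.Analysis" "HOL-Homology.Simplices" "HOL-Algebra.Group_Action"
begin

section \<open>The circle\<close>

quotient_type circle = real / "\<lambda>x y. x - y \<in> \<int>"
proof (rule equivpI)
  show "reflp (\<lambda>x y::real. x - y \<in> \<int>)"
    by (simp add: reflp_def)
  show "symp (\<lambda>x y::real. x - y \<in> \<int>)"
    by (metis (mono_tags, lifting) Ints_minus minus_diff_eq sympI)
  show "transp (\<lambda>x y::real. x - y \<in> \<int>)"
    by (rule transpI) (metis Ints_add diff_add_cancel add_diff_eq)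
qed

abbreviation proj :: "real \<Rightarrow> circle" where
  "proj \<equiv> abs_circle"

instantiation circle :: topological_space
begin

definition open_circle :: "circle set \<Rightarrow> bool" where
  "open_circle U \<longleftrightarrow> open (proj -` U)"

instance
proof
  show "open (UNIV :: circle set)"
    by (simp add: open_circle_def)
  show "open (S \<inter> T)" if "open S" "open T" for S T :: "circle set"
    using that by (simp add: open_circle_def vimage_Int open_Int)
  show "open (\<Union>K)" if "\<forall>S\<in>K. open S" for K :: "circle set set"
    using that by (auto simp: open_circle_def vimage_Union)
qed

end

section \<open>\<open>\<int>\<^sub>+\<close>-categories and \<open>\<int>\<^sub>+\<close>-functors\<close>

record ('o, 'm) zcat =
  Obj :: "'o set"
  Arr :: "'m set"
  Dom :: "'m \<Rightarrow> 'o"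
  Cod :: "'m \<Rightarrow> 'o"
  Id :: "'o \<Rightarrow> 'm"
  Comp :: "'m \<Rightarrow> 'm \<Rightarrow> 'm"  \<comment> \<open>\<open>Comp C g f\<close> is \<open>g \<circ> f\<close>\<close>
  One :: "'o \<Rightarrow> 'm"

locale small_category =
  fixes C :: "('o, 'm) zcat"
  assumes Dom_Obj: "f \<in> Arr C \<Longrightarrow> Dom C f \<in> Obj C"
    and Cod_Obj: "f \<in> Arr C \<Longrightarrow> Cod C f \<in> Obj C"
    and Id_Arr: "x \<in> Obj C \<Longrightarrow> Id C x \<in> Arr C \<and> Dom C (Id C x) = x \<and> Cod C (Id C x) = x"
    and Comp_Arr: "\<lbrakk>f \<in> Arr C; g \<in> Arr C; Cod C f = Dom C g\<rbrakk> \<Longrightarrow>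
      Comp C g f \<in> Arr C \<and> Dom C (Comp C g f) = Dom C f \<and> Cod C (Comp C g f) = Cod C g"
    and Comp_Id: "f \<in> Arr C \<Longrightarrow> Comp C f (Id C (Dom C f)) = f"
    and Id_Comp: "f \<in> Arr C \<Longrightarrow> Comp C (Id C (Cod C f)) f = f"
    and Comp_assoc: "\<lbrakk>f \<in> Arr C; g \<in> Arr C; h \<in> Arr C; Cod C f = Dom C g; Cod C g = Dom C h\<rbrakk> \<Longrightarrow>
      Comp C h (Comp C g f) = Comp C (Comp C h g) f"

locale zcategory = small_category C for C :: "('o, 'm) zcat" +
  assumes One_Arr: "x \<in> Obj C \<Longrightarrow> One C x \<in> Arr C \<and> Dom C (One C x) = x \<and> Cod C (One C x) = x"
    and One_neq_Id: "x \<in> Obj C \<Longrightarrow> One C x \<noteq> Id C x"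
    and One_natural: "f \<in> Arr C \<Longrightarrow> Comp C f (One C (Dom C f)) = Comp C (One C (Cod C f)) f"

definition op_zcat :: "('o, 'm) zcat \<Rightarrow> ('o, 'm) zcat" where
  "op_zcat C = \<lparr>Obj = Obj C, Arr = Arr C, Dom = Cod C, Cod = Dom C, Id = Id C,
     Comp = (\<lambda>g f. Comp C f g), One = One C\<rparr>"

text \<open>A functor is the pair of its object map and its arrow map, both extensional, so that
  equality of functors is equality in HOL.\<close>

type_synonym ('o, 'm, 'p, 'n) zfun = "('o \<Rightarrow> 'p) \<times> ('m \<Rightarrow> 'n)"

definition zfunctors :: "('o, 'm) zcat \<Rightarrow> ('p, 'n) zcat \<Rightarrow> ('o, 'm, 'p, 'n) zfun set" where
  "zfunctors C D = {(F, T). F \<in> Obj C \<rightarrow>\<^sub>E Obj D \<and> T \<in> Arr C \<rightarrow>\<^sub>E Arr D \<and>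
     (\<forall>f\<in>Arr C. Dom D (T f) = F (Dom C f) \<and> Cod D (T f) = F (Cod C f)) \<and>
     (\<forall>x\<in>Obj C. T (Id C x) = Id D (F x)) \<and>
     (\<forall>f\<in>Arr C. \<forall>g\<in>Arr C. Cod C f = Dom C g \<longrightarrow> T (Comp C g f) = Comp D (T g) (T f)) \<and>
     (\<forall>x\<in>Obj C. T (One C x) = One D (F x))}"

definition zfun_id :: "('o, 'm) zcat \<Rightarrow> ('o, 'm, 'o, 'm) zfun" where
  "zfun_id C = (\<lambda>x\<in>Obj C. x, \<lambda>f\<in>Arr C. f)"

definition zfun_comp :: "('o, 'm) zcat \<Rightarrow> ('p, 'n, 'q, 'l) zfun \<Rightarrow> ('o, 'm, 'p, 'n) zfun
    \<Rightarrow> ('o, 'm, 'q, 'l) zfun" where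
  "zfun_comp C G F = (compose (Obj C) (fst G) (fst F), compose (Arr C) (snd G) (snd F))"

text \<open>The tags make the union of covariant and contravariant functors disjoint.\<close>

datatype 'f dmor = Cov 'f | Contra 'f

definition dhom :: "('o, 'm) zcat \<Rightarrow> ('p, 'n) zcat \<Rightarrow> ('o, 'm, 'p, 'n) zfun dmor set" where
  "dhom C D = Cov ` zfunctors C D \<union> Contra ` zfunctors C (op_zcat D)"

definition did :: "('o, 'm) zcat \<Rightarrow> ('o, 'm, 'o, 'm) zfun dmor" where
  "did C = Cov (zfun_id C)"

text \<open>Passing to the opposite functor does not change the object and arrow maps.\<close>

fun dcomp :: "('o, 'm) zcat \<Rightarrow> ('p, 'n, 'q, 'l) zfun dmor \<Rightarrow> ('o, 'm, 'p, 'n) zfun dmor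
    \<Rightarrow> ('o, 'm, 'q, 'l) zfun dmor" where
  "dcomp C (Cov G) (Cov F) = Cov (zfun_comp C G F)"
| "dcomp C (Cov G) (Contra F) = Contra (zfun_comp C G F)"
| "dcomp C (Contra G) (Cov F) = Contra (zfun_comp C G F)"
| "dcomp C (Contra G) (Contra F) = Cov (zfun_comp C G F)"

definition is_dinv :: "('o, 'm) zcat \<Rightarrow> ('p, 'n) zcat \<Rightarrow> ('o, 'm, 'p, 'n) zfun dmor
    \<Rightarrow> ('p, 'n, 'o, 'm) zfun dmor \<Rightarrow> bool" where
  "is_dinv C D \<phi> \<psi> \<longleftrightarrow>
     \<phi> \<in> dhom C D \<and> \<psi> \<in> dhom D C \<and> dcomp C \<psi> \<phi> = did C \<and> dcomp D \<phi> \<psi> = did D"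

definition dinv :: "('o, 'm) zcat \<Rightarrow> ('p, 'n) zcat \<Rightarrow> ('o, 'm, 'p, 'n) zfun dmor
    \<Rightarrow> ('p, 'n, 'o, 'm) zfun dmor" where
  "dinv C D \<phi> = (THE \<psi>. is_dinv C D \<phi> \<psi>)"

definition zcat_iso :: "('o, 'm) zcat \<Rightarrow> ('p, 'n) zcat \<Rightarrow> bool" where
  "zcat_iso C D \<longleftrightarrow> (\<exists>F G. is_dinv C D (Cov F) (Cov G))"

section \<open>The circle as a \<open>\<int>\<^sub>+\<close>-category\<close>

definition monotone_paths :: "(real \<Rightarrow> circle) set" where
  "monotone_paths = {p. \<exists>g. continuous_on {0..1} g \<and> mono_on {0..1} g \<and>
     (\<forall>t\<in>{0..1}. p t = proj (g t))}"

text \<open>The class of a path among the monotone paths; it is also used for paths that are only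
  homotopic to a monotone one.\<close>

definition path_class :: "(real \<Rightarrow> circle) \<Rightarrow> (real \<Rightarrow> circle) set" where
  "path_class p = {q \<in> monotone_paths. homotopic_paths UNIV p q}"

definition circle_cat :: "(circle, (real \<Rightarrow> circle) set) zcat" where
  "circle_cat = \<lparr>Obj = UNIV, Arr = path_class ` monotone_paths,
     Dom = (\<lambda>A. pathstart (SOME p. p \<in> A)), Cod = (\<lambda>A. pathfinish (SOME p. p \<in> A)),
     Id = (\<lambda>x. path_class (\<lambda>t. x)),
     Comp = (\<lambda>B A. \<Union>p\<in>A. \<Union>q\<in>B. path_class (p +++ q)),
     One = (\<lambda>x. path_class (\<lambda>t. proj (rep_circle x + t)))\<rparr>"

section \<open>The categories of interest\<close>

text \<open>A single type of objects and a single type of arrows which serve as the universe of small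
  categories: \<open>Vertex i\<close> is the element \<open>i\<close> of \<open>[n]\<close>, \<open>Interval I\<close> is a component of the complement
  of a finite subset of \<open>[0,1]\<close>, and \<open>Arc c\<close> is a component of the complement of a finite subset of
  the circle.\<close>

datatype uobj = Vertex nat | Interval "real set" | Arc "circle set"

text \<open>\<open>Word a k b\<close> is the arrow \<open>a \<rightarrow> b\<close> of a category \<open>\<A>\<^sub>c\<^sub>y\<^sub>c\<close> in which the generator from the
  last to the first object occurs \<open>k\<close> times; \<open>Path A\<close> is an arrow of the circle.\<close>

datatype uarr = Word uobj nat uobj | Path "(real \<Rightarrow> circle) set"

type_synonym ucat = "(uobj, uarr) zcat"
type_synonym ufun = "(uobj, uarr, uobj, uarr) zfun"

subsection \<open>The construction \<open>\<A>\<^sub>c\<^sub>y\<^sub>c\<close>\<close>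

text \<open>For a linear order \<open>r\<close> on \<open>A\<close>, the composites of arrows of the poset with \<open>k\<close> copies of the
  new generator are determined by source, target and \<open>k\<close>: between two consecutive copies there is
  exactly one arrow, the one from the first to the last object. For \<open>k = 0\<close> the poset must have an
  arrow from the source to the target, for \<open>k \<ge> 1\<close> there is no condition.\<close>

definition cyc :: "uobj set \<Rightarrow> (uobj \<Rightarrow> uobj \<Rightarrow> bool) \<Rightarrow> ucat" where
  "cyc A r = \<lparr>Obj = A, Arr = {Word a k b | a k b. a \<in> A \<and> b \<in> A \<and> (k = 0 \<longrightarrow> r a b)},
     Dom = (\<lambda>f. case f of Word a k b \<Rightarrow> a), Cod = (\<lambda>f. case f of Word a k b \<Rightarrow> b),
     Id = (\<lambda>a. Word a 0 a),
     Comp = (\<lambda>g f. case (f, g) of (Word a k b, Word b' l c) \<Rightarrow> Word a (k + l) c),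
     One = (\<lambda>a. Word a 1 a)\<rparr>"

definition cyc_fun :: "uobj set \<Rightarrow> (uobj \<Rightarrow> uobj \<Rightarrow> bool) \<Rightarrow> (uobj \<Rightarrow> uobj) \<Rightarrow> ufun" where
  "cyc_fun A r f =
     (restrict f A, \<lambda>w\<in>Arr (cyc A r). case w of Word a k b \<Rightarrow> Word (f a) k (f b))"

text \<open>For a linear order on a finite set with first element \<open>a0\<close> and last element \<open>an\<close>, \<open>cyc A r\<close>
  is the category generated by the poset \<open>A\<close> and one new arrow \<open>an \<rightarrow> a0\<close>.\<close>

lemma cyc_universal:
  assumes r: "\<And>a. a \<in> A \<Longrightarrow> r a a"
      "\<And>a b c. \<lbrakk>a \<in> A; b \<in> A; c \<in> A; r a b; r b c\<rbrakk> \<Longrightarrow> r a c"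
    and ends: "a0 \<in> A" "an \<in> A" "\<And>a. a \<in> A \<Longrightarrow> r a0 a \<and> r a an"
    and D: "small_category D"
    and F: "F \<in> A \<rightarrow> Obj D"
    and P: "\<And>a b. \<lbrakk>a \<in> A; b \<in> A; r a b\<rbrakk> \<Longrightarrow>
        P a b \<in> Arr D \<and> Dom D (P a b) = F a \<and> Cod D (P a b) = F b"
      "\<And>a. a \<in> A \<Longrightarrow> P a a = Id D (F a)"
      "\<And>a b c. \<lbrakk>a \<in> A; b \<in> A; c \<in> A; r a b; r b c\<rbrakk> \<Longrightarrow> Comp D (P b c) (P a b) = P a c"
    and t: "t \<in> Arr D" "Dom D t = F an" "Cod D t = F a0"
  shows "\<exists>!T. T \<in> Arr (cyc A r) \<rightarrow>\<^sub>E Arr D \<and>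
     (\<forall>f\<in>Arr (cyc A r). Dom D (T f) = F (Dom (cyc A r) f) \<and> Cod D (T f) = F (Cod (cyc A r) f)) \<and>
     (\<forall>f\<in>Arr (cyc A r). \<forall>g\<in>Arr (cyc A r). Cod (cyc A r) f = Dom (cyc A r) g \<longrightarrow>
        T (Comp (cyc A r) g f) = Comp D (T g) (T f)) \<and>
     (\<forall>a\<in>A. \<forall>b\<in>A. r a b \<longrightarrow> T (Word a 0 b) = P a b) \<and> T (Word an 1 a0) = t"
proof -
  interpret small_category D by fact
  let ?C = "cyc A r"
  let ?c = "Comp D"
  define H where "H f x y \<longleftrightarrow> f \<in> Arr D \<and> Dom D f = x \<and> Cod D f = y" for f x y
  define is_T where "is_T T \<longleftrightarrow> T \<in> Arr ?C \<rightarrow>\<^sub>E Arr D \<and>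
     (\<forall>f\<in>Arr ?C. Dom D (T f) = F (Dom ?C f) \<and> Cod D (T f) = F (Cod ?C f)) \<and>
     (\<forall>f\<in>Arr ?C. \<forall>g\<in>Arr ?C. Cod ?C f = Dom ?C g \<longrightarrow> T (Comp ?C g f) = ?c (T g) (T f)) \<and>
     (\<forall>a\<in>A. \<forall>b\<in>A. r a b \<longrightarrow> T (Word a 0 b) = P a b) \<and> T (Word an 1 a0) = t" for T
  have Hc: "H (?c g f) x z" if "H f x y" "H g y z" for f g x y z
    using that Comp_Arr by (auto simp: H_def)
  have Ha: "?c h (?c g f) = ?c (?c h g) f" if "H f x y" "H g y z" "H h z w" for f g h x y z w
    using that Comp_assoc by (auto simp: H_def)
  have HP: "H (P a b) (F a) (F b)" if "a \<in> A" "b \<in> A" "r a b" for a b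
    using that P(1) by (auto simp: H_def)
  have Ht: "H t (F an) (F a0)"
    using t by (simp add: H_def)
  define s where "s = ?c t (P a0 an)"
  have Hs: "H s (F a0) (F a0)"
    unfolding s_def using Hc HP Ht ends by blast
  define S where "S = rec_nat (Id D (F a0)) (\<lambda>_ f. ?c s f)"
  have S0: "S 0 = Id D (F a0)" and SS: "S (Suc j) = ?c s (S j)" for j
    by (simp_all add: S_def)
  have HS: "H (S j) (F a0) (F a0)" for j
  proof (induction j)
    case 0 then show ?case using Id_Arr F ends by (auto simp: S0 H_def)
  next
    case (Suc j) then show ?case using Hc Hs SS by metis
  qed
  define R where "R a j = ?c (S j) (?c t (P a an))" for a j
  have HtP: "H (?c t (P a an)) (F a) (F a0)" if "a \<in> A" for a
    using that Hc HP Ht ends by blast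
  have HR: "H (R a j) (F a) (F a0)" if "a \<in> A" for a j
    unfolding R_def using that Hc HtP HS by blast
  have RS: "R a (Suc j) = ?c s (R a j)" if "a \<in> A" for a j
    unfolding R_def SS using Ha[OF HtP[OF that] HS Hs] by simp
  have R0: "R a 0 = ?c t (P a an)" if "a \<in> A" for a
    using HtP[OF that] Id_Comp[of "?c t (P a an)"] by (auto simp: R_def S0 H_def)
  have RP: "?c (R b j) (P a b) = R a j" if "a \<in> A" "b \<in> A" "r a b" for a b j
  proof -
    have "?c (R b j) (P a b) = ?c (S j) (?c (?c t (P b an)) (P a b))"
      unfolding R_def using Ha[OF HP[OF that] HtP[OF that(2)] HS] by simp
    also have "?c (?c t (P b an)) (P a b) = ?c t (P a an)"
      using Ha[OF HP[OF that] HP[OF that(2) ends(2)] Ht] P(3) that ends by simp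
    finally show ?thesis unfolding R_def .
  qed
  have RR: "?c (R b l) (?c (P a0 b) (R a k)) = R a (Suc (k + l))" if "a \<in> A" "b \<in> A" for a b k l
  proof (induction l)
    case 0
    have "?c (R b 0) (?c (P a0 b) (R a k)) = ?c (?c (R b 0) (P a0 b)) (R a k)"
      using Ha[OF HR[OF that(1)] HP HR] that ends by blast
    also have "?c (R b 0) (P a0 b) = s"
      using RP[OF ends(1) that(2)] ends that R0[OF ends(1)] by (simp add: s_def)
    finally show ?case using RS[OF that(1)] by simp
  next
    case (Suc l)
    have "H (?c (P a0 b) (R a k)) (F a) (F b)"
      using Hc[OF HR[OF that(1)] HP] that ends by blast
    from Ha[OF this HR[OF that(2)] Hs] show ?case
      by (metis Suc RS[OF that(2)] RS[OF that(1)] add_Suc_right)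
  qed
  define T where "T = (\<lambda>w\<in>Arr ?C. case w of Word a k b \<Rightarrow>
    (case k of 0 \<Rightarrow> P a b | Suc j \<Rightarrow> ?c (P a0 b) (R a j)))"
  have T0: "T (Word a 0 b) = P a b" if "a \<in> A" "b \<in> A" "r a b" for a b
    using that by (simp add: T_def cyc_def)
  have TS: "T (Word a (Suc j) b) = ?c (P a0 b) (R a j)" if "a \<in> A" "b \<in> A" for a b j
    using that by (simp add: T_def cyc_def)
  have HT: "H (T (Word a k b)) (F a) (F b)" if "a \<in> A" "b \<in> A" "k = 0 \<longrightarrow> r a b" for a b k
  proof (cases k)
    case 0
    then show ?thesis using that HP T0 by simp
  next
    case (Suc j)
    have "H (?c (P a0 b) (R a j)) (F a) (F b)"
      using Hc[OF HR[OF that(1)] HP[OF ends(1) that(2)]] ends(3)[OF that(2)] by blast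
    then show ?thesis using TS[OF that(1,2)] Suc by simp
  qed
  have TT: "T (Word a (k + l) c) = ?c (T (Word b l c)) (T (Word a k b))"
    if abc: "a \<in> A" "b \<in> A" "c \<in> A" and kl: "k = 0 \<longrightarrow> r a b" "l = 0 \<longrightarrow> r b c" for a b c k l
  proof -
    have r0: "r a0 a" "r a0 b" "r a0 c" using ends abc by blast+
    consider "k = 0" "l = 0" | j where "k = 0" "l = Suc j" | i where "k = Suc i" "l = 0"
      | i j where "k = Suc i" "l = Suc j" by (meson not0_implies_Suc)
    then show ?thesis
    proof cases
      case 1
      then have "r a b" "r b c" "r a c" using kl r(2)[OF abc] by auto
      then show ?thesis using 1 abc T0[of a b] T0[of b c] T0[of a c] P(3)[OF abc] by simp
    next
      case 2
      then have ab: "r a b" using kl by simp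
      have "?c (P a0 c) (R a j) = ?c (?c (P a0 c) (R b j)) (P a b)"
        using Ha[OF HP[OF abc(1,2) ab] HR[OF abc(2)] HP[OF ends(1) abc(3) r0(3)], of j]
          RP[OF abc(1,2) ab, of j] by metis
      then show ?thesis
        using 2 TS[OF abc(1,3)] TS[OF abc(2,3)] T0[OF abc(1,2) ab] by simp
    next
      case 3
      then have bc: "r b c" using kl by simp
      have "?c (P a0 c) (R a i) = ?c (P b c) (?c (P a0 b) (R a i))"
        using Ha[OF HR[OF abc(1)] HP[OF ends(1) abc(2) r0(2)] HP[OF abc(2,3) bc], of i]
          P(3)[OF ends(1) abc(2,3) r0(2) bc] by metis
      then show ?thesis
        using 3 TS[OF abc(1,3)] TS[OF abc(1,2)] T0[OF abc(2,3) bc] by simp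
    next
      case 4
      have "?c (P a0 c) (R a (Suc (i + j))) = ?c (?c (P a0 c) (R b j)) (?c (P a0 b) (R a i))"
        using Ha[OF Hc[OF HR[OF abc(1)] HP[OF ends(1) abc(2) r0(2)]] HR[OF abc(2)]
            HP[OF ends(1) abc(3) r0(3)], of j i] RR[OF abc(1,2), of j i] by metis
      then show ?thesis
        using 4 TS[OF abc(1,3), of "Suc (i + j)"] TS[OF abc(1,2), of i] TS[OF abc(2,3), of j] by simp
    qed
  qed
  have ArrC: "w \<in> Arr ?C \<longleftrightarrow> (\<exists>a k b. w = Word a k b \<and> a \<in> A \<and> b \<in> A \<and> (k = 0 \<longrightarrow> r a b))"
    and DomC: "Dom ?C (Word a k b) = a" and CodC: "Cod ?C (Word a k b) = b"
    and CompC: "Comp ?C (Word b' l c) (Word a k b) = Word a (k + l) c" for w a k b b' l c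
    by (auto simp: cyc_def)
  have "is_T T"
    unfolding is_T_def
  proof (intro conjI ballI impI)
    show "T \<in> Arr ?C \<rightarrow>\<^sub>E Arr D"
      unfolding PiE_iff
    proof (intro conjI ballI)
      show "T \<in> extensional (Arr ?C)" unfolding T_def by (rule restrict_extensional)
      show "T w \<in> Arr D" if w: "w \<in> Arr ?C" for w
      proof -
        obtain a k b where "w = Word a k b" "a \<in> A" "b \<in> A" "k = 0 \<longrightarrow> r a b"
          using w unfolding ArrC by blast
        then show ?thesis using HT[of a b k] by (simp add: H_def)
      qed
    qed
    show "Dom D (T f) = F (Dom ?C f)" "Cod D (T f) = F (Cod ?C f)" if f: "f \<in> Arr ?C" for f
    proof -
      obtain a k b where "f = Word a k b" "a \<in> A" "b \<in> A" "k = 0 \<longrightarrow> r a b"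
        using f unfolding ArrC by blast
      then show "Dom D (T f) = F (Dom ?C f)" "Cod D (T f) = F (Cod ?C f)"
        using HT[of a b k] by (simp_all add: H_def DomC CodC)
    qed
    show "T (Comp ?C g f) = ?c (T g) (T f)"
      if f: "f \<in> Arr ?C" and g: "g \<in> Arr ?C" and fg: "Cod ?C f = Dom ?C g" for f g
    proof -
      obtain a k b where 1: "f = Word a k b" "a \<in> A" "b \<in> A" "k = 0 \<longrightarrow> r a b"
        using f unfolding ArrC by blast
      obtain b' l c where 2: "g = Word b' l c" "b' \<in> A" "c \<in> A" "l = 0 \<longrightarrow> r b' c"
        using g unfolding ArrC by blast
      have "b' = b" using fg 1 2 by (simp add: DomC CodC)
      then show ?thesis using TT[of a b c k l] 1 2 by (simp add: CompC)
    qed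
    show "T (Word a 0 b) = P a b" if "a \<in> A" "b \<in> A" "r a b" for a b
      using that by (rule T0)
    have "T (Word an 1 a0) = ?c (P a0 a0) (?c t (P an an))"
      using TS[OF ends(2,1), of 0] R0[OF ends(2)] by simp
    also have "\<dots> = t"
      using P(2)[OF ends(1)] P(2)[OF ends(2)] Comp_Id[of t] Id_Comp[of t] t by simp
    finally show "T (Word an 1 a0) = t" .
  qed
  have "T' = T" if T': "is_T T'" for T'
  proof (rule extensionalityI)
    show "T' \<in> extensional (Arr ?C)" "T \<in> extensional (Arr ?C)"
      using T' \<open>is_T T\<close> by (simp_all add: is_T_def PiE_iff)
    have C: "T' (Word a (k + l) c) = ?c (T' (Word b l c)) (T' (Word a k b))"
      if abc: "a \<in> A" "b \<in> A" "c \<in> A" "k = 0 \<longrightarrow> r a b" "l = 0 \<longrightarrow> r b c" for a b c k l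
    proof -
      have "Word a k b \<in> Arr ?C" "Word b l c \<in> Arr ?C"
        using abc unfolding ArrC by blast+
      moreover have "Cod ?C (Word a k b) = Dom ?C (Word b l c)" by (simp add: DomC CodC)
      ultimately have "T' (Comp ?C (Word b l c) (Word a k b)) = ?c (T' (Word b l c)) (T' (Word a k b))"
        using T' unfolding is_T_def by blast
      then show ?thesis by (simp add: CompC)
    qed
    have Z: "T' (Word a 0 b) = P a b" if "a \<in> A" "b \<in> A" "r a b" for a b
      using T' that by (simp add: is_T_def)
    have t': "T' (Word an 1 a0) = t"
      using T' by (simp add: is_T_def)
    have one: "T' (Word a (Suc 0) b) = ?c (P a0 b) (?c t (P a an))" if "a \<in> A" "b \<in> A" for a b
      using C[of a a0 b 1 0] C[of a an a0 0 1] Z[of a0 b] Z[of a an] t' that ends by simp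
    have T_one: "T (Word a (Suc 0) b) = ?c (P a0 b) (?c t (P a an))" if "a \<in> A" "b \<in> A" for a b
      using TS[OF that, of 0] R0 that by simp
    have "T' (Word a (Suc j) b) = T (Word a (Suc j) b)" if "a \<in> A" "b \<in> A" for a b j
      using that(2)
    proof (induction j arbitrary: b)
      case 0 then show ?case using one T_one that by simp
    next
      case (Suc j)
      then show ?case
        using C[of a a0 b "Suc j" 1] TT[of a a0 b "Suc j" 1] one[of a0 b] T_one[of a0 b] that ends
        by simp
    qed
    then have *: "T' (Word a k b) = T (Word a k b)"
      if "a \<in> A" "b \<in> A" "k = 0 \<longrightarrow> r a b" for a b k
      using that Z T0 by (cases k) simp_all
    show "T' w = T w" if w: "w \<in> Arr ?C" for w
    proof -
      obtain a k b where "w = Word a k b" "a \<in> A" "b \<in> A" "k = 0 \<longrightarrow> r a b"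
        using w unfolding ArrC by blast
      then show ?thesis using *[of a b k] by simp
    qed
  qed
  with \<open>is_T T\<close> have "\<exists>!T. is_T T" by blast
  then show ?thesis unfolding is_T_def .
qed

definition vertices :: "nat \<Rightarrow> uobj set" where
  "vertices n = Vertex ` {..n}"

definition vertex_le :: "uobj \<Rightarrow> uobj \<Rightarrow> bool" where
  "vertex_le u v \<longleftrightarrow> (\<exists>i j. u = Vertex i \<and> v = Vertex j \<and> i \<le> j)"

definition ncyc :: "nat \<Rightarrow> ucat" where
  "ncyc n = cyc (vertices n) vertex_le"

definition intervals :: "real set \<Rightarrow> uobj set" where
  "intervals F = Interval ` components ({0..1} - F)"

definition interval_le :: "uobj \<Rightarrow> uobj \<Rightarrow> bool" where
  "interval_le u v \<longleftrightarrow> (\<exists>I J. u = Interval I \<and> v = Interval J \<and> (\<exists>x\<in>I. \<exists>y\<in>J. x \<le> y))"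

definition interval_cyc :: "real set \<Rightarrow> ucat" where
  "interval_cyc F = cyc (intervals F) interval_le"

subsection \<open>Complements of finite subsets of the circle\<close>

definition pt :: "circle set \<Rightarrow> circle" where
  "pt c = (SOME x. x \<in> c)"

definition comp_of :: "circle set \<Rightarrow> circle \<Rightarrow> circle set" where
  "comp_of F x = connected_component_set (- F) x"

text \<open>An arrow \<open>c \<rightarrow> d\<close> is an arrow \<open>pt c \<rightarrow> pt d\<close> of the circle. The components are disjoint, so
  such an arrow determines \<open>c\<close> and \<open>d\<close>.\<close>

definition pi0 :: "circle set \<Rightarrow> ucat" where
  "pi0 F = \<lparr>Obj = Arc ` components (- F),
     Arr = Path ` {A \<in> Arr circle_cat. Dom circle_cat A \<in> pt ` components (- F) \<and>
       Cod circle_cat A \<in> pt ` components (- F)},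
     Dom = (\<lambda>f. case f of Path A \<Rightarrow> Arc (comp_of F (Dom circle_cat A))),
     Cod = (\<lambda>f. case f of Path A \<Rightarrow> Arc (comp_of F (Cod circle_cat A))),
     Id = (\<lambda>u. case u of Arc c \<Rightarrow> Path (Id circle_cat (pt c))),
     Comp = (\<lambda>g f. case (g, f) of (Path B, Path A) \<Rightarrow> Path (Comp circle_cat B A)),
     One = (\<lambda>u. case u of Arc c \<Rightarrow> Path (One circle_cat (pt c)))\<rparr>"

text \<open>A path \<open>q\<close> whose end points lie in components of the complement of \<open>F\<close> is turned into an arrow
  between the chosen points by adding paths inside the components. If \<open>F\<close> is finite and nonempty,
  the components are simply connected arcs and the choice of these paths is irrelevant.\<close>

definition adjust :: "circle set \<Rightarrow> (real \<Rightarrow> circle) \<Rightarrow> (real \<Rightarrow> circle) set" where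
  "adjust F q = \<Union>{path_class (reversepath d +++ q +++ e) | d e.
     path d \<and> path_image d \<subseteq> comp_of F (pathstart q) \<and>
     pathstart d = pathstart q \<and> pathfinish d = pt (comp_of F (pathstart q)) \<and>
     path e \<and> path_image e \<subseteq> comp_of F (pathfinish q) \<and>
     pathstart e = pathfinish q \<and> pathfinish e = pt (comp_of F (pathfinish q))}"

text \<open>The functors from \<open>pi0 G\<close> to \<open>pi0 F\<close> induced by a map \<open>\<phi>\<close> of the circle to itself which takes
  the complement of \<open>G\<close> to the complement of \<open>F\<close>; covariant for monotone \<open>\<phi>\<close>, contravariant for antitone \<open>\<phi>\<close>.\<close>

definition induced_cov :: "circle set \<Rightarrow> circle set \<Rightarrow> (circle \<Rightarrow> circle) \<Rightarrow> ufun" where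
  "induced_cov G F \<phi> =
     (\<lambda>u\<in>Obj (pi0 G). case u of Arc c \<Rightarrow> Arc (comp_of F (\<phi> (pt c))),
      \<lambda>f\<in>Arr (pi0 G). case f of Path A \<Rightarrow> Path (\<Union>p\<in>A. adjust F (\<phi> \<circ> p)))"

definition induced_contra :: "circle set \<Rightarrow> circle set \<Rightarrow> (circle \<Rightarrow> circle) \<Rightarrow> ufun" where
  "induced_contra G F \<phi> =
     (\<lambda>u\<in>Obj (pi0 G). case u of Arc c \<Rightarrow> Arc (comp_of F (\<phi> (pt c))),
      \<lambda>f\<in>Arr (pi0 G). case f of Path A \<Rightarrow> Path (\<Union>p\<in>A. adjust F (reversepath (\<phi> \<circ> p))))"

text \<open>The functor \<open>pi0 G \<rightarrow> pi0 F\<close> for \<open>F \<subseteq> G\<close>.\<close>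

definition forget :: "circle set \<Rightarrow> circle set \<Rightarrow> ufun dmor" where
  "forget G F = Cov (induced_cov G F id)"

text \<open>The identification of \<open>\<pi>\<^sub>0([0,1] - F)\<^sub>c\<^sub>y\<^sub>c\<close> with \<open>\<pi>\<^sub>0\<close> of the complement of the image of \<open>F\<close>, for
  \<open>F\<close> containing \<open>0\<close> or \<open>1\<close>. The arrow with \<open>k\<close> occurrences of the new generator corresponds to the
  paths which lift to a path from \<open>I\<close> to the \<open>k\<close>-th translate of \<open>J\<close>.\<close>

definition unroll :: "real set \<Rightarrow> ufun dmor" where
  "unroll F = Cov
     (\<lambda>u\<in>intervals F. case u of Interval I \<Rightarrow> Arc (proj ` I - proj ` F),
      \<lambda>f\<in>Arr (interval_cyc F). case f of Word (Interval I) k (Interval J) \<Rightarrow>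
        Path {p. \<exists>g. continuous_on {0..1} g \<and> mono_on {0..1} g \<and>
          (\<forall>t\<in>{0..1}. p t = proj (g t)) \<and> g 0 \<in> I \<and> g 1 - real k \<in> J \<and>
          proj (g 0) = pt (proj ` I - proj ` F) \<and> proj (g 1) = pt (proj ` J - proj ` F)})"

section \<open>Dihedral sets\<close>

definition DeltaD :: "ucat set" where
  "DeltaD = range ncyc"

definition DeltaD_big :: "ucat set" where
  "DeltaD_big = {C. zcategory C \<and> (\<exists>n. zcat_iso C (ncyc n))}"

text \<open>Contravariant functors from a full subcategory of the category of \<open>\<int>\<^sub>+\<close>-categories and
  functors of both variances to sets: \<open>Map_at X C D \<phi>\<close> is the map \<open>X D \<rightarrow> X C\<close> induced by
  \<open>\<phi> : C \<rightarrow> D\<close>.\<close>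

record 'x zpresheaf =
  Set_at :: "ucat \<Rightarrow> 'x set"
  Map_at :: "ucat \<Rightarrow> ucat \<Rightarrow> ufun dmor \<Rightarrow> 'x \<Rightarrow> 'x"

definition presheaf_on :: "ucat set \<Rightarrow> 'x zpresheaf \<Rightarrow> bool" where
  "presheaf_on \<O> X \<longleftrightarrow>
     (\<forall>C\<in>\<O>. \<forall>D\<in>\<O>. \<forall>\<phi>\<in>dhom C D. Map_at X C D \<phi> \<in> Set_at X D \<rightarrow> Set_at X C) \<and>
     (\<forall>C\<in>\<O>. \<forall>x\<in>Set_at X C. Map_at X C C (did C) x = x) \<and>
     (\<forall>C\<in>\<O>. \<forall>D\<in>\<O>. \<forall>E\<in>\<O>. \<forall>\<phi>\<in>dhom C D. \<forall>\<psi>\<in>dhom D E. \<forall>x\<in>Set_at X E.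
        Map_at X C E (dcomp C \<psi> \<phi>) x = Map_at X C D \<phi> (Map_at X D E \<psi> x))"

definition dihedral_set :: "'x zpresheaf \<Rightarrow> bool" where
  "dihedral_set X \<longleftrightarrow> presheaf_on DeltaD X"

definition dihedral_extension :: "'x zpresheaf \<Rightarrow> 'x zpresheaf \<Rightarrow> bool" where
  "dihedral_extension X Xt \<longleftrightarrow> presheaf_on DeltaD_big Xt \<and>
     (\<forall>C\<in>DeltaD. Set_at Xt C = Set_at X C) \<and>
     (\<forall>C\<in>DeltaD. \<forall>D\<in>DeltaD. \<forall>\<phi>\<in>dhom C D. \<forall>x\<in>Set_at X D. Map_at Xt C D \<phi> x = Map_at X C D \<phi> x)"

lemma op_op [simp]: "op_zcat (op_zcat C) = C"
  by (simp add: op_zcat_def)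

lemma zcategory_op: "zcategory C \<Longrightarrow> zcategory (op_zcat C)"
  unfolding zcategory_def small_category_def zcategory_axioms_def
  by (simp add: op_zcat_def)

lemma zfunctors_op: "zfunctors (op_zcat C) (op_zcat D) = zfunctors C D"
  by (auto simp: zfunctors_def op_zcat_def)

lemma zfun_comp_in:
  assumes "zcategory C" "F \<in> zfunctors C D" "G \<in> zfunctors D E"
  shows "zfun_comp C G F \<in> zfunctors C E"
proof -
  interpret zcategory C by fact
  show ?thesis
    using assms(2,3) Dom_Obj Cod_Obj Id_Arr Comp_Arr One_Arr
    by (auto simp: zfunctors_def zfun_comp_def compose_def PiE_iff split: prod.splits)
qed

lemma zfun_id_in:
  assumes "zcategory C" shows "zfun_id C \<in> zfunctors C C"
proof -
  interpret zcategory C by fact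
  show ?thesis
    using Dom_Obj Cod_Obj Id_Arr Comp_Arr One_Arr
    by (auto simp: zfunctors_def zfun_id_def)
qed

lemma dcomp_in:
  assumes "zcategory C" "\<phi> \<in> dhom C D" "\<psi> \<in> dhom D E"
  shows "dcomp C \<psi> \<phi> \<in> dhom C E"
proof -
  have "zfunctors (op_zcat D) E = zfunctors D (op_zcat E)"
    using zfunctors_op[of D "op_zcat E"] by simp
  moreover have "zfunctors (op_zcat D) (op_zcat E) = zfunctors D E"
    by (rule zfunctors_op)
  ultimately show ?thesis
    using assms zfun_comp_in[OF assms(1), of _ D _ E] zfun_comp_in[OF assms(1), of _ D _ "op_zcat E"]
      zfun_comp_in[OF assms(1), of _ "op_zcat D" _ E]
      zfun_comp_in[OF assms(1), of _ "op_zcat D" _ "op_zcat E"]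
    unfolding dhom_def by (elim UnE imageE) simp_all
qed

lemma did_in: "zcategory C \<Longrightarrow> did C \<in> dhom C C"
  by (simp add: did_def dhom_def zfun_id_in)

lemma zfun_comp_assoc:
  assumes "F \<in> zfunctors C D"
  shows "zfun_comp C H (zfun_comp C G F) = zfun_comp C (zfun_comp D H G) F"
  using assms by (auto simp: zfun_comp_def zfunctors_def compose_def PiE_iff fun_eq_iff)

lemma Obj_op [simp]: "Obj (op_zcat C) = Obj C" and Arr_op [simp]: "Arr (op_zcat C) = Arr C"
  by (simp_all add: op_zcat_def)

lemma zfun_comp_op [simp]: "zfun_comp (op_zcat C) = zfun_comp C"
  by (simp add: zfun_comp_def fun_eq_iff)

lemma dcomp_assoc:
  assumes "\<phi> \<in> dhom C D"
  shows "dcomp C \<eta> (dcomp C \<psi> \<phi>) = dcomp C (dcomp D \<eta> \<psi>) \<phi>"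
proof -
  obtain F E where "E = D \<or> E = op_zcat D" and F: "F \<in> zfunctors C E" and "\<phi> = Cov F \<or> \<phi> = Contra F"
    using assms by (auto simp: dhom_def)
  moreover have "zfun_comp C H (zfun_comp C G F) = zfun_comp C (zfun_comp D H G) F" for G H
    using zfun_comp_assoc[OF F, of H G] calculation(1) by auto
  ultimately show ?thesis
    by (cases \<eta>; cases \<psi>) auto
qed

lemma zfun_comp_id:
  assumes "F \<in> zfunctors C D"
  shows "zfun_comp C F (zfun_id C) = F" and "zfun_comp C (zfun_id D) F = F"
proof -
  obtain f t where F: "F = (f, t)" by (cases F)
  then have "f \<in> Obj C \<rightarrow> Obj D" "f \<in> extensional (Obj C)" "t \<in> Arr C \<rightarrow> Arr D" "t \<in> extensional (Arr C)"
    using assms by (auto simp: zfunctors_def PiE_def)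
  then show "zfun_comp C F (zfun_id C) = F" "zfun_comp C (zfun_id D) F = F"
    by (simp_all add: F zfun_comp_def zfun_id_def Id_compose compose_Id)
qed

lemma zfun_id_op [simp]: "zfun_id (op_zcat C) = zfun_id C"
  by (simp add: zfun_id_def)

lemma dcomp_did:
  assumes "\<phi> \<in> dhom C D"
  shows "dcomp C \<phi> (did C) = \<phi>" and "dcomp C (did D) \<phi> = \<phi>"
  using assms zfun_comp_id[of _ C D] zfun_comp_id[of _ C "op_zcat D"]
  by (auto simp: dhom_def did_def)

lemma zcategory_cyc:
  assumes "\<And>a. a \<in> A \<Longrightarrow> r a a"
    and "\<And>a b c. \<lbrakk>a \<in> A; b \<in> A; c \<in> A; r a b; r b c\<rbrakk> \<Longrightarrow> r a c"
  shows "zcategory (cyc A r)"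
  by unfold_locales (auto simp: cyc_def intro: assms)

lemma zcategory_ncyc: "zcategory (ncyc n)"
  unfolding ncyc_def by (rule zcategory_cyc) (auto simp: vertices_def vertex_le_def)

lemma is_dinv_did: "zcategory C \<Longrightarrow> is_dinv C C (did C) (did C)"
  by (simp add: is_dinv_def did_in dcomp_did)

lemma ncyc_in_DeltaD_big: "ncyc n \<in> DeltaD_big"
proof -
  have "is_dinv (ncyc n) (ncyc n) (Cov (zfun_id (ncyc n))) (Cov (zfun_id (ncyc n)))"
    using is_dinv_did[OF zcategory_ncyc] by (simp only: did_def)
  then have "zcat_iso (ncyc n) (ncyc n)"
    unfolding zcat_iso_def by (intro exI)
  then show ?thesis
    unfolding DeltaD_big_def using zcategory_ncyc by blast
qed

lemma DeltaD_subset: "DeltaD \<subseteq> DeltaD_big"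
  unfolding DeltaD_def using ncyc_in_DeltaD_big by blast

text \<open>Extensions exist, with values in the same type; uniqueness up to isomorphism is the usual
  argument.\<close>

lemma dihedral_extension_exists:
  assumes X: "dihedral_set X"
  shows "\<exists>Xt. dihedral_extension X Xt"
proof -
  have "\<exists>N \<phi> \<psi>. N \<in> DeltaD \<and> is_dinv N C \<phi> \<psi> \<and> (C \<in> DeltaD \<longrightarrow> N = C \<and> \<phi> = did C \<and> \<psi> = did C)"
    if C: "C \<in> DeltaD_big" for C
  proof (cases "C \<in> DeltaD")
    case True
    then show ?thesis using C is_dinv_did by (auto simp: DeltaD_big_def)
  next
    case False
    obtain n F G where "is_dinv C (ncyc n) (Cov F) (Cov G)"
      using C by (auto simp: DeltaD_big_def zcat_iso_def)
    then have "is_dinv (ncyc n) C (Cov G) (Cov F)"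
      unfolding is_dinv_def by blast
    then show ?thesis
      using False unfolding DeltaD_def by blast
  qed
  then obtain N \<phi> \<psi> where N: "\<And>C. C \<in> DeltaD_big \<Longrightarrow> N C \<in> DeltaD"
    and inv: "\<And>C. C \<in> DeltaD_big \<Longrightarrow> is_dinv (N C) C (\<phi> C) (\<psi> C)"
    and triv: "\<And>C. C \<in> DeltaD \<Longrightarrow> N C = C \<and> \<phi> C = did C \<and> \<psi> C = did C"
    using DeltaD_subset by (metis subsetD)
  have cat: "zcategory C" if "C \<in> DeltaD_big" for C
    using that by (simp add: DeltaD_big_def)
  have catN: "zcategory (N C)" if "C \<in> DeltaD_big" for C
    using that N DeltaD_subset cat by blast
  have \<phi>: "\<phi> C \<in> dhom (N C) C" and \<psi>: "\<psi> C \<in> dhom C (N C)"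
    and \<psi>\<phi>: "dcomp (N C) (\<psi> C) (\<phi> C) = did (N C)" and \<phi>\<psi>: "dcomp C (\<phi> C) (\<psi> C) = did C"
    if "C \<in> DeltaD_big" for C
    using inv[OF that] by (auto simp: is_dinv_def)
  define conj where "conj C D \<eta> = dcomp (N C) (\<psi> D) (dcomp (N C) \<eta> (\<phi> C))" for C D \<eta>
  have conj_in: "conj C D \<eta> \<in> dhom (N C) (N D)"
    if "C \<in> DeltaD_big" "D \<in> DeltaD_big" "\<eta> \<in> dhom C D" for C D \<eta>
    unfolding conj_def using that by (meson dcomp_in catN \<phi> \<psi>)
  have conj_id: "conj C C (did C) = did (N C)" if "C \<in> DeltaD_big" for C
    using that by (simp add: conj_def dcomp_did \<phi> \<psi>\<phi>)
  have conj_comp: "conj C E (dcomp C \<omega> \<eta>) = dcomp (N C) (conj D E \<omega>) (conj C D \<eta>)"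
    if C: "C \<in> DeltaD_big" and D: "D \<in> DeltaD_big" and E: "E \<in> DeltaD_big"
      and \<eta>: "\<eta> \<in> dhom C D" and \<omega>: "\<omega> \<in> dhom D E" for C D E \<eta> \<omega>
  proof -
    have 1: "dcomp (N C) \<eta> (\<phi> C) \<in> dhom (N C) D" (is "?a \<in> _")
      using C \<eta> by (meson dcomp_in catN \<phi>)
    have 2: "dcomp (N D) \<omega> (\<phi> D) \<in> dhom (N D) E"
      using D \<omega> by (meson dcomp_in catN \<phi>)
    have 3: "dcomp (N C) (\<psi> D) ?a \<in> dhom (N C) (N D)"
      using 1 C D by (meson dcomp_in catN \<psi>)
    have "dcomp (N C) (conj D E \<omega>) (conj C D \<eta>)
      = dcomp (N C) (\<psi> E) (dcomp (N C) \<omega> (dcomp (N C) (\<phi> D) (dcomp (N C) (\<psi> D) ?a)))"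
      unfolding conj_def by (simp add: dcomp_assoc[OF 3, symmetric])
    also have "dcomp (N C) (\<phi> D) (dcomp (N C) (\<psi> D) ?a) = ?a"
      by (metis dcomp_assoc[OF 1] \<phi>\<psi>[OF D] dcomp_did(2)[OF 1])
    finally show ?thesis
      unfolding conj_def by (simp add: dcomp_assoc[OF \<phi>[OF C], symmetric])
  qed
  define Xt where "Xt = \<lparr>Set_at = (\<lambda>C. Set_at X (N C)),
    Map_at = (\<lambda>C D \<eta>. Map_at X (N C) (N D) (conj C D \<eta>))\<rparr>"
  have "presheaf_on DeltaD_big Xt"
    using X N conj_in conj_id conj_comp
    unfolding dihedral_set_def presheaf_on_def Xt_def by simp
  moreover have "conj C D \<eta> = \<eta>" if "C \<in> DeltaD" "D \<in> DeltaD" "\<eta> \<in> dhom C D" for C D \<eta>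
    using that triv by (simp add: conj_def dcomp_did)
  ultimately have "dihedral_extension X Xt"
    using triv by (auto simp: dihedral_extension_def Xt_def)
  then show ?thesis ..
qed

section \<open>Geometric realization\<close>

definition equiv_closure_on :: "'a set \<Rightarrow> ('a \<times> 'a) set \<Rightarrow> ('a \<times> 'a) set" where
  "equiv_closure_on A r = (r \<union> r\<inverse>)\<^sup>* \<inter> A \<times> A"

definition quotient_topology :: "'a topology \<Rightarrow> ('a \<times> 'a) set \<Rightarrow> 'a set topology" where
  "quotient_topology T r =
     topology (\<lambda>U. U \<subseteq> topspace T // r \<and> openin T {x \<in> topspace T. r `` {x} \<in> U})"

definition simplex_map :: "nat \<Rightarrow> (nat \<Rightarrow> nat) \<Rightarrow> (nat \<Rightarrow> real) \<Rightarrow> (nat \<Rightarrow> real)" where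
  "simplex_map m \<theta> z = (\<lambda>j. \<Sum>i | i \<le> m \<and> \<theta> i = j. z i)"

definition vertex_map :: "(nat \<Rightarrow> nat) \<Rightarrow> uobj \<Rightarrow> uobj" where
  "vertex_map \<theta> u = (case u of Vertex i \<Rightarrow> Vertex (\<theta> i))"

definition simplicial_op :: "'x zpresheaf \<Rightarrow> nat \<Rightarrow> nat \<Rightarrow> (nat \<Rightarrow> nat) \<Rightarrow> 'x \<Rightarrow> 'x" where
  "simplicial_op X m n \<theta> =
     Map_at X (ncyc m) (ncyc n) (Cov (cyc_fun (vertices m) vertex_le (vertex_map \<theta>)))"

definition cells :: "'x zpresheaf \<Rightarrow> (nat \<times> 'x \<times> (nat \<Rightarrow> real)) topology" where
  "cells X = sum_topology (\<lambda>n. prod_topology (discrete_topology (Set_at X (ncyc n)))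
     (subtopology (powertop_real UNIV) (standard_simplex n))) UNIV"

definition glue :: "'x zpresheaf \<Rightarrow> ((nat \<times> 'x \<times> (nat \<Rightarrow> real)) \<times> (nat \<times> 'x \<times> (nat \<Rightarrow> real))) set" where
  "glue X = equiv_closure_on (topspace (cells X))
     {((n, x, simplex_map m \<theta> z), (m, simplicial_op X m n \<theta> x, z)) | m n \<theta> x z.
        \<theta> \<in> {..m} \<rightarrow> {..n} \<and> mono_on {..m} \<theta> \<and> x \<in> Set_at X (ncyc n) \<and> z \<in> standard_simplex m}"

definition realization :: "'x zpresheaf \<Rightarrow> (nat \<times> 'x \<times> (nat \<Rightarrow> real)) set topology" where
  "realization X = quotient_topology (cells X) (glue X)"

section \<open>The colimit and the canonical map\<close>

text \<open>The empty subset is excluded: for nonempty \<open>G\<close> there is no natural functor from \<open>pi0 G\<close> to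
  \<open>pi0 {}\<close>. A \<open>\<int>\<^sub>+\<close>-functor between them amounts to the choice of the one point of \<open>G\<close> that a path
  has to cross to gain degree one; compatibility with \<open>{a} \<subseteq> {a, b} \<supseteq> {b}\<close> would force this point
  to be both \<open>a\<close> and \<open>b\<close>.\<close>

definition index_sets :: "circle set set" where
  "index_sets = {F. finite F \<and> F \<noteq> {}}"

definition transition :: "'x zpresheaf \<Rightarrow> circle set \<Rightarrow> circle set \<Rightarrow> 'x \<Rightarrow> 'x" where
  "transition Xt F G = Map_at Xt (pi0 G) (pi0 F) (forget G F)"

definition filtered_diagram :: "'x zpresheaf \<Rightarrow> bool" where
  "filtered_diagram Xt \<longleftrightarrow>
     index_sets \<noteq> {} \<and> (\<forall>F\<in>index_sets. \<forall>G\<in>index_sets. \<exists>H\<in>index_sets. F \<subseteq> H \<and> G \<subseteq> H) \<and>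
     (\<forall>F\<in>index_sets. \<forall>G\<in>index_sets. F \<subseteq> G \<longrightarrow>
        transition Xt F G \<in> Set_at Xt (pi0 F) \<rightarrow> Set_at Xt (pi0 G)) \<and>
     (\<forall>F\<in>index_sets. \<forall>\<xi>\<in>Set_at Xt (pi0 F). transition Xt F F \<xi> = \<xi>) \<and>
     (\<forall>F\<in>index_sets. \<forall>G\<in>index_sets. \<forall>H\<in>index_sets. F \<subseteq> G \<longrightarrow> G \<subseteq> H \<longrightarrow>
        (\<forall>\<xi>\<in>Set_at Xt (pi0 F). transition Xt G H (transition Xt F G \<xi>) = transition Xt F H \<xi>))"

definition colim_carrier :: "'x zpresheaf \<Rightarrow> (circle set \<times> 'x) set" where
  "colim_carrier Xt = (SIGMA F:index_sets. Set_at Xt (pi0 F))"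

definition colim_rel :: "'x zpresheaf \<Rightarrow> ((circle set \<times> 'x) \<times> (circle set \<times> 'x)) set" where
  "colim_rel Xt = equiv_closure_on (colim_carrier Xt)
     {((F, \<xi>), (G, transition Xt F G \<xi>)) | F G \<xi>.
        F \<in> index_sets \<and> G \<in> index_sets \<and> F \<subseteq> G \<and> \<xi> \<in> Set_at Xt (pi0 F)}"

definition colim :: "'x zpresheaf \<Rightarrow> (circle set \<times> 'x) set set" where
  "colim Xt = colim_carrier Xt // colim_rel Xt"

definition in_colim :: "'x zpresheaf \<Rightarrow> circle set \<Rightarrow> 'x \<Rightarrow> (circle set \<times> 'x) set" where
  "in_colim Xt F \<xi> = colim_rel Xt `` {(F, \<xi>)}"

definition cut :: "(nat \<Rightarrow> real) \<Rightarrow> nat \<Rightarrow> real" where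
  "cut z i = (\<Sum>j<i. z j)"

definition cuts :: "nat \<Rightarrow> (nat \<Rightarrow> real) \<Rightarrow> real set" where
  "cuts n z = cut z ` {..n + 1}"

definition cut_index :: "nat \<Rightarrow> (nat \<Rightarrow> real) \<Rightarrow> uobj \<Rightarrow> uobj" where
  "cut_index n z u = (case u of Interval I \<Rightarrow>
     Vertex (THE i. i \<le> n \<and> I = {cut z i<..<cut z (i + 1)}))"

text \<open>On representatives. The inverse of \<open>unroll\<close> expresses the equality
  \<open>\<pi>\<^sub>0([0,1] - F)\<^sub>c\<^sub>y\<^sub>c = pi0 (proj ` F)\<close>.\<close>

fun canonical_rep :: "'x zpresheaf \<Rightarrow> nat \<times> 'x \<times> (nat \<Rightarrow> real) \<Rightarrow> (circle set \<times> 'x) set" where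
  "canonical_rep Xt (n, \<xi>, z) = (let F = cuts n z; C = interval_cyc F; D = pi0 (proj ` F) in
     in_colim Xt (proj ` F)
       (Map_at Xt D C (dinv C D (unroll F))
         (Map_at Xt C (ncyc n) (Cov (cyc_fun (intervals F) interval_le (cut_index n z))) \<xi>)))"

text \<open>The value on a class is the common value on its representatives.\<close>

definition canonical_map :: "'x zpresheaf \<Rightarrow> (nat \<times> 'x \<times> (nat \<Rightarrow> real)) set \<Rightarrow> (circle set \<times> 'x) set" where
  "canonical_map Xt p = the_elem (canonical_rep Xt ` p)"

section \<open>The action of the homeomorphisms of the circle\<close>

definition homeos :: "(circle \<Rightarrow> circle) set" where
  "homeos = {\<alpha>. \<exists>\<beta>. homeomorphism UNIV UNIV \<alpha> \<beta>}"

definition Homeo :: "(circle \<Rightarrow> circle) monoid" where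
  "Homeo = \<lparr>carrier = homeos, mult = (\<circ>), one = id\<rparr>"

definition orientation_preserving :: "(circle \<Rightarrow> circle) \<Rightarrow> bool" where
  "orientation_preserving \<alpha> \<longleftrightarrow>
     (\<exists>a::real \<Rightarrow> real. continuous_on UNIV a \<and> strict_mono a \<and> (\<forall>x. \<alpha> (proj x) = proj (a x)))"

text \<open>A homeomorphism of the circle which does not preserve the orientation reverses it.\<close>

definition homeo_pi0 :: "(circle \<Rightarrow> circle) \<Rightarrow> circle set \<Rightarrow> ufun dmor" where
  "homeo_pi0 \<alpha> F = (if orientation_preserving \<alpha> then Cov (induced_cov F (\<alpha> ` F) \<alpha>)
     else Contra (induced_contra F (\<alpha> ` F) \<alpha>))"

definition is_rho :: "'x zpresheaf \<Rightarrow> (circle \<Rightarrow> circle)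
    \<Rightarrow> ((circle set \<times> 'x) set \<Rightarrow> (circle set \<times> 'x) set) \<Rightarrow> bool" where
  "is_rho Xt \<alpha> \<rho> \<longleftrightarrow> \<rho> \<in> colim Xt \<rightarrow>\<^sub>E colim Xt \<and>
     (\<forall>F\<in>index_sets. \<forall>\<xi>\<in>Set_at Xt (pi0 F). \<rho> (in_colim Xt F \<xi>) =
        in_colim Xt (\<alpha> ` F)
          (Map_at Xt (pi0 (\<alpha> ` F)) (pi0 F) (dinv (pi0 F) (pi0 (\<alpha> ` F)) (homeo_pi0 \<alpha> F)) \<xi>))"

definition rho :: "'x zpresheaf \<Rightarrow> (circle \<Rightarrow> circle) \<Rightarrow> (circle set \<times> 'x) set \<Rightarrow> (circle set \<times> 'x) set" where
  "rho Xt \<alpha> = (THE \<rho>. is_rho Xt \<alpha> \<rho>)"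

text \<open>The action on the realization, transported along the canonical bijection.\<close>

definition act :: "'x zpresheaf \<Rightarrow> 'x zpresheaf \<Rightarrow> (circle \<Rightarrow> circle)
    \<Rightarrow> (nat \<times> 'x \<times> (nat \<Rightarrow> real)) set \<Rightarrow> (nat \<times> 'x \<times> (nat \<Rightarrow> real)) set" where
  "act X Xt \<alpha> = (\<lambda>p\<in>topspace (realization X).
     inv_into (topspace (realization X)) (canonical_map Xt) (rho Xt \<alpha> (canonical_map Xt p)))"

section \<open>Topology on the homeomorphism group\<close>

definition compact_open_topology :: "(circle \<Rightarrow> circle) topology" where
  "compact_open_topology = topology_generated_by
     {{f. continuous_on UNIV f \<and> f ` K \<subseteq> U} | K U. compact K \<and> open U}"

definition Homeo_topology :: "(circle \<Rightarrow> circle) topology" where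
  "Homeo_topology = subtopology (kification compact_open_topology) homeos"

text \<open>Product and continuous maps in the category of k-spaces. The library tests openness on compact
  subsets rather than on maps from compact Hausdorff spaces; for Hausdorff spaces, such as all those
  to which this is applied here, there is no difference.\<close>

definition k_prod :: "'a topology \<Rightarrow> 'b topology \<Rightarrow> ('a \<times> 'b) topology" where
  "k_prod S T = kification (prod_topology S T)"

definition k_continuous :: "'a topology \<Rightarrow> 'b topology \<Rightarrow> ('a \<Rightarrow> 'b) \<Rightarrow> bool" where
  "k_continuous S T f \<longleftrightarrow> k_space S \<and> k_space T \<and> continuous_map S T f"

end

theory Submission
  imports Defs
begin

text \<open>
All the categories that occur are described by lifts to the real line. A class of monotone paths in the
circle is determined by the end points of a lift, up to a common translation by an integer. Hence
\<open>\<pi>\<^sub>0\<close> of the complement of a finite set, its unrolled version over the unit interval, and \<open>[n]\<^sub>c\<^sub>y\<^sub>c\<close>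
all have the same shape: there is a preorder on a set of reals, invariant under translation by one,
and an arrow is a pair \<open>x \<le> y\<close> up to translation (\<open>cover\<close>, \<open>is_cover\<close>). A functor is induced by a map
of reals that is monotone, or antitone for a contravariant functor, and commutes with translation by
one up to sign (\<open>equivariant\<close>, \<open>functor_of\<close>). Composition, equality and inversion of functors become
statements about such maps, and every functor of the theorem is of this kind: refinement and
unrolling are induced by the identity, a homeomorphism acts through its lift, and simplicial operators
through the periodic extension of a monotone map.

A point \<open>z\<close> of the \<open>n\<close>-simplex is a configuration of points on the circle, starting at the base point.
Its arcs are numbered by the function \<open>idx n z\<close> on the line, which is adjoint to the sequence of the
points: \<open>k \<le> idx n z x\<close> if and only if the \<open>k\<close>-th point is at most \<open>x\<close>. The canonical map sends a simplex
\<open>\<xi>\<close> at \<open>z\<close> to the pullback of \<open>\<xi>\<close> along this numbering. It is compatible with the gluing because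
a simplicial operator only renumbers arcs (\<open>idx_simplex_map\<close>, \<open>canonical_rep_glue\<close>). It is surjective
because every finite set can be enlarged to contain the base point, and then it is a configuration of
distinct points, for which the numbering is an isomorphism. It is injective because two elements with
equal images agree over a finite set \<open>H\<close>; as a configuration of distinct points, \<open>H\<close> refines both given
configurations, so each of them arises from \<open>H\<close> by a monotone map (\<open>refine_config\<close>), and both simplices are
glued to the same simplex over \<open>H\<close> (\<open>canonical_rep_eq_imp_glue\<close>).

A homeomorphism of the circle has a lift that is strictly monotone or antitone (\<open>homeo_lift_exists\<close>), so
it induces isomorphisms compatible with refinement; this gives \<open>\<rho>\<close> and the action of the group.

For continuity, a compact set of pairs of a homeomorphism and a point projects to a compact Hausdorff
set of homeomorphisms, and the product of the latter with the quotient map from the disjoint union of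
the simplices is again a quotient map. So it suffices to consider homeomorphisms \<open>\<alpha>\<close> and points \<open>z\<close> of a
single simplex. If \<open>\<alpha>\<close> takes a point \<open>t\<close> of the \<open>i\<close>-th arc of \<open>z\<close> to the base point, then \<open>\<alpha>\<close> takes the simplex \<open>\<xi>\<close> at
\<open>z\<close> to a simplex of dimension \<open>n + 1\<close> that depends only on \<open>\<xi>\<close>, \<open>i\<close> and the orientation, at the point whose
coordinates are the lengths of the images of the arcs into which the old points and \<open>t\<close> divide the circle
(\<open>act_formula\<close>). These lengths are continuous in \<open>\<alpha>\<close>, \<open>z\<close> and \<open>t\<close>. The triples \<open>((\<alpha>, z), t)\<close> with given \<open>i\<close> and
orientation form a closed set, finitely many such sets lie over all pairs \<open>(\<alpha>, z)\<close>, and the projection along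
the compact unit interval of \<open>t\<close> is closed.
\<close>

section \<open>Lifting from the circle to the line\<close>

lemma proj_eq_iff: "proj x = proj y \<longleftrightarrow> x - y \<in> \<int>"
  by (simp add: circle.abs_eq_iff)

lemma proj_eqE:
  assumes "proj x = proj y"
  obtains k :: int where "y = x + of_int k"
proof -
  have "y - x \<in> \<int>" using assms proj_eq_iff[of y x] by simp
  then obtain k :: int where "y - x = of_int k" by (rule Ints_cases)
  then show ?thesis by (intro that[of k]) simp
qed

lemma proj_add_int [simp]: "proj (x + of_int k) = proj x"
  by (simp add: proj_eq_iff)

lemma proj_add_1 [simp]: "proj (x + 1) = proj x"
  using proj_add_int[of x 1] by simp

lemma proj_rep [simp]: "proj (rep_circle c) = c"
  by (rule Quotient_abs_rep[OF Quotient_circle])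

lemma continuous_on_proj [continuous_intros]:
  assumes "continuous_on S f" shows "continuous_on S (\<lambda>x. proj (f x))"
proof -
  have "continuous_on UNIV proj"
    by (simp add: continuous_on_open_vimage open_circle_def)
  then show ?thesis
    using assms continuous_on_compose2 by blast
qed

lemma open_proj_image:
  assumes "open U" shows "open (proj ` U)"
proof -
  have "proj -` proj ` U = (\<Union>k::int. (\<lambda>x. of_int k + x) ` U)"
  proof (intro Set.set_eqI iffI)
    fix y assume "y \<in> proj -` proj ` U"
    then obtain u where u: "u \<in> U" "proj u = proj y" by auto
    then obtain k where "y = u + of_int k" using proj_eqE by blast
    then show "y \<in> (\<Union>k::int. (\<lambda>x. of_int k + x) ` U)" using u by (auto simp: add.commute)
  next
    fix y assume "y \<in> (\<Union>k::int. (\<lambda>x. of_int k + x) ` U)"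
    then obtain k :: int and x where "x \<in> U" "y = x + of_int k"
      by (auto simp: add.commute)
    then show "y \<in> proj -` proj ` U" by auto
  qed
  moreover have "open \<dots>"
    by (intro open_UN ballI open_translation assms)
  ultimately show ?thesis by (simp add: open_circle_def)
qed

text \<open>The embedding as the unit circle of the plane turns paths in the circle into paths in the
  punctured plane, which is covered by the exponential map; lifting of maps and monodromy come from
  this covering.\<close>

definition to_complex :: "circle \<Rightarrow> complex" where
  "to_complex c = cis (2 * pi * rep_circle c)"

lemma to_complex_proj: "to_complex (proj x) = cis (2 * pi * x)"
proof -
  obtain k :: int where "rep_circle (proj x) = x + of_int k"
    using proj_eqE[of x "rep_circle (proj x)"] by auto
  then have "to_complex (proj x) = cis (2 * pi * x) * cis (2 * pi * of_int k)"
    by (simp add: to_complex_def cis_mult algebra_simps)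
  then show ?thesis by (simp add: cis_multiple_2pi)
qed

lemma inj_to_complex: "inj to_complex"
proof (rule injI)
  fix c d assume "to_complex c = to_complex d"
  then have "exp (\<i> * complex_of_real (2 * pi * rep_circle c)) = exp (\<i> * complex_of_real (2 * pi * rep_circle d))"
    by (simp add: to_complex_def cis_conv_exp)
  then obtain n :: int where n: "\<i> * complex_of_real (2 * pi * rep_circle c)
      = \<i> * complex_of_real (2 * pi * rep_circle d) + (of_int (2 * n) * pi) * \<i>"
    by (auto simp: exp_eq)
  then have "2 * pi * rep_circle c = 2 * pi * rep_circle d + of_int (2 * n) * pi"
    by (simp add: complex_eq_iff)
  then have "2 * pi * (rep_circle c - rep_circle d) = 2 * pi * of_int n"
    by (simp add: algebra_simps)
  then have "rep_circle c - rep_circle d = of_int n" by simp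
  then have "proj (rep_circle c) = proj (rep_circle d)" by (simp only: proj_eq_iff Ints_of_int)
  then show "c = d" by (simp only: proj_rep)
qed

lemma continuous_to_complex: "continuous_on UNIV to_complex"
  unfolding continuous_on_open_vimage[OF open_UNIV]
proof (intro allI impI)
  fix B :: "complex set" assume "open B"
  moreover have "continuous_on UNIV (\<lambda>x. cis (2 * pi * x))"
    by (intro continuous_intros)
  ultimately have "open ((\<lambda>x. cis (2 * pi * x)) -` B)"
    by (simp add: continuous_on_open_vimage)
  moreover have "(\<lambda>x. cis (2 * pi * x)) -` B = proj -` (to_complex -` B)"
    by (auto simp: to_complex_proj)
  ultimately show "open (to_complex -` B \<inter> UNIV)" by (simp add: open_circle_def)
qed

lemma circle_lift:
  fixes f :: "real \<Rightarrow> circle"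
  assumes f: "continuous_on S f" and S: "convex S"
  obtains g where "continuous_on S g" "\<And>x. x \<in> S \<Longrightarrow> f x = proj (g x)"
proof -
  have "continuous_on S (to_complex \<circ> f)"
    using f continuous_to_complex continuous_on_compose continuous_on_subset by blast
  moreover have "(to_complex \<circ> f) x \<noteq> 0" for x by (simp add: to_complex_def)
  ultimately obtain l where l: "continuous_on S l" "\<And>x. x \<in> S \<Longrightarrow> to_complex (f x) = exp (l x)"
    using continuous_logarithm_on_contractible[of S "to_complex \<circ> f"] convex_imp_contractible[OF S]
    by (metis comp_apply)
  show ?thesis
  proof
    show "continuous_on S (\<lambda>x. Im (l x) / (2 * pi))"
      by (intro continuous_intros l) simp
    fix x assume x: "x \<in> S"
    have "norm (exp (l x)) = 1"
      using l(2)[OF x] by (metis norm_cis to_complex_def)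
    then have "Re (l x) = 0" by simp
    then have "exp (l x) = cis (Im (l x))" by (simp add: exp_eq_polar)
    also have "\<dots> = to_complex (proj (Im (l x) / (2 * pi)))"
      by (simp add: to_complex_proj)
    finally show "f x = proj (Im (l x) / (2 * pi))"
      using l(2)[OF x] inj_to_complex by (metis injD)
  qed
qed

lemma integer_valued_continuous_const:
  fixes h :: "real \<Rightarrow> real"
  assumes "continuous_on S h" "connected S" "\<And>x. x \<in> S \<Longrightarrow> h x \<in> \<int>"
  obtains k :: int where "\<And>x. x \<in> S \<Longrightarrow> h x = of_int k"
proof -
  have "h constant_on S"
  proof (rule continuous_discrete_range_constant[OF assms(2,1)])
    fix x assume "x \<in> S"
    have "1 \<le> norm (h y - h x)" if "y \<in> S" "h y \<noteq> h x" for y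
    proof -
      have "h y - h x \<in> \<int>" "h y - h x \<noteq> 0" using that \<open>x \<in> S\<close> assms(3) by auto
      then show ?thesis using Ints_nonzero_abs_ge1[of "h y - h x"] by simp
    qed
    then show "\<exists>e>0. \<forall>y. y \<in> S \<and> h y \<noteq> h x \<longrightarrow> e \<le> norm (h y - h x)"
      by (intro exI[of _ 1]) auto
  qed
  then obtain c where c: "\<And>x. x \<in> S \<Longrightarrow> h x = c" by (auto simp: constant_on_def)
  show ?thesis
  proof (cases "S = {}")
    case True then show ?thesis using that[of 0] by simp
  next
    case False
    then obtain k where "c = of_int k" using c assms(3) by (metis Ints_cases ex_in_conv)
    then show ?thesis using that c by blast
  qed
qed

lemma circle_lift_unique:
  fixes g h :: "real \<Rightarrow> real"
  assumes "continuous_on S g" "continuous_on S h" "connected S"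
    and "\<And>x. x \<in> S \<Longrightarrow> proj (g x) = proj (h x)"
  obtains k :: int where "\<And>x. x \<in> S \<Longrightarrow> h x = g x + of_int k"
proof -
  have "h x - g x \<in> \<int>" if "x \<in> S" for x
    using assms(4)[OF that] by (metis proj_eq_iff)
  moreover have "continuous_on S (\<lambda>x. h x - g x)" by (intro continuous_intros assms)
  ultimately obtain k :: int where "\<And>x. x \<in> S \<Longrightarrow> h x - g x = of_int k"
    using integer_valued_continuous_const assms(3) by blast
  then show ?thesis by (intro that[of k]) (simp add: algebra_simps)
qed

subsection \<open>Homotopy classes of monotone paths\<close>

definition lifts :: "(real \<Rightarrow> real) \<Rightarrow> (real \<Rightarrow> circle) \<Rightarrow> bool" where
  "lifts g p \<longleftrightarrow> continuous_on {0..1} g \<and> (\<forall>t\<in>{0..1}. p t = proj (g t))"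

text \<open>The parameters are the end points of a lift and not a displacement, so that arrows of the circle
  become pairs of reals modulo simultaneous translation by integers. For \<open>x > y\<close> there is no monotone lift
  and the set is empty, which agrees with \<open>path_class\<close> for paths that are not homotopic to a monotone one.\<close>

definition monotone_class :: "real \<Rightarrow> real \<Rightarrow> (real \<Rightarrow> circle) set" where
  "monotone_class x y = {p. \<exists>g. lifts g p \<and> mono_on {0..1} g \<and> g 0 = x \<and> g 1 = y}"

lemma lifts_add: "lifts g p \<Longrightarrow> lifts (\<lambda>t. g t + of_int k) p"
  by (auto simp: lifts_def intro: continuous_intros)

lemma lifts_proj: "continuous_on {0..1} g \<Longrightarrow> lifts g (\<lambda>t. proj (g t))"
  by (simp add: lifts_def)

lemma lifts_unique:
  assumes "lifts g p" "lifts h p"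
  obtains k :: int where "\<And>t. t \<in> {0..1} \<Longrightarrow> h t = g t + of_int k"
  by (rule circle_lift_unique[of "{0..1}" g h]) (use assms in \<open>auto simp: lifts_def\<close>)

lemma monotone_class_add_int: "monotone_class (x + of_int k) (y + of_int k) = monotone_class x y"
proof -
  have "monotone_class x y \<subseteq> monotone_class (x + of_int k) (y + of_int k)" for x y and k :: int
  proof
    fix p assume "p \<in> monotone_class x y"
    then obtain g where "lifts g p" "mono_on {0..1} g" "g 0 = x" "g 1 = y" by (auto simp: monotone_class_def)
    then show "p \<in> monotone_class (x + of_int k) (y + of_int k)"
      unfolding monotone_class_def using lifts_add[of g p k]
      by (intro CollectI exI[of _ "\<lambda>t. g t + of_int k"]) (auto simp: mono_on_def)
  qed
  from this[of x y k] this[of "x + of_int k" "y + of_int k" "- k"] show ?thesis by auto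
qed

lemma linear_path_in_monotone_class: "x \<le> y \<Longrightarrow> (\<lambda>t. proj (x + t * (y - x))) \<in> monotone_class x y"
  unfolding monotone_class_def
  by (intro CollectI exI[of _ "\<lambda>t. x + t * (y - x)"])
    (auto intro!: lifts_proj continuous_intros mono_onI mult_right_mono)

lemma monotone_class_ends: "p \<in> monotone_class x y \<Longrightarrow> pathstart p = proj x \<and> pathfinish p = proj y \<and> x \<le> y"
  by (auto simp: monotone_class_def lifts_def pathstart_def pathfinish_def mono_on_def)

lemma monotone_class_eq_iff:
  assumes "x \<le> y"
  shows "monotone_class x y = monotone_class x' y' \<longleftrightarrow> (\<exists>k::int. x' = x + of_int k \<and> y' = y + of_int k)"
proof
  assume eq: "monotone_class x y = monotone_class x' y'"
  obtain p where "p \<in> monotone_class x y" using linear_path_in_monotone_class[OF assms] by blast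
  then obtain g h where "lifts g p" "lifts h p" "g 0 = x" "g 1 = y" "h 0 = x'" "h 1 = y'"
    using eq unfolding monotone_class_def by fast
  then show "\<exists>k::int. x' = x + of_int k \<and> y' = y + of_int k"
    using lifts_unique[of g p h] by (metis atLeastAtMost_iff order_refl zero_le_one)
qed (auto simp: monotone_class_add_int)

lemma monotone_paths_iff: "p \<in> monotone_paths \<longleftrightarrow> (\<exists>x y. p \<in> monotone_class x y)"
  by (auto simp: monotone_paths_def monotone_class_def lifts_def)

text \<open>Homotopic paths with lifts that start at the same point have lifts that end at the same point;
  conversely such lifts are joined by a straight-line homotopy.\<close>

lemma path_class_eq:
  assumes g: "lifts g p"
  shows "path_class p = monotone_class (g 0) (g 1)"
proof (rule Set.set_eqI)
  fix q
  show "q \<in> path_class p \<longleftrightarrow> q \<in> monotone_class (g 0) (g 1)"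
  proof
    assume q: "q \<in> path_class p"
    then obtain h where h: "lifts h q" "mono_on {0..1} h"
      by (auto simp: path_class_def monotone_paths_iff monotone_class_def)
    have hom: "homotopic_paths UNIV p q" using q by (simp add: path_class_def)
    have "proj (g 0) = proj (h 0)"
      using homotopic_paths_imp_pathstart[OF hom] g h by (auto simp: lifts_def pathstart_def)
    then obtain k :: int where k: "g 0 = h 0 + of_int k" using proj_eqE by metis
    \<comment> \<open>Replacing the lift of \<open>q\<close> by a translate makes both lifts start at the same point, as required for monodromy.\<close>
    define h' where "h' t = h t + of_int k" for t
    have h': "lifts h' q" "mono_on {0..1} h'" "h' 0 = g 0"
      using lifts_add[OF h(1), of k] h(2) k by (auto simp: h'_def[abs_def] mono_on_def)
    \<comment> \<open>The lift of a path in the circle becomes a lift along the exponential map.\<close>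
    let ?e = "\<lambda>f t. 2 * pi * complex_of_real (f t) * \<i>"
    have "homotopic_paths (- {0}) (to_complex \<circ> p) (to_complex \<circ> q)"
      by (rule homotopic_paths_continuous_image[OF hom])
        (use continuous_to_complex in \<open>auto simp: to_complex_def\<close>)
    moreover have "exp (?e f t) = to_complex (proj (f t))" for f t
      by (simp add: to_complex_proj cis_conv_exp algebra_simps)
    moreover have "path (?e f)" if "continuous_on {0..1} f" for f
      unfolding path_def by (intro continuous_intros that)
    moreover have "path (to_complex \<circ> p)" "path (to_complex \<circ> q)"
      using calculation(1) homotopic_paths_imp_path by blast+
    moreover have "path_image (to_complex \<circ> r) \<subseteq> - {0}" for r :: "real \<Rightarrow> circle"
      by (auto simp: path_image_def to_complex_def)
    moreover have "\<And>t. t \<in> {0..1} \<Longrightarrow> exp (?e g t) = (to_complex \<circ> p) t"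
        "\<And>t. t \<in> {0..1} \<Longrightarrow> exp (?e h' t) = (to_complex \<circ> q) t"
      using calculation(2) g h' by (simp_all add: lifts_def)
    moreover have "path (?e g)" "path (?e h')"
      using calculation(3) g h' by (simp_all add: lifts_def)
    moreover have "pathstart (?e g) = pathstart (?e h')"
      using h' by (simp add: pathstart_def)
    ultimately have "pathfinish (?e g) = pathfinish (?e h')"
      using covering_space_monodromy[OF covering_space_exp_punctured_plane,
          of "to_complex \<circ> p" "to_complex \<circ> q" "?e g" "?e h'"] by blast
    then have "g 1 = h' 1" by (simp add: pathfinish_def)
    then show "q \<in> monotone_class (g 0) (g 1)" using h' by (auto simp: monotone_class_def)
  next
    assume "q \<in> monotone_class (g 0) (g 1)"
    then obtain h where h: "lifts h q" "h 0 = g 0" "h 1 = g 1" "mono_on {0..1} h" by (auto simp: monotone_class_def)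
    have "homotopic_paths UNIV (\<lambda>t. proj (g t)) (\<lambda>t. proj (h t))"
    proof -
      have "homotopic_paths UNIV g h"
        using g h by (intro homotopic_paths_linear)
          (auto simp: lifts_def path_def pathstart_def pathfinish_def)
      then have "homotopic_paths UNIV (proj \<circ> g) (proj \<circ> h)"
        by (rule homotopic_paths_continuous_image)
          (auto intro!: continuous_on_proj continuous_on_id)
      then show ?thesis by (simp add: o_def)
    qed
    moreover have "homotopic_paths UNIV p (\<lambda>t. proj (g t))" "homotopic_paths UNIV (\<lambda>t. proj (h t)) q"
    proof -
      have "path (\<lambda>t. proj (g t))" "path (\<lambda>t. proj (h t))"
        using g h by (auto simp: path_def lifts_def intro: continuous_on_proj)
      moreover have "path p = path (\<lambda>t. proj (g t))"
        unfolding path_def using g by (intro continuous_on_cong) (auto simp: lifts_def)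
      ultimately have "path p" "path (\<lambda>t. proj (h t))" by simp_all
      then show "homotopic_paths UNIV p (\<lambda>t. proj (g t))" "homotopic_paths UNIV (\<lambda>t. proj (h t)) q"
        using g h by (auto intro!: homotopic_paths_eq simp: lifts_def)
    qed
    ultimately have "homotopic_paths UNIV p q" using homotopic_paths_trans by blast
    then show "q \<in> path_class p"
      using h by (auto simp: path_class_def monotone_paths_iff monotone_class_def)
  qed
qed

lemma lifts_joinpaths:
  assumes "lifts g p" "lifts h q" "g 1 = h 0"
  shows "lifts (g +++ h) (p +++ q)"
proof -
  have "path (g +++ h)"
    by (rule path_join_imp) (use assms in \<open>auto simp: lifts_def path_def pathstart_def pathfinish_def\<close>)
  then show ?thesis
    using assms by (auto simp: lifts_def path_def joinpaths_def)
qed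

lemma joinpaths_ends [simp]: "(g +++ h) 0 = g 0" "(g +++ h) 1 = h 1"
  by (simp_all add: joinpaths_def)

lemma lifts_reversepath: "lifts g p \<Longrightarrow> lifts (reversepath g) (reversepath p)"
  unfolding lifts_def reversepath_def
  by (auto intro!: continuous_intros elim!: continuous_on_compose2)

subsection \<open>The category of the circle in terms of lifts\<close>

lemma Arr_circle: "A \<in> Arr circle_cat \<longleftrightarrow> (\<exists>x y. x \<le> y \<and> A = monotone_class x y)"
proof
  assume "A \<in> Arr circle_cat"
  then obtain p where p: "p \<in> monotone_paths" "A = path_class p" by (auto simp: circle_cat_def)
  then obtain g where "lifts g p" "mono_on {0..1} g" by (auto simp: monotone_paths_iff monotone_class_def)
  then have "g 0 \<le> g 1" "A = monotone_class (g 0) (g 1)"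
    using p path_class_eq[of g p] by (auto simp: mono_on_def)
  then show "\<exists>x y. x \<le> y \<and> A = monotone_class x y" by blast
next
  assume "\<exists>x y. x \<le> y \<and> A = monotone_class x y"
  then obtain x y p where p: "A = monotone_class x y" "p \<in> monotone_class x y" using linear_path_in_monotone_class by blast
  then obtain g where g: "lifts g p" "g 0 = x" "g 1 = y" by (auto simp: monotone_class_def)
  have "p \<in> monotone_paths" using p by (auto simp: monotone_paths_iff)
  then show "A \<in> Arr circle_cat" using p path_class_eq[OF g(1)] g by (auto simp: circle_cat_def)
qed

lemma
  assumes "x \<le> y"
  shows Dom_circle: "Dom circle_cat (monotone_class x y) = proj x"
    and Cod_circle: "Cod circle_cat (monotone_class x y) = proj y"
proof -
  have "(SOME p. p \<in> monotone_class x y) \<in> monotone_class x y"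
    by (rule someI[of "\<lambda>p. p \<in> monotone_class x y", OF linear_path_in_monotone_class[OF assms]])
  from monotone_class_ends[OF this] show "Dom circle_cat (monotone_class x y) = proj x" "Cod circle_cat (monotone_class x y) = proj y"
    by (simp_all add: circle_cat_def)
qed

lemma Id_circle: "Id circle_cat (proj x) = monotone_class x x"
proof -
  have "lifts (\<lambda>t. x) (\<lambda>t. proj x)" by (simp add: lifts_def)
  then show ?thesis by (simp add: circle_cat_def path_class_eq)
qed

lemma One_circle: "One circle_cat (proj x) = monotone_class x (x + 1)"
proof -
  obtain k :: int where k: "rep_circle (proj x) = x + of_int k"
    using proj_eqE[of x "rep_circle (proj x)"] by auto
  have "lifts (\<lambda>t. rep_circle (proj x) + t) (\<lambda>t. proj (rep_circle (proj x) + t))"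
    by (intro lifts_proj continuous_intros)
  from path_class_eq[OF this] have "One circle_cat (proj x) = monotone_class (x + of_int k) (x + 1 + of_int k)"
    by (simp add: circle_cat_def k algebra_simps)
  then show ?thesis by (simp only: monotone_class_add_int)
qed

lemma Comp_circle:
  assumes "x \<le> y" "y \<le> z"
  shows "Comp circle_cat (monotone_class y z) (monotone_class x y) = monotone_class x z"
proof -
  have *: "path_class (p +++ q) = monotone_class x z" if "p \<in> monotone_class x y" "q \<in> monotone_class y z" for p q
  proof -
    from that obtain g h where "lifts g p" "g 0 = x" "g 1 = y" "lifts h q" "h 0 = y" "h 1 = z"
      by (auto simp: monotone_class_def)
    then show ?thesis
      using path_class_eq[OF lifts_joinpaths[of g p h q]] by simp
  qed
  have "(\<Union>p\<in>monotone_class x y. \<Union>q\<in>monotone_class y z. path_class (p +++ q)) = (\<Union>p\<in>monotone_class x y. \<Union>q\<in>monotone_class y z. monotone_class x z)"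
    using * by simp
  also have "\<dots> = monotone_class x z"
    using linear_path_in_monotone_class[OF assms(1)] linear_path_in_monotone_class[OF assms(2)] by blast
  finally show ?thesis by (simp add: circle_cat_def)
qed

section \<open>Lifted descriptions of \<open>\<int>\<^sub>+\<close>-categories\<close>

text \<open>A presentation of a \<open>\<int>\<^sub>+\<close>-category by the line. Points that are equivalent for the preorder \<open>Le\<close> stand
  for the same lift of an object, \<open>Ob\<close> forgets the lift, and \<open>Ar x y\<close> is the arrow of a pair \<open>x \<le> y\<close>; it is
  meaningful only for such pairs. Translation by one is the deck transformation, and the pair
  \<open>(x, x + 1)\<close> is the structural endomorphism.\<close>

record cover =
  Cat :: ucat
  Pts :: "real set"
  Le :: "real \<Rightarrow> real \<Rightarrow> bool"
  Ob :: "real \<Rightarrow> uobj"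
  Ar :: "real \<Rightarrow> real \<Rightarrow> uarr"

definition eqv :: "cover \<Rightarrow> real \<Rightarrow> real \<Rightarrow> bool" where
  "eqv K x y \<longleftrightarrow> Le K x y \<and> Le K y x"

locale is_cover =
  fixes K :: cover
  assumes Pts_add: "x \<in> Pts K \<Longrightarrow> x + of_int k \<in> Pts K"
    and Le_refl: "x \<in> Pts K \<Longrightarrow> Le K x x"
    and Le_trans: "\<lbrakk>x \<in> Pts K; y \<in> Pts K; z \<in> Pts K; Le K x y; Le K y z\<rbrakk> \<Longrightarrow> Le K x z"
    and Le_add: "\<lbrakk>x \<in> Pts K; y \<in> Pts K; Le K x y\<rbrakk> \<Longrightarrow> Le K (x + of_int k) (y + of_int k)"
    and Le_1: "x \<in> Pts K \<Longrightarrow> Le K x (x + 1)"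
    and not_Le_1: "x \<in> Pts K \<Longrightarrow> \<not> Le K (x + 1) x"
    and Obj_eq: "Obj (Cat K) = Ob K ` Pts K"
    and Arr_eq: "Arr (Cat K) = {Ar K x y | x y. x \<in> Pts K \<and> y \<in> Pts K \<and> Le K x y}"
    and Ob_eq_iff: "\<lbrakk>x \<in> Pts K; y \<in> Pts K\<rbrakk> \<Longrightarrow>
      Ob K x = Ob K y \<longleftrightarrow> (\<exists>k::int. eqv K (x + of_int k) y)"
    and Ar_eq_iff: "\<lbrakk>x \<in> Pts K; y \<in> Pts K; x' \<in> Pts K; y' \<in> Pts K; Le K x y; Le K x' y'\<rbrakk> \<Longrightarrow>
      Ar K x y = Ar K x' y' \<longleftrightarrow> (\<exists>k::int. eqv K (x + of_int k) x' \<and> eqv K (y + of_int k) y')"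
    and Dom_Ar: "\<lbrakk>x \<in> Pts K; y \<in> Pts K; Le K x y\<rbrakk> \<Longrightarrow> Dom (Cat K) (Ar K x y) = Ob K x"
    and Cod_Ar: "\<lbrakk>x \<in> Pts K; y \<in> Pts K; Le K x y\<rbrakk> \<Longrightarrow> Cod (Cat K) (Ar K x y) = Ob K y"
    and Id_Ob: "x \<in> Pts K \<Longrightarrow> Id (Cat K) (Ob K x) = Ar K x x"
    and One_Ob: "x \<in> Pts K \<Longrightarrow> One (Cat K) (Ob K x) = Ar K x (x + 1)"
    and Comp_Ar: "\<lbrakk>x \<in> Pts K; y \<in> Pts K; z \<in> Pts K; Le K x y; Le K y z\<rbrakk> \<Longrightarrow>
      Comp (Cat K) (Ar K y z) (Ar K x y) = Ar K x z"
begin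

lemma eqv_refl: "x \<in> Pts K \<Longrightarrow> eqv K x x"
  by (simp add: eqv_def Le_refl)

lemma eqv_sym: "eqv K x y \<Longrightarrow> eqv K y x"
  by (simp add: eqv_def)

lemma eqv_trans: "\<lbrakk>x \<in> Pts K; y \<in> Pts K; z \<in> Pts K; eqv K x y; eqv K y z\<rbrakk> \<Longrightarrow> eqv K x z"
  unfolding eqv_def using Le_trans by blast

lemma eqv_add: "\<lbrakk>x \<in> Pts K; y \<in> Pts K; eqv K x y\<rbrakk> \<Longrightarrow> eqv K (x + of_int k) (y + of_int k)"
  unfolding eqv_def using Le_add by blast

lemma Pts_1: "x \<in> Pts K \<Longrightarrow> x + 1 \<in> Pts K"
  using Pts_add[of x 1] by simp

lemma Le_eqv_trans: "\<lbrakk>x \<in> Pts K; y \<in> Pts K; z \<in> Pts K; Le K x y; eqv K y z\<rbrakk> \<Longrightarrow> Le K x z"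
  and eqv_Le_trans: "\<lbrakk>x \<in> Pts K; y \<in> Pts K; z \<in> Pts K; eqv K x y; Le K y z\<rbrakk> \<Longrightarrow> Le K x z"
  unfolding eqv_def using Le_trans by blast+

lemma Ar_eqI:
  assumes "x \<in> Pts K" "y \<in> Pts K" "x' \<in> Pts K" "y' \<in> Pts K" "Le K x y"
    and "eqv K (x + of_int k) x'" "eqv K (y + of_int k) y'"
  shows "Ar K x y = Ar K x' y'"
proof -
  have "Le K (x + of_int k) (y + of_int k)" using assms Le_add by blast
  then have "Le K x' y'"
    using assms Pts_add Le_eqv_trans eqv_Le_trans eqv_sym by meson
  then show ?thesis using assms Ar_eq_iff by blast
qed

lemma Ar_eqI0:
  assumes "x \<in> Pts K" "y \<in> Pts K" "x' \<in> Pts K" "y' \<in> Pts K" "Le K x y" "eqv K x x'" "eqv K y y'"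
  shows "Ar K x y = Ar K x' y'"
  using Ar_eqI[of x y x' y' 0] assms by simp

lemma ArrE:
  assumes "f \<in> Arr (Cat K)"
  obtains x y where "x \<in> Pts K" "y \<in> Pts K" "Le K x y" "f = Ar K x y"
  using assms unfolding Arr_eq by blast

lemma Ar_in: "\<lbrakk>x \<in> Pts K; y \<in> Pts K; Le K x y\<rbrakk> \<Longrightarrow> Ar K x y \<in> Arr (Cat K)"
  unfolding Arr_eq by blast

text \<open>A lift of an arrow may be translated, so it can be made to start at any given lift of the source.\<close>

lemma composable_lift:
  assumes "f \<in> Arr (Cat K)" "y \<in> Pts K" "Ob K y = Dom (Cat K) f"
  obtains z where "z \<in> Pts K" "Le K y z" "f = Ar K y z"
proof -
  obtain a b where ab: "a \<in> Pts K" "b \<in> Pts K" "Le K a b" "f = Ar K a b"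
    using assms(1) ArrE by blast
  then have "Ob K a = Ob K y" using assms Dom_Ar by simp
  then obtain k :: int where k: "eqv K (a + of_int k) y"
    using Ob_eq_iff ab assms by blast
  show ?thesis
  proof
    show "b + of_int k \<in> Pts K" using ab Pts_add by blast
    have "Le K (a + of_int k) (b + of_int k)" using ab Le_add by blast
    then show "Le K y (b + of_int k)"
      using k ab assms Pts_add eqv_Le_trans eqv_sym by meson
    show "f = Ar K y (b + of_int k)"
      using Ar_eqI[of a b y "b + of_int k" k] ab assms k Pts_add eqv_refl by blast
  qed
qed

text \<open>Composable arrows lift to chains in the preorder, so the laws hold because composition joins two
  adjacent pairs into one. The structural endomorphism is not the identity since \<open>x + 1 \<le> x\<close> never holds.\<close>

lemma zcategory_Cat: "zcategory (Cat K)"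
proof unfold_locales
  fix f assume "f \<in> Arr (Cat K)"
  then obtain x y where f: "x \<in> Pts K" "y \<in> Pts K" "Le K x y" "f = Ar K x y" by (rule ArrE)
  show "Dom (Cat K) f \<in> Obj (Cat K)" "Cod (Cat K) f \<in> Obj (Cat K)"
    using f by (auto simp: Dom_Ar Cod_Ar Obj_eq)
  show "Comp (Cat K) f (Id (Cat K) (Dom (Cat K) f)) = f"
    "Comp (Cat K) (Id (Cat K) (Cod (Cat K) f)) f = f"
    using f by (simp_all add: Dom_Ar Cod_Ar Id_Ob Comp_Ar Le_refl)
  have y1: "Le K y (y + 1)" "Le K x (x + 1)" "y + 1 \<in> Pts K" "x + 1 \<in> Pts K"
    using f Le_1 Pts_1 by blast+
  have xy: "Le K (x + 1) (y + 1)" using f Le_add[of x y 1] by simp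
  have fe: "f = Ar K (x + 1) (y + 1)"
    using f Ar_eqI[of x y "x + 1" "y + 1" 1] y1 eqv_refl by simp
  have "Comp (Cat K) f (One (Cat K) (Dom (Cat K) f)) = Comp (Cat K) (Ar K (x + 1) (y + 1)) (Ar K x (x + 1))"
    using f fe by (simp add: Dom_Ar One_Ob)
  also have "\<dots> = Ar K x (y + 1)" using f y1 xy Comp_Ar by simp
  also have "\<dots> = Comp (Cat K) (One (Cat K) (Cod (Cat K) f)) f"
    using f y1 by (simp add: Cod_Ar One_Ob Comp_Ar)
  finally show "Comp (Cat K) f (One (Cat K) (Dom (Cat K) f)) = Comp (Cat K) (One (Cat K) (Cod (Cat K) f)) f" .
next
  fix u assume "u \<in> Obj (Cat K)"
  then obtain x where x: "x \<in> Pts K" "u = Ob K x" by (auto simp: Obj_eq)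
  note x1 = Le_1[OF x(1)] Pts_1[OF x(1)] Le_refl[OF x(1)] not_Le_1[OF x(1)]
  have "Ob K (x + 1) = Ob K x"
    using x x1 Ob_eq_iff[of x "x + 1"] eqv_refl[of "x + 1"] by (metis of_int_1)
  then show "Id (Cat K) u \<in> Arr (Cat K) \<and> Dom (Cat K) (Id (Cat K) u) = u \<and> Cod (Cat K) (Id (Cat K) u) = u"
      "One (Cat K) u \<in> Arr (Cat K) \<and> Dom (Cat K) (One (Cat K) u) = u \<and> Cod (Cat K) (One (Cat K) u) = u"
    using x x1 by (auto simp: Id_Ob One_Ob Dom_Ar Cod_Ar intro: Ar_in)
  show "One (Cat K) u \<noteq> Id (Cat K) u"
  proof
    assume "One (Cat K) u = Id (Cat K) u"
    then have "Ar K x (x + 1) = Ar K x x" using x by (simp add: Id_Ob One_Ob)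
    then obtain k :: int where k: "eqv K (x + of_int k) x" "eqv K (x + 1 + of_int k) x"
      using Ar_eq_iff x x1 by blast
    then have "Le K (x + 1 + of_int k) (x + of_int k)"
      using x x1 Pts_add eqv_sym eqv_trans by (meson eqv_def)
    then have "Le K (x + 1 + of_int k + of_int (- k)) (x + of_int k + of_int (- k))"
      using Le_add x x1 Pts_add by blast
    then show False using x1 by simp
  qed
next
  fix f g assume f: "f \<in> Arr (Cat K)" and g: "g \<in> Arr (Cat K)" and fg: "Cod (Cat K) f = Dom (Cat K) g"
  obtain x y where xy: "x \<in> Pts K" "y \<in> Pts K" "Le K x y" "f = Ar K x y" using f by (rule ArrE)
  then obtain z where z: "z \<in> Pts K" "Le K y z" "g = Ar K y z"
    using composable_lift[OF g, of y] fg Cod_Ar by metis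
  have "Le K x z" using xy z Le_trans by blast
  then show "Comp (Cat K) g f \<in> Arr (Cat K) \<and> Dom (Cat K) (Comp (Cat K) g f) = Dom (Cat K) f \<and>
      Cod (Cat K) (Comp (Cat K) g f) = Cod (Cat K) g"
    using xy z by (simp add: Comp_Ar Dom_Ar Cod_Ar Ar_in)
  fix h assume h: "h \<in> Arr (Cat K)" and gh: "Cod (Cat K) g = Dom (Cat K) h"
  obtain w where w: "w \<in> Pts K" "Le K z w" "h = Ar K z w"
    using composable_lift[OF h, of z] gh Cod_Ar z xy by metis
  have "Le K y w" using xy z w Le_trans by blast
  then show "Comp (Cat K) h (Comp (Cat K) g f) = Comp (Cat K) (Comp (Cat K) h g) f"
    using xy z w \<open>Le K x z\<close> by (simp add: Comp_Ar)
qed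

end

subsection \<open>Functors induced by monotone and antitone maps of the lifts\<close>

definition sg :: "bool \<Rightarrow> int" where
  "sg v = (if v then 1 else - 1)"

text \<open>The flag \<open>v\<close> is the variance. It is carried as a parameter through the whole development because
  orientation-preserving and orientation-reversing homeomorphisms are treated by the same arguments.
  Commuting with the translation is only required up to the equivalence of points.\<close>

definition equivariant :: "bool \<Rightarrow> cover \<Rightarrow> cover \<Rightarrow> (real \<Rightarrow> real) \<Rightarrow> bool" where
  "equivariant v K L f \<longleftrightarrow> is_cover K \<and> is_cover L \<and> (\<forall>x\<in>Pts K. f x \<in> Pts L) \<and>
     (\<forall>x\<in>Pts K. \<forall>y\<in>Pts K. Le K x y \<longrightarrow> (if v then Le L (f x) (f y) else Le L (f y) (f x))) \<and>
     (\<forall>x\<in>Pts K. eqv L (f (x + 1)) (f x + of_int (sg v)))"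

text \<open>A functor of either variance is determined by its values on \<open>Ob\<close> and \<open>Ar\<close> together with
  extensionality.\<close>

definition induces :: "bool \<Rightarrow> cover \<Rightarrow> cover \<Rightarrow> (real \<Rightarrow> real) \<Rightarrow> ufun dmor \<Rightarrow> bool" where
  "induces v K L f \<phi> \<longleftrightarrow> (\<exists>F T. \<phi> = (if v then Cov (F, T) else Contra (F, T)) \<and>
     F \<in> extensional (Obj (Cat K)) \<and> T \<in> extensional (Arr (Cat K)) \<and>
     (\<forall>x\<in>Pts K. F (Ob K x) = Ob L (f x)) \<and>
     (\<forall>x\<in>Pts K. \<forall>y\<in>Pts K. Le K x y \<longrightarrow>
        T (Ar K x y) = (if v then Ar L (f x) (f y) else Ar L (f y) (f x))))"

definition functor_of :: "bool \<Rightarrow> cover \<Rightarrow> cover \<Rightarrow> (real \<Rightarrow> real) \<Rightarrow> ufun dmor" where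
  "functor_of v K L f = (THE \<phi>. induces v K L f \<phi>)"

lemma equivariant_add_int:
  assumes "equivariant v K L f" "x \<in> Pts K"
  shows "eqv L (f (x + of_int k)) (f x + of_int (sg v * k))"
proof -
  interpret K: is_cover K using assms by (simp add: equivariant_def)
  interpret L: is_cover L using assms by (simp add: equivariant_def)
  have f: "f y \<in> Pts L" "eqv L (f (y + 1)) (f y + of_int (sg v))" if "y \<in> Pts K" for y
    using assms that by (auto simp: equivariant_def)
  have nat: "eqv L (f (y + of_int (int n))) (f y + of_int (sg v * int n))" if y: "y \<in> Pts K" for n y
  proof (induction n)
    case 0 then show ?case using f[OF y] L.eqv_refl by simp
  next
    case (Suc n)
    let ?y = "y + of_int (int n)"
    have yn: "?y \<in> Pts K" using y K.Pts_add by blast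
    have "eqv L (f (?y + 1)) (f ?y + of_int (sg v))" using f yn by blast
    moreover have "eqv L (f ?y + of_int (sg v)) (f y + of_int (sg v * int n) + of_int (sg v))"
      by (rule L.eqv_add[OF f(1)[OF yn] L.Pts_add[OF f(1)[OF y]] Suc.IH])
    moreover have "f (?y + 1) \<in> Pts L" by (rule f(1)[OF K.Pts_1[OF yn]])
    moreover have "f ?y + of_int (sg v) \<in> Pts L" by (rule L.Pts_add[OF f(1)[OF yn]])
    moreover have "f y + of_int (sg v * int n) + of_int (sg v) \<in> Pts L"
      by (intro L.Pts_add f(1)[OF y])
    ultimately have "eqv L (f (?y + 1)) (f y + of_int (sg v * int n) + of_int (sg v))"
      using L.eqv_trans by blast
    then show ?case by (simp add: algebra_simps)
  qed
  show ?thesis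
  proof (cases "k \<ge> 0")
    case True
    then show ?thesis using nat[OF assms(2), of "nat k"] by simp
  next
    case False
    let ?y = "x + of_int k"
    have y: "?y \<in> Pts K" using K.Pts_add assms by blast
    have "eqv L (f (?y + of_int (int (nat (- k))))) (f ?y + of_int (sg v * int (nat (- k))))"
      by (rule nat[OF y])
    then have "eqv L (f x) (f ?y + of_int (sg v * - k))" using False by simp
    then have "eqv L (f x + of_int (sg v * k)) (f ?y + of_int (sg v * - k) + of_int (sg v * k))"
      by (rule L.eqv_add[OF f(1)[OF assms(2)] L.Pts_add[OF f(1)[OF y]]])
    then show ?thesis using L.eqv_sym by (simp add: algebra_simps)
  qed
qed

lemma equivariant_eqv:
  assumes "equivariant v K L f" "x \<in> Pts K" "y \<in> Pts K" "eqv K x y"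
  shows "eqv L (f x) (f y)"
  using assms by (cases v) (auto simp: equivariant_def eqv_def)

lemma equivariant_eqv_add:
  assumes g: "equivariant v K L f" and xy: "x \<in> Pts K" "y \<in> Pts K" and e: "eqv K (x + of_int k) y"
  shows "eqv L (f x + of_int (sg v * k)) (f y)"
proof -
  interpret K: is_cover K using g by (simp add: equivariant_def)
  interpret L: is_cover L using g by (simp add: equivariant_def)
  have "eqv L (f (x + of_int k)) (f y)" by (rule equivariant_eqv[OF g K.Pts_add[OF xy(1)] xy(2) e])
  moreover have f: "f x \<in> Pts L" "f y \<in> Pts L" "f (x + of_int k) \<in> Pts L"
    using g xy K.Pts_add[OF xy(1), of k] by (auto simp: equivariant_def)
  ultimately show ?thesis
    using L.eqv_trans[OF L.Pts_add[OF f(1)] f(3,2)] L.eqv_sym equivariant_add_int[OF g xy(1), of k] by blast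
qed

lemma induces_unique:
  assumes "equivariant v K L f" "induces v K L f \<phi>" "induces v K L f \<psi>"
  shows "\<phi> = \<psi>"
proof -
  interpret K: is_cover K using assms by (simp add: equivariant_def)
  obtain F T F' T' where F: "\<phi> = (if v then Cov (F, T) else Contra (F, T))"
      "F \<in> extensional (Obj (Cat K))" "T \<in> extensional (Arr (Cat K))"
      "\<And>x. x \<in> Pts K \<Longrightarrow> F (Ob K x) = Ob L (f x)"
      "\<And>x y. \<lbrakk>x \<in> Pts K; y \<in> Pts K; Le K x y\<rbrakk> \<Longrightarrow>
        T (Ar K x y) = (if v then Ar L (f x) (f y) else Ar L (f y) (f x))"
    and F': "\<psi> = (if v then Cov (F', T') else Contra (F', T'))"
      "F' \<in> extensional (Obj (Cat K))" "T' \<in> extensional (Arr (Cat K))"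
      "\<And>x. x \<in> Pts K \<Longrightarrow> F' (Ob K x) = Ob L (f x)"
      "\<And>x y. \<lbrakk>x \<in> Pts K; y \<in> Pts K; Le K x y\<rbrakk> \<Longrightarrow>
        T' (Ar K x y) = (if v then Ar L (f x) (f y) else Ar L (f y) (f x))"
    using assms(2,3) unfolding induces_def by blast
  have "F = F'"
    by (rule extensionalityI[OF F(2) F'(2)]) (auto simp: K.Obj_eq F(4) F'(4))
  moreover have "T = T'"
    by (rule extensionalityI[OF F(3) F'(3)]) (auto simp: F(5) F'(5) elim!: K.ArrE)
  ultimately show ?thesis using F(1) F'(1) by simp
qed

text \<open>Two lifts of the same object or arrow differ by a translation and an equivalence, which an equivariant
  map preserves; so the value does not depend on the lift that is picked.\<close>

lemma induces_exists:
  assumes g: "equivariant v K L f"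
  shows "\<exists>\<phi>. induces v K L f \<phi>"
proof -
  interpret K: is_cover K using g by (simp add: equivariant_def)
  interpret L: is_cover L using g by (simp add: equivariant_def)
  have f: "f x \<in> Pts L" if "x \<in> Pts K" for x using g that by (auto simp: equivariant_def)
  have fle: "if v then Le L (f x) (f y) else Le L (f y) (f x)"
    if "x \<in> Pts K" "y \<in> Pts K" "Le K x y" for x y
    using g that by (auto simp: equivariant_def)
  define F where "F = (\<lambda>u\<in>Obj (Cat K). Ob L (f (SOME x. x \<in> Pts K \<and> Ob K x = u)))"
  define P where "P m p \<longleftrightarrow> fst p \<in> Pts K \<and> snd p \<in> Pts K \<and> Le K (fst p) (snd p) \<and> Ar K (fst p) (snd p) = m" for m p
  define A where "A x y = (if v then Ar L (f x) (f y) else Ar L (f y) (f x))" for x y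
  define T where "T = (\<lambda>m\<in>Arr (Cat K). A (fst (SOME p. P m p)) (snd (SOME p. P m p)))"
  have "F (Ob K x) = Ob L (f x)" if x: "x \<in> Pts K" for x
  proof -
    define x' where "x' = (SOME x'. x' \<in> Pts K \<and> Ob K x' = Ob K x)"
    have x': "x' \<in> Pts K \<and> Ob K x' = Ob K x"
      unfolding x'_def by (rule someI[of _ x]) (use x in simp)
    then obtain k :: int where "eqv K (x' + of_int k) x" using K.Ob_eq_iff x by blast
    then have "eqv L (f x' + of_int (sg v * k)) (f x)" using equivariant_eqv_add[OF g] x x' by blast
    then have "Ob L (f x') = Ob L (f x)" using L.Ob_eq_iff f x x' by blast
    then show ?thesis using x by (simp add: F_def x'_def K.Obj_eq)
  qed
  moreover have "T (Ar K x y) = A x y" if xy: "x \<in> Pts K" "y \<in> Pts K" "Le K x y" for x y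
  proof -
    define p where "p = (SOME p. P (Ar K x y) p)"
    have "P (Ar K x y) p"
      unfolding p_def by (rule someI[of _ "(x, y)"]) (use xy in \<open>simp add: P_def\<close>)
    then obtain a b where p: "p = (a, b)" "a \<in> Pts K" "b \<in> Pts K" "Le K a b" "Ar K a b = Ar K x y"
      by (cases p) (auto simp: P_def)
    then obtain k :: int where "eqv K (a + of_int k) x" "eqv K (b + of_int k) y"
      using K.Ar_eq_iff xy by blast
    then have "eqv L (f a + of_int (sg v * k)) (f x)" "eqv L (f b + of_int (sg v * k)) (f y)"
      using equivariant_eqv_add[OF g] xy p by blast+
    then have "A a b = A x y"
      unfolding A_def using L.Ar_eqI[of "f a" "f b" "f x" "f y" "sg v * k"]
        L.Ar_eqI[of "f b" "f a" "f y" "f x" "sg v * k"] f xy p fle[of a b] by (cases v) auto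
    then show ?thesis using p(1) K.Ar_in[OF xy] by (simp add: T_def flip: p_def)
  qed
  ultimately have "induces v K L f (if v then Cov (F, T) else Contra (F, T))"
    unfolding induces_def A_def by (intro exI[of _ F] exI[of _ T]) (simp add: F_def T_def)
  then show ?thesis ..
qed

lemma induces_functor_of: "equivariant v K L f \<Longrightarrow> induces v K L f (functor_of v K L f)"
  unfolding functor_of_def using induces_exists induces_unique by (metis (mono_tags, lifting) theI')

lemma functor_of_eqI: "equivariant v K L f \<Longrightarrow> induces v K L f \<phi> \<Longrightarrow> functor_of v K L f = \<phi>"
  using induces_functor_of induces_unique by blast

text \<open>Only the structural endomorphisms need an argument: \<open>(x, x + 1)\<close> goes to the pair of \<open>f x\<close> and \<open>f x + 1\<close>
  for monotone \<open>f\<close>, and to the pair of \<open>f x - 1\<close> and \<open>f x\<close> for antitone \<open>f\<close>, which is a translate of the former.\<close>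

lemma functor_of_in_dhom:
  assumes g: "equivariant v K L f"
  shows "functor_of v K L f \<in> dhom (Cat K) (Cat L)"
proof -
  interpret K: is_cover K using g by (simp add: equivariant_def)
  interpret L: is_cover L using g by (simp add: equivariant_def)
  have f: "f x \<in> Pts L" "eqv L (f (x + 1)) (f x + of_int (sg v))" if "x \<in> Pts K" for x
    using g that by (auto simp: equivariant_def)
  have fle: "Le L (f x) (f y)" if "v" "x \<in> Pts K" "y \<in> Pts K" "Le K x y" for x y
    using g that by (auto simp: equivariant_def)
  have fle': "Le L (f y) (f x)" if "\<not> v" "x \<in> Pts K" "y \<in> Pts K" "Le K x y" for x y
    using g that by (auto simp: equivariant_def)
  obtain F T where \<phi>: "functor_of v K L f = (if v then Cov (F, T) else Contra (F, T))"
    and periodic_extension: "F \<in> extensional (Obj (Cat K))" "T \<in> extensional (Arr (Cat K))"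
    and F: "\<And>x. x \<in> Pts K \<Longrightarrow> F (Ob K x) = Ob L (f x)"
    and T: "\<And>x y. \<lbrakk>x \<in> Pts K; y \<in> Pts K; Le K x y\<rbrakk> \<Longrightarrow>
        T (Ar K x y) = (if v then Ar L (f x) (f y) else Ar L (f y) (f x))"
    using induces_functor_of[OF g] unfolding induces_def by blast
  define D where "D = (if v then Cat L else op_zcat (Cat L))"
  have DO: "Obj D = Obj (Cat L)" and DA: "Arr D = Arr (Cat L)" by (simp_all add: D_def)
  have DC: "Dom D m = (if v then Dom (Cat L) m else Cod (Cat L) m)"
      "Cod D m = (if v then Cod (Cat L) m else Dom (Cat L) m)"
      "Id D = Id (Cat L)" "One D = One (Cat L)"
      "Comp D m m' = (if v then Comp (Cat L) m m' else Comp (Cat L) m' m)" for m m'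
    by (simp_all add: D_def op_zcat_def)
  have TA: "T (Ar K x y) \<in> Arr (Cat L)" "Dom D (T (Ar K x y)) = F (Ob K x)" "Cod D (T (Ar K x y)) = F (Ob K y)"
    if "x \<in> Pts K" "y \<in> Pts K" "Le K x y" for x y
    using that f fle[of x y] fle'[of x y]
    by (auto simp: T F DC L.Dom_Ar L.Cod_Ar intro: L.Ar_in)
  have "(F, T) \<in> zfunctors (Cat K) D"
    unfolding zfunctors_def
  proof (intro CollectI case_prodI conjI ballI impI)
    show "F \<in> Obj (Cat K) \<rightarrow>\<^sub>E Obj D"
      using periodic_extension F f by (auto simp: PiE_def K.Obj_eq L.Obj_eq DO)
    show "T \<in> Arr (Cat K) \<rightarrow>\<^sub>E Arr D"
      using periodic_extension TA(1) by (auto simp: PiE_def DA elim!: K.ArrE)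
    show "Dom D (T m) = F (Dom (Cat K) m)" "Cod D (T m) = F (Cod (Cat K) m)" if "m \<in> Arr (Cat K)" for m
      using that TA(2,3) by (auto simp: K.Dom_Ar K.Cod_Ar elim!: K.ArrE)
    show "T (Id (Cat K) u) = Id D (F u)" if "u \<in> Obj (Cat K)" for u
      using that f by (auto simp: K.Obj_eq K.Id_Ob F T DC L.Id_Ob K.Le_refl)
    show "T (One (Cat K) u) = One D (F u)" if u: "u \<in> Obj (Cat K)" for u
    proof -
      obtain x where x: "x \<in> Pts K" "u = Ob K x" using u by (auto simp: K.Obj_eq)
      have x1: "x + 1 \<in> Pts K" "Le K x (x + 1)" using x K.Pts_1 K.Le_1 by blast+
      have "(if v then Ar L (f x) (f (x + 1)) else Ar L (f (x + 1)) (f x)) = Ar L (f x) (f x + 1)"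
      proof (cases v)
        case True
        then show ?thesis
          using L.Ar_eqI0[of "f x" "f (x + 1)" "f x" "f x + 1"] f x x1 fle L.eqv_refl L.Pts_1
          by (simp add: sg_def)
      next
        case False
        have "eqv L (f (x + 1)) (f x - 1)" using f(2)[OF x(1)] False by (simp add: sg_def)
        moreover have "f x - 1 \<in> Pts L" using L.Pts_add[OF f(1)[OF x(1)], of "-1"] by simp
        ultimately have "eqv L (f (x + 1) + of_int 1) (f x)"
          using L.eqv_add[of "f (x + 1)" "f x - 1" 1] f x x1 by simp
        then show ?thesis
          using L.Ar_eqI[of "f (x + 1)" "f x" "f x" "f x + 1" 1] f x x1 fle' L.eqv_refl L.Pts_1 False
          by simp
      qed
      then show ?thesis using x x1 f by (simp add: K.One_Ob F T DC L.One_Ob)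
    qed
    show "T (Comp (Cat K) n m) = Comp D (T n) (T m)"
      if mn: "m \<in> Arr (Cat K)" "n \<in> Arr (Cat K)" "Cod (Cat K) m = Dom (Cat K) n" for m n
    proof -
      obtain x y where xy: "x \<in> Pts K" "y \<in> Pts K" "Le K x y" "m = Ar K x y" using mn K.ArrE by blast
      then obtain z where z: "z \<in> Pts K" "Le K y z" "n = Ar K y z"
        using K.composable_lift[OF mn(2), of y] mn(3) K.Cod_Ar by metis
      have "Le K x z" using xy z K.Le_trans by blast
      then show ?thesis
        using xy z f by (auto simp: K.Comp_Ar T DC L.Comp_Ar fle fle')
    qed
  qed
  then show ?thesis using \<phi> by (auto simp: dhom_def D_def)
qed

text \<open>This is how functors are compared: two of them are equal if they are induced by pointwise equivalent
  maps.\<close>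

lemma functor_of_cong:
  assumes "equivariant v K L f" "\<And>x. x \<in> Pts K \<Longrightarrow> g x \<in> Pts L \<and> eqv L (f x) (g x)"
  shows "equivariant v K L g" and "functor_of v K L g = functor_of v K L f"
proof -
  interpret K: is_cover K using assms by (simp add: equivariant_def)
  interpret L: is_cover L using assms by (simp add: equivariant_def)
  have f: "f x \<in> Pts L" "eqv L (f (x + 1)) (f x + of_int (sg v))" if "x \<in> Pts K" for x
    using assms that by (auto simp: equivariant_def)
  have le: "Le L (f x) (f y) \<longleftrightarrow> Le L (g x) (g y)" if "x \<in> Pts K" "y \<in> Pts K" for x y
  proof -
    have "g x \<in> Pts L" "g y \<in> Pts L" "Le L (f x) (g x)" "Le L (g x) (f x)" "Le L (f y) (g y)" "Le L (g y) (f y)"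
      using assms(2) that by (auto simp: eqv_def)
    then show ?thesis using that f L.Le_trans by meson
  qed
  show g: "equivariant v K L g"
    unfolding equivariant_def
  proof (intro conjI ballI impI)
    show "is_cover K" "is_cover L" by unfold_locales
    fix x assume x: "x \<in> Pts K"
    show "g x \<in> Pts L" using assms(2) x by blast
    have "x + 1 \<in> Pts K" using x K.Pts_1 by blast
    then have x1: "g (x + 1) \<in> Pts L" "eqv L (g (x + 1)) (f (x + 1))" "f (x + 1) \<in> Pts L"
      using assms(2) f L.eqv_sym by blast+
    have gx: "g x \<in> Pts L" "eqv L (f x) (g x)" using assms(2) x by blast+
    have "eqv L (g (x + 1)) (f x + of_int (sg v))"
      by (rule L.eqv_trans[OF x1(1,3) L.Pts_add[OF f(1)[OF x]] x1(2) f(2)[OF x]])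
    then show "eqv L (g (x + 1)) (g x + of_int (sg v))"
      using L.eqv_trans[OF x1(1) L.Pts_add[OF f(1)[OF x]] L.Pts_add[OF gx(1)]]
        L.eqv_add[OF f(1)[OF x] gx] by blast
    fix y assume y: "y \<in> Pts K" "Le K x y"
    then have "if v then Le L (f x) (f y) else Le L (f y) (f x)" using assms(1) x by (simp add: equivariant_def)
    then show "if v then Le L (g x) (g y) else Le L (g y) (g x)"
      using le[OF x y(1)] le[OF y(1) x] by (cases v) auto
  qed
  have "induces v K L g (functor_of v K L f)"
  proof -
    have fle: "if v then Le L (f x) (f y) else Le L (f y) (f x)"
      if "x \<in> Pts K" "y \<in> Pts K" "Le K x y" for x y
      using assms(1) that by (auto simp: equivariant_def)
    have "Ob L (f x) = Ob L (g x)" if "x \<in> Pts K" for x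
      using L.Ob_eq_iff[of "f x" "g x"] f assms(2) that by (metis add.right_neutral of_int_0)
    moreover have "(if v then Ar L (f x) (f y) else Ar L (f y) (f x)) = (if v then Ar L (g x) (g y) else Ar L (g y) (g x))"
      if "x \<in> Pts K" "y \<in> Pts K" "Le K x y" for x y
      using L.Ar_eqI0[of "f x" "f y" "g x" "g y"] L.Ar_eqI0[of "f y" "f x" "g y" "g x"]
        f assms(2) that fle[OF that] by (cases v) auto
    ultimately show ?thesis
      using induces_functor_of[OF assms(1)] unfolding induces_def by (metis (no_types, lifting))
  qed
  then show "functor_of v K L g = functor_of v K L f" using g functor_of_eqI by blast
qed

lemma equivariant_id:
  assumes "is_cover K" shows "equivariant True K K (\<lambda>x. x)"
proof -
  interpret is_cover K by fact
  show ?thesis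
    unfolding equivariant_def by (auto simp: sg_def intro: is_cover_axioms eqv_refl Pts_1)
qed

lemma functor_of_id:
  assumes "is_cover K" shows "functor_of True K K (\<lambda>x. x) = did (Cat K)"
proof -
  interpret is_cover K by fact
  have "induces True K K (\<lambda>x. x) (did (Cat K))"
    unfolding induces_def did_def zfun_id_def
    by (intro exI[of _ "\<lambda>x\<in>Obj (Cat K). x"] exI[of _ "\<lambda>f\<in>Arr (Cat K). f"])
      (auto simp: Obj_eq intro: Ar_in)
  then show ?thesis using functor_of_eqI equivariant_id assms by blast
qed

text \<open>Variances multiply like signs, hence the composite has variance \<open>v = w\<close>.\<close>

lemma
  assumes f: "equivariant v K L f" and g: "equivariant w L M g"
  shows equivariant_comp: "equivariant (v = w) K M (\<lambda>x. g (f x))"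
    and dcomp_functor_of: "dcomp (Cat K) (functor_of w L M g) (functor_of v K L f) = functor_of (v = w) K M (\<lambda>x. g (f x))"
proof -
  interpret K: is_cover K using f by (simp add: equivariant_def)
  interpret L: is_cover L using f by (simp add: equivariant_def)
  interpret M: is_cover M using g by (simp add: equivariant_def)
  have fP: "f x \<in> Pts L" "eqv L (f (x + 1)) (f x + of_int (sg v))" if "x \<in> Pts K" for x
    using f that by (auto simp: equivariant_def)
  have gP: "g x \<in> Pts M" if "x \<in> Pts L" for x
    using g that by (auto simp: equivariant_def)
  have fle: "if v then Le L (f x) (f y) else Le L (f y) (f x)"
    if "x \<in> Pts K" "y \<in> Pts K" "Le K x y" for x y
    using f that by (auto simp: equivariant_def)
  have gle: "if w then Le M (g x) (g y) else Le M (g y) (g x)"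
    if "x \<in> Pts L" "y \<in> Pts L" "Le L x y" for x y
    using g that by (auto simp: equivariant_def)
  show equivariant: "equivariant (v = w) K M (\<lambda>x. g (f x))"
    unfolding equivariant_def
  proof (intro conjI ballI impI)
    show "is_cover K" "is_cover M" by unfold_locales
    fix x assume x: "x \<in> Pts K"
    show "g (f x) \<in> Pts M" using gP fP x by blast
    have x1: "x + 1 \<in> Pts K" using x K.Pts_1 by blast
    have "eqv M (g (f x) + of_int (sg w * sg v)) (g (f (x + 1)))"
      using equivariant_eqv_add[OF g, of "f x" "f (x + 1)" "sg v"] fP x x1 L.eqv_sym by blast
    moreover have "sg w * sg v = sg (v = w)" by (auto simp: sg_def)
    ultimately show "eqv M (g (f (x + 1))) (g (f x) + of_int (sg (v = w)))"
      using M.eqv_sym by metis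
    fix y assume y: "y \<in> Pts K" "Le K x y"
    show "if v = w then Le M (g (f x)) (g (f y)) else Le M (g (f y)) (g (f x))"
      using fle[OF x y] gle[of "f x" "f y"] gle[of "f y" "f x"] fP x y by (cases v; cases w) auto
  qed
  obtain F T where 1: "functor_of v K L f = (if v then Cov (F, T) else Contra (F, T))"
    and F: "\<And>x. x \<in> Pts K \<Longrightarrow> F (Ob K x) = Ob L (f x)"
    and T: "\<And>x y. \<lbrakk>x \<in> Pts K; y \<in> Pts K; Le K x y\<rbrakk> \<Longrightarrow>
        T (Ar K x y) = (if v then Ar L (f x) (f y) else Ar L (f y) (f x))"
    using induces_functor_of[OF f] unfolding induces_def by blast
  obtain G U where 2: "functor_of w L M g = (if w then Cov (G, U) else Contra (G, U))"
    and G: "\<And>x. x \<in> Pts L \<Longrightarrow> G (Ob L x) = Ob M (g x)"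
    and U: "\<And>x y. \<lbrakk>x \<in> Pts L; y \<in> Pts L; Le L x y\<rbrakk> \<Longrightarrow>
        U (Ar L x y) = (if w then Ar M (g x) (g y) else Ar M (g y) (g x))"
    using induces_functor_of[OF g] unfolding induces_def by blast
  have "dcomp (Cat K) (functor_of w L M g) (functor_of v K L f)
    = (if v = w then Cov (compose (Obj (Cat K)) G F, compose (Arr (Cat K)) U T)
       else Contra (compose (Obj (Cat K)) G F, compose (Arr (Cat K)) U T))"
    unfolding 1 2 by (cases v; cases w) (auto simp: zfun_comp_def)
  moreover have "compose (Obj (Cat K)) G F (Ob K x) = Ob M (g (f x))" if "x \<in> Pts K" for x
    using that fP by (simp add: compose_def K.Obj_eq F G)
  moreover have "compose (Arr (Cat K)) U T (Ar K x y)
      = (if v = w then Ar M (g (f x)) (g (f y)) else Ar M (g (f y)) (g (f x)))"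
    if "x \<in> Pts K" "y \<in> Pts K" "Le K x y" for x y
    using that fP fle[OF that] K.Ar_in[OF that] by (cases v; cases w) (auto simp: compose_def T U)
  ultimately have "induces (v = w) K M (\<lambda>x. g (f x)) (dcomp (Cat K) (functor_of w L M g) (functor_of v K L f))"
    unfolding induces_def
    by (intro exI[of _ "compose (Obj (Cat K)) G F"] exI[of _ "compose (Arr (Cat K)) U T"]) simp
  then show "dcomp (Cat K) (functor_of w L M g) (functor_of v K L f) = functor_of (v = w) K M (\<lambda>x. g (f x))"
    using functor_of_eqI[OF equivariant] by simp
qed

lemma is_dinv_functor_of:
  assumes f: "equivariant v K L f" and g: "equivariant v L K g"
    and gf: "\<And>x. x \<in> Pts K \<Longrightarrow> eqv K (g (f x)) x" and fg: "\<And>x. x \<in> Pts L \<Longrightarrow> eqv L (f (g x)) x"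
  shows "is_dinv (Cat K) (Cat L) (functor_of v K L f) (functor_of v L K g)"
proof -
  have c: "is_cover K" "is_cover L" using f by (auto simp: equivariant_def)
  have "functor_of True K K (\<lambda>x. g (f x)) = functor_of True K K (\<lambda>x. x)"
    by (rule functor_of_cong(2)[OF equivariant_id[OF c(1)]])
      (use f g gf in \<open>auto simp: equivariant_def eqv_def\<close>)
  moreover have "functor_of True L L (\<lambda>x. f (g x)) = functor_of True L L (\<lambda>x. x)"
    by (rule functor_of_cong(2)[OF equivariant_id[OF c(2)]])
      (use f g fg in \<open>auto simp: equivariant_def eqv_def\<close>)
  ultimately show ?thesis
    unfolding is_dinv_def using dcomp_functor_of[OF f g] dcomp_functor_of[OF g f] functor_of_in_dhom[OF f] functor_of_in_dhom[OF g] functor_of_id c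
    by simp
qed

lemma dinv_functor_of:
  assumes f: "equivariant v K L f" and g: "equivariant v L K g"
    and gf: "\<And>x. x \<in> Pts K \<Longrightarrow> eqv K (g (f x)) x" and fg: "\<And>x. x \<in> Pts L \<Longrightarrow> eqv L (f (g x)) x"
  shows "dinv (Cat K) (Cat L) (functor_of v K L f) = functor_of v L K g"
  unfolding dinv_def
proof (rule the_equality)
  show inv: "is_dinv (Cat K) (Cat L) (functor_of v K L f) (functor_of v L K g)" using assms by (rule is_dinv_functor_of)
  let ?\<phi> = "functor_of v K L f" and ?\<chi> = "functor_of v L K g"
  fix \<psi> assume \<psi>: "is_dinv (Cat K) (Cat L) ?\<phi> \<psi>"
  have "\<psi> = dcomp (Cat L) \<psi> (did (Cat L))"
    using \<psi> dcomp_did(1) by (metis is_dinv_def)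
  also have "\<dots> = dcomp (Cat L) \<psi> (dcomp (Cat L) ?\<phi> ?\<chi>)" using inv by (simp add: is_dinv_def)
  also have "\<dots> = dcomp (Cat L) (dcomp (Cat K) \<psi> ?\<phi>) ?\<chi>"
    using inv by (intro dcomp_assoc) (auto simp: is_dinv_def)
  also have "\<dots> = ?\<chi>" using \<psi> inv dcomp_did(2) by (metis is_dinv_def)
  finally show "\<psi> = ?\<chi>" .
qed

section \<open>Complements of finite subsets of the circle\<close>

text \<open>The relation says that both points lie in the same component of the preimage of the complement of \<open>F\<close>.
  One of the two intervals is always empty or a point; with both of them the relation is visibly symmetric.\<close>

definition same :: "circle set \<Rightarrow> real \<Rightarrow> real \<Rightarrow> bool" where
  "same F x y \<longleftrightarrow> {y..x} \<inter> proj -` F = {} \<and> {x..y} \<inter> proj -` F = {}"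

text \<open>Arrows of \<open>pi0\<close> are by definition arrows between the chosen points of the components. This is the
  lift of the chosen point in the lifted component of \<open>x\<close>.\<close>

definition base_lift :: "circle set \<Rightarrow> real \<Rightarrow> real" where
  "base_lift F x = (THE h. same F x h \<and> proj h = pt (comp_of F (proj x)))"

lemma same_segment: "same F x y \<longleftrightarrow> closed_segment x y \<inter> proj -` F = {}"
  by (auto simp: same_def closed_segment_eq_real_ivl disjoint_iff)

lemma same_sym: "same F x y \<Longrightarrow> same F y x"
  by (auto simp: same_def)

lemma same_refl: "proj x \<notin> F \<Longrightarrow> same F x x"
  by (auto simp: same_def)

lemma misses_trans:
  fixes x y z :: real
  assumes "{y..x} \<inter> C = {}" "{z..y} \<inter> C = {}"
  shows "{z..x} \<inter> C = {}"
proof -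
  have "{z..x} \<subseteq> {y..x} \<union> {z..y}" by auto
  then show ?thesis using assms by blast
qed

lemma same_trans: "same F x y \<Longrightarrow> same F y z \<Longrightarrow> same F x z"
  unfolding same_def using misses_trans by blast

lemma misses_add:
  "{y..x} \<inter> proj -` F = {} \<Longrightarrow> {y + of_int k..x + of_int k} \<inter> proj -` F = {}"
proof -
  assume *: "{y..x} \<inter> proj -` F = {}"
  have False if "u \<in> {y + of_int k..x + of_int k}" "proj u \<in> F" for u
  proof -
    have "u - of_int k \<in> {y..x}" using that by auto
    moreover have "proj (u - of_int k) = proj u" using proj_add_int[of u "- k"] by simp
    ultimately show False using * that by (auto simp: disjoint_iff)
  qed
  then show ?thesis by blast
qed

lemma same_add: "same F x y \<Longrightarrow> same F (x + of_int k) (y + of_int k)"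
  unfolding same_def using misses_add by blast

lemma same_notin: "same F x y \<Longrightarrow> proj x \<notin> F \<and> proj y \<notin> F"
  unfolding same_segment by (auto simp: disjoint_iff)

lemma closed_vimage_proj:
  assumes "finite F" shows "closed (proj -` F)"
proof -
  have "closed (proj -` {c})" for c
  proof -
    have "proj -` {c} = (\<lambda>x. x - rep_circle c) -` \<int>"
      by (auto simp: proj_eq_iff[symmetric])
    then show ?thesis by (simp add: closed_Ints continuous_closed_vimage)
  qed
  moreover have "proj -` F = (\<Union>c\<in>F. proj -` {c})" by auto
  ultimately show ?thesis using assms by (auto intro: closed_UN)
qed

lemma open_same:
  assumes "finite F" shows "open {y. same F x y}"
  unfolding open_contains_ball
proof
  fix y assume "y \<in> {y. same F x y}"
  then have y: "same F x y" by simp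
  have "open (- (proj -` F))" using closed_vimage_proj[OF assms] by blast
  moreover have "y \<in> - (proj -` F)" using same_notin[OF y] by auto
  ultimately obtain e where e: "e > 0" "ball y e \<subseteq> - (proj -` F)" by (meson open_contains_ball)
  have "same F y z" if "z \<in> ball y e" for z
  proof -
    have "y \<in> ball y e" using e by simp
    then have "closed_segment y z \<subseteq> ball y e" using that by (meson convex_ball convex_contains_segment)
    then show ?thesis using e by (auto simp: same_segment)
  qed
  then show "\<exists>e>0. ball y e \<subseteq> {y. same F x y}" using e y same_trans by blast
qed

text \<open>The projection maps the component of the lifted complement onto the component of the
  complement: distinct images of lifted components are disjoint and open.\<close>

lemma comp_of_proj:
  assumes F: "finite F" and x: "proj x \<notin> F"
  shows "comp_of F (proj x) = proj ` {y. same F x y}"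
proof
  let ?U = "\<lambda>x. proj ` {y. same F x y}"
  have op: "open (?U y)" for y using open_proj_image[OF open_same[OF F]] .
  define V where "V = \<Union> (?U ` {y. proj y \<notin> F \<and> proj y \<notin> ?U x})"
  have dis: "?U x \<inter> V = {}"
  proof -
    have "proj y \<in> ?U x" if ab: "same F x a" "same F y b" "proj a = proj b" for a b y
    proof -
      obtain k :: int where "b = a + of_int k" using proj_eqE ab(3) by blast
      then have "same F (x + of_int k) y" using ab(1,2) same_add same_trans same_sym by blast
      then have "same F x (y + of_int (- k))" using same_add[of F "x + of_int k" y "- k"] by simp
      then have "y + of_int (- k) \<in> {y. same F x y}" by simp
      then have "proj (y + of_int (- k)) \<in> ?U x" by (rule imageI)
      then show ?thesis by (simp only: proj_add_int)
    qed
    then show ?thesis unfolding V_def by auto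
  qed
  have cov: "- F \<subseteq> ?U x \<union> V"
  proof
    fix c assume "c \<in> - F"
    then have "proj (rep_circle c) \<notin> F" by simp
    then have "c \<in> ?U (rep_circle c)" using same_refl[of "rep_circle c" F] by force
    then show "c \<in> ?U x \<union> V" unfolding V_def using \<open>c \<in> - F\<close> by (cases "c \<in> ?U x") (auto intro!: exI[of _ "rep_circle c"])
  qed
  have "V \<inter> comp_of F (proj x) = {}"
  proof (rule ccontr)
    assume V: "V \<inter> comp_of F (proj x) \<noteq> {}"
    have "connected (comp_of F (proj x))" by (simp add: comp_of_def)
    moreover have "comp_of F (proj x) \<subseteq> - F" unfolding comp_of_def by (rule connected_component_subset)
    moreover have "proj x \<in> comp_of F (proj x)" "proj x \<in> ?U x"
      using x by (auto simp: comp_of_def same_refl)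
    moreover have "open V" unfolding V_def using op by blast
    ultimately show False
      using V dis cov op[of x] connectedD[of "comp_of F (proj x)" "?U x" V] by auto
  qed
  moreover have "comp_of F (proj x) \<subseteq> - F" unfolding comp_of_def by (rule connected_component_subset)
  ultimately show "comp_of F (proj x) \<subseteq> ?U x" using cov by blast
  have "is_interval {y. same F x y}"
    unfolding is_interval_1
  proof (intro ballI allI impI; elim conjE)
    fix a b z :: real assume ab: "a \<in> {y. same F x y}" "b \<in> {y. same F x y}" and z: "a \<le> z" "z \<le> b"
    then have "same F a b" using same_trans[OF same_sym, of F x a b] by simp
    moreover have "{a..z} \<subseteq> {a..b}" "{z..a} \<subseteq> {a..b}" using z by auto
    ultimately have "same F a z" unfolding same_def by blast
    then show "z \<in> {y. same F x y}" using ab same_trans[of F x a z] by simp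
  qed
  then have "connected {y. same F x y}" by (simp add: is_interval_connected_1)
  then have "connected (?U x)"
    by (rule connected_continuous_image[rotated]) (intro continuous_on_proj continuous_on_id)
  moreover have "?U x \<subseteq> - F" using same_notin by auto
  ultimately show "?U x \<subseteq> comp_of F (proj x)"
    unfolding comp_of_def by (rule connected_component_maximal[rotated]) (use x same_refl in auto)
qed

lemma comp_of_eq_iff:
  assumes "finite F" "proj x \<notin> F" "proj y \<notin> F"
  shows "comp_of F (proj x) = comp_of F (proj y) \<longleftrightarrow> (\<exists>k::int. same F (x + of_int k) y)"
proof
  assume "comp_of F (proj x) = comp_of F (proj y)"
  moreover have "proj y \<in> comp_of F (proj y)" using assms by (simp add: comp_of_def)
  ultimately have "proj y \<in> proj ` {y. same F x y}" using comp_of_proj[OF assms(1,2)] by simp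
  then obtain a where a: "same F x a" "proj a = proj y" by auto
  then obtain k where "y = a + of_int k" using proj_eqE by blast
  then show "\<exists>k::int. same F (x + of_int k) y" using same_add a by blast
next
  assume "\<exists>k::int. same F (x + of_int k) y"
  then obtain k :: int where k: "same F (x + of_int k) y" by blast
  then have "{z. same F (x + of_int k) z} = {z. same F y z}"
    using same_trans[OF k] same_trans[OF same_sym[OF k]] by blast
  then show "comp_of F (proj x) = comp_of F (proj y)"
    using comp_of_proj[of F "x + of_int k"] comp_of_proj[of F y] assms by simp
qed

locale finite_nonempty =
  fixes F :: "circle set" assumes F: "F \<in> index_sets"
begin

lemma fin: "finite F" using F by (simp add: index_sets_def)

text \<open>A lifted component is shorter than one turn, so it contains one lift of the chosen point.\<close>

lemma no_full_turn: "\<not> {x..x + 1} \<inter> proj -` F = {}"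
proof -
  obtain c where "c \<in> F" using F by (auto simp: index_sets_def)
  define u where "u = x + frac (rep_circle c - x)"
  have "u = rep_circle c + of_int (- \<lfloor>rep_circle c - x\<rfloor>)" by (simp add: u_def frac_def)
  then have "proj u = c" by (simp only: proj_add_int proj_rep)
  moreover have "u \<in> {x..x + 1}"
    using frac_ge_0[of "rep_circle c - x"] frac_lt_1[of "rep_circle c - x"] by (auto simp: u_def)
  ultimately show ?thesis using \<open>c \<in> F\<close> by (auto simp: disjoint_iff)
qed

lemma same_proj_eq:
  assumes "same F x y" "proj x = proj y" shows "x = y"
proof -
  obtain k :: int where k: "y = x + of_int k" using proj_eqE assms(2) by blast
  have False if "k \<ge> 1"
  proof -
    have "{x..x + 1} \<subseteq> {x..y}" using that k by auto
    then show False using no_full_turn[of x] assms(1) unfolding same_def by blast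
  qed
  moreover have False if "k \<le> -1"
  proof -
    have "{y..y + 1} \<subseteq> {y..x}" using that k by auto
    then show False using no_full_turn[of y] assms(1) unfolding same_def by blast
  qed
  ultimately show ?thesis using k by (cases "k = 0") force+
qed

lemma base_lift:
  assumes x: "proj x \<notin> F"
  shows "same F x (base_lift F x)" "proj (base_lift F x) = pt (comp_of F (proj x))"
    and base_lift_unique: "\<lbrakk>same F x h; proj h = pt (comp_of F (proj x))\<rbrakk> \<Longrightarrow> base_lift F x = h"
proof -
  have "proj x \<in> comp_of F (proj x)" using x by (simp add: comp_of_def)
  then have "pt (comp_of F (proj x)) \<in> comp_of F (proj x)" unfolding pt_def by (rule someI)
  then obtain h where h: "same F x h" "proj h = pt (comp_of F (proj x))"
    using comp_of_proj[OF fin x] by auto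
  have uniq: "h' = h''" if "same F x h'" "proj h' = pt (comp_of F (proj x))"
    "same F x h''" "proj h'' = pt (comp_of F (proj x))" for h' h''
    using that same_proj_eq same_trans same_sym by metis
  then have eq: "base_lift F x = h'" if "same F x h'" "proj h' = pt (comp_of F (proj x))" for h'
    unfolding base_lift_def using that by (intro the_equality) auto
  then show "same F x (base_lift F x)" "proj (base_lift F x) = pt (comp_of F (proj x))" using h by auto
  show "\<lbrakk>same F x h; proj h = pt (comp_of F (proj x))\<rbrakk> \<Longrightarrow> base_lift F x = h" for h by (rule eq)
qed

lemma base_lift_notin: "proj x \<notin> F \<Longrightarrow> proj (base_lift F x) \<notin> F"
  using base_lift(1) same_notin by blast

lemma base_lift_cong:
  assumes "same F x y" shows "base_lift F x = base_lift F y"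
proof (rule base_lift_unique)
  have xy: "proj x \<notin> F" "proj y \<notin> F" using same_notin[OF assms] by auto
  show "proj x \<notin> F" by fact
  show "same F x (base_lift F y)" using assms base_lift(1)[OF xy(2)] same_trans by blast
  have "comp_of F (proj x) = comp_of F (proj y)"
    using comp_of_eq_iff[OF fin xy] assms by (metis add.right_neutral of_int_0)
  then show "proj (base_lift F y) = pt (comp_of F (proj x))" using base_lift(2)[OF xy(2)] by simp
qed

lemma base_lift_add:
  assumes "proj x \<notin> F" shows "base_lift F (x + of_int k) = base_lift F x + of_int k"
proof (rule base_lift_unique)
  show "proj (x + of_int k) \<notin> F" using assms by simp
  show "same F (x + of_int k) (base_lift F x + of_int k)" by (rule same_add[OF base_lift(1)[OF assms]])
  show "proj (base_lift F x + of_int k) = pt (comp_of F (proj (x + of_int k)))"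
    using base_lift(2)[OF assms] by (simp only: proj_add_int)
qed

lemma base_lift_le_iff:
  assumes x: "proj x \<notin> F" and y: "proj y \<notin> F"
  shows "base_lift F x \<le> base_lift F y \<longleftrightarrow> {y..x} \<inter> proj -` F = {}"
proof -
  have less: "base_lift F a < base_lift F b" if ab: "proj a \<notin> F" "proj b \<notin> F" "u \<in> {a..b}" "proj u \<in> F" for a b u
  proof -
    have "\<not> u \<le> base_lift F a" "\<not> base_lift F b \<le> u"
      using base_lift(1)[OF ab(1)] base_lift(1)[OF ab(2)] ab by (auto simp: same_def disjoint_iff)
    then show ?thesis by linarith
  qed
  show ?thesis
  proof
    assume "base_lift F x \<le> base_lift F y"
    then show "{y..x} \<inter> proj -` F = {}" using less[OF y x] by force
  next
    assume m: "{y..x} \<inter> proj -` F = {}"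
    show "base_lift F x \<le> base_lift F y"
    proof (cases "{x..y} \<inter> proj -` F = {}")
      case True
      then have "same F x y" using m by (simp add: same_def)
      then show ?thesis using base_lift_cong by simp
    next
      case False
      then show ?thesis using less[OF x y] by force
    qed
  qed
qed

lemma base_lift_eq_iff:
  assumes "proj x \<notin> F" "proj y \<notin> F" shows "base_lift F x = base_lift F y \<longleftrightarrow> same F x y"
  using base_lift_le_iff[OF assms] base_lift_le_iff[OF assms(2,1)] by (auto simp: same_def)

end

text \<open>The preorder is \<open>x \<le> y\<close> up to components: for \<open>x < y\<close> the interval \<open>{y..x}\<close> is empty, and otherwise the
  condition says that both points lie in the same component.\<close>

definition pi0_cover :: "circle set \<Rightarrow> cover" where
  "pi0_cover F = \<lparr>Cat = pi0 F, Pts = {x. proj x \<notin> F}, Le = (\<lambda>x y. {y..x} \<inter> proj -` F = {}),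
     Ob = (\<lambda>x. Arc (comp_of F (proj x))), Ar = (\<lambda>x y. Path (monotone_class (base_lift F x) (base_lift F y)))\<rparr>"

lemma pi0_cover_simps [simp]: "Cat (pi0_cover F) = pi0 F" "x \<in> Pts (pi0_cover F) \<longleftrightarrow> proj x \<notin> F"
    "Le (pi0_cover F) x y \<longleftrightarrow> {y..x} \<inter> proj -` F = {}" "Ob (pi0_cover F) x = Arc (comp_of F (proj x))"
    "Ar (pi0_cover F) x y = Path (monotone_class (base_lift F x) (base_lift F y))"
  by (simp_all add: pi0_cover_def)

lemma eqv_pi0_cover [simp]: "eqv (pi0_cover F) x y \<longleftrightarrow> same F x y"
  by (simp add: eqv_def same_def)

context finite_nonempty
begin

lemma is_cover_pi0: "is_cover (pi0_cover F)"
proof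
  fix x y z :: real and k :: int
  show "x \<in> Pts (pi0_cover F) \<Longrightarrow> x + of_int k \<in> Pts (pi0_cover F)" by simp
  show "x \<in> Pts (pi0_cover F) \<Longrightarrow> Le (pi0_cover F) x x" by simp
  show "Le (pi0_cover F) x y \<Longrightarrow> Le (pi0_cover F) y z \<Longrightarrow> Le (pi0_cover F) x z"
    unfolding pi0_cover_simps using misses_trans by blast
  show "Le (pi0_cover F) x y \<Longrightarrow> Le (pi0_cover F) (x + of_int k) (y + of_int k)"
    unfolding pi0_cover_simps by (rule misses_add)
  show "Le (pi0_cover F) x (x + 1)" by simp
  show "\<not> Le (pi0_cover F) (x + 1) x" unfolding pi0_cover_simps by (rule no_full_turn)
next
  have comps: "components (- F) = (\<lambda>x. comp_of F (proj x)) ` {x. proj x \<notin> F}"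
  proof -
    have "- F = proj ` {x. proj x \<notin> F}"
      by (auto intro: image_eqI[of _ proj "rep_circle _"])
    then show ?thesis unfolding components_def comp_of_def by auto
  qed
  show "Obj (Cat (pi0_cover F)) = Ob (pi0_cover F) ` Pts (pi0_cover F)"
    by (auto simp: pi0_def comps)
  have ends: "(\<exists>x. proj x \<notin> F \<and> a = base_lift F x) \<longleftrightarrow> proj a \<in> pt ` components (- F)" for a
  proof
    assume "\<exists>x. proj x \<notin> F \<and> a = base_lift F x"
    then show "proj a \<in> pt ` components (- F)" using base_lift(2) by (auto simp: comps)
  next
    assume "proj a \<in> pt ` components (- F)"
    then obtain x where x: "proj x \<notin> F" "proj a = pt (comp_of F (proj x))" by (auto simp: comps)
    then have "proj (base_lift F x) = proj a" using base_lift(2) by simp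
    then obtain k :: int where "a = base_lift F x + of_int k" using proj_eqE by blast
    then show "\<exists>x. proj x \<notin> F \<and> a = base_lift F x"
      using x base_lift_add by (intro exI[of _ "x + of_int k"]) simp
  qed
  show "Arr (Cat (pi0_cover F)) = {Ar (pi0_cover F) x y | x y. x \<in> Pts (pi0_cover F) \<and> y \<in> Pts (pi0_cover F) \<and> Le (pi0_cover F) x y}"
  proof (intro Set.set_eqI iffI)
    fix m assume "m \<in> Arr (Cat (pi0_cover F))"
    then obtain A where A: "m = Path A" "A \<in> Arr circle_cat"
        "Dom circle_cat A \<in> pt ` components (- F)" "Cod circle_cat A \<in> pt ` components (- F)"
      by (auto simp: pi0_def)
    then obtain a b where ab: "a \<le> b" "A = monotone_class a b" using Arr_circle by blast
    obtain x where x: "proj x \<notin> F" "a = base_lift F x"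
      using A ab ends[of a] by (auto simp: Dom_circle)
    obtain y where y: "proj y \<notin> F" "b = base_lift F y"
      using A ab ends[of b] by (auto simp: Cod_circle)
    have "{y..x} \<inter> proj -` F = {}" using base_lift_le_iff[OF x(1) y(1)] ab x y by simp
    then show "m \<in> {Ar (pi0_cover F) x y | x y. x \<in> Pts (pi0_cover F) \<and> y \<in> Pts (pi0_cover F) \<and> Le (pi0_cover F) x y}"
      using A(1) ab x y by (intro CollectI exI[of _ x] exI[of _ y]) (simp del: Int_atLeastAtMost)
  next
    fix m assume "m \<in> {Ar (pi0_cover F) x y | x y. x \<in> Pts (pi0_cover F) \<and> y \<in> Pts (pi0_cover F) \<and> Le (pi0_cover F) x y}"
    then obtain x y where xy: "proj x \<notin> F" "proj y \<notin> F" "base_lift F x \<le> base_lift F y"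
        "m = Path (monotone_class (base_lift F x) (base_lift F y))"
      using base_lift_le_iff by auto
    then show "m \<in> Arr (Cat (pi0_cover F))"
      using ends[of "base_lift F x"] ends[of "base_lift F y"]
      by (auto simp: pi0_def Arr_circle Dom_circle Cod_circle intro!: imageI)
  qed
  fix x y z x' y' :: real
  show "Ob (pi0_cover F) x = Ob (pi0_cover F) y \<longleftrightarrow> (\<exists>k::int. eqv (pi0_cover F) (x + of_int k) y)"
    if "x \<in> Pts (pi0_cover F)" "y \<in> Pts (pi0_cover F)"
    using comp_of_eq_iff[OF fin] that by simp
  show "Ar (pi0_cover F) x y = Ar (pi0_cover F) x' y' \<longleftrightarrow>
      (\<exists>k::int. eqv (pi0_cover F) (x + of_int k) x' \<and> eqv (pi0_cover F) (y + of_int k) y')"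
    if "x \<in> Pts (pi0_cover F)" "y \<in> Pts (pi0_cover F)" "x' \<in> Pts (pi0_cover F)" "y' \<in> Pts (pi0_cover F)" "Le (pi0_cover F) x y"
  proof -
    have n: "proj x \<notin> F" "proj y \<notin> F" "proj x' \<notin> F" "proj y' \<notin> F" using that by auto
    have "base_lift F x \<le> base_lift F y" using that n base_lift_le_iff by simp
    then have "Ar (pi0_cover F) x y = Ar (pi0_cover F) x' y' \<longleftrightarrow>
        (\<exists>k::int. base_lift F x' = base_lift F (x + of_int k) \<and> base_lift F y' = base_lift F (y + of_int k))"
      using n by (simp add: monotone_class_eq_iff base_lift_add)
    also have "\<dots> \<longleftrightarrow> (\<exists>k::int. same F (x + of_int k) x' \<and> same F (y + of_int k) y')"
      using n base_lift_eq_iff by (metis proj_add_int)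
    finally show ?thesis by simp
  qed
  have eq: "comp_of F (proj (base_lift F x)) = comp_of F (proj x)" if "proj x \<notin> F" for x
    using comp_of_eq_iff[OF fin that base_lift_notin[OF that]] base_lift(1)[OF that]
    by (metis add.right_neutral of_int_0)
  show "Dom (Cat (pi0_cover F)) (Ar (pi0_cover F) x y) = Ob (pi0_cover F) x"
    "Cod (Cat (pi0_cover F)) (Ar (pi0_cover F) x y) = Ob (pi0_cover F) y"
    if "x \<in> Pts (pi0_cover F)" "y \<in> Pts (pi0_cover F)" "Le (pi0_cover F) x y"
    using that base_lift_le_iff[of x y] eq by (simp_all add: pi0_def Dom_circle Cod_circle)
  show "Id (Cat (pi0_cover F)) (Ob (pi0_cover F) x) = Ar (pi0_cover F) x x"
    "One (Cat (pi0_cover F)) (Ob (pi0_cover F) x) = Ar (pi0_cover F) x (x + 1)" if "x \<in> Pts (pi0_cover F)"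
    using that base_lift(2)[of x, symmetric] base_lift_add[of x 1] by (simp_all add: pi0_def Id_circle One_circle)
  show "Comp (Cat (pi0_cover F)) (Ar (pi0_cover F) y z) (Ar (pi0_cover F) x y) = Ar (pi0_cover F) x z"
    if "x \<in> Pts (pi0_cover F)" "y \<in> Pts (pi0_cover F)" "z \<in> Pts (pi0_cover F)" "Le (pi0_cover F) x y" "Le (pi0_cover F) y z"
    using that base_lift_le_iff[of x y] base_lift_le_iff[of y z] by (simp add: pi0_def Comp_circle)
qed

lemma lift_stays_in_component:
  fixes d :: "real \<Rightarrow> real"
  assumes "continuous_on {0..1} d" "\<And>t. t \<in> {0..1} \<Longrightarrow> proj (d t) \<notin> F"
  shows "same F (d 0) (d 1)"
proof -
  have c: "connected (d ` {0..1::real})"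
    using assms(1) connected_continuous_image by (meson connected_Icc)
  have "d 0 \<in> d ` {0..1::real}" "d 1 \<in> d ` {0..1::real}" by auto
  then have "{d 0..d 1} \<subseteq> d ` {0..1}" "{d 1..d 0} \<subseteq> d ` {0..1}"
    using connected_contains_Icc[OF c] by auto
  then show ?thesis using assms(2) by (auto simp: same_def)
qed

text \<open>The auxiliary paths lift to paths inside the lifted components, so they move the end points of a lift to
  the lifts of the chosen points, whatever auxiliary paths are used.\<close>

lemma adjust_eq:
  assumes q: "lifts g q" and ends: "proj (g 0) \<notin> F" "proj (g 1) \<notin> F"
  shows "adjust F q = monotone_class (base_lift F (g 0)) (base_lift F (g 1))"
proof -
  define P where "P x d \<longleftrightarrow> path d \<and> path_image d \<subseteq> comp_of F (proj x) \<and> pathstart d = proj x \<and>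
    pathfinish d = pt (comp_of F (proj x))" for x d
  have P_lift: "\<exists>d'. lifts d' d \<and> d' 0 = x \<and> d' 1 = base_lift F x" if "P x d" "proj x \<notin> F" for x d
  proof -
    have "continuous_on {0..1} d" using that by (simp add: P_def path_def)
    then obtain d1 where d1: "continuous_on {0..1} d1" "\<And>t. t \<in> {0..1} \<Longrightarrow> d t = proj (d1 t)"
      using circle_lift[of "{0..1}" d] by auto
    then have "proj (d1 0) = proj x" using that by (auto simp: P_def pathstart_def)
    then obtain k :: int where k: "x = d1 0 + of_int k" using proj_eqE by blast
    define d' where "d' t = d1 t + of_int k" for t
    have d': "lifts d' d" "d' 0 = x"
      using lifts_add[of d1 d k] d1 k by (simp_all add: lifts_def d'_def[abs_def])
    have "proj (d' t) \<notin> F" if "t \<in> {0..1}" for t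
    proof -
      have "proj (d' t) \<in> comp_of F (proj x)"
        using d' that \<open>P x d\<close> by (auto simp: lifts_def P_def path_image_def)
      then show ?thesis using connected_component_subset[of "- F"] by (auto simp: comp_of_def)
    qed
    then have "same F x (d' 1)" using lift_stays_in_component[of d'] d' by (simp add: lifts_def)
    moreover have "proj (d' 1) = pt (comp_of F (proj x))"
      using d' \<open>P x d\<close> by (auto simp: lifts_def P_def pathfinish_def)
    ultimately have "d' 1 = base_lift F x" using base_lift_unique[OF that(2)] by simp
    then show ?thesis using d' by blast
  qed
  have P_ex: "\<exists>d. P x d" if x: "proj x \<notin> F" for x
  proof
    let ?d = "\<lambda>t. proj (x + t * (base_lift F x - x))"
    have "same F x (x + t * (base_lift F x - x))" if "t \<in> {0..1}" for t
    proof -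
      have "x + t * (base_lift F x - x) \<in> closed_segment x (base_lift F x)"
        using that unfolding closed_segment_def by (auto intro!: exI[of _ t] simp: algebra_simps)
      then have "closed_segment x (x + t * (base_lift F x - x)) \<subseteq> closed_segment x (base_lift F x)"
        by (simp add: subset_closed_segment)
      then show ?thesis using base_lift(1)[OF x] by (auto simp: same_segment)
    qed
    then show "P x ?d"
      using comp_of_proj[OF fin x] base_lift(2)[OF x]
      by (auto simp: P_def path_def path_image_def pathstart_def pathfinish_def intro!: continuous_intros)
  qed
  have q01: "pathstart q = proj (g 0)" "pathfinish q = proj (g 1)"
    using q by (auto simp: lifts_def pathstart_def pathfinish_def)
  have adj: "adjust F q = \<Union>{path_class (reversepath d +++ q +++ e) | d e. P (g 0) d \<and> P (g 1) e}"
    unfolding adjust_def P_def q01 by (intro arg_cong[where f = "\<Union>"] Collect_cong ex_cong1) blast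
  have "path_class (reversepath d +++ q +++ e) = monotone_class (base_lift F (g 0)) (base_lift F (g 1))"
    if de: "P (g 0) d" "P (g 1) e" for d e
  proof -
    obtain d' where d': "lifts d' d" "d' 0 = g 0" "d' 1 = base_lift F (g 0)" using P_lift de ends by blast
    obtain e' where e': "lifts e' e" "e' 0 = g 1" "e' 1 = base_lift F (g 1)" using P_lift de ends by blast
    have "lifts (reversepath d' +++ g +++ e') (reversepath d +++ q +++ e)"
      using d' e' q by (intro lifts_joinpaths lifts_reversepath) (auto simp: reversepath_def)
    from path_class_eq[OF this] show ?thesis using d' e' by (simp add: reversepath_def)
  qed
  moreover obtain d e where "P (g 0) d" "P (g 1) e" using P_ex ends by blast
  ultimately show ?thesis unfolding adj by blast
qed

end

text \<open>By the intermediate value theorem, every point between \<open>a x\<close> and \<open>a y\<close> is the image of a point between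
  \<open>x\<close> and \<open>y\<close>. So if no point between \<open>x\<close> and \<open>y\<close> lies over \<open>G\<close>, none between their images lies over \<open>F\<close>.\<close>

lemma equivariant_pi0:
  assumes FG: "F \<in> index_sets" "G \<in> index_sets"
    and a: "continuous_on UNIV a" "if v then mono a else antimono a"
      "\<And>x. a (x + 1) = a x + of_int (sg v)"
    and avoid: "\<And>x. proj x \<notin> G \<Longrightarrow> proj (a x) \<notin> F"
  shows "equivariant v (pi0_cover G) (pi0_cover F) a"
proof -
  interpret F: finite_nonempty F by unfold_locales fact
  interpret G: finite_nonempty G by unfold_locales fact
  have le: "if v then Le (pi0_cover F) (a x) (a y) else Le (pi0_cover F) (a y) (a x)"
    if xy: "proj x \<notin> G" "proj y \<notin> G" "{y..x} \<inter> proj -` G = {}" for x y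
  proof -
    have miss: "{a x..a y} \<inter> proj -` F = {}" "{a y..a x} \<inter> proj -` F = {}" if "y \<le> x"
    proof -
      have c: "connected (a ` {y..x})"
        using a(1) connected_continuous_image continuous_on_subset by (metis connected_Icc subset_UNIV)
      have "a x \<in> a ` {y..x}" "a y \<in> a ` {y..x}" using that by auto
      then have "{a x..a y} \<subseteq> a ` {y..x}" "{a y..a x} \<subseteq> a ` {y..x}"
        using connected_contains_Icc[OF c] by auto
      then show "{a x..a y} \<inter> proj -` F = {}" "{a y..a x} \<inter> proj -` F = {}"
        using xy avoid by (auto simp: disjoint_iff)
    qed
    show ?thesis
    proof (cases "y \<le> x")
      case True
      then show ?thesis using miss by simp
    next
      case False
      then have "if v then a x \<le> a y else a y \<le> a x" using a(2) by (auto simp: mono_def antimono_def split: if_splits)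
      moreover have "proj (a x) \<notin> F" "proj (a y) \<notin> F" using avoid xy by auto
      ultimately show ?thesis by (cases "a x = a y") (auto split: if_splits)
    qed
  qed
  show ?thesis
    unfolding equivariant_def
  proof (intro conjI ballI impI)
    show "is_cover (pi0_cover G)" "is_cover (pi0_cover F)" by (rule F.is_cover_pi0 G.is_cover_pi0)+
    fix x assume x: "x \<in> Pts (pi0_cover G)"
    then show "a x \<in> Pts (pi0_cover F)" using avoid by simp
    then show "eqv (pi0_cover F) (a (x + 1)) (a x + of_int (sg v))" using a(3) by (simp add: same_refl)
    fix y assume "y \<in> Pts (pi0_cover G)" "Le (pi0_cover G) x y"
    then show "if v then Le (pi0_cover F) (a x) (a y) else Le (pi0_cover F) (a y) (a x)"
      using x by (intro le) simp_all
  qed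
qed

text \<open>A lift of a path followed by \<open>a\<close> is a lift of its image, and \<open>adjust\<close> only moves end points within
  components. This covers refinement of finite sets and homeomorphisms of both orientations.\<close>

lemma induced_eq_functor_of:
  assumes FG: "F \<in> index_sets" "G \<in> index_sets"
    and equivariant: "equivariant v (pi0_cover G) (pi0_cover F) a" and a: "continuous_on UNIV a"
    and \<phi>: "\<And>x. \<phi> (proj x) = proj (a x)"
  shows "(if v then Cov (induced_cov G F \<phi>) else Contra (induced_contra G F \<phi>)) = functor_of v (pi0_cover G) (pi0_cover F) a"
proof -
  interpret F: finite_nonempty F by unfold_locales fact
  interpret G: finite_nonempty G by unfold_locales fact
  interpret KG: is_cover "pi0_cover G" by (rule G.is_cover_pi0)
  interpret KF: is_cover "pi0_cover F" by (rule F.is_cover_pi0)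
  define E where "E = (\<lambda>u\<in>Obj (pi0 G). case u of Arc c \<Rightarrow> Arc (comp_of F (\<phi> (pt c))))"
  define T where "T = (\<lambda>f\<in>Arr (pi0 G). case f of Path A \<Rightarrow>
    Path (\<Union>p\<in>A. adjust F (if v then \<phi> \<circ> p else reversepath (\<phi> \<circ> p))))"
  have avoid: "proj (a x) \<notin> F" if "proj x \<notin> G" for x
    using equivariant that by (auto simp: equivariant_def)
  have same: "same F (a x) (a (base_lift G x))" if "proj x \<notin> G" for x
    using equivariant_eqv[OF equivariant, of x "base_lift G x"] that G.base_lift(1) G.base_lift_notin by simp
  have "E (Ob (pi0_cover G) x) = Ob (pi0_cover F) (a x)" if x: "proj x \<notin> G" for x
  proof -
    have "Ob (pi0_cover G) x \<in> Obj (pi0 G)" using KG.Obj_eq x by auto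
    then have "E (Ob (pi0_cover G) x) = Ob (pi0_cover F) (a (base_lift G x))"
      by (simp add: E_def G.base_lift(2)[OF x, symmetric] \<phi>)
    also have "\<dots> = Ob (pi0_cover F) (a x)"
      using KF.Ob_eq_iff[of "a x" "a (base_lift G x)"] same[OF x] avoid[OF x] avoid[OF G.base_lift_notin[OF x]]
      by (metis add.right_neutral of_int_0 eqv_pi0_cover pi0_cover_simps(2))
    finally show ?thesis .
  qed
  moreover have "T (Ar (pi0_cover G) x y) = (if v then Ar (pi0_cover F) (a x) (a y) else Ar (pi0_cover F) (a y) (a x))"
    if xy: "proj x \<notin> G" "proj y \<notin> G" "Le (pi0_cover G) x y" for x y
  proof -
    let ?M = "monotone_class (base_lift G x) (base_lift G y)"
    let ?R = "if v then monotone_class (base_lift F (a x)) (base_lift F (a y)) else monotone_class (base_lift F (a y)) (base_lift F (a x))"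
    have n: "proj (a (base_lift G x)) \<notin> F" "proj (a (base_lift G y)) \<notin> F"
      using avoid G.base_lift_notin xy by blast+
    have h: "base_lift F (a (base_lift G x)) = base_lift F (a x)" "base_lift F (a (base_lift G y)) = base_lift F (a y)"
      using F.base_lift_cong same xy by metis+
    have "adjust F (if v then \<phi> \<circ> p else reversepath (\<phi> \<circ> p)) = ?R" if p: "p \<in> ?M" for p
    proof -
      obtain g where g: "lifts g p" "g 0 = base_lift G x" "g 1 = base_lift G y" using p by (auto simp: monotone_class_def)
      have l: "lifts (a \<circ> g) (\<phi> \<circ> p)"
        using g(1) \<phi> a unfolding lifts_def
        by (auto intro: continuous_on_compose2[OF a])
      show ?thesis
      proof (cases v)
        case True
        then show ?thesis using F.adjust_eq[OF l] g n h by simp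
      next
        case False
        then show ?thesis using F.adjust_eq[OF lifts_reversepath[OF l]] g n h by (simp add: reversepath_def)
      qed
    qed
    moreover have "?M \<noteq> {}"
    proof -
      have "base_lift G x \<le> base_lift G y" using G.base_lift_le_iff[OF xy(1,2)] xy(3) by simp
      then show ?thesis using linear_path_in_monotone_class by blast
    qed
    ultimately have "(\<Union>p\<in>?M. adjust F (if v then \<phi> \<circ> p else reversepath (\<phi> \<circ> p))) = ?R" by auto
    moreover have "Ar (pi0_cover G) x y \<in> Arr (pi0 G)" using KG.Ar_in[of x y] xy by simp
    ultimately show ?thesis by (simp add: T_def)
  qed
  ultimately have "induces v (pi0_cover G) (pi0_cover F) a (if v then Cov (E, T) else Contra (E, T))"
    unfolding induces_def by (intro exI[of _ E] exI[of _ T]) (auto simp: E_def T_def)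
  then have "functor_of v (pi0_cover G) (pi0_cover F) a = (if v then Cov (E, T) else Contra (E, T))"
    using functor_of_eqI[OF equivariant] by simp
  then show ?thesis
    by (cases v) (simp_all only: induced_cov_def induced_contra_def E_def T_def if_True if_False simp_thms)
qed

lemma equivariant_forget: "F \<in> index_sets \<Longrightarrow> G \<in> index_sets \<Longrightarrow> F \<subseteq> G \<Longrightarrow> equivariant True (pi0_cover G) (pi0_cover F) (\<lambda>x. x)"
  by (rule equivariant_pi0) (auto simp: sg_def mono_def)

lemma forget_eq_functor_of:
  assumes "F \<in> index_sets" "G \<in> index_sets" "F \<subseteq> G"
  shows "forget G F = functor_of True (pi0_cover G) (pi0_cover F) (\<lambda>x. x)"
  using induced_eq_functor_of[OF assms(1,2) equivariant_forget[OF assms], of id] by (simp add: forget_def)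

section \<open>Cyclic categories of linear orders\<close>

text \<open>The integer part of a point counts how often the new generator has been passed, so the arrow from \<open>x\<close> to
  \<open>y\<close> contains it \<open>\<lfloor>y\<rfloor> - \<lfloor>x\<rfloor>\<close> times.\<close>

definition cyc_cover :: "uobj set \<Rightarrow> (uobj \<Rightarrow> uobj \<Rightarrow> bool) \<Rightarrow> real set \<Rightarrow> (real \<Rightarrow> real \<Rightarrow> bool)
    \<Rightarrow> (real \<Rightarrow> uobj) \<Rightarrow> cover" where
  "cyc_cover A r S lr ob = \<lparr>Cat = cyc A r, Pts = S, Le = lr, Ob = ob,
     Ar = (\<lambda>x y. Word (ob x) (nat (\<lfloor>y\<rfloor> - \<lfloor>x\<rfloor>)) (ob y))\<rparr>"

lemma cyc_cover_simps [simp]: "Cat (cyc_cover A r S lr ob) = cyc A r" "Pts (cyc_cover A r S lr ob) = S"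
    "Le (cyc_cover A r S lr ob) = lr" "Ob (cyc_cover A r S lr ob) = ob"
    "Ar (cyc_cover A r S lr ob) x y = Word (ob x) (nat (\<lfloor>y\<rfloor> - \<lfloor>x\<rfloor>)) (ob y)"
  by (simp_all add: cyc_cover_def)

text \<open>The points are placed in \<open>[0, 1)\<close> in the order of the given linear order and repeated periodically; the
  preorder is the lexicographic order of integer part and object.\<close>

lemma is_cover_cyc:
  assumes A: "A = ob ` S"
    and S: "\<And>x k. x \<in> S \<Longrightarrow> x + of_int k \<in> S"
    and ob: "\<And>x k. x \<in> S \<Longrightarrow> ob (x + of_int k) = ob x"
    and le: "\<And>x y. \<lbrakk>x \<in> S; y \<in> S\<rbrakk> \<Longrightarrow> lr x y \<longleftrightarrow> \<lfloor>x\<rfloor> < \<lfloor>y\<rfloor> \<or> \<lfloor>x\<rfloor> = \<lfloor>y\<rfloor> \<and> r (ob x) (ob y)"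
    and r: "\<And>a. a \<in> A \<Longrightarrow> r a a" "\<And>a b. \<lbrakk>a \<in> A; b \<in> A; r a b; r b a\<rbrakk> \<Longrightarrow> a = b"
      "\<And>a b c. \<lbrakk>a \<in> A; b \<in> A; c \<in> A; r a b; r b c\<rbrakk> \<Longrightarrow> r a c"
  shows "is_cover (cyc_cover A r S lr ob)"
proof -
  let ?K = "cyc_cover A r S lr ob"
  have obA: "ob x \<in> A" if "x \<in> S" for x using A that by blast
  have le1: "lr x y \<Longrightarrow> \<lfloor>x\<rfloor> \<le> \<lfloor>y\<rfloor>" if "x \<in> S" "y \<in> S" for x y using le that by force
  have eqv: "eqv ?K x y \<longleftrightarrow> \<lfloor>x\<rfloor> = \<lfloor>y\<rfloor> \<and> ob x = ob y" if "x \<in> S" "y \<in> S" for x y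
  proof
    assume "eqv ?K x y"
    then have "lr x y" "lr y x" by (simp_all add: eqv_def)
    then have "\<lfloor>x\<rfloor> = \<lfloor>y\<rfloor>" "r (ob x) (ob y)" "r (ob y) (ob x)" using le[OF that] le[OF that(2,1)] by auto
    then show "\<lfloor>x\<rfloor> = \<lfloor>y\<rfloor> \<and> ob x = ob y" using r(2) obA that by blast
  qed (use le[OF that] le[OF that(2,1)] r(1) obA that in \<open>auto simp: eqv_def\<close>)
  have ex: "(\<exists>k::int. eqv ?K (x + of_int k) x' \<and> eqv ?K (y + of_int k) y')
      \<longleftrightarrow> ob x = ob x' \<and> ob y = ob y' \<and> \<lfloor>y\<rfloor> - \<lfloor>x\<rfloor> = \<lfloor>y'\<rfloor> - \<lfloor>x'\<rfloor>" (is "?l \<longleftrightarrow> ?r")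
    if xy: "x \<in> S" "y \<in> S" "x' \<in> S" "y' \<in> S" for x y x' y'
  proof
    assume ?l
    then obtain k :: int where "\<lfloor>x + of_int k\<rfloor> = \<lfloor>x'\<rfloor>" "ob (x + of_int k) = ob x'"
        "\<lfloor>y + of_int k\<rfloor> = \<lfloor>y'\<rfloor>" "ob (y + of_int k) = ob y'"
      using eqv[OF S[OF xy(1)] xy(3)] eqv[OF S[OF xy(2)] xy(4)] by blast
    then show ?r using ob xy by simp
  next
    assume ?r
    then show ?l
      using eqv[OF S[OF xy(1)] xy(3)] eqv[OF S[OF xy(2)] xy(4)] ob xy
      by (intro exI[of _ "\<lfloor>x'\<rfloor> - \<lfloor>x\<rfloor>"]) (auto simp del: of_int_diff)
  qed
  show ?thesis
  proof
    fix x y z :: real and k :: int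
    show "x \<in> Pts ?K \<Longrightarrow> x + of_int k \<in> Pts ?K" using S by simp
    show "x \<in> Pts ?K \<Longrightarrow> Le ?K x x" using le[of x x] r(1)[of "ob x"] obA by simp
    show "Le ?K x z"
      if "x \<in> Pts ?K" "y \<in> Pts ?K" "z \<in> Pts ?K"
        "Le ?K x y" "Le ?K y z"
    proof -
      have xyz: "x \<in> S" "y \<in> S" "z \<in> S" "lr x y" "lr y z" using that by simp_all
      show ?thesis
        using xyz le[of x y] le[of y z] le[of x z] r(3)[of "ob x" "ob y" "ob z"] obA by auto
    qed
    show "Le ?K (x + of_int k) (y + of_int k)"
      if "x \<in> Pts ?K" "y \<in> Pts ?K" "Le ?K x y"
      using that le[of x y] le[OF S S, of x y k k] ob by simp
    show "x \<in> Pts ?K \<Longrightarrow> Le ?K x (x + 1)"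
      using le[of x "x + 1"] S[of x 1] by simp
    show "x \<in> Pts ?K \<Longrightarrow> \<not> Le ?K (x + 1) x"
      using le[of "x + 1" x] S[of x 1] by simp
  next
    show "Obj (Cat ?K) = Ob ?K ` Pts ?K"
      using A by (simp add: cyc_def)
    have "Word a k b \<in> {Word (ob x) (nat (\<lfloor>y\<rfloor> - \<lfloor>x\<rfloor>)) (ob y) | x y. x \<in> S \<and> y \<in> S \<and> lr x y}"
      if k: "a \<in> A" "b \<in> A" "k = 0 \<longrightarrow> r a b" for a b k
    proof -
      obtain x y where xy: "x \<in> S" "a = ob x" "y \<in> S" "b = ob y" using A k by blast
      let ?y = "y + of_int (\<lfloor>x\<rfloor> - \<lfloor>y\<rfloor> + int k)"
      have y: "?y \<in> S" "ob ?y = b" using S ob xy by blast+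
      have f: "\<lfloor>?y\<rfloor> = \<lfloor>x\<rfloor> + int k" using floor_add_int[of y "\<lfloor>x\<rfloor> - \<lfloor>y\<rfloor> + int k"] by linarith
      then have "lr x ?y" using le[OF xy(1) y(1)] k xy y by (cases "k = 0") auto
      moreover have "Word a k b = Word (ob x) (nat (\<lfloor>?y\<rfloor> - \<lfloor>x\<rfloor>)) (ob ?y)"
        unfolding f y(2) using xy by simp
      ultimately show ?thesis using xy(1) y(1) by blast
    qed
    moreover have "nat (\<lfloor>y\<rfloor> - \<lfloor>x\<rfloor>) = 0 \<longrightarrow> r (ob x) (ob y)" if "x \<in> S" "y \<in> S" "lr x y" for x y
      using le[OF that(1,2)] that by auto
    ultimately show "Arr (Cat ?K) = {Ar ?K x y | x y.
        x \<in> Pts ?K \<and> y \<in> Pts ?K \<and> Le ?K x y}"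
      using obA unfolding cyc_cover_simps by (fastforce simp: cyc_def)
    fix x y z x' y' :: real
    show "Ob ?K x = Ob ?K y
        \<longleftrightarrow> (\<exists>k::int. eqv ?K (x + of_int k) y)"
      if "x \<in> Pts ?K" "y \<in> Pts ?K"
      using ex[of x x y y] that by simp
    show "Ar ?K x y = Ar ?K x' y' \<longleftrightarrow>
        (\<exists>k::int. eqv ?K (x + of_int k) x' \<and> eqv ?K (y + of_int k) y')"
      if "x \<in> Pts ?K" "y \<in> Pts ?K"
        "x' \<in> Pts ?K" "y' \<in> Pts ?K"
        "Le ?K x y" "Le ?K x' y'"
      using ex[of x y x' y'] that le1[of x y] le1[of x' y'] by auto
    show "Dom (Cat ?K) (Ar ?K x y) = Ob ?K x"
      "Cod (Cat ?K) (Ar ?K x y) = Ob ?K y"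
      by (simp_all add: cyc_def)
    show "Id (Cat ?K) (Ob ?K x) = Ar ?K x x"
      by (simp add: cyc_def)
    show "One (Cat ?K) (Ob ?K x) = Ar ?K x (x + 1)"
      if "x \<in> Pts ?K" using that ob[of x 1] by (simp add: cyc_def)
    show "Comp (Cat ?K) (Ar ?K y z) (Ar ?K x y)
        = Ar ?K x z"
      if "x \<in> Pts ?K" "y \<in> Pts ?K" "z \<in> Pts ?K"
        "Le ?K x y" "Le ?K y z"
      using that le1[of x y] le1[of y z] by (simp add: cyc_def nat_add_distrib[symmetric])
  qed
qed

lemma cyc_fun_eq_functor_of:
  assumes equivariant: "equivariant True (cyc_cover A r S lr ob) (cyc_cover B r' S' lr' ob') f"
    and f: "\<And>x. x \<in> S \<Longrightarrow> h (ob x) = ob' (f x)" "\<And>x. x \<in> S \<Longrightarrow> \<lfloor>f x\<rfloor> = \<lfloor>x\<rfloor>"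
  shows "Cov (cyc_fun A r h) = functor_of True (cyc_cover A r S lr ob) (cyc_cover B r' S' lr' ob') f"
proof -
  let ?K = "cyc_cover A r S lr ob" and ?L = "cyc_cover B r' S' lr' ob'"
  interpret K: is_cover ?K using equivariant by (simp add: equivariant_def)
  have "induces True ?K ?L f (Cov (cyc_fun A r h))"
    unfolding induces_def cyc_fun_def
  proof (intro exI conjI ballI impI)
    show "Cov (restrict h A, \<lambda>w\<in>Arr (cyc A r). case w of Word a k b \<Rightarrow> Word (h a) k (h b)) =
        (if True then Cov (restrict h A, \<lambda>w\<in>Arr (cyc A r). case w of Word a k b \<Rightarrow> Word (h a) k (h b))
         else Contra (restrict h A, \<lambda>w\<in>Arr (cyc A r). case w of Word a k b \<Rightarrow> Word (h a) k (h b)))"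
      by simp
    show "restrict h A \<in> extensional (Obj (Cat ?K))" by (simp add: cyc_def)
    show "(\<lambda>w\<in>Arr (cyc A r). case w of Word a k b \<Rightarrow> Word (h a) k (h b)) \<in>
        extensional (Arr (Cat ?K))" by simp
    fix x assume x: "x \<in> Pts ?K"
    have "ob x \<in> A" using K.Obj_eq x by (auto simp: cyc_def)
    then show "restrict h A (Ob ?K x) = Ob ?L (f x)"
      using f x by simp
    fix y assume y: "y \<in> Pts ?K" "Le ?K x y"
    show "(\<lambda>w\<in>Arr (cyc A r). case w of Word a k b \<Rightarrow> Word (h a) k (h b)) (Ar ?K x y) =
       (if True then Ar ?L (f x) (f y) else Ar ?L (f y) (f x))"
      using K.Ar_in[OF x y] x y f by simp
  qed
  then show ?thesis using functor_of_eqI[OF equivariant] by simp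
qed

subsection \<open>The standard categories\<close>

text \<open>The category \<open>[n]\<^sub>c\<^sub>y\<^sub>c\<close> is covered by the whole line, divided into slots of length \<open>1/(n + 1)\<close> that are
  numbered by the integers. Functors between these categories are given by maps of the slot numbers.\<close>

definition tick :: "nat \<Rightarrow> int \<Rightarrow> real" where
  "tick n k = of_int k / (real n + 1)"

definition slot :: "nat \<Rightarrow> real \<Rightarrow> int" where
  "slot n x = \<lfloor>(real n + 1) * x\<rfloor>"

lemma slot_tick [simp]: "slot n (tick n k) = k"
  by (simp add: slot_def tick_def add.commute)

lemma slot_add_int: "slot n (x + of_int k) = slot n x + k * (int n + 1)"
proof -
  have "(real n + 1) * (x + of_int k) = (real n + 1) * x + of_int (k * (int n + 1))"
    by (simp add: algebra_simps)
  then show ?thesis unfolding slot_def by (simp only: floor_add_int)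
qed

lemma slot_add_1: "slot n (x + 1) = slot n x + (int n + 1)"
  using slot_add_int[of n x 1] by simp

lemma floor_slot: "\<lfloor>x\<rfloor> = slot n x div (int n + 1)"
proof -
  have "\<lfloor>x\<rfloor> * (int n + 1) \<le> slot n x"
    unfolding slot_def le_floor_iff by (simp add: mult.commute mult_right_mono)
  moreover have "slot n x < (\<lfloor>x\<rfloor> + 1) * (int n + 1)"
  proof -
    have "x < of_int (\<lfloor>x\<rfloor> + 1)" by linarith
    then have "(real n + 1) * x < of_int ((\<lfloor>x\<rfloor> + 1) * (int n + 1))"
      by (simp add: mult.commute mult_strict_right_mono)
    then show ?thesis unfolding slot_def by (simp only: floor_less_iff)
  qed
  ultimately show ?thesis
    by (intro int_div_pos_eq[of _ _ _ "slot n x - \<lfloor>x\<rfloor> * (int n + 1)", symmetric]) (auto simp: algebra_simps)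
qed

lemma floor_tick: "\<lfloor>tick n k\<rfloor> = k div (int n + 1)"
  using floor_slot[of "tick n k" n] by simp

definition ncyc_cover :: "nat \<Rightarrow> cover" where
  "ncyc_cover n = cyc_cover (vertices n) vertex_le UNIV (\<lambda>x y. slot n x \<le> slot n y)
     (\<lambda>x. Vertex (nat (slot n x mod (int n + 1))))"

lemma ncyc_cover_simps [simp]: "Cat (ncyc_cover n) = ncyc n" "Pts (ncyc_cover n) = UNIV"
    "Le (ncyc_cover n) x y \<longleftrightarrow> slot n x \<le> slot n y"
  by (simp_all add: ncyc_cover_def ncyc_def)

lemma eqv_ncyc_cover [simp]: "eqv (ncyc_cover n) x y \<longleftrightarrow> slot n x = slot n y"
  by (auto simp: eqv_def)

lemma is_cover_ncyc: "is_cover (ncyc_cover n)"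
  unfolding ncyc_cover_def
proof (rule is_cover_cyc)
  let ?N = "int n + 1"
  have m: "0 \<le> k mod ?N" "k mod ?N \<le> int n" for k
    using pos_mod_sign[of ?N k] pos_mod_bound[of ?N k] by linarith+
  show "vertices n = range (\<lambda>x. Vertex (nat (slot n x mod ?N)))"
  proof
    show "vertices n \<subseteq> range (\<lambda>x. Vertex (nat (slot n x mod ?N)))"
    proof
      fix u assume "u \<in> vertices n"
      then obtain i where "u = Vertex i" "i \<le> n" by (auto simp: vertices_def)
      then have "u = Vertex (nat (slot n (tick n (int i)) mod ?N))" by simp
      then show "u \<in> range (\<lambda>x. Vertex (nat (slot n x mod ?N)))" by blast
    qed
    have "nat (k mod ?N) \<le> n" for k using m[of k] by linarith
    then show "range (\<lambda>x. Vertex (nat (slot n x mod ?N))) \<subseteq> vertices n"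
      by (auto simp: vertices_def)
  qed
  fix x y :: real and k :: int
  show "Vertex (nat (slot n (x + of_int k) mod ?N)) = Vertex (nat (slot n x mod ?N))"
    by (simp add: slot_add_int)
  have le: "a \<le> b \<longleftrightarrow> a div ?N < b div ?N \<or> a div ?N = b div ?N \<and> a mod ?N \<le> b mod ?N" for a b :: int
  proof -
    have "a \<le> b \<Longrightarrow> a div ?N \<le> b div ?N" by (simp add: zdiv_mono1)
    moreover have "b < a \<Longrightarrow> b div ?N \<le> a div ?N" by (simp add: zdiv_mono1)
    moreover have "a \<le> b \<longleftrightarrow> a mod ?N \<le> b mod ?N" if "a div ?N = b div ?N"
    proof -
      have "a = ?N * (a div ?N) + a mod ?N" "b = ?N * (b div ?N) + b mod ?N" by simp_all
      then show ?thesis using that by (metis add_le_cancel_left)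
    qed
    ultimately show ?thesis by (cases "a div ?N = b div ?N"; cases "a \<le> b") auto
  qed
  have v: "vertex_le (Vertex (nat (a mod ?N))) (Vertex (nat (b mod ?N))) \<longleftrightarrow> a mod ?N \<le> b mod ?N" for a b
    using m[of a] m[of b] nat_le_eq_zle[of "a mod ?N" "b mod ?N"] by (auto simp: vertex_le_def)
  show "(slot n x \<le> slot n y) = (\<lfloor>x\<rfloor> < \<lfloor>y\<rfloor> \<or> \<lfloor>x\<rfloor> = \<lfloor>y\<rfloor> \<and>
      vertex_le (Vertex (nat (slot n x mod ?N))) (Vertex (nat (slot n y mod ?N))))"
    unfolding v floor_slot[of x n] floor_slot[of y n] by (rule le)
qed (auto simp: vertices_def vertex_le_def)

lemma equivariant_ncyc:
  assumes "if v then mono g else antimono g" "\<And>j. g (j + (int m + 1)) = g j + sg v * (int n + 1)"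
  shows "equivariant v (ncyc_cover m) (ncyc_cover n) (\<lambda>x. tick n (g (slot m x)))"
  using assms by (auto simp: equivariant_def is_cover_ncyc slot_add_1 slot_add_int mono_def antimono_def)

text \<open>The extension \<open>j\<close> of a map of vertices to all integers with \<open>j(k + m + 1) = j(k) + n + 1\<close>.\<close>

definition periodic_extension :: "nat \<Rightarrow> nat \<Rightarrow> (nat \<Rightarrow> nat) \<Rightarrow> int \<Rightarrow> int" where
  "periodic_extension m n \<theta> j = j div (int m + 1) * (int n + 1) + int (\<theta> (nat (j mod (int m + 1))))"

lemma simplicial_op_functor_of:
  assumes \<theta>: "\<theta> \<in> {..m} \<rightarrow> {..n}" "mono_on {..m} \<theta>"
  shows "equivariant True (ncyc_cover m) (ncyc_cover n) (\<lambda>x. tick n (periodic_extension m n \<theta> (slot m x)))"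
    and "Cov (cyc_fun (vertices m) vertex_le (vertex_map \<theta>))
      = functor_of True (ncyc_cover m) (ncyc_cover n) (\<lambda>x. tick n (periodic_extension m n \<theta> (slot m x)))"
proof -
  let ?M = "int m + 1" and ?N = "int n + 1"
  have md: "nat (k mod ?M) \<le> m" for k
    using pos_mod_sign[of ?M k] pos_mod_bound[of ?M k] by linarith
  have b: "int (\<theta> (nat (k mod ?M))) \<le> int n" for k using \<theta>(1) md[of k] by auto
  have "periodic_extension m n \<theta> a \<le> periodic_extension m n \<theta> b" if "a \<le> b" for a b
  proof (cases "a div ?M = b div ?M")
    case True
    have "a = ?M * (a div ?M) + a mod ?M" "b = ?M * (b div ?M) + b mod ?M" by simp_all
    then have "a mod ?M \<le> b mod ?M" using that True by (metis add_le_cancel_left)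
    then have "nat (a mod ?M) \<le> nat (b mod ?M)" by simp
    then show ?thesis using \<theta>(2) md[of a] md[of b] True by (simp add: periodic_extension_def mono_onD)
  next
    case False
    then have "a div ?M + 1 \<le> b div ?M" using zdiv_mono1[OF that, of ?M] by linarith
    then have "(a div ?M + 1) * ?N \<le> b div ?M * ?N" by (intro mult_right_mono) auto
    then show ?thesis using b[of a] by (simp add: periodic_extension_def algebra_simps)
  qed
  then have "mono (periodic_extension m n \<theta>)" by (simp add: mono_def)
  moreover have "periodic_extension m n \<theta> (j + ?M) = periodic_extension m n \<theta> j + sg True * ?N" for j
  proof -
    have "(j + ?M) div ?M = j div ?M + 1" "(j + ?M) mod ?M = j mod ?M" by simp_all
    then show ?thesis unfolding periodic_extension_def by (simp add: sg_def algebra_simps)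
  qed
  ultimately show equivariant: "equivariant True (ncyc_cover m) (ncyc_cover n) (\<lambda>x. tick n (periodic_extension m n \<theta> (slot m x)))"
    by (intro equivariant_ncyc) simp_all
  have d: "periodic_extension m n \<theta> j div ?N = j div ?M" "periodic_extension m n \<theta> j mod ?N = int (\<theta> (nat (j mod ?M)))" for j
    using b[of j] by (simp_all add: periodic_extension_def)
  show "Cov (cyc_fun (vertices m) vertex_le (vertex_map \<theta>))
      = functor_of True (ncyc_cover m) (ncyc_cover n) (\<lambda>x. tick n (periodic_extension m n \<theta> (slot m x)))"
    unfolding ncyc_cover_def
  proof (rule cyc_fun_eq_functor_of[OF equivariant[unfolded ncyc_cover_def]])
    fix x
    show "\<lfloor>tick n (periodic_extension m n \<theta> (slot m x))\<rfloor> = \<lfloor>x\<rfloor>" by (simp only: floor_tick d floor_slot[of x m])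
    show "vertex_map \<theta> (Vertex (nat (slot m x mod ?M))) = Vertex (nat (slot n (tick n (periodic_extension m n \<theta> (slot m x))) mod ?N))"
      by (simp add: vertex_map_def d)
  qed
qed

subsection \<open>Complements of finite subsets of the interval\<close>

text \<open>With both end points in \<open>F\<close>, the components of the complement in the unit interval are open
  intervals, and they are also components of the preimage of the complement of the image of \<open>F\<close>.\<close>

locale unit_cuts =
  fixes F :: "real set"
  assumes finF: "finite F" and F01: "0 \<in> F" "1 \<in> F" "F \<subseteq> {0..1}"
begin

abbreviation "P \<equiv> proj ` F"

lemma P_in_index: "P \<in> index_sets"
  using finF F01 by (auto simp: index_sets_def)

sublocale finite_nonempty P
  by unfold_locales (rule P_in_index)

lemma int_in: "proj (of_int k) \<in> P"
proof -
  have "proj (of_int k) = proj 0" using proj_add_int[of 0 k] by simp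
  then show ?thesis using F01(1) by simp
qed

lemma proj_in_P_iff: "x \<in> {0..1} \<Longrightarrow> proj x \<in> P \<longleftrightarrow> x \<in> F"
proof
  assume x: "x \<in> {0..1}" "proj x \<in> P"
  then obtain y where y: "y \<in> F" "proj x = proj y" by auto
  then obtain k :: int where k: "y = x + of_int k" using proj_eqE by blast
  have "y \<in> {0..1}" using y F01 by auto
  then have "- 1 \<le> real_of_int k" "real_of_int k \<le> 1" using k x(1) by auto
  then consider "k = 0" | "k = 1" | "k = - 1" by linarith
  then show "x \<in> F"
  proof cases
    case 2
    then have "x = 0" using k x(1) \<open>y \<in> {0..1}\<close> by simp
    then show ?thesis using F01 by simp
  next
    case 3
    then have "x = 1" using k x(1) \<open>y \<in> {0..1}\<close> by simp
    then show ?thesis using F01 by simp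
  qed (use k y in simp)
qed auto

definition "comp_in x = connected_component_set ({0..1} - F) x"

lemma comp_in_eq:
  assumes "x \<in> {0..1}" "proj x \<notin> P"
  shows "comp_in x = {y. same P x y}"
proof (intro Set.set_eqI)
  fix y
  have "closed_segment x y \<subseteq> {0..1} - F \<longleftrightarrow> closed_segment x y \<inter> proj -` P = {}"
  proof
    assume *: "closed_segment x y \<subseteq> {0..1} - F"
    show "closed_segment x y \<inter> proj -` P = {}"
    proof (rule ccontr)
      assume "closed_segment x y \<inter> proj -` P \<noteq> {}"
      then obtain u where "u \<in> closed_segment x y" "proj u \<in> P" by blast
      then show False using * proj_in_P_iff[of u] by blast
    qed
  next
    assume *: "closed_segment x y \<inter> proj -` P = {}"
    have "0 \<notin> closed_segment x y" "1 \<notin> closed_segment x y" using * int_in[of 0] int_in[of 1] by auto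
    then have y: "0 < y" "y < 1" using assms(1) by (auto simp: closed_segment_eq_real_ivl split: if_splits)
    have "closed_segment x y \<subseteq> {0..1}" using assms(1) y by (auto simp: closed_segment_eq_real_ivl)
    then show "closed_segment x y \<subseteq> {0..1} - F" using * by auto
  qed
  then show "y \<in> comp_in x \<longleftrightarrow> y \<in> {y. same P x y}"
    by (simp add: comp_in_def connected_component_1 same_segment)
qed

lemma frac_props: "frac x \<in> {0..1}" "proj (frac x) = proj x" "x = frac x + of_int \<lfloor>x\<rfloor>"
proof -
  show x: "x = frac x + of_int \<lfloor>x\<rfloor>" by (simp add: frac_def)
  show "frac x \<in> {0..1}" using frac_ge_0[of x] frac_lt_1[of x] by simp
  show "proj (frac x) = proj x" by (subst (2) x) (simp only: proj_add_int)
qed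

text \<open>Points and preorder are those of the complement of the image of \<open>F\<close> in the circle, so that unrolling is
  induced by the identity in both directions.\<close>

definition "interval_cover = cyc_cover (intervals F) interval_le {x. proj x \<notin> P} (\<lambda>x y. {y..x} \<inter> proj -` P = {})
  (\<lambda>x. Interval (comp_in (frac x)))"

lemma interval_cover_simps [simp]: "Cat interval_cover = interval_cyc F" "Pts interval_cover = {x. proj x \<notin> P}"
    "Le interval_cover x y \<longleftrightarrow> {y..x} \<inter> proj -` P = {}" "eqv interval_cover x y \<longleftrightarrow> same P x y"
  by (simp_all add: interval_cover_def interval_cyc_def eqv_def same_def)

lemma interval_le_iff:
  assumes "x \<in> {0..1}" "proj x \<notin> P" "y \<in> {0..1}" "proj y \<notin> P"
  shows "interval_le (Interval (comp_in x)) (Interval (comp_in y)) \<longleftrightarrow> {y..x} \<inter> proj -` P = {}"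
proof
  assume "interval_le (Interval (comp_in x)) (Interval (comp_in y))"
  then obtain u v where uv: "same P x u" "same P y v" "u \<le> v"
    using comp_in_eq assms by (auto simp: interval_le_def)
  have "{v..u} \<inter> proj -` P = {}" using uv same_notin[OF uv(1)] by (cases "u = v") auto
  moreover have "{u..x} \<inter> proj -` P = {}" "{y..v} \<inter> proj -` P = {}" using uv by (auto simp: same_def)
  ultimately show "{y..x} \<inter> proj -` P = {}"
    using misses_trans[OF misses_trans, of u x "proj -` P" v y] by blast
next
  assume m: "{y..x} \<inter> proj -` P = {}"
  have xy: "x \<in> comp_in x" "y \<in> comp_in y" using comp_in_eq assms same_refl by auto
  show "interval_le (Interval (comp_in x)) (Interval (comp_in y))"
  proof (cases "x \<le> y")
    case True
    then show ?thesis using xy by (auto simp: interval_le_def)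
  next
    case False
    then have "same P y x" using m by (simp add: same_def)
    then have "x \<in> comp_in y" using comp_in_eq assms by simp
    then show ?thesis using xy by (auto simp: interval_le_def)
  qed
qed

lemma intervals_eq: "intervals F = (\<lambda>x. Interval (comp_in (frac x))) ` {x. proj x \<notin> P}"
proof -
  have "components ({0..1} - F) = (\<lambda>x. comp_in (frac x)) ` {x. proj x \<notin> P}"
  proof (intro Set.set_eqI iffI)
    fix I assume "I \<in> components ({0..1} - F)"
    then obtain x where x: "x \<in> {0..1} - F" "I = comp_in x" by (auto simp: components_def comp_in_def)
    then have "proj x \<notin> P" using proj_in_P_iff by blast
    moreover have "x \<noteq> 1" using x F01 by auto
    then have "frac x = x" using x by (simp add: frac_eq)
    ultimately show "I \<in> (\<lambda>x. comp_in (frac x)) ` {x. proj x \<notin> P}"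
      using x by (intro image_eqI[of _ _ x]) simp_all
  next
    fix I assume "I \<in> (\<lambda>x. comp_in (frac x)) ` {x. proj x \<notin> P}"
    then obtain x where x: "proj x \<notin> P" "I = comp_in (frac x)" by auto
    then have "frac x \<in> {0..1} - F" using frac_props[of x] proj_in_P_iff[of "frac x"] by auto
    then show "I \<in> components ({0..1} - F)" using x by (auto simp: components_def comp_in_def)
  qed
  then show ?thesis by (auto simp: intervals_def)
qed

lemma is_cover_interval: "is_cover interval_cover"
  unfolding interval_cover_def
proof (rule is_cover_cyc)
  show "intervals F = (\<lambda>x. Interval (comp_in (frac x))) ` {x. proj x \<notin> P}" by (rule intervals_eq)
  fix x y :: real and k :: int
  show "x \<in> {x. proj x \<notin> P} \<Longrightarrow> x + of_int k \<in> {x. proj x \<notin> P}" by simp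
  have "frac (x + of_int k) = frac x" by (simp add: frac_def)
  then show "Interval (comp_in (frac (x + of_int k))) = Interval (comp_in (frac x))" by simp
  assume xy: "x \<in> {x. proj x \<notin> P}" "y \<in> {x. proj x \<notin> P}"
  have fp: "frac z \<in> {0..1}" "proj (frac z) \<notin> P" if "z \<in> {x. proj x \<notin> P}" for z
    using that frac_props[of z] by auto
  consider "\<lfloor>x\<rfloor> < \<lfloor>y\<rfloor>" | "\<lfloor>y\<rfloor> < \<lfloor>x\<rfloor>" | "\<lfloor>x\<rfloor> = \<lfloor>y\<rfloor>" by linarith
  then show "({y..x} \<inter> proj -` P = {}) = (\<lfloor>x\<rfloor> < \<lfloor>y\<rfloor> \<or> \<lfloor>x\<rfloor> = \<lfloor>y\<rfloor> \<and>
      interval_le (Interval (comp_in (frac x))) (Interval (comp_in (frac y))))"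
  proof cases
    case 1
    then have "x < y" by linarith
    then show ?thesis using 1 by simp
  next
    case 2
    then have "of_int \<lfloor>x\<rfloor> \<in> {y..x}" by (auto simp: le_floor_iff floor_less_iff)
    then have "{y..x} \<inter> proj -` P \<noteq> {}" using int_in by blast
    then show ?thesis using 2 by simp
  next
    case 3
    have "{y..x} \<inter> proj -` P = {} \<longleftrightarrow> {frac y..frac x} \<inter> proj -` P = {}"
    proof
      assume "{y..x} \<inter> proj -` P = {}"
      from misses_add[OF this, of "- \<lfloor>x\<rfloor>"] show "{frac y..frac x} \<inter> proj -` P = {}" using 3 by (simp add: frac_def)
    next
      assume "{frac y..frac x} \<inter> proj -` P = {}"
      from misses_add[OF this, of "\<lfloor>x\<rfloor>"] show "{y..x} \<inter> proj -` P = {}" using 3 by (simp add: frac_def)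
    qed
    then show ?thesis using 3 interval_le_iff[OF fp[OF xy(1)] fp[OF xy(2)]] by simp
  qed
next
  have rep: "\<exists>x\<in>{0..1}. proj x \<notin> P \<and> a = Interval (comp_in x)" if a: "a \<in> intervals F" for a
  proof -
    obtain x where x: "a = Interval (comp_in (frac x))" "proj x \<notin> P" using a unfolding intervals_eq by blast
    show ?thesis using x frac_props[of x] by (intro bexI[of _ "frac x"]) auto
  qed
  show "interval_le a a" if "a \<in> intervals F" for a
    using rep[OF that] interval_le_iff same_refl by auto
  show "a = b" if ab: "a \<in> intervals F" "b \<in> intervals F" "interval_le a b" "interval_le b a" for a b
  proof -
    obtain x y where x: "x \<in> {0..1}" "proj x \<notin> P" "a = Interval (comp_in x)"
        and y: "y \<in> {0..1}" "proj y \<notin> P" "b = Interval (comp_in y)"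
      using rep[OF ab(1)] rep[OF ab(2)] by blast
    then have s: "same P x y" using ab interval_le_iff[of x y] interval_le_iff[of y x] by (simp add: same_def)
    have "{z. same P x z} = {z. same P y z}"
      using same_trans[OF s] same_trans[OF same_sym[OF s]] by blast
    then show ?thesis using x y comp_in_eq by simp
  qed
  show "interval_le a c" if abc: "a \<in> intervals F" "b \<in> intervals F" "c \<in> intervals F"
      "interval_le a b" "interval_le b c" for a b c
  proof -
    obtain x y z where x: "x \<in> {0..1}" "proj x \<notin> P" "a = Interval (comp_in x)"
        and y: "y \<in> {0..1}" "proj y \<notin> P" "b = Interval (comp_in y)"
        and z: "z \<in> {0..1}" "proj z \<notin> P" "c = Interval (comp_in z)"
      using rep[OF abc(1)] rep[OF abc(2)] rep[OF abc(3)] by blast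
    then show ?thesis
      using abc interval_le_iff[of x y] interval_le_iff[of y z] interval_le_iff[of x z]
        misses_trans[of y x "proj -` P" z] by simp
  qed
qed

lemma equivariant_unroll: "equivariant True interval_cover (pi0_cover P) (\<lambda>x. x)" "equivariant True (pi0_cover P) interval_cover (\<lambda>x. x)"
  unfolding equivariant_def using is_cover_interval is_cover_pi0 by (auto simp: sg_def same_refl)

lemma unroll_eq_functor_of: "unroll F = functor_of True interval_cover (pi0_cover P) (\<lambda>x. x)"
proof -
  interpret K: is_cover interval_cover by (rule is_cover_interval)
  define E where "E = (\<lambda>u\<in>intervals F. case u of Interval I \<Rightarrow> Arc (proj ` I - proj ` F))"
  define T where "T = (\<lambda>f\<in>Arr (interval_cyc F). case f of Word (Interval I) k (Interval I') \<Rightarrow>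
        Path {p. \<exists>g. continuous_on {0..1} g \<and> mono_on {0..1} g \<and>
          (\<forall>t\<in>{0..1}. p t = proj (g t)) \<and> g 0 \<in> I \<and> g 1 - real k \<in> I' \<and>
          proj (g 0) = pt (proj ` I - proj ` F) \<and> proj (g 1) = pt (proj ` I' - proj ` F)})"
  have fp: "frac z \<in> {0..1}" "proj (frac z) \<notin> P" if "proj z \<notin> P" for z
    using that frac_props[of z] by auto
  have comp: "proj ` comp_in (frac x) - P = comp_of P (proj x)" if "proj x \<notin> P" for x
  proof -
    have "proj ` comp_in (frac x) = comp_of P (proj (frac x))"
      using comp_in_eq[OF fp[OF that]] comp_of_proj[OF fin fp(2)[OF that]] by simp
    moreover have "comp_of P c \<inter> P = {}" for c
      using connected_component_subset[of "- P" c] by (auto simp: comp_of_def)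
    ultimately show ?thesis using frac_props(2)[of x] by auto
  qed
  have E: "E (Ob interval_cover x) = Ob (pi0_cover P) x" if "proj x \<notin> P" for x
    using that comp by (simp add: E_def interval_cover_def intervals_eq)
  have T: "T (Ar interval_cover x y) = Ar (pi0_cover P) x y" if xy: "proj x \<notin> P" "proj y \<notin> P" "{y..x} \<inter> proj -` P = {}" for x y
  proof -
    have fl: "\<lfloor>x\<rfloor> \<le> \<lfloor>y\<rfloor>"
    proof (rule ccontr)
      assume "\<not> \<lfloor>x\<rfloor> \<le> \<lfloor>y\<rfloor>"
      then have "of_int \<lfloor>x\<rfloor> \<in> {y..x}" by (auto simp: le_floor_iff floor_less_iff)
      then show False using xy(3) int_in by blast
    qed
    have in_comp: "(u \<in> comp_in (frac z) \<and> proj u = pt (proj ` comp_in (frac z) - P)) \<longleftrightarrow> u = base_lift P (frac z)"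
      if "proj z \<notin> P" for u z
      unfolding comp[OF that] unfolding comp_in_eq[OF fp[OF that]] mem_Collect_eq
    proof
      assume "same P (frac z) u \<and> proj u = pt (comp_of P (proj z))"
      then show "u = base_lift P (frac z)"
        using base_lift_unique[OF fp(2)[OF that], of u, unfolded frac_props(2)] by simp
    next
      assume u: "u = base_lift P (frac z)"
      show "same P (frac z) u \<and> proj u = pt (comp_of P (proj z))"
        unfolding u using base_lift(1,2)[OF fp(2)[OF that], unfolded frac_props(2)] by (rule conjI)
    qed
    define k where "k = nat (\<lfloor>y\<rfloor> - \<lfloor>x\<rfloor>)"
    have "proj (w - real k) = proj w" for w using proj_add_int[of w "- int k"] by simp
    then have eq: "(g 0 \<in> comp_in (frac x) \<and> g 1 - real k \<in> comp_in (frac y) \<and>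
          proj (g 0) = pt (proj ` comp_in (frac x) - P) \<and> proj (g 1) = pt (proj ` comp_in (frac y) - P))
        \<longleftrightarrow> g 0 = base_lift P (frac x) \<and> g 1 = base_lift P (frac y) + real k" for g :: "real \<Rightarrow> real"
      using in_comp[OF xy(1), of "g 0"] in_comp[OF xy(2), of "g 1 - real k"] by auto
    have "T (Ar interval_cover x y) = Path (monotone_class (base_lift P (frac x)) (base_lift P (frac y) + real k))"
    proof -
      have "Ar interval_cover x y \<in> Arr (interval_cyc F)" using K.Ar_in[of x y] xy by simp
      then show ?thesis
        unfolding T_def monotone_class_def lifts_def
        by (simp add: interval_cover_def eq k_def[symmetric]) (metis (no_types, lifting) eq)
    qed
    also have "\<dots> = Path (monotone_class (base_lift P (frac x) + of_int \<lfloor>x\<rfloor>) (base_lift P (frac y) + real k + of_int \<lfloor>x\<rfloor>))"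
      by (simp only: monotone_class_add_int)
    also have "base_lift P (frac x) + of_int \<lfloor>x\<rfloor> = base_lift P x"
      using base_lift_add[OF fp(2)[OF xy(1)], of "\<lfloor>x\<rfloor>"] frac_props(3)[of x] by simp
    also have "base_lift P (frac y) + real k + of_int \<lfloor>x\<rfloor> = base_lift P y"
      using base_lift_add[OF fp(2)[OF xy(2)], of "\<lfloor>y\<rfloor>"] frac_props(3)[of y] fl by (simp add: k_def)
    finally show ?thesis by simp
  qed
  have "induces True interval_cover (pi0_cover P) (\<lambda>x. x) (Cov (E, T))"
    unfolding induces_def
    by (intro exI[of _ E] exI[of _ T]) (use E T in \<open>auto simp: E_def T_def interval_cyc_def cyc_def\<close>)
  then have "functor_of True interval_cover (pi0_cover P) (\<lambda>x. x) = Cov (E, T)" using functor_of_eqI equivariant_unroll(1) by blast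
  then show ?thesis by (simp add: unroll_def E_def T_def)
qed

lemma dinv_unroll: "dinv (interval_cyc F) (pi0 P) (unroll F) = functor_of True (pi0_cover P) interval_cover (\<lambda>x. x)"
  using dinv_functor_of[OF equivariant_unroll] by (simp add: unroll_eq_functor_of same_refl)

end

section \<open>Points of simplices as configurations on the circle\<close>

text \<open>The cut points of a point of the simplex, continued to all integers with period \<open>n + 1\<close> and
  translation by one.\<close>

definition xcut :: "nat \<Rightarrow> (nat \<Rightarrow> real) \<Rightarrow> int \<Rightarrow> real" where
  "xcut n z k = of_int (k div (int n + 1)) + cut z (nat (k mod (int n + 1)))"

text \<open>The number of the arc that contains \<open>x\<close>, where arcs are half open and those of length zero contain no
  point. As a function of \<open>x\<close> it is adjoint to the sequence of cut points, see \<open>idx_galois\<close>.\<close>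

definition idx :: "nat \<Rightarrow> (nat \<Rightarrow> real) \<Rightarrow> real \<Rightarrow> int" where
  "idx n z x = \<lfloor>x\<rfloor> * (int n + 1) + int (Max {r. r \<le> n \<and> cut z r \<le> frac x})"

text \<open>A representative of the \<open>k\<close>-th arc, as long as this arc is not empty.\<close>

definition mid :: "nat \<Rightarrow> (nat \<Rightarrow> real) \<Rightarrow> int \<Rightarrow> real" where
  "mid n z k = (xcut n z k + xcut n z (k + 1)) / 2"

definition config_map :: "nat \<Rightarrow> (nat \<Rightarrow> real) \<Rightarrow> real \<Rightarrow> real" where
  "config_map n z x = tick n (idx n z x)"

lemma cut_Suc: "cut z (Suc i) = cut z i + z i"
  by (simp add: cut_def)

lemma cut_0 [simp]: "cut z 0 = 0"
  by (simp add: cut_def)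

locale config =
  fixes n :: nat and z :: "nat \<Rightarrow> real"
  assumes z: "z \<in> standard_simplex n"
begin

lemma z_nonneg: "0 \<le> z i" and z_sum: "sum z {..n} = 1"
  using z by (auto simp: standard_simplex_def)

lemma cut_mono: "i \<le> j \<Longrightarrow> cut z i \<le> cut z j"
  unfolding cut_def by (rule sum_mono2) (auto simp: z_nonneg)

lemma cut_last: "cut z (Suc n) = 1"
  using z_sum by (simp add: cut_def lessThan_Suc_atMost)

lemma cut_range: "i \<le> Suc n \<Longrightarrow> cut z i \<in> {0..1}"
  using cut_mono[of 0 i] cut_mono[of i "Suc n"] cut_last by simp

sublocale unit_cuts "cuts n z"
proof
  show "finite (cuts n z)" by (simp add: cuts_def)
  show "0 \<in> cuts n z" unfolding cuts_def by (rule image_eqI[of _ _ 0]) simp_all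
  show "1 \<in> cuts n z" unfolding cuts_def using cut_last by (intro image_eqI[of _ _ "Suc n"]) simp_all
  show "cuts n z \<subseteq> {0..1}" using cut_range by (auto simp: cuts_def)
qed

abbreviation "N \<equiv> int n + 1"

lemma divmod: obtains q r where "k = q * N + int r" "r \<le> n" "q = k div N" "r = nat (k mod N)"
proof -
  have m: "0 \<le> k mod N" "k mod N < N" using pos_mod_sign[of N k] pos_mod_bound[of N k] by linarith+
  show ?thesis
  proof (rule that)
    have "int (nat (k mod N)) = k mod N" using m(1) by simp
    then show "k = k div N * N + int (nat (k mod N))" by (simp only: div_mult_mod_eq)
    show "nat (k mod N) \<le> n" using m by linarith
  qed simp_all
qed

lemma xcut_of:
  assumes "r \<le> Suc n" shows "xcut n z (q * N + int r) = of_int q + cut z r"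
proof (cases "r \<le> n")
  case True
  then have "(q * N + int r) div N = q" "(q * N + int r) mod N = int r" by simp_all
  then show ?thesis by (simp add: xcut_def)
next
  case False
  then have r: "r = Suc n" using assms by simp
  have "q * N + int r = (q + 1) * N" by (simp add: r algebra_simps)
  then have "(q * N + int r) div N = q + 1" "(q * N + int r) mod N = 0"
    by (metis nonzero_mult_div_cancel_right of_nat_0_le_iff zle_add1_eq_le order_less_irrefl,
        metis mod_mult_self2_is_0)
  then show ?thesis by (simp add: xcut_def r cut_last)
qed

lemma xcut_step: "xcut n z (k + 1) = xcut n z k + z (nat (k mod N))"
proof -
  obtain q r where k: "k = q * N + int r" and r: "r \<le> n" "r = nat (k mod N)" using divmod by metis
  have k1: "k + 1 = q * N + int (Suc r)" using k by simp
  have "xcut n z (k + 1) = of_int q + cut z (Suc r)" unfolding k1 by (rule xcut_of) (use r in simp)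
  moreover have "xcut n z k = of_int q + cut z r" unfolding k by (rule xcut_of) (use r in simp)
  ultimately have "xcut n z (k + 1) = xcut n z k + z r" by (simp add: cut_Suc)
  then show ?thesis by (simp only: r(2)[symmetric])
qed

lemma xcut_mono: "k \<le> l \<Longrightarrow> xcut n z k \<le> xcut n z l"
proof (induction l rule: int_ge_induct)
  case (step l)
  then show ?case using xcut_step[of l] z_nonneg[of "nat (l mod N)"] by simp
qed simp

lemma xcut_add: "xcut n z (k + l * N) = xcut n z k + of_int l"
  by (simp add: xcut_def)

lemma xcut_small: "i \<le> Suc n \<Longrightarrow> xcut n z (int i) = cut z i"
  using xcut_of[of i 0] by simp

lemma proj_xcut: "proj (xcut n z k) \<in> P"
proof -
  obtain q r where k: "k = q * N + int r" "r \<le> n" using divmod by metis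
  then have "proj (xcut n z k) = proj (cut z r)"
    using xcut_of[of r q] proj_add_int[of "cut z r" q] by (simp add: add.commute)
  then show ?thesis using k by (auto simp: cuts_def)
qed

lemma in_P_iff: "proj x \<in> P \<longleftrightarrow> (\<exists>k. x = xcut n z k)"
proof
  assume "proj x \<in> P"
  then obtain r where r: "r \<le> Suc n" "proj x = proj (cut z r)" by (auto simp: cuts_def)
  then obtain q :: int where "x = cut z r + of_int q" using proj_eqE[of "cut z r" x] by metis
  then show "\<exists>k. x = xcut n z k" using xcut_of[OF r(1), of q] by (metis add.commute)
qed (auto simp: proj_xcut)

lemma idx_galois: "k \<le> idx n z x \<longleftrightarrow> xcut n z k \<le> x"
proof -
  define R where "R = {r. r \<le> n \<and> cut z r \<le> frac x}"
  have R: "finite R" "0 \<in> R" by (auto simp: R_def)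
  define m where "m = Max R"
  have m: "m \<in> R" unfolding m_def using R by (intro Max_in) auto
  have m_max: "r \<le> m" if "r \<in> R" for r unfolding m_def using that R by simp
  have R_iff: "r \<in> R \<longleftrightarrow> r \<le> m" if "r \<le> n" for r
  proof
    assume "r \<le> m"
    then have "cut z r \<le> cut z m" by (rule cut_mono)
    then show "r \<in> R" using m that by (auto simp: R_def)
  qed (use m_max in auto)
  have idx: "idx n z x = \<lfloor>x\<rfloor> * N + int m" by (simp add: idx_def m_def R_def)
  have mn: "m \<le> n" using m by (simp add: R_def)
  obtain q r where k: "k = q * N + int r" "r \<le> n" using divmod by metis
  have xk: "xcut n z k = of_int q + cut z r" using xcut_of[of r q] k by simp
  have c: "0 \<le> cut z r" "cut z r \<le> 1" using cut_range[of r] k by auto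
  consider "q < \<lfloor>x\<rfloor>" | "q > \<lfloor>x\<rfloor>" | "q = \<lfloor>x\<rfloor>" by linarith
  then show ?thesis
  proof cases
    case 1
    then have "(q + 1) * N \<le> \<lfloor>x\<rfloor> * N" by (intro mult_right_mono) auto
    then have "k \<le> idx n z x" using k idx by (simp add: algebra_simps)
    moreover have "of_int (q + 1) \<le> x" using 1 by linarith
    then have "xcut n z k \<le> x" using xk c by simp
    ultimately show ?thesis by simp
  next
    case 2
    then have "(\<lfloor>x\<rfloor> + 1) * N \<le> q * N" by (intro mult_right_mono) auto
    then have "\<not> k \<le> idx n z x" using k idx mn by (simp add: algebra_simps)
    moreover have "x < of_int q" using 2 by linarith
    then have "\<not> xcut n z k \<le> x" using xk c by simp
    ultimately show ?thesis by simp
  next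
    case 3
    have "xcut n z k \<le> x \<longleftrightarrow> cut z r \<le> frac x" using xk 3 by (auto simp: frac_def)
    also have "\<dots> \<longleftrightarrow> r \<le> m" using R_iff[OF k(2)] k(2) by (simp add: R_def)
    also have "\<dots> \<longleftrightarrow> k \<le> idx n z x" using k idx 3 by simp
    finally show ?thesis by simp
  qed
qed

lemma idx_bounds: "xcut n z (idx n z x) \<le> x" "x < xcut n z (idx n z x + 1)"
  using idx_galois[of "idx n z x" x] idx_galois[of "idx n z x + 1" x] by auto

lemma idx_unique: "xcut n z k \<le> x \<Longrightarrow> x < xcut n z (k + 1) \<Longrightarrow> idx n z x = k"
  using idx_galois[of k x] idx_galois[of "k + 1" x] by linarith

lemma idx_strict: "proj x \<notin> P \<Longrightarrow> xcut n z (idx n z x) < x"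
  using idx_bounds(1)[of x] proj_xcut[of "idx n z x"] by (metis order_less_le)

lemma idx_add_int: "idx n z (x + of_int l) = idx n z x + l * N"
  by (simp add: idx_def frac_def algebra_simps)

lemma idx_mono: "x \<le> y \<Longrightarrow> idx n z x \<le> idx n z y"
  using idx_galois[of "idx n z x" y] idx_bounds(1)[of x] by linarith

lemma same_iff:
  assumes "proj x \<notin> P"
  shows "same P x y \<longleftrightarrow> xcut n z (idx n z x) < y \<and> y < xcut n z (idx n z x + 1)"
proof
  assume s: "same P x y"
  show "xcut n z (idx n z x) < y \<and> y < xcut n z (idx n z x + 1)"
  proof (rule ccontr)
    assume "\<not> ?thesis"
    then have "xcut n z (idx n z x) \<in> {y..x} \<or> xcut n z (idx n z x + 1) \<in> {x..y}"
      using idx_bounds[of x] by auto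
    then show False
      using s proj_xcut[of "idx n z x"] proj_xcut[of "idx n z x + 1"] unfolding same_def by blast
  qed
next
  assume y: "xcut n z (idx n z x) < y \<and> y < xcut n z (idx n z x + 1)"
  have "proj u \<notin> P" if "xcut n z (idx n z x) < u" "u < xcut n z (idx n z x + 1)" for u
  proof
    assume "proj u \<in> P"
    then obtain k where k: "u = xcut n z k" using in_P_iff by blast
    have "\<not> k \<le> idx n z x" using xcut_mono[of k "idx n z x"] k that by auto
    moreover have "\<not> idx n z x + 1 \<le> k" using xcut_mono[of "idx n z x + 1" k] k that by auto
    ultimately show False by linarith
  qed
  then show "same P x y"
    using y idx_strict[OF assms] idx_bounds(2)[of x] unfolding same_def by (auto simp: disjoint_iff)
qed

lemma equivariant_config_map: "equivariant True (pi0_cover P) (ncyc_cover n) (config_map n z)"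
  unfolding equivariant_def
proof (intro conjI ballI impI)
  show "is_cover (pi0_cover P)" by (rule is_cover_pi0)
  show "is_cover (ncyc_cover n)" by (rule is_cover_ncyc)
  fix x assume x: "x \<in> Pts (pi0_cover P)"
  show "config_map n z x \<in> Pts (ncyc_cover n)" by simp
  show "eqv (ncyc_cover n) (config_map n z (x + 1)) (config_map n z x + of_int (sg True))"
    using idx_add_int[of x 1] by (simp add: config_map_def sg_def slot_add_1)
  fix y assume y: "y \<in> Pts (pi0_cover P)" "Le (pi0_cover P) x y"
  have "idx n z x \<le> idx n z y"
  proof (rule ccontr)
    assume "\<not> idx n z x \<le> idx n z y"
    then have "\<not> xcut n z (idx n z x) \<le> y" using idx_galois by simp
    then have "xcut n z (idx n z x) \<in> {y..x}" using idx_bounds(1)[of x] by simp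
    then show False using y proj_xcut by auto
  qed
  then show "if True then Le (ncyc_cover n) (config_map n z x) (config_map n z y) else Le (ncyc_cover n) (config_map n z y) (config_map n z x)"
    by (simp add: config_map_def)
qed

text \<open>A component of the complement in the unit interval is an arc of positive length, and such an arc
  determines its number.\<close>

lemma cut_index_eq_functor_of:
  "Cov (cyc_fun (intervals (cuts n z)) interval_le (cut_index n z)) = functor_of True interval_cover (ncyc_cover n) (config_map n z)"
proof -
  have equivariant: "equivariant True interval_cover (ncyc_cover n) (config_map n z)"
    using equivariant_comp[OF equivariant_unroll(1) equivariant_config_map] by simp
  show ?thesis
    unfolding interval_cover_def ncyc_cover_def
  proof (rule cyc_fun_eq_functor_of[OF equivariant[unfolded interval_cover_def ncyc_cover_def]])
    fix x
    have jd: "idx n z x div N = \<lfloor>x\<rfloor>" if "i \<le> n" "idx n z x = \<lfloor>x\<rfloor> * N + int i" for i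
      using that by simp
    have fr: "idx n z (frac x) = idx n z x - \<lfloor>x\<rfloor> * N"
      using idx_add_int[of "frac x" "\<lfloor>x\<rfloor>"] frac_props(3)[of x] by simp
    have "0 \<le> idx n z (frac x)" using idx_galois[of 0 "frac x"] xcut_small[of 0] by simp
    moreover have "\<not> N \<le> idx n z (frac x)"
      using idx_galois[of N "frac x"] xcut_small[of "Suc n"] cut_last frac_lt_1[of x] by (simp add: add.commute)
    ultimately obtain i where i: "idx n z (frac x) = int i" "i \<le> n"
      by (metis linorder_not_le nonneg_int_cases of_nat_less_iff zle_add1_eq_le nat_int_comparison(3) not_le)
    have xi: "idx n z x = \<lfloor>x\<rfloor> * N + int i" using fr i by simp
    show "\<lfloor>config_map n z x\<rfloor> = \<lfloor>x\<rfloor>" unfolding config_map_def floor_tick by (rule jd[OF i(2) xi])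
    assume "x \<in> {x. proj x \<notin> P}"
    then have x: "proj (frac x) \<notin> P" "frac x \<in> {0..1}" using frac_props[of x] by auto
    have "xcut n z (int i) = cut z i" "xcut n z (int i + 1) = cut z (i + 1)"
      using xcut_small[of i] xcut_small[of "Suc i"] i(2) by (simp_all add: add.commute)
    note ci = this
    have "comp_in (frac x) = {xcut n z (idx n z (frac x))<..<xcut n z (idx n z (frac x) + 1)}"
      unfolding comp_in_eq[OF x(2,1)] by (intro Set.set_eqI) (simp add: same_iff[OF x(1)])
    moreover have "xcut n z (idx n z (frac x)) < xcut n z (idx n z (frac x) + 1)"
      using idx_strict[OF x(1)] idx_bounds(2)[of "frac x"] by linarith
    ultimately have I: "comp_in (frac x) = {cut z i<..<cut z (i + 1)}" "cut z i < cut z (i + 1)"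
      unfolding i(1) ci by simp_all
    have "(THE j. j \<le> n \<and> {cut z i<..<cut z (i + 1)} = {cut z j<..<cut z (j + 1)}) = i"
    proof (rule the_equality)
      show "i \<le> n \<and> {cut z i<..<cut z (i + 1)} = {cut z i<..<cut z (i + 1)}" using i by simp
      fix j assume j: "j \<le> n \<and> {cut z i<..<cut z (i + 1)} = {cut z j<..<cut z (j + 1)}"
      have "cut z j < cut z (j + 1)"
        using j I(2) dense[OF I(2)] by (metis emptyE greaterThanLessThan_empty_iff greaterThanLessThan_iff linorder_not_le)
      then have "cut z i = cut z j" "cut z (i + 1) = cut z (j + 1)"
        using j I(2) by (metis cInf_greaterThanLessThan, metis cSup_greaterThanLessThan)
      moreover have "i + 1 \<le> j \<Longrightarrow> cut z (i + 1) \<le> cut z j" "j + 1 \<le> i \<Longrightarrow> cut z (j + 1) \<le> cut z i"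
        by (rule cut_mono; simp)+
      ultimately show "j = i" using I(2) by force
    qed
    then have "cut_index n z (Interval (comp_in (frac x))) = Vertex i"
      by (simp add: cut_index_def I(1))
    moreover have "nat (slot n (config_map n z x) mod N) = i"
      using i(2) by (simp add: config_map_def xi)
    ultimately show "cut_index n z (Interval (comp_in (frac x))) = Vertex (nat (slot n (config_map n z x) mod N))"
      by simp
  qed
qed

end

subsection \<open>Degeneracies and faces\<close>

lemma cut_simplex_map:
  assumes "\<theta> \<in> {..m} \<rightarrow> {..n}"
  shows "cut (simplex_map m \<theta> z) j = (\<Sum>i | i \<le> m \<and> \<theta> i < j. z i)"
proof -
  have "cut (simplex_map m \<theta> z) j = (\<Sum>l\<in>{..<j}. \<Sum>i | i \<in> {i. i \<le> m \<and> \<theta> i < j} \<and> \<theta> i = l. z i)"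
    unfolding cut_def simplex_map_def by (intro sum.cong refl) auto
  also have "\<dots> = (\<Sum>i | i \<le> m \<and> \<theta> i < j. z i)"
    by (rule sum.group) auto
  finally show ?thesis .
qed

lemma cut_simplex_map_initial:
  assumes "\<theta> \<in> {..m} \<rightarrow> {..n}" and l: "l \<le> Suc m" "\<And>i. i \<le> m \<Longrightarrow> \<theta> i < j \<longleftrightarrow> i < l"
  shows "cut (simplex_map m \<theta> z) j = cut z l"
proof -
  have "{i. i \<le> m \<and> \<theta> i < j} = {..<l}" using l by auto
  then show ?thesis using cut_simplex_map[OF assms(1)] by (simp add: cut_def)
qed

lemma mono_initial_segment:
  fixes \<theta> :: "nat \<Rightarrow> nat"
  assumes "mono_on {..m} \<theta>"
  obtains l where "l \<le> Suc m" "\<And>i. i \<le> m \<Longrightarrow> \<theta> i < j \<longleftrightarrow> i < l"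
proof -
  define l where "l = card {i. i \<le> m \<and> \<theta> i < j}"
  define S where "S = {i. i \<le> m \<and> \<theta> i < j}"
  have "i \<in> S \<longleftrightarrow> i < card S" if "i \<le> m" for i
  proof
    assume "i \<in> S"
    then have "{..i} \<subseteq> S" using assms that by (auto simp: S_def mono_on_def) (meson le_less_trans le_trans)
    moreover have "finite S" by (simp add: S_def)
    ultimately have "card {..i} \<le> card S" by (rule card_mono[rotated])
    then show "i < card S" by simp
  next
    assume i: "i < card S"
    show "i \<in> S"
    proof (rule ccontr)
      assume "i \<notin> S"
      then have "S \<subseteq> {..<i}"
        using assms that by (auto simp: S_def mono_on_def) (meson le_less_trans not_le)
      then have "card S \<le> i" using card_mono[of "{..<i}" S] by simp
      then show False using i by simp
    qed
  qed
  moreover have "card S \<le> Suc m" using card_mono[of "{..m}" S] by (auto simp: S_def)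
  ultimately show ?thesis by (intro that[of "card S"]) (auto simp: S_def)
qed

lemma simplex_map_in:
  assumes "\<theta> \<in> {..m} \<rightarrow> {..n}" "z \<in> standard_simplex m"
  shows "simplex_map m \<theta> z \<in> standard_simplex n"
proof -
  interpret config m z by unfold_locales fact
  have nn: "0 \<le> simplex_map m \<theta> z j" for j unfolding simplex_map_def by (intro sum_nonneg) (simp add: z_nonneg)
  have s: "sum (simplex_map m \<theta> z) {..n} = 1"
  proof -
    have "sum (simplex_map m \<theta> z) {..n} = (\<Sum>i | i \<le> m \<and> \<theta> i < Suc n. z i)"
      using cut_simplex_map[OF assms(1), of z "Suc n"] by (simp add: cut_def lessThan_Suc_atMost)
    also have "{i. i \<le> m \<and> \<theta> i < Suc n} = {..m}" using assms(1) by (auto simp: less_Suc_eq_le)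
    finally show ?thesis using z_sum by simp
  qed
  have z0: "simplex_map m \<theta> z j = 0" if "j > n" for j
  proof -
    have "\<theta> i \<le> n" if "i \<le> m" for i using assms(1) that by auto
    then have "{i. i \<le> m \<and> \<theta> i = j} = {}" using that by fastforce
    then show ?thesis unfolding simplex_map_def by (simp only: sum.empty)
  qed
  have "simplex_map m \<theta> z j \<le> 1" for j
  proof (cases "j \<le> n")
    case True
    then have "simplex_map m \<theta> z j \<le> sum (simplex_map m \<theta> z) {..n}"
      by (intro member_le_sum) (auto simp: nn)
    then show ?thesis using s by simp
  qed (simp add: z0)
  then show ?thesis using nn z0 s by (auto simp: standard_simplex_def)
qed

text \<open>The interval of \<open>z\<close> numbered \<open>r\<close> is contained in the interval of the image configuration numbered \<open>\<theta> r\<close>.\<close>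

lemma idx_simplex_map:
  assumes \<theta>: "\<theta> \<in> {..m} \<rightarrow> {..n}" "mono_on {..m} \<theta>" and z: "z \<in> standard_simplex m"
  shows "idx n (simplex_map m \<theta> z) x = periodic_extension m n \<theta> (idx m z x)"
proof -
  interpret m: config m z by unfold_locales fact
  interpret n: config n "simplex_map m \<theta> z" by unfold_locales (rule simplex_map_in[OF \<theta>(1) z])
  obtain q r where k: "idx m z x = q * m.N + int r" "r \<le> m" using m.divmod by metis
  have x: "of_int q + cut z r \<le> x" "x < of_int q + cut z (Suc r)"
    using m.idx_bounds[of x] m.xcut_of[of r q] m.xcut_of[of "Suc r" q] k by (auto simp: add.assoc add.commute)
  have \<theta>r: "\<theta> r \<le> n" using \<theta>(1) k by auto
  have e: "periodic_extension m n \<theta> (idx m z x) = q * n.N + int (\<theta> r)"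
    using k by (simp add: periodic_extension_def)
  have "cut (simplex_map m \<theta> z) (\<theta> r) \<le> cut z r"
    unfolding cut_simplex_map[OF \<theta>(1)] cut_def[of z]
  proof (rule sum_mono2)
    show "{i. i \<le> m \<and> \<theta> i < \<theta> r} \<subseteq> {..<r}"
    proof
      fix i assume "i \<in> {i. i \<le> m \<and> \<theta> i < \<theta> r}"
      then show "i \<in> {..<r}" using mono_onD[OF \<theta>(2), of r i] k by force
    qed
  qed (auto simp: m.z_nonneg)
  moreover have "cut z (Suc r) \<le> cut (simplex_map m \<theta> z) (Suc (\<theta> r))"
    unfolding cut_simplex_map[OF \<theta>(1)] cut_def[of z]
  proof (rule sum_mono2)
    show "{..<Suc r} \<subseteq> {i. i \<le> m \<and> \<theta> i < Suc (\<theta> r)}"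
      using mono_onD[OF \<theta>(2)] k by (auto simp: less_Suc_eq_le)
  qed (auto simp: m.z_nonneg)
  moreover have "xcut n (simplex_map m \<theta> z) (q * n.N + int (\<theta> r)) = of_int q + cut (simplex_map m \<theta> z) (\<theta> r)"
    using n.xcut_of[of "\<theta> r" q] \<theta>r by simp
  moreover have "xcut n (simplex_map m \<theta> z) (q * n.N + int (\<theta> r) + 1) = of_int q + cut (simplex_map m \<theta> z) (Suc (\<theta> r))"
    using n.xcut_of[of "Suc (\<theta> r)" q] \<theta>r by (simp add: add.assoc add.commute)
  ultimately have "idx n (simplex_map m \<theta> z) x = q * n.N + int (\<theta> r)"
    using x by (intro n.idx_unique) auto
  then show ?thesis using e by simp
qed

lemma cuts_simplex_map:
  assumes \<theta>: "\<theta> \<in> {..m} \<rightarrow> {..n}" "mono_on {..m} \<theta>"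
  shows "cuts n (simplex_map m \<theta> z) \<subseteq> cuts m z"
proof
  fix x assume "x \<in> cuts n (simplex_map m \<theta> z)"
  then obtain j where j: "x = cut (simplex_map m \<theta> z) j" by (auto simp: cuts_def)
  obtain l where l: "l \<le> Suc m" "\<And>i. i \<le> m \<Longrightarrow> \<theta> i < j \<longleftrightarrow> i < l"
    using mono_initial_segment[OF \<theta>(2), of j] by blast
  then have "x = cut z l" using cut_simplex_map_initial[OF \<theta>(1) l] j by simp
  then show "x \<in> cuts m z" using l by (auto simp: cuts_def)
qed

subsection \<open>Configurations of distinct points\<close>

locale pos_config = config +
  assumes pos: "i \<le> n \<Longrightarrow> 0 < z i"
begin

lemma xcut_less: "xcut n z k < xcut n z (k + 1)"
  using xcut_step[of k] pos[of "nat (k mod N)"] divmod[of k] by (metis less_add_same_cancel1)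

lemma mid_bounds: "xcut n z k < mid n z k" "mid n z k < xcut n z (k + 1)"
  using xcut_less[of k] by (auto simp: mid_def)

lemma idx_mid [simp]: "idx n z (mid n z k) = k"
  using mid_bounds[of k] by (intro idx_unique) auto

lemma mid_notin: "proj (mid n z k) \<notin> P"
proof
  assume "proj (mid n z k) \<in> P"
  then obtain j where j: "mid n z k = xcut n z j" using in_P_iff by blast
  then have "xcut n z j \<le> mid n z k" by simp
  then have "j \<le> idx n z (mid n z k)" using idx_galois by blast
  then have "j \<le> k" by simp
  then show False using xcut_mono[of j k] mid_bounds(1)[of k] j by simp
qed

lemma mid_less: "k < l \<Longrightarrow> mid n z k < mid n z l"
  using mid_bounds(2)[of k] mid_bounds(1)[of l] xcut_mono[of "k + 1" l] by simp

lemma equivariant_mid: "equivariant True (ncyc_cover n) (pi0_cover P) (\<lambda>x. mid n z (slot n x))"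
  unfolding equivariant_def
proof (intro conjI ballI impI)
  show "is_cover (pi0_cover P)" by (rule is_cover_pi0)
  show "is_cover (ncyc_cover n)" by (rule is_cover_ncyc)
  fix x show "mid n z (slot n x) \<in> Pts (pi0_cover P)" using mid_notin by simp
  have "mid n z (slot n x + N) = mid n z (slot n x) + 1"
    using xcut_add[of "slot n x" 1] xcut_add[of "slot n x + 1" 1] by (simp add: mid_def algebra_simps)
  then show "eqv (pi0_cover P) (mid n z (slot n (x + 1))) (mid n z (slot n x) + of_int (sg True))"
    using mid_notin same_refl by (simp add: slot_add_1 sg_def)
  fix y assume "Le (ncyc_cover n) x y"
  then have "slot n x = slot n y \<or> mid n z (slot n x) < mid n z (slot n y)" using mid_less[of "slot n x" "slot n y"] by force
  then have "{mid n z (slot n y)..mid n z (slot n x)} \<subseteq> {mid n z (slot n x)}" by auto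
  moreover have "mid n z (slot n x) \<notin> proj -` P" using mid_notin by simp
  ultimately have "{mid n z (slot n y)..mid n z (slot n x)} \<inter> proj -` P = {}" by blast
  then show "if True then Le (pi0_cover P) (mid n z (slot n x)) (mid n z (slot n y))
      else Le (pi0_cover P) (mid n z (slot n y)) (mid n z (slot n x))"
    by simp
qed

lemma mid_config_map: "proj x \<notin> P \<Longrightarrow> same P (mid n z (slot n (config_map n z x))) x"
  using same_sym same_iff[of x "mid n z (idx n z x)"] mid_bounds[of "idx n z x"] by (simp add: config_map_def)

lemma config_map_mid: "slot n (config_map n z (mid n z k)) = k"
  by (simp add: config_map_def)

end

text \<open>The coordinates are the gaps between consecutive elements.\<close>

lemma enumerate_cuts:
  assumes A: "finite A" "0 \<in> A" "1 \<in> A" "A \<subseteq> {0..1}"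
  obtains n z where "pos_config n z" "cuts n z = A"
proof -
  define xs where "xs = sorted_list_of_set A"
  have xs: "set xs = A" "sorted_wrt (<) xs" "length xs = card A"
    using A by (simp_all add: xs_def)
  have "card {0, 1 :: real} \<le> card A" using A by (intro card_mono) auto
  then have len: "length xs \<ge> 2" using xs by simp
  define n where "n = length xs - 2"
  have ln: "length xs = n + 2" using len by (simp add: n_def)
  have nth_less: "xs ! i < xs ! j" if "i < j" "j \<le> n + 1" for i j
    using sorted_wrt_nth_less[OF xs(2)] that ln by simp
  have nth_le: "xs ! i \<le> xs ! j" if "i \<le> j" "j \<le> n + 1" for i j
    using nth_less[of i j] that by (cases "i = j") auto
  have nth_range: "xs ! i \<in> {0..1}" if "i \<le> n + 1" for i
    using nth_mem[of i xs] that ln xs A by auto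
  have first: "xs ! 0 = 0"
  proof -
    obtain i where "i < length xs" "xs ! i = 0" using A xs by (metis in_set_conv_nth)
    then have "xs ! 0 \<le> 0" using nth_le[of 0 i] ln by simp
    then show ?thesis using nth_range[of 0] by simp
  qed
  have last: "xs ! (n + 1) = 1"
  proof -
    obtain i where "i < length xs" "xs ! i = 1" using A xs by (metis in_set_conv_nth)
    then have "1 \<le> xs ! (n + 1)" using nth_le[of i "n + 1"] ln by simp
    then show ?thesis using nth_range[of "n + 1"] by simp
  qed
  define z where "z i = (if i \<le> n then xs ! (i + 1) - xs ! i else 0)" for i
  have cut: "cut z i = xs ! i" if "i \<le> n + 1" for i
    using that by (induction i) (auto simp: first cut_Suc z_def)
  have "sum z {..n} = 1"
    using cut[of "n + 1"] last by (simp add: cut_def lessThan_Suc_atMost)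
  moreover have "0 \<le> z i" "z i \<le> 1" for i
    using nth_le[of i "i + 1"] nth_range[of i] nth_range[of "i + 1"] by (auto simp: z_def)
  ultimately have "z \<in> standard_simplex n" by (simp add: standard_simplex_def z_def)
  moreover have "0 < z i" if "i \<le> n" for i using nth_less[of i "i + 1"] that by (simp add: z_def)
  ultimately have "pos_config n z" by (simp add: pos_config_def config_def pos_config_axioms_def)
  moreover have "cuts n z = A"
  proof -
    have "cuts n z = (!) xs ` {..<length xs}"
      unfolding cuts_def ln using cut by (intro image_cong) auto
    also have "\<dots> = set xs" by (auto simp: set_conv_nth)
    finally show ?thesis using xs(1) by simp
  qed
  ultimately show ?thesis by (rule that)
qed

lemma enumerate_circle:
  assumes F: "finite F" "proj 0 \<in> F"
  obtains n z where "pos_config n z" "proj ` cuts n z = F"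
proof -
  \<comment> \<open>The base point has the two lifts 0 and 1 in the unit interval, and both are cut points.\<close>
  define A where "A = {x. 0 \<le> x \<and> x \<le> 1 \<and> proj x \<in> F}"
  have fr: "proj (frac (rep_circle c)) = c" for c
  proof -
    have "rep_circle c = frac (rep_circle c) + of_int \<lfloor>rep_circle c\<rfloor>" by (simp add: frac_def)
    then show ?thesis by (metis proj_add_int proj_rep)
  qed
  have "x \<in> insert 1 ((\<lambda>c. frac (rep_circle c)) ` F)" if "x \<in> A" for x
  proof (cases "x = 1")
    case False
    then have x: "0 \<le> x" "x < 1" "proj x \<in> F" using that by (auto simp: A_def)
    obtain k :: int where "rep_circle (proj x) = x + of_int k" using proj_eqE[of x "rep_circle (proj x)"] by auto
    then have "frac (rep_circle (proj x)) = frac x" by (simp add: frac_def)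
    then have "frac (rep_circle (proj x)) = x" using x by (simp add: frac_eq)
    then show ?thesis using x(3) by (metis image_eqI insertI2)
  qed simp
  then have "finite A" using F(1) finite_subset[of A "insert 1 ((\<lambda>c. frac (rep_circle c)) ` F)"] by blast
  moreover have "proj 1 = proj 0" using proj_add_1[of 0] by simp
  then have "0 \<in> A" "1 \<in> A" "A \<subseteq> {0..1}" using F by (auto simp: A_def)
  ultimately obtain n z where nz: "pos_config n z" "cuts n z = A" using enumerate_cuts by blast
  have "proj ` A = F"
  proof
    show "proj ` A \<subseteq> F" by (auto simp: A_def)
    show "F \<subseteq> proj ` A"
    proof
      fix c assume "c \<in> F"
      then have "frac (rep_circle c) \<in> A"
        using fr[of c] frac_ge_0[of "rep_circle c"] frac_lt_1[of "rep_circle c"] by (simp add: A_def)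
      then show "c \<in> proj ` A" using fr[of c] by (metis image_eqI)
    qed
  qed
  then show ?thesis using that nz by simp
qed

section \<open>Dihedral sets on complements of finite sets\<close>

definition pull :: "'x zpresheaf \<Rightarrow> bool \<Rightarrow> cover \<Rightarrow> cover \<Rightarrow> (real \<Rightarrow> real) \<Rightarrow> 'x \<Rightarrow> 'x" where
  "pull Xt v K L f = Map_at Xt (Cat K) (Cat L) (functor_of v K L f)"

lemma functor_of_Cov:
  assumes "equivariant True K L f" obtains F where "functor_of True K L f = Cov F"
  using induces_functor_of[OF assms] unfolding induces_def by auto

lemma in_DeltaD_bigI:
  assumes "equivariant True K (ncyc_cover n) f" "equivariant True (ncyc_cover n) K g"
    and "\<And>x. x \<in> Pts K \<Longrightarrow> eqv K (g (f x)) x" "\<And>x. slot n (f (g x)) = slot n x"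
  shows "Cat K \<in> DeltaD_big"
proof -
  interpret is_cover K using assms(1) by (simp add: equivariant_def)
  have "is_dinv (Cat K) (ncyc n) (functor_of True K (ncyc_cover n) f) (functor_of True (ncyc_cover n) K g)"
    using is_dinv_functor_of[OF assms(1,2,3)] assms(4) by simp
  then have "zcat_iso (Cat K) (ncyc n)"
    unfolding zcat_iso_def by (metis functor_of_Cov assms(1,2))
  then show ?thesis using zcategory_Cat by (auto simp: DeltaD_big_def)
qed

lemma proj_shift: "proj x = proj (y - r) \<longleftrightarrow> proj (x + r) = proj y"
  by (simp add: proj_eq_iff algebra_simps)

text \<open>An arbitrary finite nonempty set is rotated to one that contains the base point. There the numbering of
  the arcs is an equivalence, inverse to picking midpoints.\<close>

lemma pi0_numbering:
  assumes FI: "F \<in> index_sets"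
  obtains n f g where "equivariant True (pi0_cover F) (ncyc_cover n) f" "equivariant True (ncyc_cover n) (pi0_cover F) g"
    "\<And>x. proj x \<notin> F \<Longrightarrow> same F (g (f x)) x" "\<And>x. slot n (f (g x)) = slot n x"
proof -
  obtain c where c: "c \<in> F" using FI by (auto simp: index_sets_def)
  define r where "r = rep_circle c"
  define G where "G = (\<lambda>c. proj (rep_circle c - r)) ` F"
  have G: "proj x \<in> G \<longleftrightarrow> proj (x + r) \<in> F" for x
  proof
    assume "proj x \<in> G"
    then obtain d where d: "d \<in> F" "proj x = proj (rep_circle d - r)" by (auto simp: G_def)
    then have "proj (x + r) = d" by (simp only: proj_shift proj_rep)
    then show "proj (x + r) \<in> F" using d by simp
  next
    assume x: "proj (x + r) \<in> F"
    have "proj x = proj (rep_circle (proj (x + r)) - r)" by (simp only: proj_shift proj_rep)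
    then show "proj x \<in> G" using x by (auto simp: G_def)
  qed
  have GI: "G \<in> index_sets" using FI by (auto simp: G_def index_sets_def)
  have "proj 0 \<in> G" using G[of 0] c by (simp add: r_def)
  then obtain n z where nz: "pos_config n z" and Gz: "proj ` cuts n z = G"
    using enumerate_circle[of G] GI by (auto simp: index_sets_def)
  interpret pos_config n z by (rule nz)
  have 1: "equivariant True (pi0_cover F) (pi0_cover G) (\<lambda>x. x - r)"
  proof (rule equivariant_pi0)
    show "if True then mono (\<lambda>x. x - r) else antimono (\<lambda>x. x - r)" by (simp add: mono_def)
  qed (use GI FI G in \<open>auto simp: sg_def intro: continuous_intros\<close>)
  have 2: "equivariant True (pi0_cover G) (pi0_cover F) (\<lambda>x. x + r)"
  proof (rule equivariant_pi0)
    show "if True then mono (\<lambda>x. x + r) else antimono (\<lambda>x. x + r)" by (simp add: mono_def)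
  qed (use GI FI G in \<open>auto simp: sg_def intro: continuous_intros\<close>)
  have "equivariant True (pi0_cover F) (ncyc_cover n) (\<lambda>x. config_map n z (x - r))"
    using equivariant_comp[OF 1 equivariant_config_map[unfolded Gz]] by simp
  moreover have "equivariant True (ncyc_cover n) (pi0_cover F) (\<lambda>x. mid n z (slot n x) + r)"
    using equivariant_comp[OF equivariant_mid[unfolded Gz] 2] by simp
  moreover have "same F (mid n z (slot n (config_map n z (x - r))) + r) x" if "proj x \<notin> F" for x
  proof -
    have x: "proj (x - r) \<notin> G" using G[of "x - r"] that by simp
    then have "same G (mid n z (slot n (config_map n z (x - r)))) (x - r)" using mid_config_map[unfolded Gz] by blast
    then show ?thesis using equivariant_eqv[OF 2, of "mid n z (slot n (config_map n z (x - r)))" "x - r"] same_notin by auto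
  qed
  moreover have "slot n (config_map n z (mid n z (slot n x) + r - r)) = slot n x" for x by (simp add: config_map_mid)
  ultimately show ?thesis by (rule that)
qed

lemma pi0_big:
  assumes FI: "F \<in> index_sets" shows "pi0 F \<in> DeltaD_big"
proof -
  obtain n f g where nfg: "equivariant True (pi0_cover F) (ncyc_cover n) f" "equivariant True (ncyc_cover n) (pi0_cover F) g"
    "\<And>x. proj x \<notin> F \<Longrightarrow> same F (g (f x)) x" "\<And>x. slot n (f (g x)) = slot n x"
    using pi0_numbering[OF FI] by blast
  show ?thesis using in_DeltaD_bigI[OF nfg(1,2) _ nfg(4)] nfg(3) by simp
qed

lemma (in config) interval_cyc_big: "interval_cyc (cuts n z) \<in> DeltaD_big"
proof -
  obtain m f g where fg: "equivariant True (pi0_cover P) (ncyc_cover m) f" "equivariant True (ncyc_cover m) (pi0_cover P) g"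
    "\<And>x. proj x \<notin> P \<Longrightarrow> same P (g (f x)) x" "\<And>x. slot m (f (g x)) = slot m x"
    using pi0_numbering[OF P_in_index] by blast
  have "equivariant True interval_cover (ncyc_cover m) f" "equivariant True (ncyc_cover m) interval_cover g"
    using equivariant_comp[OF equivariant_unroll(1) fg(1)] equivariant_comp[OF fg(2) equivariant_unroll(2)] by simp_all
  then show ?thesis using in_DeltaD_bigI[of interval_cover m f g] fg(3,4) by simp
qed

locale dihedral =
  fixes X Xt :: "'x zpresheaf"
  assumes X: "dihedral_set X" and extension: "dihedral_extension X Xt"
begin

lemma ncyc_Delta: "ncyc n \<in> DeltaD"
  by (simp add: DeltaD_def)

lemma presheaf: "presheaf_on DeltaD_big Xt"
  using extension by (simp add: dihedral_extension_def)

lemma Set_ncyc: "Set_at Xt (ncyc n) = Set_at X (ncyc n)"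
  using extension ncyc_Delta by (simp add: dihedral_extension_def)

lemma pull_in:
  assumes "equivariant v K L f" "Cat K \<in> DeltaD_big" "Cat L \<in> DeltaD_big" "x \<in> Set_at Xt (Cat L)"
  shows "pull Xt v K L f x \<in> Set_at Xt (Cat K)"
proof -
  have "Map_at Xt (Cat K) (Cat L) (functor_of v K L f) \<in> Set_at Xt (Cat L) \<rightarrow> Set_at Xt (Cat K)"
    using presheaf functor_of_in_dhom[OF assms(1)] assms(2,3) unfolding presheaf_on_def by blast
  then show ?thesis using assms(4) unfolding pull_def by (rule funcset_mem)
qed

lemma pull_comp:
  assumes f: "equivariant v K L f" and g: "equivariant w L M g"
    and big: "Cat K \<in> DeltaD_big" "Cat L \<in> DeltaD_big" "Cat M \<in> DeltaD_big"
    and x: "x \<in> Set_at Xt (Cat M)"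
  shows "pull Xt v K L f (pull Xt w L M g x) = pull Xt (v = w) K M (\<lambda>x. g (f x)) x"
proof -
  have "Map_at Xt (Cat K) (Cat M) (dcomp (Cat K) (functor_of w L M g) (functor_of v K L f)) x
      = Map_at Xt (Cat K) (Cat L) (functor_of v K L f) (Map_at Xt (Cat L) (Cat M) (functor_of w L M g) x)"
    using presheaf functor_of_in_dhom[OF f] functor_of_in_dhom[OF g] big x unfolding presheaf_on_def by blast
  then show ?thesis unfolding pull_def dcomp_functor_of[OF f g] by simp
qed

lemma pull_cong:
  assumes "equivariant v K L f" "\<And>x. x \<in> Pts K \<Longrightarrow> g x \<in> Pts L \<and> eqv L (f x) (g x)"
  shows "pull Xt v K L g = pull Xt v K L f"
  by (simp add: fun_eq_iff pull_def functor_of_cong(2)[OF assms])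

lemma pull_id:
  assumes "is_cover K" "Cat K \<in> DeltaD_big" "x \<in> Set_at Xt (Cat K)"
    and "\<And>y. y \<in> Pts K \<Longrightarrow> f y \<in> Pts K \<and> eqv K y (f y)"
  shows "pull Xt True K K f x = x"
proof -
  have "pull Xt True K K f x = pull Xt True K K (\<lambda>y. y) x"
    using pull_cong[OF equivariant_id[OF assms(1)] assms(4)] by simp
  also have "\<dots> = x"
    using presheaf assms(2,3) unfolding pull_def functor_of_id[OF assms(1)] presheaf_on_def by blast
  finally show ?thesis .
qed

abbreviation S where "S F \<equiv> Set_at Xt (pi0 F)"

lemma cover_pi0: "F \<in> index_sets \<Longrightarrow> is_cover (pi0_cover F)"
  by (simp add: finite_nonempty.is_cover_pi0 finite_nonempty_def)

lemma transition_eq: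
  assumes "F \<in> index_sets" "G \<in> index_sets" "F \<subseteq> G"
  shows "transition Xt F G = pull Xt True (pi0_cover G) (pi0_cover F) (\<lambda>x. x)"
  by (simp add: transition_def pull_def forget_eq_functor_of[OF assms])

lemma transition_in:
  assumes "F \<in> index_sets" "G \<in> index_sets" "F \<subseteq> G" "\<xi> \<in> S F"
  shows "transition Xt F G \<xi> \<in> S G"
  using pull_in[OF equivariant_forget[OF assms(1-3)]] pi0_big assms by (simp add: transition_eq)

lemma transition_id:
  assumes "F \<in> index_sets" "\<xi> \<in> S F" shows "transition Xt F F \<xi> = \<xi>"
  using pull_id[OF cover_pi0[OF assms(1)]] pi0_big assms by (simp add: transition_eq same_refl)

lemma transition_trans:
  assumes "F \<in> index_sets" "G \<in> index_sets" "H \<in> index_sets" "F \<subseteq> G" "G \<subseteq> H" "\<xi> \<in> S F"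
  shows "transition Xt G H (transition Xt F G \<xi>) = transition Xt F H \<xi>"
  using pull_comp[OF equivariant_forget[OF assms(2,3,5)] equivariant_forget[OF assms(1,2,4)]] pi0_big assms
  by (simp add: transition_eq)

lemma index_Un: "F \<in> index_sets \<Longrightarrow> G \<in> index_sets \<Longrightarrow> F \<union> G \<in> index_sets"
  by (simp add: index_sets_def)

lemma filtered: "filtered_diagram Xt"
  unfolding filtered_diagram_def
proof (intro conjI ballI impI)
  show "index_sets \<noteq> {}" by (auto simp: index_sets_def intro!: exI[of _ "{proj 0}"])
  show "\<exists>H\<in>index_sets. F \<subseteq> H \<and> G \<subseteq> H" if "F \<in> index_sets" "G \<in> index_sets" for F G
    using index_Un[OF that] by blast
qed (auto simp: transition_in transition_id transition_trans)

subsection \<open>The colimit\<close>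

text \<open>In a filtered diagram two elements are identified in the colimit if and only if they become equal at
  some later stage.\<close>

definition rel1 :: "circle set \<times> 'x \<Rightarrow> circle set \<times> 'x \<Rightarrow> bool" where
  "rel1 p q \<longleftrightarrow> (\<exists>H\<in>index_sets. fst p \<subseteq> H \<and> fst q \<subseteq> H \<and>
     transition Xt (fst p) H (snd p) = transition Xt (fst q) H (snd q))"

lemma colim_carrier: "(F, \<xi>) \<in> colim_carrier Xt \<longleftrightarrow> F \<in> index_sets \<and> \<xi> \<in> S F"
  by (auto simp: colim_carrier_def)

lemma rel1_trans:
  assumes p: "p \<in> colim_carrier Xt" and q: "q \<in> colim_carrier Xt" and r: "r \<in> colim_carrier Xt"
    and pq: "rel1 p q" and qr: "rel1 q r"
  shows "rel1 p r"
proof -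
  obtain F \<xi> G \<eta> E \<zeta> where e: "p = (F, \<xi>)" "q = (G, \<eta>)" "r = (E, \<zeta>)"
    by (metis surj_pair)
  have i: "F \<in> index_sets" "\<xi> \<in> S F" "G \<in> index_sets" "\<eta> \<in> S G" "E \<in> index_sets" "\<zeta> \<in> S E"
    using p q r by (auto simp: e colim_carrier)
  obtain H where H: "H \<in> index_sets" "F \<subseteq> H" "G \<subseteq> H" "transition Xt F H \<xi> = transition Xt G H \<eta>"
    using pq by (auto simp: rel1_def e)
  obtain K where K: "K \<in> index_sets" "G \<subseteq> K" "E \<subseteq> K" "transition Xt G K \<eta> = transition Xt E K \<zeta>"
    using qr by (auto simp: rel1_def e)
  have HK: "H \<union> K \<in> index_sets" "H \<subseteq> H \<union> K" "K \<subseteq> H \<union> K" using index_Un[OF H(1) K(1)] by auto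
  have "transition Xt F (H \<union> K) \<xi> = transition Xt H (H \<union> K) (transition Xt F H \<xi>)"
    using transition_trans[OF i(1) H(1) HK(1) H(2) HK(2) i(2)] by simp
  also have "\<dots> = transition Xt G (H \<union> K) \<eta>"
    using transition_trans[OF i(3) H(1) HK(1) H(3) HK(2) i(4)] H(4) by simp
  also have "\<dots> = transition Xt K (H \<union> K) (transition Xt G K \<eta>)"
    using transition_trans[OF i(3) K(1) HK(1) K(2) HK(3) i(4)] by simp
  also have "\<dots> = transition Xt E (H \<union> K) \<zeta>"
    using transition_trans[OF i(5) K(1) HK(1) K(3) HK(3) i(6)] K(4) by simp
  finally show ?thesis unfolding rel1_def e fst_conv snd_conv using HK(1) H(2) K(3) by blast
qed

lemma colim_rel_iff:
  assumes p: "p \<in> colim_carrier Xt" and q: "q \<in> colim_carrier Xt"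
  shows "(p, q) \<in> colim_rel Xt \<longleftrightarrow> rel1 p q"
proof
  define R where "R = {((F, \<xi>), (G, transition Xt F G \<xi>)) | F G \<xi>.
        F \<in> index_sets \<and> G \<in> index_sets \<and> F \<subseteq> G \<and> \<xi> \<in> Set_at Xt (pi0 F)}"
  have colim_rel: "colim_rel Xt = (R \<union> R\<inverse>)\<^sup>* \<inter> colim_carrier Xt \<times> colim_carrier Xt"
    by (simp add: colim_rel_def equiv_closure_on_def R_def)
  {
    assume "(p, q) \<in> colim_rel Xt"
    then have "(p, q) \<in> (R \<union> R\<inverse>)\<^sup>*" by (simp add: colim_rel)
    then have "q \<in> colim_carrier Xt \<and> rel1 p q"
    proof (induction rule: rtrancl_induct)
      case base
      then show ?case using p by (cases p) (auto simp: rel1_def colim_carrier)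
    next
      case (step q r)
      have R: "a \<in> colim_carrier Xt \<and> b \<in> colim_carrier Xt \<and> rel1 a b \<and> rel1 b a" if ab_R: "(a, b) \<in> R" for a b
      proof -
        obtain F G \<xi> where ab: "a = (F, \<xi>)" "b = (G, transition Xt F G \<xi>)"
            "F \<in> index_sets" "G \<in> index_sets" "F \<subseteq> G" "\<xi> \<in> S F"
          using ab_R unfolding R_def by blast
        then show ?thesis
          using transition_in transition_id by (auto simp: rel1_def colim_carrier intro!: bexI[of _ G])
      qed
      have "r \<in> colim_carrier Xt \<and> rel1 q r" using step(2) R[of q r] R[of r q] by blast
      then show ?case using rel1_trans[OF p] step(3) by blast
    qed
    then show "rel1 p q" by simp
  next
    assume pq: "rel1 p q"
    obtain F \<xi> G \<eta> where e: "p = (F, \<xi>)" "q = (G, \<eta>)" by (metis surj_pair)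
    have i: "F \<in> index_sets" "\<xi> \<in> S F" "G \<in> index_sets" "\<eta> \<in> S G" using p q by (auto simp: e colim_carrier)
    obtain H where H: "H \<in> index_sets" "F \<subseteq> H" "G \<subseteq> H" "transition Xt F H \<xi> = transition Xt G H \<eta>"
      using pq by (auto simp: rel1_def e)
    have "(p, (H, transition Xt F H \<xi>)) \<in> R" using i H unfolding R_def e by blast
    moreover have "(q, (H, transition Xt F H \<xi>)) \<in> R" using i H unfolding R_def e by auto
    ultimately have "(p, q) \<in> (R \<union> R\<inverse>)\<^sup>*"
      by (meson UnI1 UnI2 converseI converse_rtrancl_into_rtrancl rtrancl.rtrancl_refl)
    then show "(p, q) \<in> colim_rel Xt" using p q by (simp add: colim_rel)
  }
qed

end

lemma equiv_equiv_closure: "equiv A (equiv_closure_on A r)"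
  unfolding equiv_closure_on_def
proof (rule equivI)
  show "(r \<union> r\<inverse>)\<^sup>* \<inter> A \<times> A \<subseteq> A \<times> A" by blast
  show "refl_on A ((r \<union> r\<inverse>)\<^sup>* \<inter> A \<times> A)" by (auto simp: refl_on_def)
  show "sym ((r \<union> r\<inverse>)\<^sup>* \<inter> A \<times> A)"
    using sym_rtrancl[OF sym_Un_converse[of r]] by (auto simp: sym_def)
  show "trans ((r \<union> r\<inverse>)\<^sup>* \<inter> A \<times> A)" by (auto simp: trans_def)
qed

context dihedral
begin

lemma equiv_colim: "equiv (colim_carrier Xt) (colim_rel Xt)"
  unfolding colim_rel_def by (rule equiv_equiv_closure)

lemma in_colim_eq_iff:
  assumes "F \<in> index_sets" "\<xi> \<in> S F" "G \<in> index_sets" "\<eta> \<in> S G"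
  shows "in_colim Xt F \<xi> = in_colim Xt G \<eta> \<longleftrightarrow>
    (\<exists>H\<in>index_sets. F \<subseteq> H \<and> G \<subseteq> H \<and> transition Xt F H \<xi> = transition Xt G H \<eta>)"
proof -
  have "in_colim Xt F \<xi> = in_colim Xt G \<eta> \<longleftrightarrow> ((F, \<xi>), (G, \<eta>)) \<in> colim_rel Xt"
    unfolding in_colim_def using eq_equiv_class_iff[OF equiv_colim] assms by (simp add: colim_carrier)
  then show ?thesis using colim_rel_iff assms by (simp add: colim_carrier rel1_def)
qed

lemma in_colim_transition:
  assumes "F \<in> index_sets" "\<xi> \<in> S F" "G \<in> index_sets" "F \<subseteq> G"
  shows "in_colim Xt G (transition Xt F G \<xi>) = in_colim Xt F \<xi>"
  using assms by (subst in_colim_eq_iff) (auto simp: transition_in transition_id intro!: bexI[of _ G])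

lemma in_colim_in: "F \<in> index_sets \<Longrightarrow> \<xi> \<in> S F \<Longrightarrow> in_colim Xt F \<xi> \<in> colim Xt"
  unfolding in_colim_def colim_def by (rule quotientI) (simp add: colim_carrier)

lemma colimE:
  assumes "c \<in> colim Xt" obtains F \<xi> where "F \<in> index_sets" "\<xi> \<in> S F" "c = in_colim Xt F \<xi>"
  using assms unfolding colim_def quotient_def in_colim_def by (auto simp: colim_carrier_def)

subsection \<open>The canonical map\<close>

lemma ncyc_big: "ncyc n \<in> DeltaD_big" by (rule ncyc_in_DeltaD_big)

text \<open>Unrolling is induced by the identity and cancels against the definition of the canonical map; what
  remains is the numbering of the arcs.\<close>

lemma canonical_rep_eq:
  assumes z: "z \<in> standard_simplex n" and \<xi>: "\<xi> \<in> Set_at X (ncyc n)"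
  shows "canonical_rep Xt (n, \<xi>, z) =
      in_colim Xt (proj ` cuts n z) (pull Xt True (pi0_cover (proj ` cuts n z)) (ncyc_cover n) (config_map n z) \<xi>)"
    and "proj ` cuts n z \<in> index_sets"
    and "pull Xt True (pi0_cover (proj ` cuts n z)) (ncyc_cover n) (config_map n z) \<xi> \<in> S (proj ` cuts n z)"
proof -
  interpret config n z by unfold_locales fact
  have big: "pi0 P \<in> DeltaD_big" "interval_cyc (cuts n z) \<in> DeltaD_big"
    using pi0_big[OF P_in_index] interval_cyc_big by auto
  have \<xi>': "\<xi> \<in> Set_at Xt (Cat (ncyc_cover n))" using \<xi> Set_ncyc by simp
  have equivariant: "equivariant True interval_cover (ncyc_cover n) (config_map n z)"
    using equivariant_comp[OF equivariant_unroll(1) equivariant_config_map] by simp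
  have "pull Xt True (pi0_cover P) interval_cover (\<lambda>x. x) (pull Xt True interval_cover (ncyc_cover n) (config_map n z) \<xi>)
      = pull Xt True (pi0_cover P) (ncyc_cover n) (config_map n z) \<xi>"
    using pull_comp[OF equivariant_unroll(2) equivariant _ _ _ \<xi>'] big ncyc_big by simp
  then show "canonical_rep Xt (n, \<xi>, z) = in_colim Xt P (pull Xt True (pi0_cover P) (ncyc_cover n) (config_map n z) \<xi>)"
    by (simp add: Let_def dinv_unroll cut_index_eq_functor_of pull_def)
  show "P \<in> index_sets" by (rule P_in_index)
  show "pull Xt True (pi0_cover P) (ncyc_cover n) (config_map n z) \<xi> \<in> S P"
    using pull_in[OF equivariant_config_map _ _ \<xi>'] big ncyc_big by simp
qed

lemma simplicial_op_eq_pull: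
  assumes \<theta>: "\<theta> \<in> {..m} \<rightarrow> {..n}" "mono_on {..m} \<theta>" and x: "x \<in> Set_at X (ncyc n)"
  shows "simplicial_op X m n \<theta> x = pull Xt True (ncyc_cover m) (ncyc_cover n) (\<lambda>x. tick n (periodic_extension m n \<theta> (slot m x))) x"
    and "simplicial_op X m n \<theta> x \<in> Set_at X (ncyc m)"
proof -
  have "functor_of True (ncyc_cover m) (ncyc_cover n) (\<lambda>x. tick n (periodic_extension m n \<theta> (slot m x))) \<in> dhom (ncyc m) (ncyc n)"
    using functor_of_in_dhom[OF simplicial_op_functor_of(1)[OF \<theta>]] by simp
  then show "simplicial_op X m n \<theta> x = pull Xt True (ncyc_cover m) (ncyc_cover n) (\<lambda>x. tick n (periodic_extension m n \<theta> (slot m x))) x"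
    unfolding simplicial_op_def pull_def simplicial_op_functor_of(2)[OF \<theta>] ncyc_cover_simps
    using extension ncyc_Delta x unfolding dihedral_extension_def by metis
  then show "simplicial_op X m n \<theta> x \<in> Set_at X (ncyc m)"
    using pull_in[OF simplicial_op_functor_of(1)[OF \<theta>]] x ncyc_big by (simp add: Set_ncyc)
qed

text \<open>A degeneracy or face only relabels the components, so it can be moved across the colimit.\<close>

lemma canonical_rep_glue:
  assumes \<theta>: "\<theta> \<in> {..m} \<rightarrow> {..n}" "mono_on {..m} \<theta>"
    and x: "x \<in> Set_at X (ncyc n)" and z: "z \<in> standard_simplex m"
  shows "canonical_rep Xt (n, x, simplex_map m \<theta> z) = canonical_rep Xt (m, simplicial_op X m n \<theta> x, z)"
proof -
  let ?w = "simplex_map m \<theta> z"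
  let ?P = "proj ` cuts m z" and ?Q = "proj ` cuts n ?w"
  let ?t = "\<lambda>x. tick n (periodic_extension m n \<theta> (slot m x))"
  have w: "?w \<in> standard_simplex n" using simplex_map_in \<theta> z by blast
  interpret m: config m z by unfold_locales fact
  interpret n: config n ?w by unfold_locales fact
  note w_rep = canonical_rep_eq[OF w x]
  have sub: "?Q \<subseteq> ?P" using cuts_simplex_map[OF \<theta>] by blast
  have x': "x \<in> Set_at Xt (Cat (ncyc_cover n))" using x Set_ncyc by simp
  have big: "pi0 ?P \<in> DeltaD_big" "pi0 ?Q \<in> DeltaD_big" using pi0_big m.P_in_index n.P_in_index by auto
  have "canonical_rep Xt (n, x, ?w) = in_colim Xt ?P (transition Xt ?Q ?P (pull Xt True (pi0_cover ?Q) (ncyc_cover n) (config_map n ?w) x))"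
    using w_rep in_colim_transition[OF w_rep(2,3) m.P_in_index sub] by simp
  also have "transition Xt ?Q ?P (pull Xt True (pi0_cover ?Q) (ncyc_cover n) (config_map n ?w) x) = pull Xt True (pi0_cover ?P) (ncyc_cover n) (config_map n ?w) x"
    using pull_comp[OF equivariant_forget[OF n.P_in_index m.P_in_index sub] n.equivariant_config_map _ _ _ x'] big ncyc_big
    by (simp add: transition_eq[OF n.P_in_index m.P_in_index sub])
  also have "config_map n ?w = (\<lambda>x. ?t (config_map m z x))"
    by (simp add: fun_eq_iff config_map_def idx_simplex_map[OF \<theta> z])
  also have "pull Xt True (pi0_cover ?P) (ncyc_cover n) (\<lambda>x. ?t (config_map m z x)) x = pull Xt True (pi0_cover ?P) (ncyc_cover m) (config_map m z) (simplicial_op X m n \<theta> x)"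
    using pull_comp[OF m.equivariant_config_map simplicial_op_functor_of(1)[OF \<theta>] _ _ _ x'] big ncyc_big
    by (simp add: simplicial_op_eq_pull(1)[OF \<theta> x])
  also have "in_colim Xt ?P \<dots> = canonical_rep Xt (m, simplicial_op X m n \<theta> x, z)"
    using canonical_rep_eq(1)[OF z simplicial_op_eq_pull(2)[OF \<theta> x]] by simp
  finally show ?thesis .
qed

lemma topspace_cells: "(n, x, z) \<in> topspace (cells X) \<longleftrightarrow> x \<in> Set_at X (ncyc n) \<and> z \<in> standard_simplex n"
  by (simp add: cells_def)

lemma equiv_glue: "equiv (topspace (cells X)) (glue X)"
  unfolding glue_def by (rule equiv_equiv_closure)

lemma glueI:
  assumes "\<theta> \<in> {..m} \<rightarrow> {..n}" "mono_on {..m} \<theta>" "x \<in> Set_at X (ncyc n)" "z \<in> standard_simplex m"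
  shows "((n, x, simplex_map m \<theta> z), (m, simplicial_op X m n \<theta> x, z)) \<in> glue X"
proof -
  have "(n, x, simplex_map m \<theta> z) \<in> topspace (cells X)" "(m, simplicial_op X m n \<theta> x, z) \<in> topspace (cells X)"
    using assms simplex_map_in simplicial_op_eq_pull(2) by (simp_all add: topspace_cells)
  then show ?thesis
    unfolding glue_def equiv_closure_on_def using assms by (blast intro: r_into_rtrancl)
qed

lemma respects: "canonical_rep Xt respects glue X"
proof (rule congruentI)
  fix p q assume "(p, q) \<in> glue X"
  then have "(p, q) \<in> ({((n, x, simplex_map m \<theta> z), (m, simplicial_op X m n \<theta> x, z)) | m n \<theta> x z.
        \<theta> \<in> {..m} \<rightarrow> {..n} \<and> mono_on {..m} \<theta> \<and> x \<in> Set_at X (ncyc n) \<and> z \<in> standard_simplex m} \<union>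
      {((n, x, simplex_map m \<theta> z), (m, simplicial_op X m n \<theta> x, z)) | m n \<theta> x z.
        \<theta> \<in> {..m} \<rightarrow> {..n} \<and> mono_on {..m} \<theta> \<and> x \<in> Set_at X (ncyc n) \<and> z \<in> standard_simplex m}\<inverse>)\<^sup>*"
    unfolding glue_def equiv_closure_on_def by blast
  then show "canonical_rep Xt p = canonical_rep Xt q"
  proof (induction rule: rtrancl_induct)
    case (step q r)
    have "canonical_rep Xt q = canonical_rep Xt r"
      using step(2) by (elim UnE converseE CollectE exE conjE; elim Pair_inject; simp only: canonical_rep_glue)
    then show ?case using step by simp
  qed simp
qed

text \<open>Each arc of a configuration of distinct points lies in one arc of any configuration whose points it
  contains, and the lengths of the coarse arcs are sums of lengths of fine ones.\<close>

lemma refine_config: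
  assumes u: "pos_config k u" and z: "z \<in> standard_simplex n"
    and sub: "proj ` cuts n z \<subseteq> proj ` cuts k u"
  obtains \<theta> where "\<theta> \<in> {..k} \<rightarrow> {..n}" "mono_on {..k} \<theta>" "simplex_map k \<theta> u = z"
proof -
  interpret u: pos_config k u by fact
  interpret z: config n z by unfold_locales fact
  \<comment> \<open>Each arc of the fine configuration lies in one arc of the coarse one, which is found by its midpoint.\<close>
  define \<theta> where "\<theta> r = nat (idx n z (mid k u (int r)))" for r
  have bounds: "0 \<le> idx n z (mid k u (int r))" "idx n z (mid k u (int r)) \<le> int n" if "r \<le> k" for r
  proof -
    have "xcut k u 0 \<le> xcut k u (int r)" "xcut k u (int r + 1) \<le> xcut k u (int (Suc k))"
      using that by (intro u.xcut_mono; simp)+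
    then have "0 \<le> mid k u (int r)" "mid k u (int r) < 1"
      using u.mid_bounds[of "int r"] u.xcut_small[of 0] u.xcut_small[of "Suc k"] u.cut_last by auto
    then show "0 \<le> idx n z (mid k u (int r))" "idx n z (mid k u (int r)) \<le> int n"
      using z.idx_galois[of 0 "mid k u (int r)"] z.idx_galois[of "int (Suc n)" "mid k u (int r)"]
        z.xcut_small[of 0] z.xcut_small[of "Suc n"] z.cut_last by auto
  qed
  have \<theta>1: "\<theta> \<in> {..k} \<rightarrow> {..n}" using bounds by (auto simp: \<theta>_def nat_le_iff)
  have "\<theta> r \<le> \<theta> s" if "r \<le> s" for r s
  proof -
    have "mid k u (int r) \<le> mid k u (int s)" using u.mid_less[of "int r" "int s"] that by (cases "r = s") auto
    then show ?thesis unfolding \<theta>_def using z.idx_mono nat_mono by blast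
  qed
  then have \<theta>2: "mono_on {..k} \<theta>" by (simp add: mono_on_def)
  have cut_eq: "cut (simplex_map k \<theta> u) j = cut z j" if "j \<le> Suc n" for j
  proof -
    have "proj (cut z j) \<in> proj ` cuts k u" using sub that by (auto simp: cuts_def)
    then have "cut z j \<in> cuts k u" using u.proj_in_P_iff z.cut_range[OF that] by blast
    then obtain l where l: "l \<le> Suc k" "cut z j = cut u l" by (auto simp: cuts_def)
    have "\<theta> i < j \<longleftrightarrow> i < l" if "i \<le> k" for i
    proof -
      have "\<theta> i < j \<longleftrightarrow> \<not> int j \<le> idx n z (mid k u (int i))" using bounds(1)[OF that] by (auto simp: \<theta>_def)
      also have "\<dots> \<longleftrightarrow> mid k u (int i) < cut u l"
        using z.idx_galois[of "int j"] z.xcut_small[OF \<open>j \<le> Suc n\<close>] l by (simp add: not_le)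
      also have "\<dots> \<longleftrightarrow> i < l"
      proof -
        have "int l \<le> int i \<longleftrightarrow> xcut k u (int l) \<le> mid k u (int i)"
          using u.idx_galois[of "int l" "mid k u (int i)"] by (simp only: u.idx_mid)
        then show ?thesis using u.xcut_small[OF l(1)] by linarith
      qed
      finally show ?thesis .
    qed
    then have "cut (simplex_map k \<theta> u) j = cut u l" by (rule cut_simplex_map_initial[OF \<theta>1 l(1)])
    then show ?thesis using l by simp
  qed
  interpret w: config n "simplex_map k \<theta> u" by unfold_locales (rule simplex_map_in[OF \<theta>1 u.z])
  have "simplex_map k \<theta> u j = z j" for j
  proof (cases "j \<le> n")
    case True
    then show ?thesis
      using cut_eq[of j] cut_eq[of "Suc j"] cut_Suc[of z j] cut_Suc[of "simplex_map k \<theta> u" j] by simp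
  next
    case False
    then show ?thesis using w.z z.z by (simp add: standard_simplex_def)
  qed
  then show ?thesis using that \<theta>1 \<theta>2 by blast
qed

text \<open>Elements with equal images agree over a finite set \<open>H\<close>. Both simplices are glued to simplices over \<open>H\<close>,
  and these are equal because the numbering of the arcs of \<open>H\<close> is an isomorphism.\<close>

lemma canonical_rep_eq_imp_glue:
  assumes p: "(n, x, z) \<in> topspace (cells X)" and q: "(m, y, w) \<in> topspace (cells X)"
    and eq: "canonical_rep Xt (n, x, z) = canonical_rep Xt (m, y, w)"
  shows "((n, x, z), (m, y, w)) \<in> glue X"
proof -
  have x: "x \<in> Set_at X (ncyc n)" "z \<in> standard_simplex n" and y: "y \<in> Set_at X (ncyc m)" "w \<in> standard_simplex m"
    using p q by (simp_all add: topspace_cells)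
  let ?P = "proj ` cuts n z" and ?Q = "proj ` cuts m w"
  note rx = canonical_rep_eq[OF x(2,1)] and ry = canonical_rep_eq[OF y(2,1)]
  obtain H where H: "H \<in> index_sets" "?P \<subseteq> H" "?Q \<subseteq> H"
    "transition Xt ?P H (pull Xt True (pi0_cover ?P) (ncyc_cover n) (config_map n z) x)
      = transition Xt ?Q H (pull Xt True (pi0_cover ?Q) (ncyc_cover m) (config_map m w) y)"
    using eq rx ry in_colim_eq_iff[OF rx(2,3) ry(2,3)] by auto
  have "0 \<in> cuts n z" unfolding cuts_def by (rule image_eqI[of _ _ 0]) simp_all
  then have "proj 0 \<in> H" using H(2) by blast
  then obtain k u where u: "pos_config k u" and Hu: "proj ` cuts k u = H"
    using enumerate_circle[of H] H(1) by (auto simp: index_sets_def)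
  interpret u: pos_config k u by fact
  have key: "\<exists>\<theta>. \<theta> \<in> {..k} \<rightarrow> {..n} \<and> mono_on {..k} \<theta> \<and> simplex_map k \<theta> u = z \<and>
      transition Xt (proj ` cuts n z) H (pull Xt True (pi0_cover (proj ` cuts n z)) (ncyc_cover n) (config_map n z) x)
      = pull Xt True (pi0_cover H) (ncyc_cover k) (config_map k u) (simplicial_op X k n \<theta> x)"
    if x: "x \<in> Set_at X (ncyc n)" "z \<in> standard_simplex n" and sub: "proj ` cuts n z \<subseteq> H" for n x z
  proof -
    let ?P = "proj ` cuts n z"
    interpret z: config n z by unfold_locales fact
    obtain \<theta> where \<theta>: "\<theta> \<in> {..k} \<rightarrow> {..n}" "mono_on {..k} \<theta>" "simplex_map k \<theta> u = z"
      using refine_config[OF u x(2)] sub Hu by blast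
    have x': "x \<in> Set_at Xt (Cat (ncyc_cover n))" using x Set_ncyc by simp
    have big: "pi0 ?P \<in> DeltaD_big" "pi0 H \<in> DeltaD_big" using pi0_big z.P_in_index H by auto
    have c: "config_map n z = (\<lambda>x. tick n (periodic_extension k n \<theta> (slot k (config_map k u x))))"
      using idx_simplex_map[OF \<theta>(1,2) u.z] \<theta>(3) by (simp add: fun_eq_iff config_map_def)
    have "transition Xt ?P H (pull Xt True (pi0_cover ?P) (ncyc_cover n) (config_map n z) x) = pull Xt True (pi0_cover H) (ncyc_cover n) (config_map n z) x"
      using pull_comp[OF equivariant_forget[OF z.P_in_index H(1) sub] z.equivariant_config_map _ _ _ x'] big ncyc_big
      by (simp add: transition_eq[OF z.P_in_index H(1) sub])
    also have "\<dots> = pull Xt True (pi0_cover H) (ncyc_cover k) (config_map k u) (simplicial_op X k n \<theta> x)"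
      unfolding c
      using pull_comp[OF u.equivariant_config_map[unfolded Hu] simplicial_op_functor_of(1)[OF \<theta>(1,2)] _ _ _ x'] big ncyc_big
      by (simp add: simplicial_op_eq_pull(1)[OF \<theta>(1,2) x(1)])
    finally show ?thesis using \<theta> by (intro exI[of _ \<theta>] conjI)
  qed
  obtain \<theta> where \<theta>: "\<theta> \<in> {..k} \<rightarrow> {..n}" "mono_on {..k} \<theta>" "simplex_map k \<theta> u = z"
      "transition Xt ?P H (pull Xt True (pi0_cover ?P) (ncyc_cover n) (config_map n z) x)
      = pull Xt True (pi0_cover H) (ncyc_cover k) (config_map k u) (simplicial_op X k n \<theta> x)"
    using key[OF x H(2)] by blast
  obtain \<eta> where \<eta>: "\<eta> \<in> {..k} \<rightarrow> {..m}" "mono_on {..k} \<eta>" "simplex_map k \<eta> u = w"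
      "transition Xt ?Q H (pull Xt True (pi0_cover ?Q) (ncyc_cover m) (config_map m w) y)
      = pull Xt True (pi0_cover H) (ncyc_cover k) (config_map k u) (simplicial_op X k m \<eta> y)"
    using key[OF y H(3)] by blast
  have inj: "pull Xt True (ncyc_cover k) (pi0_cover H) (\<lambda>x. mid k u (slot k x)) (pull Xt True (pi0_cover H) (ncyc_cover k) (config_map k u) a) = a"
    if "a \<in> Set_at X (ncyc k)" for a
  proof -
    have a: "a \<in> Set_at Xt (Cat (ncyc_cover k))" using that Set_ncyc by simp
    have "pull Xt True (ncyc_cover k) (pi0_cover H) (\<lambda>x. mid k u (slot k x)) (pull Xt True (pi0_cover H) (ncyc_cover k) (config_map k u) a)
        = pull Xt True (ncyc_cover k) (ncyc_cover k) (\<lambda>x. config_map k u (mid k u (slot k x))) a"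
      using pull_comp[OF u.equivariant_mid[unfolded Hu] u.equivariant_config_map[unfolded Hu] _ _ _ a] pi0_big[OF H(1)] ncyc_big by simp
    also have "\<dots> = a"
      by (rule pull_id[OF is_cover_ncyc]) (use a ncyc_big u.config_map_mid in simp_all)
    finally show ?thesis .
  qed
  have "pull Xt True (pi0_cover H) (ncyc_cover k) (config_map k u) (simplicial_op X k n \<theta> x)
      = pull Xt True (pi0_cover H) (ncyc_cover k) (config_map k u) (simplicial_op X k m \<eta> y)"
    using H(4) \<theta>(4) \<eta>(4) by simp
  then have "simplicial_op X k n \<theta> x = simplicial_op X k m \<eta> y"
    using inj simplicial_op_eq_pull(2)[OF \<theta>(1,2) x(1)] simplicial_op_eq_pull(2)[OF \<eta>(1,2) y(1)] by metis
  moreover have "((n, x, z), (k, simplicial_op X k n \<theta> x, u)) \<in> glue X"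
    using glueI[OF \<theta>(1,2) x(1) u.z] \<theta>(3) by simp
  moreover have "((m, y, w), (k, simplicial_op X k m \<eta> y, u)) \<in> glue X"
    using glueI[OF \<eta>(1,2) y(1) u.z] \<eta>(3) by simp
  ultimately show ?thesis using equiv_glue by (metis equivE symD transD)
qed

end

text \<open>Taking preimages commutes with unions and intersections, so the sets in the definition form a
  topology.\<close>

lemma
  assumes r: "equiv (topspace T) r"
  shows topspace_quotient_topology: "topspace (quotient_topology T r) = topspace T // r"
    and quotient_map_quotient_topology: "quotient_map T (quotient_topology T r) (\<lambda>x. r `` {x})"
proof -
  let ?f = "\<lambda>x. r `` {x}"
  let ?O = "\<lambda>U. U \<subseteq> topspace T // r \<and> openin T {x \<in> topspace T. ?f x \<in> U}"
  have "istopology ?O"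
    unfolding istopology_def
  proof (rule conjI; intro allI impI)
    fix U V assume U: "?O U" and V: "?O V"
    have eq: "{x \<in> topspace T. ?f x \<in> U \<inter> V} = {x \<in> topspace T. ?f x \<in> U} \<inter> {x \<in> topspace T. ?f x \<in> V}" by auto
    show "?O (U \<inter> V)"
    proof (rule conjI)
      show "U \<inter> V \<subseteq> topspace T // r" using U by blast
      show "openin T {x \<in> topspace T. ?f x \<in> U \<inter> V}" unfolding eq using U V by (intro openin_Int) simp_all
    qed
  next
    fix \<K> assume K: "\<forall>U\<in>\<K>. ?O U"
    have "{x \<in> topspace T. ?f x \<in> \<Union>\<K>} = \<Union>((\<lambda>U. {x \<in> topspace T. ?f x \<in> U}) ` \<K>)" by auto
    moreover have "openin T \<dots>" using K by (intro openin_Union) auto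
    ultimately have "openin T {x \<in> topspace T. ?f x \<in> \<Union>\<K>}" by simp
    then show "?O (\<Union>\<K>)" using K by blast
  qed
  then have op: "openin (quotient_topology T r) U \<longleftrightarrow> ?O U" for U
    by (simp add: quotient_topology_def topology_inverse')
  have im: "?f ` topspace T = topspace T // r" by (auto simp: quotient_def)
  have "?O (topspace T // r)"
  proof -
    have "{x \<in> topspace T. ?f x \<in> topspace T // r} = topspace T" by (auto intro: quotientI)
    then show ?thesis by simp
  qed
  then have "openin (quotient_topology T r) (topspace T // r)" using op by blast
  moreover have "openin (quotient_topology T r) U \<Longrightarrow> U \<subseteq> topspace T // r" for U using op by blast
  ultimately show top: "topspace (quotient_topology T r) = topspace T // r"
    by (metis openin_subset openin_topspace subset_antisym)
  show "quotient_map T (quotient_topology T r) ?f"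
    unfolding quotient_map_def top using im op by blast
qed

context dihedral
begin

lemma topspace_realization: "topspace (realization X) = topspace (cells X) // glue X"
  unfolding realization_def by (rule topspace_quotient_topology[OF equiv_glue])

definition cls :: "nat \<times> 'x \<times> (nat \<Rightarrow> real) \<Rightarrow> (nat \<times> 'x \<times> (nat \<Rightarrow> real)) set" where
  "cls p = glue X `` {p}"

lemma quotient_map_cls: "quotient_map (cells X) (realization X) cls"
  unfolding realization_def cls_def using quotient_map_quotient_topology[OF equiv_glue] .

lemma cls_in: "p \<in> topspace (cells X) \<Longrightarrow> cls p \<in> topspace (realization X)"
  unfolding topspace_realization cls_def by (rule quotientI)

lemma realizationE:
  assumes "c \<in> topspace (realization X)" obtains n x z where "(n, x, z) \<in> topspace (cells X)" "c = cls (n, x, z)"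
  using assms unfolding topspace_realization quotient_def cls_def by auto

lemma canonical_map_cls:
  assumes "p \<in> topspace (cells X)" shows "canonical_map Xt (cls p) = canonical_rep Xt p"
proof -
  have "canonical_rep Xt q = canonical_rep Xt p" if "q \<in> cls p" for q
    using respects that unfolding cls_def congruent_def by force
  moreover have "p \<in> cls p" unfolding cls_def using assms equiv_glue by (metis equiv_class_self)
  ultimately have "canonical_rep Xt ` cls p = {canonical_rep Xt p}"
    using image_cong[OF refl, of "cls p" "canonical_rep Xt" "\<lambda>_. canonical_rep Xt p"] image_constant by metis
  then show ?thesis by (simp add: canonical_map_def)
qed

lemma canonical_bij: "bij_betw (canonical_map Xt) (topspace (realization X)) (colim Xt)"
  unfolding bij_betw_def
proof
  show "inj_on (canonical_map Xt) (topspace (realization X))"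
  proof (rule inj_onI)
    fix c d assume "c \<in> topspace (realization X)" "d \<in> topspace (realization X)"
      and eq: "canonical_map Xt c = canonical_map Xt d"
    then obtain n x z m y w where c: "(n, x, z) \<in> topspace (cells X)" "c = cls (n, x, z)"
      and d: "(m, y, w) \<in> topspace (cells X)" "d = cls (m, y, w)"
      using realizationE by metis
    then have "((n, x, z), (m, y, w)) \<in> glue X"
      using eq by (intro canonical_rep_eq_imp_glue) (simp_all only: canonical_map_cls)
    then show "c = d" using c d equiv_class_eq[OF equiv_glue] unfolding cls_def by blast
  qed
  show "canonical_map Xt ` topspace (realization X) = colim Xt"
  proof
    show "canonical_map Xt ` topspace (realization X) \<subseteq> colim Xt"
    proof
      fix e assume "e \<in> canonical_map Xt ` topspace (realization X)"
      then obtain c where c: "c \<in> topspace (realization X)" "e = canonical_map Xt c" by blast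
      obtain n x z where nxz: "(n, x, z) \<in> topspace (cells X)" "c = cls (n, x, z)"
        using realizationE[OF c(1)] by blast
      have p: "(n, x, z) \<in> topspace (cells X)" "e = canonical_rep Xt (n, x, z)"
        using c nxz canonical_map_cls by simp_all
      then have xz: "x \<in> Set_at X (ncyc n)" "z \<in> standard_simplex n" by (simp_all add: topspace_cells)
      show "e \<in> colim Xt"
        unfolding p(2) canonical_rep_eq(1)[OF xz(2,1)]
        by (rule in_colim_in[OF canonical_rep_eq(2,3)[OF xz(2,1)]])
    qed
    show "colim Xt \<subseteq> canonical_map Xt ` topspace (realization X)"
    proof
      fix e assume "e \<in> colim Xt"
      then obtain F \<xi> where F: "F \<in> index_sets" "\<xi> \<in> S F" "e = in_colim Xt F \<xi>"
        using colimE by metis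
      define G where "G = insert (proj 0) F"
      have G: "G \<in> index_sets" "F \<subseteq> G" "proj 0 \<in> G" using F by (auto simp: G_def index_sets_def)
      define \<eta> where "\<eta> = transition Xt F G \<xi>"
      have \<eta>: "\<eta> \<in> S G" "e = in_colim Xt G \<eta>"
        using transition_in[OF F(1) G(1,2) F(2)] in_colim_transition[OF F(1,2) G(1,2)] F(3) by (simp_all add: \<eta>_def)
      obtain n z where nz: "pos_config n z" and Gz: "proj ` cuts n z = G"
        using enumerate_circle[of G] G by (auto simp: index_sets_def)
      interpret pos_config n z by fact
      define x where "x = pull Xt True (ncyc_cover n) (pi0_cover G) (\<lambda>x. mid n z (slot n x)) \<eta>"
      have x: "x \<in> Set_at X (ncyc n)"
        unfolding x_def using pull_in[OF equivariant_mid[unfolded Gz]] \<eta> pi0_big[OF G(1)] ncyc_big by (simp add: Set_ncyc)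
      have "pull Xt True (pi0_cover G) (ncyc_cover n) (config_map n z) x = pull Xt True (pi0_cover G) (pi0_cover G) (\<lambda>x. mid n z (slot n (config_map n z x))) \<eta>"
        unfolding x_def using pull_comp[OF equivariant_config_map[unfolded Gz] equivariant_mid[unfolded Gz]] \<eta> pi0_big[OF G(1)] ncyc_big by simp
      also have "\<dots> = \<eta>"
      proof (rule pull_id[OF cover_pi0[OF G(1)]])
        show "mid n z (slot n (config_map n z y)) \<in> Pts (pi0_cover G) \<and> eqv (pi0_cover G) y (mid n z (slot n (config_map n z y)))"
          if "y \<in> Pts (pi0_cover G)" for y
        proof -
          have s: "same G (mid n z (slot n (config_map n z y))) y" using mid_config_map[unfolded Gz] that by simp
          then show ?thesis using same_notin[OF s] same_sym[OF s] by simp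
        qed
      qed (use \<eta> pi0_big[OF G(1)] in simp_all)
      finally have "canonical_rep Xt (n, x, z) = e" using canonical_rep_eq(1)[OF z x] Gz \<eta>(2) by simp
      moreover have "(n, x, z) \<in> topspace (cells X)" using x z by (simp add: topspace_cells)
      ultimately show "e \<in> canonical_map Xt ` topspace (realization X)"
        using canonical_map_cls cls_in by (metis image_eqI)
    qed
  qed
qed

end

section \<open>Homeomorphisms of the circle\<close>

definition homeo_lift :: "bool \<Rightarrow> (circle \<Rightarrow> circle) \<Rightarrow> (real \<Rightarrow> real) \<Rightarrow> (real \<Rightarrow> real) \<Rightarrow> bool" where
  "homeo_lift v \<alpha> a b \<longleftrightarrow> continuous_on UNIV a \<and> continuous_on UNIV b \<and>
     (\<forall>x. \<alpha> (proj x) = proj (a x)) \<and> (\<forall>x. b (a x) = x) \<and> (\<forall>x. a (b x) = x) \<and>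
     (\<forall>x y. x < y \<longrightarrow> (if v then a x < a y else a y < a x)) \<and>
     (\<forall>x. a (x + 1) = a x + of_int (sg v))"

lemma add_int_periodic:
  fixes f :: "real \<Rightarrow> real"
  assumes "\<And>x. f (x + 1) = f x + c"
  shows "f (x + of_int k) = f x + of_int k * c"
proof (induction k arbitrary: x rule: int_induct[where k = 0])
  case (step1 i)
  then show ?case using assms[of "x + of_int i"] by (simp add: algebra_simps)
next
  case (step2 i)
  then show ?case using assms[of "x + of_int (i - 1)"] step2(2)[of x] by (simp add: algebra_simps)
qed simp

lemma lift_translation:
  fixes a :: "real \<Rightarrow> real"
  assumes a: "continuous_on UNIV a" and p: "\<And>x. proj (a (x + 1)) = proj (a x)"
  obtains d :: int where "\<And>x. a (x + 1) = a x + of_int d"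
proof -
  have "continuous_on UNIV (\<lambda>x. a (x + 1))"
    by (rule continuous_on_compose2[OF a]) (auto intro: continuous_intros)
  then show ?thesis using circle_lift_unique[OF a, of "\<lambda>x. a (x + 1)"] p that by auto
qed

text \<open>The degrees of a homeomorphism and of its inverse are integers with product one, and a
  continuous injective function on the line is monotone.\<close>

lemma homeo_lift_exists:
  assumes "\<alpha> \<in> homeos" obtains v a b where "homeo_lift v \<alpha> a b"
proof -
  obtain \<beta> where h: "homeomorphism UNIV UNIV \<alpha> \<beta>" using assms by (auto simp: homeos_def)
  then have c: "continuous_on UNIV \<alpha>" "continuous_on UNIV \<beta>" and inv: "\<And>x. \<beta> (\<alpha> x) = x" "\<And>x. \<alpha> (\<beta> x) = x"
    by (auto simp: homeomorphism_def)
  have "continuous_on UNIV (\<lambda>x. \<alpha> (proj x))"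
    by (rule continuous_on_compose2[OF c(1) continuous_on_proj[OF continuous_on_id]]) simp
  moreover have "continuous_on UNIV (\<lambda>x. \<beta> (proj x))"
    by (rule continuous_on_compose2[OF c(2) continuous_on_proj[OF continuous_on_id]]) simp
  ultimately obtain a b0 where a: "continuous_on UNIV a" "\<And>x. \<alpha> (proj x) = proj (a x)"
      and b0: "continuous_on UNIV b0" "\<And>x. \<beta> (proj x) = proj (b0 x)"
    using circle_lift[of UNIV "\<lambda>x. \<alpha> (proj x)"] circle_lift[of UNIV "\<lambda>x. \<beta> (proj x)"] by (metis UNIV_I convex_UNIV)
  have "continuous_on UNIV (\<lambda>x. b0 (a x))" by (rule continuous_on_compose2[OF b0(1) a(1)]) simp
  moreover have "proj x = proj (b0 (a x))" for x using inv(1)[of "proj x"] a(2) b0(2) by simp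
  ultimately obtain k :: int where k: "\<And>x. b0 (a x) = x + of_int k"
    using circle_lift_unique[of UNIV "\<lambda>x. x" "\<lambda>x. b0 (a x)"] by auto
  define b where "b x = b0 x + of_int (- k)" for x
  have b: "continuous_on UNIV b" "\<And>x. \<beta> (proj x) = proj (b x)"
    unfolding b_def[abs_def] proj_add_int using b0 by (auto intro: continuous_intros)
  have ba: "b (a x) = x" for x using k[of x] by (simp add: b_def)
  have ab: "a (b x) = x" for x
  proof -
    have "continuous_on UNIV (\<lambda>x. a (b x))" by (rule continuous_on_compose2[OF a(1) b(1)]) simp
    moreover have "proj x = proj (a (b x))" for x using inv(2)[of "proj x"] a(2) b(2) by simp
    ultimately obtain l :: int where l: "\<And>x. a (b x) = x + of_int l"
      using circle_lift_unique[of UNIV "\<lambda>x. x" "\<lambda>x. a (b x)"] by auto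
    have "a 0 = a 0 + of_int l" using l[of "a 0"] ba[of 0] by simp
    then show ?thesis using l[of x] by simp
  qed
  have "proj (a (x + 1)) = proj (a x)" "proj (b (x + 1)) = proj (b x)" for x
    using a(2)[of "x + 1"] a(2)[of x] b(2)[of "x + 1"] b(2)[of x] by simp_all
  then obtain d e :: int where d: "\<And>x. a (x + 1) = a x + of_int d" and e: "\<And>x. b (x + 1) = b x + of_int e"
    using lift_translation[OF a(1)] lift_translation[OF b(1)] by metis
  have "1 = b (a 0 + of_int d) - b (a 0)" using d[of 0] ba[of 1] ba[of 0] by simp
  also have "\<dots> = of_int (d * e)" using add_int_periodic[of b "of_int e", OF e, of "a 0" d] by simp
  finally have "d * e = 1" by (metis of_int_eq_1_iff)
  \<comment> \<open>The inverse lift undoes a translation, so the two degrees are inverse integers.\<close>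
  then have d1: "d = 1 \<or> d = - 1" using zmult_eq_1_iff by blast
  define v where "v = (d = 1)"
  have dv: "d = sg v" using d1 by (auto simp: v_def sg_def)
  have "if v then a x < a y else a y < a x" if xy: "x < y" for x y
  proof -
    \<comment> \<open>Three points at a distance of more than one turn show in which direction \<open>a\<close> is monotone, since \<open>a\<close> moves by \<open>d\<close> per turn.\<close>
    define m where "m = \<lceil>y - x\<rceil> + 1"
    have m: "y < x + of_int m" "0 < m" using xy by (auto simp: m_def) linarith+
    have "inj_on a {x..x + of_int m}" using ba by (metis inj_on_inverseI)
    moreover have "continuous_on {x..x + of_int m} a" using a(1) continuous_on_subset by blast
    ultimately have "a x < a y \<and> a y < a (x + of_int m) \<or> a (x + of_int m) < a y \<and> a y < a x"
      using continuous_inj_imp_mono[OF xy m(1)] by blast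
    moreover have "a (x + of_int m) = a x + of_int m * of_int d" using add_int_periodic[of a "of_int d", OF d] .
    ultimately show ?thesis using m(2) d1 by (auto simp: v_def)
  qed
  then have "homeo_lift v \<alpha> a b" unfolding homeo_lift_def using a b(1) ba ab d dv by simp
  then show ?thesis by (rule that)
qed

text \<open>All lifts differ by constants, so either every lift is increasing or none is.\<close>

lemma homeo_lift_orientation:
  assumes "homeo_lift v \<alpha> a b" shows "orientation_preserving \<alpha> = v"
proof
  assume "orientation_preserving \<alpha>"
  then obtain a' where a': "continuous_on UNIV a'" "strict_mono a'" "\<And>x. \<alpha> (proj x) = proj (a' x)"
    by (auto simp: orientation_preserving_def)
  obtain k :: int where k: "\<And>x. a' x = a x + of_int k"
    using circle_lift_unique[of UNIV a a'] assms a' by (auto simp: homeo_lift_def)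
  have "a' 0 < a' 1" using a'(2) by (simp add: strict_mono_def)
  then have "a 0 < a 1" using k by simp
  moreover have "a 1 = a 0 + of_int (sg v)" using assms unfolding homeo_lift_def by (metis add_0)
  ultimately show v by (auto simp: sg_def split: if_splits)
next
  assume v
  then show "orientation_preserving \<alpha>"
    using assms unfolding homeo_lift_def orientation_preserving_def strict_mono_def by auto
qed

lemma homeo_lift_sym:
  assumes "homeo_lift v \<alpha> a b"
  shows "x < y \<Longrightarrow> if v then b x < b y else b y < b x" "b (x + 1) = b x + of_int (sg v)"
proof -
  have ab: "a (b x) = x" "b (a x) = x" and lt: "x < y \<Longrightarrow> if v then a x < a y else a y < a x"
    and a1: "a (x + 1) = a x + of_int (sg v)" for x y
    using assms by (auto simp: homeo_lift_def)
  show "if v then b x < b y else b y < b x" if "x < y"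
  proof (rule ccontr)
    assume n: "\<not> ?thesis"
    have "b x \<noteq> b y" using ab(1) that by (metis order_less_irrefl)
    then have "if v then b y < b x else b x < b y" using n by (auto split: if_splits)
    then have "a (b y) < a (b x)" using lt[of "b y" "b x"] lt[of "b x" "b y"] by (auto split: if_splits)
    then show False using ab that by simp
  qed
  have "a (b x + of_int (sg v)) = a (b x) + of_int (sg v) * of_int (sg v)"
    using add_int_periodic[of a "of_int (sg v)", OF a1] .
  also have "\<dots> = x + 1" by (simp add: ab sg_def)
  finally show "b (x + 1) = b x + of_int (sg v)" using ab(2) by metis
qed

lemma homeo_inj: "homeo_lift v \<alpha> a b \<Longrightarrow> \<alpha> c \<in> \<alpha> ` F \<Longrightarrow> c \<in> F"
proof -
  assume h: "homeo_lift v \<alpha> a b" and "\<alpha> c \<in> \<alpha> ` F"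
  then obtain d where d: "d \<in> F" "\<alpha> d = \<alpha> c" by auto
  have functor_of: "\<alpha> (proj x) = proj (a x)" "b (a x) = x" for x using h by (auto simp: homeo_lift_def)
  have "proj (a (rep_circle d)) = proj (a (rep_circle c))" using functor_of(1)[of "rep_circle d"] functor_of(1)[of "rep_circle c"] d by simp
  then obtain k :: int where k: "a (rep_circle c) = a (rep_circle d) + of_int k" using proj_eqE by blast
  have "rep_circle c = b (a (rep_circle d) + of_int k)" using k functor_of(2) by metis
  also have "\<dots> = rep_circle d + of_int k * of_int (sg v)"
    using add_int_periodic[of b "of_int (sg v)", OF homeo_lift_sym(2)[OF h], of "a (rep_circle d)" k] functor_of(2) by simp
  finally have "rep_circle c = rep_circle d + of_int (k * sg v)" by simp
  then have "proj (rep_circle c) = proj (rep_circle d)" by (simp only: proj_add_int)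
  then show "c \<in> F" using d by simp
qed

lemma homeo_image_index: "F \<in> index_sets \<Longrightarrow> \<alpha> ` F \<in> index_sets"
  by (simp add: index_sets_def)

lemma
  assumes h: "homeo_lift v \<alpha> a b" and FI: "F \<in> index_sets"
  shows equivariant_homeo: "equivariant v (pi0_cover F) (pi0_cover (\<alpha> ` F)) a"
    and equivariant_homeo_inv: "equivariant v (pi0_cover (\<alpha> ` F)) (pi0_cover F) b"
proof -
  have ab: "continuous_on UNIV a" "continuous_on UNIV b" "\<And>x. \<alpha> (proj x) = proj (a x)"
      "\<And>x. a (b x) = x" "\<And>x y. x < y \<Longrightarrow> if v then a x < a y else a y < a x"
      "\<And>x. a (x + 1) = a x + of_int (sg v)"
    using h by (auto simp: homeo_lift_def)
  note I = homeo_image_index[OF FI, of \<alpha>]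
  have m: "if v then mono f else antimono f" if f: "\<And>x y. x < y \<Longrightarrow> if v then f x < f y else f y < f x"
    for f :: "real \<Rightarrow> real"
  proof -
    have "if v then f x \<le> f y else f y \<le> f x" if "x \<le> y" for x y
      using f[of x y] that by (cases "x = y") (auto split: if_splits)
    then show ?thesis by (cases v) (auto simp: mono_def antimono_def)
  qed
  show "equivariant v (pi0_cover F) (pi0_cover (\<alpha> ` F)) a"
  proof (rule equivariant_pi0[OF I FI ab(1) m ab(6)])
    show "proj (a x) \<notin> \<alpha> ` F" if "proj x \<notin> F" for x
      using homeo_inj[OF h, of "proj x" F] ab(3)[of x] that by auto
  qed (rule ab(5))
  show "equivariant v (pi0_cover (\<alpha> ` F)) (pi0_cover F) b"
  proof (rule equivariant_pi0[OF FI I ab(2) m homeo_lift_sym(2)[OF h]])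
    show "proj (b x) \<notin> F" if "proj x \<notin> \<alpha> ` F" for x
    proof
      assume "proj (b x) \<in> F"
      then have "\<alpha> (proj (b x)) \<in> \<alpha> ` F" by (rule imageI)
      then show False using that ab(3,4) by simp
    qed
  qed (rule homeo_lift_sym(1)[OF h])
qed

lemma dinv_homeo_pi0:
  assumes h: "homeo_lift v \<alpha> a b" and FI: "F \<in> index_sets"
  shows "dinv (pi0 F) (pi0 (\<alpha> ` F)) (homeo_pi0 \<alpha> F) = functor_of v (pi0_cover (\<alpha> ` F)) (pi0_cover F) b"
proof -
  have ab: "continuous_on UNIV a" "\<And>x. \<alpha> (proj x) = proj (a x)" "\<And>x. a (b x) = x" "\<And>x. b (a x) = x"
    using h by (auto simp: homeo_lift_def)
  have "homeo_pi0 \<alpha> F = functor_of v (pi0_cover F) (pi0_cover (\<alpha> ` F)) a"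
    using induced_eq_functor_of[OF homeo_image_index[OF FI] FI equivariant_homeo[OF h FI] ab(1,2)]
    by (simp add: homeo_pi0_def homeo_lift_orientation[OF h])
  moreover have "dinv (Cat (pi0_cover F)) (Cat (pi0_cover (\<alpha> ` F))) (functor_of v (pi0_cover F) (pi0_cover (\<alpha> ` F)) a) = functor_of v (pi0_cover (\<alpha> ` F)) (pi0_cover F) b"
    by (rule dinv_functor_of[OF equivariant_homeo[OF h FI] equivariant_homeo_inv[OF h FI]])
      (simp_all only: ab pi0_cover_simps eqv_pi0_cover same_refl mem_Collect_eq not_False_eq_True)
  ultimately show ?thesis by simp
qed

lemma homeo_lift_comp:
  assumes "homeo_lift v \<alpha> a b" "homeo_lift w \<beta> a' b'"
  shows "homeo_lift (v = w) (\<alpha> \<circ> \<beta>) (\<lambda>x. a (a' x)) (\<lambda>x. b' (b x))"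
proof -
  have 1: "continuous_on UNIV a" "continuous_on UNIV b" "\<And>x. \<alpha> (proj x) = proj (a x)"
      "\<And>x. b (a x) = x" "\<And>x. a (b x) = x" "\<And>x y. x < y \<Longrightarrow> if v then a x < a y else a y < a x"
      "\<And>x. a (x + 1) = a x + of_int (sg v)"
    using assms(1) by (auto simp: homeo_lift_def)
  have 2: "continuous_on UNIV a'" "continuous_on UNIV b'" "\<And>x. \<beta> (proj x) = proj (a' x)"
      "\<And>x. b' (a' x) = x" "\<And>x. a' (b' x) = x" "\<And>x y. x < y \<Longrightarrow> if w then a' x < a' y else a' y < a' x"
      "\<And>x. a' (x + 1) = a' x + of_int (sg w)"
    using assms(2) by (auto simp: homeo_lift_def)
  have "if v = w then a (a' x) < a (a' y) else a (a' y) < a (a' x)" if "x < y" for x y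
    using 2(6)[OF that] 1(6)[of "a' x" "a' y"] 1(6)[of "a' y" "a' x"] by (cases v; cases w) auto
  moreover have "a (a' (x + 1)) = a (a' x) + of_int (sg (v = w))" for x
    using add_int_periodic[of a "of_int (sg v)", OF 1(7), of "a' x" "sg w"] 2(7)[of x] by (cases v; cases w) (auto simp: sg_def)
  moreover have "continuous_on UNIV (\<lambda>x. a (a' x))" "continuous_on UNIV (\<lambda>x. b' (b x))"
    by (rule continuous_on_compose2[OF 1(1) 2(1)] continuous_on_compose2[OF 2(2) 1(2)]; simp)+
  ultimately show ?thesis
    unfolding homeo_lift_def using 1(3-5) 2(3-5) by simp
qed

lemma homeo_lift_id: "homeo_lift True id (\<lambda>x. x) (\<lambda>x. x)"
  by (simp add: homeo_lift_def sg_def)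

section \<open>The action\<close>

lemma group_Homeo: "group Homeo"
proof (rule groupI)
  fix \<alpha> \<beta> \<gamma> assume "\<alpha> \<in> carrier Homeo" "\<beta> \<in> carrier Homeo"
  then show "\<alpha> \<otimes>\<^bsub>Homeo\<^esub> \<beta> \<in> carrier Homeo"
    unfolding Homeo_def homeos_def by (auto dest: homeomorphism_compose)
next
  fix \<alpha> assume "\<alpha> \<in> carrier Homeo"
  then obtain \<beta> where h: "homeomorphism UNIV UNIV \<alpha> \<beta>" by (auto simp: Homeo_def homeos_def)
  then have "homeomorphism UNIV UNIV \<beta> \<alpha>" by (rule homeomorphism_symD)
  moreover have "\<beta> \<circ> \<alpha> = id" using h by (auto simp: homeomorphism_def fun_eq_iff)
  ultimately show "\<exists>y\<in>carrier Homeo. y \<otimes>\<^bsub>Homeo\<^esub> \<alpha> = \<one>\<^bsub>Homeo\<^esub>"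
    by (auto simp: Homeo_def homeos_def)
next
  have "homeomorphism UNIV UNIV (id :: circle \<Rightarrow> circle) id"
    by (auto simp: homeomorphism_def continuous_on_id)
  then show "\<one>\<^bsub>Homeo\<^esub> \<in> carrier Homeo" by (auto simp: Homeo_def homeos_def)
qed (auto simp: Homeo_def fun_eq_iff)

context dihedral
begin

lemma homeo_pull_in:
  assumes "homeo_lift v \<alpha> a b" "F \<in> index_sets" "\<xi> \<in> S F"
  shows "pull Xt v (pi0_cover (\<alpha> ` F)) (pi0_cover F) b \<xi> \<in> S (\<alpha> ` F)"
  using pull_in[OF equivariant_homeo_inv[OF assms(1,2)]] pi0_big homeo_image_index assms by simp

text \<open>Both sides are induced by the same map of reals, the lift of the inverse homeomorphism.\<close>

lemma homeo_pull_transition: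
  assumes h: "homeo_lift v \<alpha> a b" and FG: "F \<in> index_sets" "G \<in> index_sets" "F \<subseteq> G" and \<xi>: "\<xi> \<in> S F"
  shows "transition Xt (\<alpha> ` F) (\<alpha> ` G) (pull Xt v (pi0_cover (\<alpha> ` F)) (pi0_cover F) b \<xi>)
    = pull Xt v (pi0_cover (\<alpha> ` G)) (pi0_cover G) b (transition Xt F G \<xi>)"
proof -
  note I = homeo_image_index[OF FG(1), of \<alpha>] homeo_image_index[OF FG(2), of \<alpha>] image_mono[OF FG(3), of \<alpha>]
  have "transition Xt (\<alpha> ` F) (\<alpha> ` G) (pull Xt v (pi0_cover (\<alpha> ` F)) (pi0_cover F) b \<xi>) = pull Xt v (pi0_cover (\<alpha> ` G)) (pi0_cover F) b \<xi>"
    using pull_comp[OF equivariant_forget[OF I] equivariant_homeo_inv[OF h FG(1)]] pi0_big I FG \<xi> by (simp add: transition_eq)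
  moreover have "pull Xt v (pi0_cover (\<alpha> ` G)) (pi0_cover G) b (transition Xt F G \<xi>) = pull Xt v (pi0_cover (\<alpha> ` G)) (pi0_cover F) b \<xi>"
    using pull_comp[OF equivariant_homeo_inv[OF h FG(2)] equivariant_forget[OF FG]] pi0_big I FG \<xi> by (simp add: transition_eq)
  ultimately show ?thesis by simp
qed

lemma homeo_in_colim_cong:
  assumes h: "homeo_lift v \<alpha> a b"
    and F: "F \<in> index_sets" "\<xi> \<in> S F" and G: "G \<in> index_sets" "\<eta> \<in> S G"
    and eq: "in_colim Xt F \<xi> = in_colim Xt G \<eta>"
  shows "in_colim Xt (\<alpha> ` F) (pull Xt v (pi0_cover (\<alpha> ` F)) (pi0_cover F) b \<xi>)
    = in_colim Xt (\<alpha> ` G) (pull Xt v (pi0_cover (\<alpha> ` G)) (pi0_cover G) b \<eta>)"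
proof -
  obtain H where H: "H \<in> index_sets" "F \<subseteq> H" "G \<subseteq> H" "transition Xt F H \<xi> = transition Xt G H \<eta>"
    using eq in_colim_eq_iff[OF F G] by blast
  show ?thesis
    unfolding in_colim_eq_iff[OF homeo_image_index[OF F(1)] homeo_pull_in[OF h F] homeo_image_index[OF G(1)] homeo_pull_in[OF h G]]
    using homeo_pull_transition[OF h F(1) H(1,2) F(2)] homeo_pull_transition[OF h G(1) H(1,3) G(2)] H
      homeo_image_index[OF H(1), of \<alpha>] image_mono[OF H(2), of \<alpha>] image_mono[OF H(3), of \<alpha>]
    by (intro bexI[of _ "\<alpha> ` H"]) simp_all
qed

lemma is_rho_iff:
  assumes h: "homeo_lift v \<alpha> a b"
  shows "is_rho Xt \<alpha> \<rho> \<longleftrightarrow> \<rho> \<in> colim Xt \<rightarrow>\<^sub>E colim Xt \<and>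
     (\<forall>F\<in>index_sets. \<forall>\<xi>\<in>S F. \<rho> (in_colim Xt F \<xi>) =
        in_colim Xt (\<alpha> ` F) (pull Xt v (pi0_cover (\<alpha> ` F)) (pi0_cover F) b \<xi>))"
  unfolding is_rho_def pull_def by (simp add: dinv_homeo_pi0[OF h])

lemma rho_ex1:
  assumes h: "homeo_lift v \<alpha> a b"
  shows "\<exists>!\<rho>. is_rho Xt \<alpha> \<rho>"
proof (rule ex_ex1I)
  define T where "T p = in_colim Xt (\<alpha> ` fst p) (pull Xt v (pi0_cover (\<alpha> ` fst p)) (pi0_cover (fst p)) b (snd p))" for p
  define Q where "Q c p \<longleftrightarrow> fst p \<in> index_sets \<and> snd p \<in> S (fst p) \<and> in_colim Xt (fst p) (snd p) = c" for c p
  define \<rho> where "\<rho> = (\<lambda>c\<in>colim Xt. T (SOME p. Q c p))"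
  have Q: "Q c (SOME p. Q c p)" if c_in: "c \<in> colim Xt" for c
  proof -
    obtain F \<xi> where "F \<in> index_sets" "\<xi> \<in> S F" "c = in_colim Xt F \<xi>" using colimE[OF c_in] by blast
    then have "Q c (F, \<xi>)" by (simp add: Q_def)
    then show ?thesis by (rule someI)
  qed
  have T_in: "T p \<in> colim Xt" if "Q c p" for c p
    using that in_colim_in[OF homeo_image_index homeo_pull_in[OF h]] by (simp add: Q_def T_def)
  have "T (SOME p. Q c p) \<in> colim Xt" if c_in: "c \<in> colim Xt" for c by (rule T_in[OF Q[OF c_in]])
  then have "\<rho> \<in> colim Xt \<rightarrow>\<^sub>E colim Xt" by (auto simp: \<rho>_def)
  moreover have "\<rho> (in_colim Xt F \<xi>) = T (F, \<xi>)" if F: "F \<in> index_sets" "\<xi> \<in> S F" for F \<xi>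
  proof -
    let ?c = "in_colim Xt F \<xi>"
    define p where "p = (SOME p. Q ?c p)"
    have c: "?c \<in> colim Xt" using in_colim_in[OF F] .
    have "Q ?c p" using Q[OF c] by (simp add: p_def)
    then have "T p = T (F, \<xi>)"
      using homeo_in_colim_cong[OF h, of "fst p" "snd p" F \<xi>] F by (simp add: Q_def T_def)
    then show ?thesis using c by (simp add: \<rho>_def p_def)
  qed
  ultimately show "\<exists>\<rho>. is_rho Xt \<alpha> \<rho>" using is_rho_iff[OF h, of \<rho>] by (auto simp: T_def)
next
  fix \<rho> \<sigma> assume "is_rho Xt \<alpha> \<rho>" "is_rho Xt \<alpha> \<sigma>"
  then have r: "\<rho> \<in> colim Xt \<rightarrow>\<^sub>E colim Xt" "\<sigma> \<in> colim Xt \<rightarrow>\<^sub>E colim Xt"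
    and eq: "\<And>F \<xi>. F \<in> index_sets \<Longrightarrow> \<xi> \<in> S F \<Longrightarrow> \<rho> (in_colim Xt F \<xi>) = \<sigma> (in_colim Xt F \<xi>)"
    unfolding is_rho_iff[OF h] by auto
  show "\<rho> = \<sigma>"
  proof (rule PiE_ext[OF r])
    fix c assume "c \<in> colim Xt"
    then obtain F \<xi> where "F \<in> index_sets" "\<xi> \<in> S F" "c = in_colim Xt F \<xi>" using colimE by metis
    then show "\<rho> c = \<sigma> c" using eq by simp
  qed
qed

lemma is_rho_rho: "homeo_lift v \<alpha> a b \<Longrightarrow> is_rho Xt \<alpha> (rho Xt \<alpha>)"
  unfolding rho_def by (rule theI'[OF rho_ex1])

lemma rho_in_colim:
  assumes h: "homeo_lift v \<alpha> a b" and "F \<in> index_sets" "\<xi> \<in> S F"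
  shows "rho Xt \<alpha> (in_colim Xt F \<xi>) = in_colim Xt (\<alpha> ` F) (pull Xt v (pi0_cover (\<alpha> ` F)) (pi0_cover F) b \<xi>)"
  using is_rho_rho[OF h] assms unfolding is_rho_iff[OF h] by blast

lemma rho_in: "homeo_lift v \<alpha> a b \<Longrightarrow> c \<in> colim Xt \<Longrightarrow> rho Xt \<alpha> c \<in> colim Xt"
  using is_rho_rho unfolding is_rho_def by blast

lemma rho_comp:
  assumes h: "homeo_lift v \<alpha> a b" and k: "homeo_lift w \<beta> a' b'" and c: "c \<in> colim Xt"
  shows "rho Xt (\<alpha> \<circ> \<beta>) c = rho Xt \<alpha> (rho Xt \<beta> c)"
proof -
  obtain F \<xi> where F: "F \<in> index_sets" "\<xi> \<in> S F" "c = in_colim Xt F \<xi>" using colimE[OF c] by blast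
  have I: "\<beta> ` F \<in> index_sets" "\<alpha> ` \<beta> ` F \<in> index_sets" using homeo_image_index F(1) by blast+
  have "rho Xt \<alpha> (rho Xt \<beta> c) = in_colim Xt (\<alpha> ` \<beta> ` F)
      (pull Xt v (pi0_cover (\<alpha> ` \<beta> ` F)) (pi0_cover (\<beta> ` F)) b (pull Xt w (pi0_cover (\<beta> ` F)) (pi0_cover F) b' \<xi>))"
    unfolding F(3) rho_in_colim[OF k F(1,2)] by (rule rho_in_colim[OF h I(1) homeo_pull_in[OF k F(1,2)]])
  also have "pull Xt v (pi0_cover (\<alpha> ` \<beta> ` F)) (pi0_cover (\<beta> ` F)) b (pull Xt w (pi0_cover (\<beta> ` F)) (pi0_cover F) b' \<xi>)
      = pull Xt (v = w) (pi0_cover (\<alpha> ` \<beta> ` F)) (pi0_cover F) (\<lambda>x. b' (b x)) \<xi>"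
    using pull_comp[OF equivariant_homeo_inv[OF h I(1)] equivariant_homeo_inv[OF k F(1)]] pi0_big I F by simp
  also have "in_colim Xt (\<alpha> ` \<beta> ` F) \<dots> = rho Xt (\<alpha> \<circ> \<beta>) c"
    unfolding F(3) rho_in_colim[OF homeo_lift_comp[OF h k] F(1,2)] image_comp by simp
  finally show ?thesis by simp
qed

lemma rho_id: "c \<in> colim Xt \<Longrightarrow> rho Xt id c = c"
proof -
  assume "c \<in> colim Xt"
  then obtain F \<xi> where F: "F \<in> index_sets" "\<xi> \<in> S F" "c = in_colim Xt F \<xi>" using colimE by metis
  have "pull Xt True (pi0_cover F) (pi0_cover F) (\<lambda>x. x) \<xi> = \<xi>"
    by (rule pull_id[OF cover_pi0[OF F(1)]]) (use F pi0_big same_refl in simp_all)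
  then show ?thesis unfolding F(3) rho_in_colim[OF homeo_lift_id F(1,2)] by simp
qed

abbreviation E where "E \<equiv> topspace (realization X)"

lemma canonical_in: "p \<in> E \<Longrightarrow> canonical_map Xt p \<in> colim Xt"
  using canonical_bij by (auto simp: bij_betw_def)

lemma act_eqI:
  assumes "p \<in> E" "q \<in> E" "rho Xt \<alpha> (canonical_map Xt p) = canonical_map Xt q"
  shows "act X Xt \<alpha> p = q"
  using assms canonical_bij by (simp add: act_def bij_betw_def inv_into_f_f)

lemma
  assumes h: "homeo_lift v \<alpha> a b" and p: "p \<in> E"
  shows act_in: "act X Xt \<alpha> p \<in> E"
    and canonical_act: "canonical_map Xt (act X Xt \<alpha> p) = rho Xt \<alpha> (canonical_map Xt p)"
proof -
  have "rho Xt \<alpha> (canonical_map Xt p) \<in> canonical_map Xt ` E"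
    using canonical_bij rho_in[OF h canonical_in[OF p]] by (simp add: bij_betw_def)
  then show "act X Xt \<alpha> p \<in> E" "canonical_map Xt (act X Xt \<alpha> p) = rho Xt \<alpha> (canonical_map Xt p)"
    using p by (simp_all add: act_def inv_into_into f_inv_into_f)
qed

lemma act_comp:
  assumes h: "homeo_lift v \<alpha> a b" and k: "homeo_lift w \<beta> a' b'" and p: "p \<in> E"
  shows "act X Xt (\<alpha> \<circ> \<beta>) p = act X Xt \<alpha> (act X Xt \<beta> p)"
proof (rule act_eqI[OF p])
  have q: "act X Xt \<beta> p \<in> E" by (rule act_in[OF k p])
  show "act X Xt \<alpha> (act X Xt \<beta> p) \<in> E" by (rule act_in[OF h q])
  show "rho Xt (\<alpha> \<circ> \<beta>) (canonical_map Xt p) = canonical_map Xt (act X Xt \<alpha> (act X Xt \<beta> p))"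
    using rho_comp[OF h k canonical_in[OF p]] canonical_act[OF h q] canonical_act[OF k p] by simp
qed

lemma act_id: "p \<in> E \<Longrightarrow> act X Xt id p = p"
  by (rule act_eqI) (simp_all add: rho_id canonical_in)

lemma group_action_act: "group_action Homeo E (act X Xt)"
proof -
  have inverse: "\<exists>\<beta>\<in>homeos. \<beta> \<circ> \<alpha> = id \<and> \<alpha> \<circ> \<beta> = id" if \<alpha>: "\<alpha> \<in> homeos" for \<alpha>
  proof -
    obtain \<beta> where h: "homeomorphism UNIV UNIV \<alpha> \<beta>" using \<alpha> by (auto simp: homeos_def)
    then have "homeomorphism UNIV UNIV \<beta> \<alpha>" by (rule homeomorphism_symD)
    then have "\<beta> \<in> homeos" by (auto simp: homeos_def)
    moreover have "\<beta> \<circ> \<alpha> = id" "\<alpha> \<circ> \<beta> = id" using h by (auto simp: homeomorphism_def fun_eq_iff)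
    ultimately show ?thesis by blast
  qed
  have acts: "act X Xt \<alpha> p \<in> E" if "\<alpha> \<in> homeos" "p \<in> E" for \<alpha> p
    using homeo_lift_exists[OF that(1)] act_in that(2) by metis
  have comp: "act X Xt (\<alpha> \<circ> \<beta>) p = act X Xt \<alpha> (act X Xt \<beta> p)" if "\<alpha> \<in> homeos" "\<beta> \<in> homeos" "p \<in> E" for \<alpha> \<beta> p
    using homeo_lift_exists[OF that(1)] homeo_lift_exists[OF that(2)] act_comp that(3) by metis
  have Bij: "act X Xt \<alpha> \<in> Bij E" if \<alpha>: "\<alpha> \<in> homeos" for \<alpha>
  proof -
    obtain \<beta> where \<beta>: "\<beta> \<in> homeos" "\<beta> \<circ> \<alpha> = id" "\<alpha> \<circ> \<beta> = id" using inverse[OF \<alpha>] by blast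
    have "act X Xt \<beta> (act X Xt \<alpha> p) = p" "act X Xt \<alpha> (act X Xt \<beta> p) = p" if "p \<in> E" for p
      using comp[OF \<beta>(1) \<alpha> that] comp[OF \<alpha> \<beta>(1) that] act_id[OF that] \<beta> by simp_all
    then have "bij_betw (act X Xt \<alpha>) E E"
      by (intro bij_betwI[where g = "act X Xt \<beta>"]) (use acts \<alpha> \<beta>(1) in auto)
    moreover have "act X Xt \<alpha> \<in> extensional E" by (simp add: act_def)
    ultimately show ?thesis by (simp add: Bij_def)
  qed
  have "act X Xt \<in> hom Homeo (BijGroup E)"
  proof (rule homI)
    fix \<alpha> \<beta> assume ab: "\<alpha> \<in> carrier Homeo" "\<beta> \<in> carrier Homeo"
    then have ab': "\<alpha> \<in> homeos" "\<beta> \<in> homeos" by (auto simp: Homeo_def)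
    then show "act X Xt \<alpha> \<in> carrier (BijGroup E)" using Bij by (simp add: BijGroup_def)
    have "act X Xt (\<alpha> \<circ> \<beta>) p = compose E (act X Xt \<alpha>) (act X Xt \<beta>) p" for p
      using comp[OF ab'] by (cases "p \<in> E") (auto simp: compose_def act_def)
    then show "act X Xt (\<alpha> \<otimes>\<^bsub>Homeo\<^esub> \<beta>) = act X Xt \<alpha> \<otimes>\<^bsub>BijGroup E\<^esub> act X Xt \<beta>"
      using Bij[OF ab'(1)] Bij[OF ab'(2)] by (simp add: BijGroup_def Homeo_def fun_eq_iff)
  qed
  then show ?thesis
    using group_Homeo group_BijGroup by (auto simp: group_action_def group_hom_def group_hom_axioms_def)
qed

end

section \<open>Continuous dependence of lifts\<close>

lemma homeo_lift_translate:
  assumes "homeo_lift v \<alpha> a b"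
  shows "homeo_lift v \<alpha> (\<lambda>x. a x + of_int k) (\<lambda>x. b (x - of_int k))"
proof -
  have b: "continuous_on UNIV b" using assms by (simp add: homeo_lift_def)
  have "continuous_on UNIV (\<lambda>x. b (x - of_int k))"
    by (rule continuous_on_compose2[OF b continuous_on_diff[OF continuous_on_id continuous_on_const]]) simp
  then show ?thesis using assms by (auto simp: homeo_lift_def intro: continuous_intros)
qed

text \<open>The signed length of the image of the interval from \<open>s\<close> to \<open>t\<close>. It is the same for all lifts, as they
  differ by constants.\<close>

definition disp :: "(circle \<Rightarrow> circle) \<Rightarrow> real \<Rightarrow> real \<Rightarrow> real" where
  "disp \<alpha> s t = (SOME d. \<exists>v a b. homeo_lift v \<alpha> a b \<and> d = a t - a s)"

lemma disp_eq:
  assumes h: "homeo_lift v \<alpha> a b" shows "disp \<alpha> s t = a t - a s"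
proof -
  have "\<exists>v a b. homeo_lift v \<alpha> a b \<and> disp \<alpha> s t = a t - a s"
    unfolding disp_def by (rule someI[of _ "a t - a s"]) (use h in blast)
  then obtain w a' b' where k: "homeo_lift w \<alpha> a' b'" "disp \<alpha> s t = a' t - a' s" by blast
  obtain k :: int where "\<And>x. a' x = a x + of_int k"
    using circle_lift_unique[of UNIV a a'] h k(1) by (auto simp: homeo_lift_def)
  then show ?thesis using k(2) by simp
qed

lemma homeo_lift_add_int:
  assumes "homeo_lift v \<alpha> a b" shows "a (x + of_int k) = a x + of_int (k * sg v)"
  using add_int_periodic[of a "of_int (sg v)"] assms by (simp add: homeo_lift_def)

text \<open>To come near a different integer, \<open>h\<close> would have to take a half-integer value in between.\<close>

lemma near_integer_const:
  fixes h :: "real \<Rightarrow> real"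
  assumes c: "continuous_on UNIV h" and e: "e \<le> 1/4"
    and n: "\<And>x. \<exists>k::int. \<bar>h x - of_int k\<bar> < e"
  obtains k :: int where "\<And>x. \<bar>h x - of_int k\<bar> < e"
proof -
  obtain k :: int where k: "\<bar>h 0 - of_int k\<bar> < e" using n by blast
  have con: "connected (range h)" by (rule connected_continuous_image[OF c connected_UNIV])
  have half: False if "m + 1 \<le> l" "\<bar>h x - of_int m\<bar> < e" "\<bar>h y - of_int l\<bar> < e" for x y and m l :: int
  proof -
    have "real_of_int m + 1 \<le> real_of_int l" using that(1) by linarith
    then have "of_int m + 1/2 \<in> {h x..h y}" using that e by (auto simp: abs_less_iff)
    then have "of_int m + 1/2 \<in> range h" using connected_contains_Icc[OF con, of "h x" "h y"] by blast
    then obtain u where u: "h u = of_int m + 1/2" by auto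
    obtain j :: int where j: "\<bar>h u - of_int j\<bar> < e" using n by blast
    then have "real_of_int m < real_of_int j" "real_of_int j < real_of_int (m + 1)"
      using u e by (auto simp: abs_less_iff)
    then have "m < j" "j < m + 1" by (simp_all only: of_int_less_iff)
    then show False by linarith
  qed
  have "\<bar>h x - of_int k\<bar> < e" for x
  proof -
    obtain l :: int where l: "\<bar>h x - of_int l\<bar> < e" using n by blast
    have "\<not> k + 1 \<le> l" "\<not> l + 1 \<le> k" using half[OF _ k l] half[OF _ l k] by blast+
    then have "l = k" by linarith
    then show ?thesis using l by simp
  qed
  then show ?thesis by (rule that)
qed

text \<open>A compact-open neighbourhood of a homeomorphism: on each piece of a fine subdivision of the
  circle the lift moves within a short interval. This makes lifts close up to an integer at every
  point, and by connectedness the integer does not depend on the point.\<close>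

lemma near_lifts:
  assumes h0: "homeo_lift v0 \<alpha>0 a0 b0" and e: "0 < e" "e \<le> 1/4"
  obtains V where "openin compact_open_topology V" "\<alpha>0 \<in> V"
    "\<And>\<alpha> v a b. \<alpha> \<in> V \<Longrightarrow> homeo_lift v \<alpha> a b \<Longrightarrow> \<exists>k::int. \<forall>x. \<bar>a x - a0 x - of_int k\<bar> < e"
proof -
  have a0: "continuous_on UNIV a0" "\<And>x. \<alpha>0 (proj x) = proj (a0 x)" using h0 by (auto simp: homeo_lift_def)
  have "uniformly_continuous_on {0..1} a0"
    using compact_uniformly_continuous a0(1) continuous_on_subset by blast
  then obtain d where d: "d > 0" "\<And>x y. x \<in> {0..1} \<Longrightarrow> y \<in> {0..1} \<Longrightarrow> dist x y < d \<Longrightarrow> dist (a0 x) (a0 y) < e / 2"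
    using e unfolding uniformly_continuous_on_def by (metis half_gt_zero)
  obtain N :: nat where N: "N > 0" "1 / real N < d"
    using real_arch_inverse[of d] d(1) by (auto simp: inverse_eq_divide)
  define p where "p j = real j / real N" for j
  define K where "K j = proj ` {p j..p (j + 1)}" for j
  define U where "U j = proj ` ball (a0 (p j)) (e / 2)" for j
  define B where "B j = {f. continuous_on UNIV f \<and> f ` K j \<subseteq> U j}" for j
  define V where "V = (\<Inter>j\<in>{..<N}. B j)"
  have opB: "openin compact_open_topology (B j)" for j
    unfolding compact_open_topology_def B_def
  proof (rule topology_generated_by_Basis)
    have "compact (K j)" unfolding K_def
      by (rule compact_continuous_image) (auto intro: continuous_on_proj continuous_on_id)
    moreover have "open (U j)" unfolding U_def by (rule open_proj_image) simp
    ultimately show "{f. continuous_on UNIV f \<and> f ` K j \<subseteq> U j} \<in>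
        {{f. continuous_on UNIV f \<and> f ` K \<subseteq> U} |K U. compact K \<and> open U}" by blast
  qed
  have piece: "dist (a0 x) (a0 (p j)) < e / 2" "x \<in> {0..1}" if "j < N" "x \<in> {p j..p (j + 1)}" for x j
  proof -
    have pj: "p (j + 1) = p j + 1 / real N" "0 \<le> p j" "p (j + 1) \<le> 1"
      using that(1) N(1) by (simp_all add: p_def field_simps)
    then show x: "x \<in> {0..1}" using that by auto
    have "p j \<in> {0..1}" using pj N(1) by (auto simp: zero_le_divide_iff intro: order_trans[of _ "p (j + 1)"])
    moreover have "dist x (p j) < d" using that(2) pj(1) N(2) by (auto simp: dist_real_def)
    ultimately show "dist (a0 x) (a0 (p j)) < e / 2" using d(2) x by blast
  qed
  show ?thesis
  proof
    show "openin compact_open_topology V" unfolding V_def using N(1) opB by (intro openin_INT2) auto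
    have "continuous_on UNIV \<alpha>0"
      unfolding continuous_on_open_vimage[OF open_UNIV]
    proof (intro allI impI)
      fix W :: "circle set" assume "open W"
      then have "open ((\<lambda>x. proj (a0 x)) -` W)"
        using continuous_on_open_vimage[OF open_UNIV, of "\<lambda>x. proj (a0 x)"] continuous_on_proj[OF a0(1)] by simp
      moreover have "(\<lambda>x. proj (a0 x)) -` W = proj -` (\<alpha>0 -` W)" using a0(2) by auto
      ultimately show "open (\<alpha>0 -` W \<inter> UNIV)" by (simp add: open_circle_def)
    qed
    moreover have "\<alpha>0 ` K j \<subseteq> U j" if "j < N" for j
      using piece(1)[OF that] a0(2) by (auto simp: K_def U_def dist_commute intro!: imageI)
    ultimately show "\<alpha>0 \<in> V" by (auto simp: V_def B_def)
    fix \<alpha> v a b assume \<alpha>: "\<alpha> \<in> V" and h: "homeo_lift v \<alpha> a b"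
    have a: "continuous_on UNIV a" "\<And>x. \<alpha> (proj x) = proj (a x)" using h by (auto simp: homeo_lift_def)
    have "\<exists>k::int. \<bar>a x - a0 x - of_int k\<bar> < e" for x
    proof -
      define y where "y = frac x"
      have y: "0 \<le> y" "y < 1" "x = y + of_int \<lfloor>x\<rfloor>" using frac_lt_1[of x] by (auto simp: y_def frac_def)
      define j where "j = nat \<lfloor>real N * y\<rfloor>"
      have j0: "0 \<le> \<lfloor>real N * y\<rfloor>" using y by simp
      have "real N * y < real N" using y N(1) by simp
      then have j: "j < N" unfolding j_def using j0 by linarith
      have "real j \<le> real N * y" "real N * y \<le> real j + 1" unfolding j_def using j0 by linarith+
      then have yj: "y \<in> {p j..p (j + 1)}" using N(1) by (simp add: p_def field_simps)
      have "\<alpha> \<in> B j" using \<alpha> j by (simp add: V_def)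
      then have "\<alpha> ` K j \<subseteq> U j" by (simp add: B_def)
      moreover have "proj y \<in> K j" unfolding K_def using yj by (rule imageI)
      ultimately have "\<alpha> (proj y) \<in> U j" by blast
      then obtain u where u: "dist (a0 (p j)) u < e / 2" "proj u = proj (a y)" using a(2) by (auto simp: U_def)
      obtain k :: int where k: "a y = u + of_int k" using proj_eqE[OF u(2)] by blast
      have "\<bar>a0 (p j) - u\<bar> < e / 2" "\<bar>a0 y - a0 (p j)\<bar> < e / 2"
        using u(1) piece(1)[OF j yj] by (simp_all add: dist_real_def)
      then have "\<bar>a y - a0 y - of_int k\<bar> < e" using k by linarith
      moreover have "a x = a y + of_int (\<lfloor>x\<rfloor> * sg v)" "a0 x = a0 y + of_int (\<lfloor>x\<rfloor> * sg v0)"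
        using homeo_lift_add_int[OF h, of y "\<lfloor>x\<rfloor>"] homeo_lift_add_int[OF h0, of y "\<lfloor>x\<rfloor>"] y(3) by simp_all
      ultimately show ?thesis
        by (intro exI[of _ "k + \<lfloor>x\<rfloor> * sg v - \<lfloor>x\<rfloor> * sg v0"]) (simp add: algebra_simps)
    qed
    moreover have "continuous_on UNIV (\<lambda>x. a x - a0 x)" by (intro continuous_on_diff a(1) a0(1))
    ultimately show "\<exists>k::int. \<forall>x. \<bar>a x - a0 x - of_int k\<bar> < e"
      using near_integer_const[of "\<lambda>x. a x - a0 x" e] e(2) by metis
  qed
qed

lemma topspace_Homeo: "topspace Homeo_topology = homeos"
proof -
  have "homeos \<subseteq> topspace compact_open_topology"
  proof
    fix \<alpha> assume "\<alpha> \<in> homeos"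
    then have "continuous_on UNIV \<alpha>" by (auto simp: homeos_def homeomorphism_def)
    then have "\<alpha> \<in> {f. continuous_on UNIV f \<and> f ` {} \<subseteq> UNIV}" by simp
    moreover have "{f :: circle \<Rightarrow> circle. continuous_on UNIV f \<and> f ` {} \<subseteq> UNIV} \<in>
        {{f. continuous_on UNIV f \<and> f ` K \<subseteq> U} |K U. compact K \<and> open U}"
      using compact_empty open_UNIV by blast
    ultimately show "\<alpha> \<in> topspace compact_open_topology"
      unfolding compact_open_topology_def topology_generated_by_topspace by (rule UnionI[rotated])
  qed
  then show ?thesis by (auto simp: Homeo_topology_def)
qed

lemma openin_Homeo: "openin compact_open_topology V \<Longrightarrow> openin Homeo_topology (V \<inter> homeos)"
  unfolding Homeo_topology_def using openin_kification_finer by (auto simp: openin_subtopology)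

text \<open>Translates of lifts by integers are lifts, so the integers of \<open>near_lifts\<close> can be made zero.\<close>

lemma near_homeos:
  assumes \<alpha>0: "homeo_lift v0 \<alpha>0 a0 b0" "\<alpha>0 \<in> homeos" and e: "0 < e"
  obtains V where "openin Homeo_topology V" "\<alpha>0 \<in> V"
    "\<And>\<alpha>. \<alpha> \<in> V \<Longrightarrow> \<exists>v a b. homeo_lift v \<alpha> a b \<and> (\<forall>x. \<bar>a x - a0 x\<bar> < e)"
proof -
  obtain V where V: "openin compact_open_topology V" "\<alpha>0 \<in> V"
    "\<And>\<alpha> v a b. \<alpha> \<in> V \<Longrightarrow> homeo_lift v \<alpha> a b \<Longrightarrow> \<exists>k::int. \<forall>x. \<bar>a x - a0 x - of_int k\<bar> < min e (1/4)"
  proof -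
    have m: "0 < min e (1/4)" "min e (1/4) \<le> 1/4" using e by auto
    show ?thesis using near_lifts[OF \<alpha>0(1) m] that by blast
  qed
  show ?thesis
  proof
    show "openin Homeo_topology (V \<inter> homeos)" using V(1) by (rule openin_Homeo)
    show "\<alpha>0 \<in> V \<inter> homeos" using V(2) \<alpha>0(2) by simp
    fix \<alpha> assume \<alpha>: "\<alpha> \<in> V \<inter> homeos"
    then obtain v a b where h: "homeo_lift v \<alpha> a b" using homeo_lift_exists by blast
    then obtain k :: int where k: "\<And>x. \<bar>a x - a0 x - of_int k\<bar> < min e (1/4)" using V(3) \<alpha> by blast
    have "\<bar>a x + of_int (- k) - a0 x\<bar> < e" for x using k[of x] by (simp add: algebra_simps)
    then show "\<exists>v a b. homeo_lift v \<alpha> a b \<and> (\<forall>x. \<bar>a x - a0 x\<bar> < e)"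
      using homeo_lift_translate[OF h, of "- k"] by blast
  qed
qed

lemma continuous_at_real:
  fixes f :: "real \<Rightarrow> real"
  assumes "continuous_on UNIV f" "0 < e"
  obtains d where "0 < d" "\<And>y. \<bar>y - x\<bar> < d \<Longrightarrow> \<bar>f y - f x\<bar> < e"
  using assms unfolding continuous_on_iff dist_real_def by (metis UNIV_I)

text \<open>Continuity may be tested with lifts that are uniformly close.\<close>

lemma continuous_map_from_Homeo:
  assumes top: "\<And>\<alpha> y. \<alpha> \<in> homeos \<Longrightarrow> y \<in> topspace Y \<Longrightarrow> f \<alpha> y \<in> topspace T"
    and near: "\<And>v0 \<alpha>0 a0 b0 y0 U. \<lbrakk>homeo_lift v0 \<alpha>0 a0 b0; y0 \<in> topspace Y; openin T U; f \<alpha>0 y0 \<in> U\<rbrakk> \<Longrightarrow>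
      \<exists>e>0. \<exists>W. openin Y W \<and> y0 \<in> W \<and>
        (\<forall>v \<alpha> a b. \<forall>y\<in>W. homeo_lift v \<alpha> a b \<longrightarrow> (\<forall>x. \<bar>a x - a0 x\<bar> < e) \<longrightarrow> f \<alpha> y \<in> U)"
  shows "continuous_map (prod_topology Homeo_topology Y) T (\<lambda>(\<alpha>, y). f \<alpha> y)"
  unfolding continuous_map_def
proof (intro conjI allI impI)
  let ?P = "prod_topology Homeo_topology Y"
  show "(\<lambda>(\<alpha>, y). f \<alpha> y) \<in> topspace ?P \<rightarrow> topspace T" using top by (auto simp: topspace_Homeo)
  fix U assume U: "openin T U"
  show "openin ?P {p \<in> topspace ?P. (case p of (\<alpha>, y) \<Rightarrow> f \<alpha> y) \<in> U}"
    unfolding openin_prod_topology_alt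
  proof (intro allI impI)
    fix \<alpha>0 y0 assume p0: "(\<alpha>0, y0) \<in> {p \<in> topspace ?P. (case p of (\<alpha>, y) \<Rightarrow> f \<alpha> y) \<in> U}"
    then have \<alpha>0: "\<alpha>0 \<in> homeos" "y0 \<in> topspace Y" "f \<alpha>0 y0 \<in> U" by (auto simp: topspace_Homeo)
    obtain v0 a0 b0 where h0: "homeo_lift v0 \<alpha>0 a0 b0" using homeo_lift_exists[OF \<alpha>0(1)] by blast
    obtain e W where eW: "0 < e" "openin Y W" "y0 \<in> W"
      "\<forall>v \<alpha> a b. \<forall>y\<in>W. homeo_lift v \<alpha> a b \<longrightarrow> (\<forall>x. \<bar>a x - a0 x\<bar> < e) \<longrightarrow> f \<alpha> y \<in> U"
      using near[OF h0 \<alpha>0(2) U \<alpha>0(3)] by (elim exE conjE) (rule that)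
    obtain V where V: "openin Homeo_topology V" "\<alpha>0 \<in> V"
      "\<And>\<alpha>. \<alpha> \<in> V \<Longrightarrow> \<exists>v a b. homeo_lift v \<alpha> a b \<and> (\<forall>x. \<bar>a x - a0 x\<bar> < e)"
      using near_homeos[OF h0 \<alpha>0(1) eW(1)] by blast
    have "f \<alpha> y \<in> U" if \<alpha>y: "\<alpha> \<in> V" "y \<in> W" for \<alpha> y
      using V(3)[OF \<alpha>y(1)] eW(4) \<alpha>y(2) by blast
    then have "V \<times> W \<subseteq> {p \<in> topspace ?P. (case p of (\<alpha>, y) \<Rightarrow> f \<alpha> y) \<in> U}"
      using openin_subset[OF V(1)] openin_subset[OF eW(2)] by auto
    then show "\<exists>V W. openin Homeo_topology V \<and> openin Y W \<and> \<alpha>0 \<in> V \<and> y0 \<in> W \<and>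
        V \<times> W \<subseteq> {p \<in> topspace ?P. (case p of (\<alpha>, y) \<Rightarrow> f \<alpha> y) \<in> U}"
      using V(1,2) eW(2,3) by (intro exI[of _ V] exI[of _ W] conjI)
  qed
qed

lemma continuous_disp:
  "continuous_map (prod_topology Homeo_topology (prod_topology euclideanreal euclideanreal)) euclideanreal
     (\<lambda>(\<alpha>, p). disp \<alpha> (fst p) (snd p))"
proof (rule continuous_map_from_Homeo)
  fix v0 \<alpha>0 a0 b0 U and y0 :: "real \<times> real"
  assume h0: "homeo_lift v0 \<alpha>0 a0 b0" and "openin euclideanreal U" "disp \<alpha>0 (fst y0) (snd y0) \<in> U"
  then obtain e where e: "0 < e" "ball (disp \<alpha>0 (fst y0) (snd y0)) e \<subseteq> U"
    by (metis open_contains_ball open_openin)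
  have c0: "continuous_on UNIV a0" and e4: "0 < e / 4" using h0 e by (simp_all add: homeo_lift_def)
  obtain d1 where d1: "0 < d1" "\<And>y. \<bar>y - fst y0\<bar> < d1 \<Longrightarrow> \<bar>a0 y - a0 (fst y0)\<bar> < e / 4"
    using continuous_at_real[OF c0 e4] by blast
  obtain d2 where d2: "0 < d2" "\<And>y. \<bar>y - snd y0\<bar> < d2 \<Longrightarrow> \<bar>a0 y - a0 (snd y0)\<bar> < e / 4"
    using continuous_at_real[OF c0 e4] by blast
  have "disp \<alpha> (fst p) (snd p) \<in> U"
    if p: "p \<in> ball (fst y0) d1 \<times> ball (snd y0) d2" and h: "homeo_lift v \<alpha> a b" "\<forall>x. \<bar>a x - a0 x\<bar> < e / 4"
    for v \<alpha> a b p
  proof -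
    have "\<bar>fst p - fst y0\<bar> < d1" "\<bar>snd p - snd y0\<bar> < d2"
      using p by (auto simp: dist_real_def abs_minus_commute)
    then have "\<bar>a0 (fst p) - a0 (fst y0)\<bar> < e / 4" "\<bar>a0 (snd p) - a0 (snd y0)\<bar> < e / 4"
      using d1(2) d2(2) by blast+
    moreover have "\<bar>a (fst p) - a0 (fst p)\<bar> < e / 4" "\<bar>a (snd p) - a0 (snd p)\<bar> < e / 4" using h(2) by blast+
    ultimately have "\<bar>disp \<alpha>0 (fst y0) (snd y0) - disp \<alpha> (fst p) (snd p)\<bar> < e"
      unfolding disp_eq[OF h(1)] disp_eq[OF h0] by linarith
    then show ?thesis using e(2) by (auto simp: dist_real_def)
  qed
  moreover have "openin (prod_topology euclideanreal euclideanreal) (ball (fst y0) d1 \<times> ball (snd y0) d2)"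
    by (simp add: open_Times)
  moreover have "y0 \<in> ball (fst y0) d1 \<times> ball (snd y0) d2" using d1(1) d2(1) by (simp add: mem_Times_iff)
  ultimately show "\<exists>e>0. \<exists>W. openin (prod_topology euclideanreal euclideanreal) W \<and> y0 \<in> W \<and>
      (\<forall>v \<alpha> a b. \<forall>y\<in>W. homeo_lift v \<alpha> a b \<longrightarrow> (\<forall>x. \<bar>a x - a0 x\<bar> < e) \<longrightarrow> disp \<alpha> (fst y) (snd y) \<in> U)"
    using e4 by (intro exI[of _ "e / 4"] exI[of _ "ball (fst y0) d1 \<times> ball (snd y0) d2"] conjI) blast+
qed simp

lemma continuous_eval:
  "continuous_map (prod_topology Homeo_topology euclideanreal) euclidean (\<lambda>(\<alpha>, t). \<alpha> (proj t))"
proof (rule continuous_map_from_Homeo)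
  fix v0 \<alpha>0 a0 b0 t0 and U :: "circle set"
  assume h0: "homeo_lift v0 \<alpha>0 a0 b0" and "openin euclidean U" "\<alpha>0 (proj t0) \<in> U"
  then have "open (proj -` U)" "a0 t0 \<in> proj -` U" by (simp_all add: open_circle_def homeo_lift_def)
  then obtain e where e: "0 < e" "ball (a0 t0) e \<subseteq> proj -` U" by (meson open_contains_ball)
  have c0: "continuous_on UNIV a0" and e2: "0 < e / 2" using h0 e by (simp_all add: homeo_lift_def)
  obtain d where d: "0 < d" "\<And>y. \<bar>y - t0\<bar> < d \<Longrightarrow> \<bar>a0 y - a0 t0\<bar> < e / 2"
    using continuous_at_real[OF c0 e2] by blast
  have "\<alpha> (proj t) \<in> U"
    if t: "t \<in> ball t0 d" and h: "homeo_lift v \<alpha> a b" "\<forall>x. \<bar>a x - a0 x\<bar> < e / 2" for v \<alpha> a b t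
  proof -
    have "\<bar>a0 t - a0 t0\<bar> < e / 2" using d(2)[of t] t by (auto simp: dist_real_def abs_minus_commute)
    moreover have "\<bar>a t - a0 t\<bar> < e / 2" using h(2) by blast
    ultimately have "\<bar>a0 t0 - a t\<bar> < e" by linarith
    then have "a t \<in> proj -` U" using e(2) by (auto simp: dist_real_def)
    then show ?thesis using h(1) by (simp add: homeo_lift_def)
  qed
  moreover have "openin euclideanreal (ball t0 d)" "t0 \<in> ball t0 d" using d(1) by simp_all
  ultimately show "\<exists>e>0. \<exists>W. openin euclideanreal W \<and> t0 \<in> W \<and>
      (\<forall>v \<alpha> a b. \<forall>t\<in>W. homeo_lift v \<alpha> a b \<longrightarrow> (\<forall>x. \<bar>a x - a0 x\<bar> < e) \<longrightarrow> \<alpha> (proj t) \<in> U)"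
    using e2 by (intro exI[of _ "e / 2"] exI[of _ "ball t0 d"] conjI) blast+
qed simp

lemma Hausdorff_Homeo: "Hausdorff_space Homeo_topology"
  unfolding Hausdorff_space_def topspace_Homeo
proof (intro allI impI; elim conjE)
  fix \<alpha> \<beta> assume ab: "\<alpha> \<in> homeos" "\<beta> \<in> homeos" "\<alpha> \<noteq> \<beta>"
  then obtain c where "\<alpha> c \<noteq> \<beta> c" by (auto simp: fun_eq_iff)
  then have "to_complex (\<alpha> c) \<noteq> to_complex (\<beta> c)" using inj_to_complex by (auto dest: injD)
  then obtain U V where UV: "open U" "open V" "to_complex (\<alpha> c) \<in> U" "to_complex (\<beta> c) \<in> V" "U \<inter> V = {}"
    using hausdorff by metis
  define B where "B W = {f. continuous_on UNIV f \<and> f ` {c} \<subseteq> to_complex -` W}" for W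
  have "openin Homeo_topology (B W \<inter> homeos)" if "open W" for W
  proof (rule openin_Homeo)
    have "open (to_complex -` W)"
      using continuous_to_complex that by (simp add: continuous_on_open_vimage)
    then show "openin compact_open_topology (B W)"
      unfolding compact_open_topology_def B_def
      using compact_sing[of c] by (intro topology_generated_by_Basis) blast
  qed
  moreover have "\<alpha> \<in> B U \<inter> homeos" "\<beta> \<in> B V \<inter> homeos"
    using ab UV by (auto simp: B_def homeos_def homeomorphism_def)
  moreover have "disjnt (B U \<inter> homeos) (B V \<inter> homeos)" using UV(5) by (auto simp: disjnt_iff B_def)
  ultimately show "\<exists>U V. openin Homeo_topology U \<and> openin Homeo_topology V \<and> \<alpha> \<in> U \<and> \<beta> \<in> V \<and> disjnt U V"
    using UV(1,2) by blast
qed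

section \<open>Continuity of the action\<close>

text \<open>The new configuration starts with the point \<open>t\<close> that is mapped to the base point and continues
  with the old points, upwards or downwards.\<close>

definition next_pt :: "bool \<Rightarrow> nat \<Rightarrow> (nat \<Rightarrow> real) \<Rightarrow> int \<Rightarrow> real \<Rightarrow> nat \<Rightarrow> real" where
  "next_pt v n z i t j = (if j = 0 then t else if j \<le> n + 1 then
     xcut n z (if v then i + int j else i + 1 - int j) else t + of_int (sg v))"

text \<open>The lengths of the images of the arcs between consecutive points of the new configuration.\<close>

definition moved :: "bool \<Rightarrow> nat \<Rightarrow> (circle \<Rightarrow> circle) \<Rightarrow> (nat \<Rightarrow> real) \<Rightarrow> int \<Rightarrow> real \<Rightarrow> nat \<Rightarrow> real" where
  "moved v n \<alpha> z i t j = (if j \<le> n + 1 then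
     disp \<alpha> (next_pt v n z i t j) (next_pt v n z i t (j + 1)) else 0)"

text \<open>The old arc that contains the \<open>j\<close>-th new arc. Inserting \<open>t\<close> cuts the \<open>i\<close>-th arc in two; the parts are the
  first and the last of the \<open>n + 2\<close> new arcs of one turn, so one step is lost whenever a turn is completed.\<close>

definition relabel :: "bool \<Rightarrow> nat \<Rightarrow> int \<Rightarrow> int \<Rightarrow> int" where
  "relabel v n i j = i + sg v * (j - j div (int n + 2))"

lemma equivariant_relabel: "equivariant v (ncyc_cover (Suc n)) (ncyc_cover n) (\<lambda>x. tick n (relabel v n i (slot (Suc n) x)))"
proof (rule equivariant_ncyc)
  define f where "f j = j - j div (int n + 2)" for j
  have step: "f j \<le> f (j + 1)" for j
  proof -
    have "(j + 1) div (int n + 2) \<le> (j + (int n + 2)) div (int n + 2)" by (intro zdiv_mono1) auto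
    also have "\<dots> = j div (int n + 2) + 1" by simp
    finally show ?thesis by (simp add: f_def)
  qed
  have "f j \<le> f k" if "j \<le> k" for j k
    using that by (induction k rule: int_ge_induct) (use step order_trans in blast)+
  note mono_f = this
  have rl: "relabel v n i j = i + sg v * f j" for j by (simp add: relabel_def f_def)
  show "if v then mono (relabel v n i) else antimono (relabel v n i)"
    unfolding mono_def antimono_def rl using mono_f by (auto simp: sg_def)
  have "(j + (int n + 2)) div (int n + 2) = j div (int n + 2) + 1" for j by simp
  then have f: "f (j + (int n + 2)) = f j + (int n + 1)" for j unfolding f_def by simp
  have n2: "int (Suc n) + 1 = int n + 2" by simp
  show "relabel v n i (j + (int (Suc n) + 1)) = relabel v n i j + sg v * (int n + 1)" for j
    unfolding rl n2 f by (simp add: algebra_simps)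
qed

text \<open>The preimages of consecutive points of the new configuration lie in a common closed arc of the old one,
  whose number is given by \<open>relabel\<close>; this covers the coincidences of \<open>t\<close> with old points as well.\<close>

lemma
  assumes z: "z \<in> standard_simplex n" and h: "homeo_lift v \<alpha> a b"
    and at: "a t = 0" and t: "xcut n z i \<le> t" "t \<le> xcut n z (i + 1)"
  shows moved_in_simplex: "moved v n \<alpha> z i t \<in> standard_simplex (Suc n)"
    and image_subset_moved: "\<alpha> ` proj ` cuts n z \<subseteq> proj ` cuts (Suc n) (moved v n \<alpha> z i t)"
    and idx_moved: "\<And>s. proj s \<notin> proj ` cuts (Suc n) (moved v n \<alpha> z i t) \<Longrightarrow>
      idx n z (b s) = relabel v n i (idx (Suc n) (moved v n \<alpha> z i t) s)"
proof -
  let ?w = "moved v n \<alpha> z i t"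
  interpret z: config n z by unfold_locales fact
  define Y where "Y = next_pt v n z i t"
  let ?c = "\<lambda>j. if v then i + int j else i + 1 - int j"
  define W where "W j = a (Y j)" for j
  have ab: "\<And>x. \<alpha> (proj x) = proj (a x)" "\<And>x. b (a x) = x" "\<And>x. a (b x) = x"
      "\<And>x y. x < y \<Longrightarrow> if v then a x < a y else a y < a x"
    using h by (auto simp: homeo_lift_def)
  have Y0: "Y 0 = t" and Yn: "Y (n + 2) = t + of_int (sg v)" by (simp_all add: Y_def next_pt_def)
  have Yj: "Y j = xcut n z (?c j)" if "1 \<le> j" "j \<le> n + 1" for j
    using that by (simp add: Y_def next_pt_def)
  have turn: "xcut n z (i + 1 + int (n + 1)) = xcut n z (i + 1) + 1" "xcut n z (i - int (n + 1)) = xcut n z i - 1"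
    using z.xcut_add[of "i + 1" 1] z.xcut_add[of i "-1"] by (simp_all add: algebra_simps)
  \<comment> \<open>The interval between two consecutive new points lies in an interval of the old configuration.\<close>
  have between: "xcut n z (relabel v n i (int r)) \<le> min (Y r) (Y (r + 1))"
      "max (Y r) (Y (r + 1)) \<le> xcut n z (relabel v n i (int r) + 1)"
      "if v then Y r \<le> Y (r + 1) else Y (r + 1) \<le> Y r" if r: "r \<le> n + 1" for r
  proof -
    have "int r div (int n + 2) = 0" using r by (simp add: div_pos_pos_trivial)
    then have rl: "relabel v n i (int r) = i + sg v * int r" by (simp add: relabel_def)
    have low: "xcut n z (i + int r) \<le> Y r" if v
      using that t r by (cases "r = 0") (simp_all add: Y0 Yj)
    have high: "Y (r + 1) \<le> xcut n z (i + int r + 1)" if v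
    proof (cases "r = n + 1")
      case True
      then show ?thesis using that t turn(1) Yn by (simp add: sg_def algebra_simps)
    next
      case False
      then show ?thesis using that r Yj[of "r + 1"] by (simp add: algebra_simps)
    qed
    have low': "Y r \<le> xcut n z (i - int r + 1)" if "\<not> v"
      using that t r by (cases "r = 0") (simp_all add: Y0 Yj algebra_simps)
    have high': "xcut n z (i - int r) \<le> Y (r + 1)" if "\<not> v"
    proof (cases "r = n + 1")
      case True
      then show ?thesis using that t turn(2) Yn by (simp add: sg_def algebra_simps)
    next
      case False
      then show ?thesis using that r Yj[of "r + 1"] by simp
    qed
    have incr: "Y r \<le> Y (r + 1)" if v
    proof (cases "r = n + 1")
      case True
      then have "Y r = xcut n z (i + int (n + 1))" using Yj[of r] that by simp
      also have "\<dots> = xcut n z i + 1" using z.xcut_add[of i 1] by (simp add: algebra_simps)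
      finally show ?thesis using True that t Yn by (simp add: sg_def)
    next
      case False
      then have "Y (r + 1) = xcut n z (i + int r + 1)" using that r Yj[of "r + 1"] by (simp add: algebra_simps)
      moreover have "Y r \<le> xcut n z (i + int r + 1)"
        using that t r z.xcut_mono[of "i + int r" "i + int r + 1"] by (cases "r = 0") (simp_all add: Y0 Yj)
      ultimately show ?thesis by simp
    qed
    have decr: "Y (r + 1) \<le> Y r" if "\<not> v"
    proof (cases "r = n + 1")
      case True
      then have "Y r = xcut n z (i + 1 - int (n + 1))" using Yj[of r] that by simp
      also have "\<dots> = xcut n z (i + 1) - 1" using z.xcut_add[of "i + 1" "-1"] by (simp add: algebra_simps)
      finally show ?thesis using True that t Yn by (simp add: sg_def)
    next
      case False
      then have "Y (r + 1) = xcut n z (i - int r)" using that r Yj[of "r + 1"] by simp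
      moreover have "xcut n z (i - int r) \<le> Y r"
        using that t r z.xcut_mono[of "i - int r" "i + 1 - int r"] by (cases "r = 0") (simp_all add: Y0 Yj)
      ultimately show ?thesis by simp
    qed
    show "if v then Y r \<le> Y (r + 1) else Y (r + 1) \<le> Y r" using incr decr by simp
    show "xcut n z (relabel v n i (int r)) \<le> min (Y r) (Y (r + 1))"
      unfolding rl using low incr high' decr by (cases v) (auto simp: sg_def)
    show "max (Y r) (Y (r + 1)) \<le> xcut n z (relabel v n i (int r) + 1)"
      unfolding rl using high incr low' decr by (cases v) (auto simp: sg_def)
  qed
  have W_mono: "W r \<le> W (r + 1)" if "r \<le> n + 1" for r
    using between(3)[OF that] ab(4)[of "Y r" "Y (r + 1)"] ab(4)[of "Y (r + 1)" "Y r"]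
    by (cases v; cases "Y r = Y (r + 1)") (auto simp: W_def)
  have W0: "W 0 = 0" using Y0 at by (simp add: W_def)
  have Wn: "W (n + 2) = 1"
    unfolding W_def Yn homeo_lift_add_int[OF h] by (simp add: at sg_def)
  have w: "?w j = (if j \<le> n + 1 then W (j + 1) - W j else 0)" for j
    by (simp add: moved_def disp_eq[OF h] W_def Y_def)
  have cut_w: "cut ?w j = W j" if "j \<le> n + 2" for j
    using that by (induction j) (auto simp: W0 cut_Suc w)
  have w_nonneg: "0 \<le> ?w j" for j using W_mono[of j] by (simp add: w)
  have w_sum: "sum ?w {..Suc n} = 1"
    using cut_w[of "n + 2"] Wn by (simp add: cut_def lessThan_Suc_atMost)
  have "?w j \<le> 1" for j
  proof (cases "j \<le> Suc n")
    case True
    then have "?w j \<le> sum ?w {..Suc n}" by (intro member_le_sum) (auto simp: w_nonneg)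
    then show ?thesis using w_sum by simp
  qed (simp add: w)
  then show w_in: "?w \<in> standard_simplex (Suc n)"
    using w_nonneg w_sum by (simp add: standard_simplex_def w)
  interpret w: config "Suc n" ?w by unfold_locales (rule w_in)
  let ?P = "proj ` cuts n z" and ?Q = "proj ` cuts (Suc n) ?w"
  have W_in: "proj (W j) \<in> ?Q" if "j \<le> n + 2" for j
    using that cut_w[OF that, symmetric] by (auto simp: cuts_def)
  show "\<alpha> ` ?P \<subseteq> ?Q"
  proof
    fix c assume "c \<in> \<alpha> ` ?P"
    then obtain u where u: "proj u \<in> ?P" "c = \<alpha> (proj u)" by auto
    then obtain k where k: "u = xcut n z k" using z.in_P_iff by blast
    \<comment> \<open>Up to translation, every old point is one of those that follow \<open>t\<close> within one turn; \<open>j\<close> is its place.\<close>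
    define m where "m = (if v then k - i - 1 else i - k)"
    define j where "j = nat (m mod (int n + 1)) + 1"
    have j: "1 \<le> j" "j \<le> n + 1" "int j = m mod (int n + 1) + 1"
      using pos_mod_sign[of "int n + 1" m] pos_mod_bound[of "int n + 1" m] by (simp_all add: j_def nat_le_iff)
    have m: "m = (m div (int n + 1)) * (int n + 1) + (int j - 1)" using j(3) div_mult_mod_eq[of m "int n + 1"] by linarith
    have "k = ?c j + sg v * (m div (int n + 1)) * (int n + 1)"
      using m unfolding m_def by (cases v) (auto simp: sg_def)
    then have "u = xcut n z (?c j) + of_int (sg v * (m div (int n + 1)))"
      using k z.xcut_add[of "?c j" "sg v * (m div (int n + 1))"] by simp
    then have "proj u = proj (Y j)" using Yj[OF j(1,2)] by (simp only: proj_add_int)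
    then have "c = proj (W j)" using u(2) ab(1) by (simp add: W_def)
    then show "c \<in> ?Q" using W_in j(2) by simp
  qed
  show "idx n z (b s) = relabel v n i (idx (Suc n) ?w s)" if s: "proj s \<notin> ?Q" for s
  proof -
    obtain q r where k: "idx (Suc n) ?w s = q * w.N + int r" "r \<le> Suc n" using w.divmod by metis
    define s' where "s' = s + of_int (- q)"
    have "of_int q + cut ?w r < s" "s < of_int q + cut ?w (Suc r)"
      using w.idx_strict[OF s] w.idx_bounds(2)[of s] w.xcut_of[of r q] w.xcut_of[of "Suc r" q] k
      by (simp_all add: add.assoc add.commute)
    then have "W r < s'" "s' < W (r + 1)" using cut_w[of r] cut_w[of "Suc r"] k(2) by (simp_all add: s'_def)
    then have bs: "if v then Y r < b s' \<and> b s' < Y (r + 1) else Y (r + 1) < b s' \<and> b s' < Y r"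
      using homeo_lift_sym(1)[OF h, of "W r" s'] homeo_lift_sym(1)[OF h, of s' "W (r + 1)"] ab(2)
      by (cases v) (simp_all add: W_def)
    have "idx n z (b s') = relabel v n i (int r)"
      using bs between(1,2)[of r] k(2) by (intro z.idx_unique) (auto split: if_splits)
    moreover have "b s = b s' + of_int (q * sg v)"
      using add_int_periodic[of b "of_int (sg v)", OF homeo_lift_sym(2)[OF h], of s' q] by (simp add: s'_def)
    ultimately have "idx n z (b s) = relabel v n i (int r) + q * sg v * (int n + 1)"
      using z.idx_add_int[of "b s'" "q * sg v"] by simp
    moreover have "relabel v n i (q * w.N + int r) = relabel v n i (int r) + q * sg v * (int n + 1)"
    proof -
      have N: "w.N = int n + 2" by simp
      have "(q * w.N + int r) div (int n + 2) = (int r + q * (int n + 2)) div (int n + 2)"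
        unfolding N by (simp only: add.commute)
      also have "\<dots> = q + int r div (int n + 2)" by (rule div_mult_self1) simp
      finally show ?thesis unfolding relabel_def by (simp add: algebra_simps)
    qed
    ultimately show ?thesis using k(1) by simp
  qed
qed

context dihedral
begin

text \<open>The image of the configuration under \<open>\<alpha>\<close> need not contain the base point, so \<open>t\<close> is added to it. By
  injectivity of the canonical map, it suffices to compare both sides over the resulting finite set; there
  they are pulled back along two numberings of its arcs, and these agree by the choice of \<open>relabel\<close>.\<close>

lemma act_formula:
  assumes z: "z \<in> standard_simplex n" and x: "x \<in> Set_at X (ncyc n)"
    and h: "homeo_lift v \<alpha> a b" and at: "a t = 0" and t: "xcut n z i \<le> t" "t \<le> xcut n z (i + 1)"
  shows "act X Xt \<alpha> (cls (n, x, z)) = cls (Suc n,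
      pull Xt v (ncyc_cover (Suc n)) (ncyc_cover n) (\<lambda>x. tick n (relabel v n i (slot (Suc n) x))) x, moved v n \<alpha> z i t)"
      (is "_ = cls (Suc n, ?y, ?w)")
proof -
  interpret z: config n z by unfold_locales fact
  note w_in = moved_in_simplex[OF z h at t] and sub = image_subset_moved[OF z h at t]
    and key = idx_moved[OF z h at t]
  interpret w: config "Suc n" ?w by unfold_locales (rule w_in)
  let ?P = "proj ` cuts n z" and ?Q = "proj ` cuts (Suc n) ?w"
  have x': "x \<in> Set_at Xt (Cat (ncyc_cover n))" using x Set_ncyc by simp
  let ?g = "\<lambda>x. tick n (relabel v n i (slot (Suc n) x))"
  have y: "?y \<in> Set_at X (ncyc (Suc n))"
    using pull_in[OF equivariant_relabel _ _ x'] ncyc_big by (simp add: Set_ncyc)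
  have I: "\<alpha> ` ?P \<in> index_sets" by (rule homeo_image_index[OF z.P_in_index])
  have big: "pi0 ?P \<in> DeltaD_big" "pi0 ?Q \<in> DeltaD_big" "pi0 (\<alpha> ` ?P) \<in> DeltaD_big"
    using pi0_big z.P_in_index w.P_in_index I by auto
  note gb = equivariant_homeo_inv[OF h z.P_in_index]
  have equivariant: "equivariant v (pi0_cover (\<alpha> ` ?P)) (ncyc_cover n) (\<lambda>s. config_map n z (b s))"
    using equivariant_comp[OF gb z.equivariant_config_map] by simp
  have equivariant': "equivariant v (pi0_cover ?Q) (ncyc_cover n) (\<lambda>s. config_map n z (b s))"
    using equivariant_comp[OF equivariant_forget[OF I w.P_in_index sub] equivariant] by simp
  define \<xi> where "\<xi> = pull Xt True (pi0_cover ?P) (ncyc_cover n) (config_map n z) x"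
  have \<xi>: "\<xi> \<in> S ?P" using canonical_rep_eq(3)[OF z x] by (simp add: \<xi>_def)
  have p: "(n, x, z) \<in> topspace (cells X)" "(Suc n, ?y, ?w) \<in> topspace (cells X)"
    using x z y w_in by (simp_all add: topspace_cells)
  have "rho Xt \<alpha> (canonical_map Xt (cls (n, x, z))) = rho Xt \<alpha> (in_colim Xt ?P \<xi>)"
    using canonical_map_cls[OF p(1)] canonical_rep_eq(1)[OF z x] by (simp add: \<xi>_def)
  also have "\<dots> = in_colim Xt (\<alpha> ` ?P) (pull Xt v (pi0_cover (\<alpha> ` ?P)) (pi0_cover ?P) b \<xi>)"
    by (rule rho_in_colim[OF h z.P_in_index \<xi>])
  also have "pull Xt v (pi0_cover (\<alpha> ` ?P)) (pi0_cover ?P) b \<xi> = pull Xt v (pi0_cover (\<alpha> ` ?P)) (ncyc_cover n) (\<lambda>s. config_map n z (b s)) x"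
    unfolding \<xi>_def using pull_comp[OF gb z.equivariant_config_map _ _ _ x'] big ncyc_big by simp
  also have "in_colim Xt (\<alpha> ` ?P) \<dots> = in_colim Xt ?Q (transition Xt (\<alpha> ` ?P) ?Q \<dots>)"
    using pull_in[OF equivariant _ _ x'] big ncyc_big by (intro in_colim_transition[symmetric] I w.P_in_index sub) simp
  also have "transition Xt (\<alpha> ` ?P) ?Q (pull Xt v (pi0_cover (\<alpha> ` ?P)) (ncyc_cover n) (\<lambda>s. config_map n z (b s)) x)
      = pull Xt v (pi0_cover ?Q) (ncyc_cover n) (\<lambda>s. config_map n z (b s)) x"
    using pull_comp[OF equivariant_forget[OF I w.P_in_index sub] equivariant _ _ _ x'] big ncyc_big
    by (simp add: transition_eq[OF I w.P_in_index sub])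
  also have "\<dots> = pull Xt v (pi0_cover ?Q) (ncyc_cover n) (\<lambda>s. ?g (config_map (Suc n) ?w s)) x"
    using pull_cong[OF equivariant', of "\<lambda>s. ?g (config_map (Suc n) ?w s)"] key by (simp add: config_map_def)
  also have "\<dots> = pull Xt True (pi0_cover ?Q) (ncyc_cover (Suc n)) (config_map (Suc n) ?w) ?y"
    using pull_comp[OF w.equivariant_config_map equivariant_relabel _ _ _ x'] big ncyc_big by simp
  also have "in_colim Xt ?Q \<dots> = canonical_map Xt (cls (Suc n, ?y, ?w))"
    using canonical_map_cls[OF p(2)] canonical_rep_eq(1)[OF w_in y] by simp
  finally show "act X Xt \<alpha> (cls (n, x, z)) = cls (Suc n, ?y, ?w)"
    by (rule act_eqI[OF cls_in[OF p(1)] cls_in[OF p(2)]])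
qed

end

definition simplex_space :: "nat \<Rightarrow> (nat \<Rightarrow> real) topology" where
  "simplex_space n = subtopology (powertop_real UNIV) (standard_simplex n)"

lemma topspace_simplex_space [simp]: "topspace (simplex_space n) = standard_simplex n"
  by (simp add: simplex_space_def)

lemma compact_simplex_space: "compact_space (simplex_space n)"
  using compactin_standard_simplex[of n] by (simp add: simplex_space_def compactin_subspace)

lemma continuous_coordinate: "continuous_map (simplex_space n) euclideanreal (\<lambda>z. z j)"
  unfolding simplex_space_def
  by (intro continuous_map_from_subtopology continuous_map_product_projection) simp

lemma continuous_xcut: "continuous_map (simplex_space n) euclideanreal (\<lambda>z. xcut n z k)"
  unfolding xcut_def cut_def
  by (intro continuous_map_add continuous_map_sum continuous_coordinate) auto

definition triple_space :: "nat \<Rightarrow> (((circle \<Rightarrow> circle) \<times> (nat \<Rightarrow> real)) \<times> real) topology" where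
  "triple_space n = prod_topology (prod_topology Homeo_topology (simplex_space n)) (top_of_set {0..1})"

text \<open>The pieces on which the image of a configuration has a fixed combinatorial type: the homeomorphism
  has degree \<open>sg v\<close> and takes the point \<open>t\<close> of the \<open>i\<close>-th arc to the base point. The point \<open>t\<close> is
  part of the data, and the arcs are closed, in order to make the pieces closed.\<close>

definition stratum :: "nat \<Rightarrow> int \<Rightarrow> bool \<Rightarrow> (((circle \<Rightarrow> circle) \<times> (nat \<Rightarrow> real)) \<times> real) set" where
  "stratum n i v = {q \<in> topspace (triple_space n). xcut n (snd (fst q)) i \<le> snd q \<and>
     snd q \<le> xcut n (snd (fst q)) (i + 1) \<and> fst (fst q) (proj (snd q)) = proj 0 \<and>
     disp (fst (fst q)) 0 1 = of_int (sg v)}"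

lemma continuous_rest:
  "continuous_map (triple_space n) Homeo_topology (\<lambda>q. fst (fst q))"
  "continuous_map (triple_space n) (simplex_space n) (\<lambda>q. snd (fst q))"
  "continuous_map (triple_space n) euclideanreal snd"
proof -
  show "continuous_map (triple_space n) Homeo_topology (\<lambda>q. fst (fst q))"
    unfolding triple_space_def
    by (rule continuous_map_compose[OF continuous_map_fst continuous_map_fst, unfolded o_def])
  show "continuous_map (triple_space n) (simplex_space n) (\<lambda>q. snd (fst q))"
    unfolding triple_space_def
    by (rule continuous_map_compose[OF continuous_map_fst continuous_map_snd, unfolded o_def])
  have "continuous_map (triple_space n) (top_of_set {0..1}) snd"
    unfolding triple_space_def by (rule continuous_map_snd)
  then show "continuous_map (triple_space n) euclideanreal snd"
    by (simp add: continuous_map_in_subtopology)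
qed

lemma continuous_rest_xcut:
  "continuous_map (triple_space n) euclideanreal (\<lambda>q. xcut n (snd (fst q)) k)"
  using continuous_map_compose[OF continuous_rest(2) continuous_xcut] by (simp add: o_def)

lemma continuous_rest_disp:
  assumes "continuous_map (triple_space n) euclideanreal f" "continuous_map (triple_space n) euclideanreal g"
  shows "continuous_map (triple_space n) euclideanreal (\<lambda>q. disp (fst (fst q)) (f q) (g q))"
  using continuous_map_compose[OF continuous_map_pairedI[OF continuous_rest(1) continuous_map_pairedI[OF assms]] continuous_disp]
  by (simp add: o_def)

lemma closedin_le:
  assumes "continuous_map T euclideanreal f" "continuous_map T euclideanreal g"
  shows "closedin T {q \<in> topspace T. f q \<le> g q}"
proof -
  have "continuous_map T euclideanreal (\<lambda>q. g q - f q)" by (intro continuous_map_diff assms)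
  then have "closedin T {q \<in> topspace T. g q - f q \<in> {0..}}"
    by (rule closedin_continuous_map_preimage) simp
  then show ?thesis by simp
qed

lemma closedin_stratum: "closedin (triple_space n) (stratum n i v)"
proof -
  let ?T = "triple_space n"
  have 1: "closedin ?T {q \<in> topspace ?T. xcut n (snd (fst q)) i \<le> snd q}"
    by (rule closedin_le[OF continuous_rest_xcut continuous_rest(3)])
  have 2: "closedin ?T {q \<in> topspace ?T. snd q \<le> xcut n (snd (fst q)) (i + 1)}"
    by (rule closedin_le[OF continuous_rest(3) continuous_rest_xcut])
  have 3: "closedin ?T {q \<in> topspace ?T. fst (fst q) (proj (snd q)) \<in> {proj 0}}"
  proof (rule closedin_continuous_map_preimage)
    show "continuous_map ?T euclidean (\<lambda>q. fst (fst q) (proj (snd q)))"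
      using continuous_map_compose[OF continuous_map_pairedI[OF continuous_rest(1,3)] continuous_eval]
      by (simp add: o_def)
    have "proj -` (- {proj 0}) = - (proj -` {proj 0})" by auto
    then have "open (- {proj 0})" using closed_vimage_proj[of "{proj 0}"] by (simp add: open_circle_def open_Compl)
    then show "closedin euclidean {proj 0}" by (simp add: closed_def)
  qed
  have 4: "closedin ?T {q \<in> topspace ?T. disp (fst (fst q)) 0 1 \<in> {of_int (sg v)}}"
    by (rule closedin_continuous_map_preimage[OF continuous_rest_disp]) auto
  have "stratum n i v = {q \<in> topspace ?T. xcut n (snd (fst q)) i \<le> snd q} \<inter>
      {q \<in> topspace ?T. snd q \<le> xcut n (snd (fst q)) (i + 1)} \<inter>
      {q \<in> topspace ?T. fst (fst q) (proj (snd q)) \<in> {proj 0}} \<inter>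
      {q \<in> topspace ?T. disp (fst (fst q)) 0 1 \<in> {of_int (sg v)}}"
    by (auto simp: stratum_def)
  then show ?thesis using 1 2 3 4 by (simp only: closedin_Int)
qed

lemma continuous_rest_moved:
  "continuous_map (triple_space n) euclideanreal (\<lambda>q. moved v n (fst (fst q)) (snd (fst q)) i (snd q) j)"
proof -
  have next_pt: "continuous_map (triple_space n) euclideanreal (\<lambda>q. next_pt v n (snd (fst q)) i (snd q) j)" for j
    unfolding next_pt_def using continuous_rest(3) continuous_rest_xcut continuous_map_add[OF continuous_rest(3)]
    by (cases "j = 0"; cases "j \<le> n + 1") simp_all
  have "continuous_map (triple_space n) euclideanreal (\<lambda>q. disp (fst (fst q))
      (next_pt v n (snd (fst q)) i (snd q) j) (next_pt v n (snd (fst q)) i (snd q) (j + 1)))"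
    by (rule continuous_rest_disp[OF next_pt next_pt])
  then show ?thesis unfolding moved_def by (cases "j \<le> n + 1") simp_all
qed

lemma stratumE:
  assumes "q \<in> stratum n i v"
  obtains a b where "homeo_lift v (fst (fst q)) a b" "a (snd q) = 0"
proof -
  have q: "fst (fst q) \<in> homeos" "fst (fst q) (proj (snd q)) = proj 0" "disp (fst (fst q)) 0 1 = of_int (sg v)"
    using assms by (auto simp: stratum_def triple_space_def topspace_Homeo)
  obtain w a b where h: "homeo_lift w (fst (fst q)) a b" using homeo_lift_exists[OF q(1)] by blast
  have "disp (fst (fst q)) 0 1 = a 1 - a 0" by (rule disp_eq[OF h])
  also have "\<dots> = of_int (sg w)" using homeo_lift_add_int[OF h, of 0 1] by simp
  finally have "w = v" using q(3) by (auto simp: sg_def split: if_splits)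
  have "proj (a (snd q)) = proj 0" using h q(2) by (simp add: homeo_lift_def)
  then obtain k :: int where k: "0 = a (snd q) + of_int k" using proj_eqE by blast
  then show ?thesis using that[OF homeo_lift_translate[OF h[unfolded \<open>w = v\<close>], of k]] by simp
qed

text \<open>The lift in \<open>[0, 1)\<close> of the preimage of the base point lies in one of the arcs.\<close>

lemma strata_cover:
  assumes \<alpha>: "\<alpha> \<in> homeos" and z: "z \<in> standard_simplex n"
  obtains i v t where "i \<in> {0..int n}" "((\<alpha>, z), t) \<in> stratum n i v"
proof -
  interpret config n z by unfold_locales fact
  obtain v a b where h: "homeo_lift v \<alpha> a b" using homeo_lift_exists[OF \<alpha>] by blast
  define t where "t = frac (b 0)"
  have t: "0 \<le> t" "t < 1" "b 0 = t + of_int \<lfloor>b 0\<rfloor>" using frac_lt_1[of "b 0"] by (auto simp: t_def frac_def)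
  have "proj t = proj (b 0)" by (subst t(3)) (simp only: proj_add_int)
  then have "\<alpha> (proj t) = proj (a (b 0))" using h by (simp add: homeo_lift_def)
  then have at: "\<alpha> (proj t) = proj 0" using h by (simp add: homeo_lift_def)
  have "0 \<le> idx n z t" using idx_galois[of 0 t] xcut_small[of 0] t by simp
  moreover have "\<not> int (Suc n) \<le> idx n z t"
    using idx_galois[of "int (Suc n)" t] xcut_small[of "Suc n"] cut_last t by simp
  ultimately have i: "idx n z t \<in> {0..int n}" by simp
  have "disp \<alpha> 0 1 = of_int (sg v)"
    using disp_eq[OF h, of 0 1] homeo_lift_add_int[OF h, of 0 1] by simp
  then have "((\<alpha>, z), t) \<in> stratum n (idx n z t) v"
    using \<alpha> z t at idx_bounds[of t] by (auto simp: stratum_def triple_space_def topspace_Homeo)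
  then show ?thesis using that i by blast
qed

context dihedral
begin

definition target :: "nat \<Rightarrow> 'x \<Rightarrow> int \<Rightarrow> bool \<Rightarrow> ((circle \<Rightarrow> circle) \<times> (nat \<Rightarrow> real)) \<times> real
    \<Rightarrow> (nat \<times> 'x \<times> (nat \<Rightarrow> real)) set" where
  "target n x i v q = cls (Suc n, pull Xt v (ncyc_cover (Suc n)) (ncyc_cover n) (\<lambda>x. tick n (relabel v n i (slot (Suc n) x))) x,
     moved v n (fst (fst q)) (snd (fst q)) i (snd q))"

lemma target_eq:
  assumes x: "x \<in> Set_at X (ncyc n)" and q: "((\<alpha>, z), t) \<in> stratum n i v"
  shows "act X Xt \<alpha> (cls (n, x, z)) = target n x i v ((\<alpha>, z), t)"
    and "moved v n \<alpha> z i t \<in> standard_simplex (Suc n)"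
proof -
  obtain a b where ab: "homeo_lift v \<alpha> a b" "a t = 0" using stratumE[OF q] by auto
  have z: "z \<in> standard_simplex n" "xcut n z i \<le> t" "t \<le> xcut n z (i + 1)"
    using q by (auto simp: stratum_def triple_space_def)
  show "act X Xt \<alpha> (cls (n, x, z)) = target n x i v ((\<alpha>, z), t)"
    using act_formula[OF z(1) x ab z(2,3)] by (simp add: target_def)
  show "moved v n \<alpha> z i t \<in> standard_simplex (Suc n)"
    using moved_in_simplex[OF z(1) ab z(2,3)] .
qed

lemma continuous_target:
  assumes x: "x \<in> Set_at X (ncyc n)"
  shows "continuous_map (subtopology (triple_space n) (stratum n i v)) (realization X) (target n x i v)"
proof -
  let ?T = "subtopology (triple_space n) (stratum n i v)"
  let ?y = "pull Xt v (ncyc_cover (Suc n)) (ncyc_cover n) (\<lambda>x. tick n (relabel v n i (slot (Suc n) x))) x"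
  let ?w = "\<lambda>q. moved v n (fst (fst q)) (snd (fst q)) i (snd q)"
  have y: "?y \<in> Set_at X (ncyc (Suc n))"
    using pull_in[OF equivariant_relabel] x ncyc_big by (simp add: Set_ncyc)
  have "continuous_map ?T (simplex_space (Suc n)) ?w"
    unfolding simplex_space_def continuous_map_in_subtopology continuous_map_componentwise_UNIV
  proof (intro conjI allI)
    show "continuous_map ?T euclideanreal (\<lambda>q. ?w q j)" for j
      by (rule continuous_map_from_subtopology[OF continuous_rest_moved])
    show "?w \<in> topspace ?T \<rightarrow> standard_simplex (Suc n)"
      using target_eq(2)[OF x] by auto
  qed
  moreover have "continuous_map ?T (discrete_topology (Set_at X (ncyc (Suc n)))) (\<lambda>q. ?y)"
    using y by simp
  ultimately have c1: "continuous_map ?T (prod_topology (discrete_topology (Set_at X (ncyc (Suc n)))) (simplex_space (Suc n)))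
      (\<lambda>q. (?y, ?w q))"
    by (intro continuous_map_pairedI)
  have c2: "continuous_map (prod_topology (discrete_topology (Set_at X (ncyc (Suc n)))) (simplex_space (Suc n)))
      (cells X) (\<lambda>p. (Suc n, p))"
    unfolding cells_def simplex_space_def
    using continuous_map_component_injection[of "Suc n" UNIV
        "\<lambda>n. prod_topology (discrete_topology (Set_at X (ncyc n))) (subtopology (powertop_real UNIV) (standard_simplex n))"]
    by simp
  have c3: "continuous_map (cells X) (realization X) cls"
    using quotient_map_cls by (rule quotient_imp_continuous_map)
  show ?thesis using continuous_map_compose[OF continuous_map_compose[OF c1 c2] c3] by (simp add: o_def target_def[abs_def])
qed

text \<open>The preimage of a closed set is the union of the projections of finitely many closed subsets of
  the strata, and the projection along the compact unit interval is closed.\<close>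

lemma continuous_act_cell:
  assumes x: "x \<in> Set_at X (ncyc n)"
  shows "continuous_map (prod_topology Homeo_topology (simplex_space n)) (realization X)
    (\<lambda>p. act X Xt (fst p) (cls (n, x, snd p)))"
  unfolding continuous_map_closedin
proof (intro conjI allI impI)
  let ?T = "prod_topology Homeo_topology (simplex_space n)"
  let ?f = "\<lambda>p. act X Xt (fst p) (cls (n, x, snd p))"
  show "?f \<in> topspace ?T \<rightarrow> topspace (realization X)"
  proof
    fix p assume p: "p \<in> topspace ?T"
    then have "cls (n, x, snd p) \<in> E" using x by (intro cls_in) (auto simp: topspace_cells)
    moreover have "fst p \<in> homeos" using p by (auto simp: topspace_Homeo)
    then obtain v a b where "homeo_lift v (fst p) a b" using homeo_lift_exists by blast
    ultimately show "?f p \<in> topspace (realization X)" using act_in by blast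
  qed
  fix C assume C: "closedin (realization X) C"
  define D where "D i v = {q \<in> stratum n i v. target n x i v q \<in> C}" for i v
  have "closedin (triple_space n) (D i v)" for i v
  proof -
    have "closedin (subtopology (triple_space n) (stratum n i v))
        {q \<in> topspace (subtopology (triple_space n) (stratum n i v)). target n x i v q \<in> C}"
      by (rule closedin_continuous_map_preimage[OF continuous_target[OF x] C])
    moreover have "{q \<in> topspace (subtopology (triple_space n) (stratum n i v)). target n x i v q \<in> C} = D i v"
      using closedin_subset[OF closedin_stratum] by (auto simp: D_def)
    ultimately show ?thesis using closedin_trans_full closedin_stratum by metis
  qed
  moreover have "closed_map (triple_space n) ?T fst"
    unfolding triple_space_def by (rule closed_map_fst) (simp add: compact_space_subtopology)
  ultimately have "closedin ?T (fst ` D i v)" for i v by (auto simp: closed_map_def)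
  then have "closedin ?T (\<Union>i\<in>{0..int n}. \<Union>v\<in>UNIV. fst ` D i v)"
    by (intro closedin_Union; auto intro!: closedin_Union)
  moreover have "{p \<in> topspace ?T. ?f p \<in> C} = (\<Union>i\<in>{0..int n}. \<Union>v\<in>UNIV. fst ` D i v)"
  proof (intro equalityI subsetI)
    fix p assume p: "p \<in> {p \<in> topspace ?T. ?f p \<in> C}"
    obtain \<alpha> z where e: "p = (\<alpha>, z)" by (metis surj_pair)
    have \<alpha>z: "\<alpha> \<in> homeos" "z \<in> standard_simplex n" "act X Xt \<alpha> (cls (n, x, z)) \<in> C"
      using p by (auto simp: e topspace_Homeo)
    obtain i v t where s: "i \<in> {0..int n}" "((\<alpha>, z), t) \<in> stratum n i v"
      using strata_cover[OF \<alpha>z(1,2)] by blast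
    then have "((\<alpha>, z), t) \<in> D i v" using \<alpha>z(3) target_eq(1)[OF x s(2)] by (simp add: D_def)
    then have "p \<in> fst ` D i v" unfolding e by force
    then show "p \<in> (\<Union>i\<in>{0..int n}. \<Union>v\<in>UNIV. fst ` D i v)" using s(1) by blast
  next
    fix p assume "p \<in> (\<Union>i\<in>{0..int n}. \<Union>v\<in>UNIV. fst ` D i v)"
    then obtain i v q where q: "q \<in> D i v" "p = fst q" by blast
    obtain \<alpha> z t where e: "q = ((\<alpha>, z), t)" by (metis surj_pair)
    have s: "((\<alpha>, z), t) \<in> stratum n i v" "target n x i v ((\<alpha>, z), t) \<in> C" using q(1) by (simp_all add: D_def e)
    then have "act X Xt \<alpha> (cls (n, x, z)) \<in> C" using target_eq(1)[OF x s(1)] by simp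
    moreover have "(\<alpha>, z) \<in> topspace ?T" using s(1) by (auto simp: stratum_def triple_space_def)
    ultimately show "p \<in> {p \<in> topspace ?T. ?f p \<in> C}" using q(2) by (simp add: e)
  qed
  ultimately show "closedin ?T {p \<in> topspace ?T. ?f p \<in> C}" by simp
qed

text \<open>The simplices are open in their disjoint union.\<close>

lemma continuous_act_cells:
  "continuous_map (prod_topology Homeo_topology (cells X)) (realization X) (\<lambda>(\<alpha>, c). act X Xt \<alpha> (cls c))"
  unfolding continuous_map_def
proof (intro conjI allI impI)
  let ?T = "prod_topology Homeo_topology (cells X)"
  let ?f = "\<lambda>(\<alpha>, c). act X Xt \<alpha> (cls c)"
  show "?f \<in> topspace ?T \<rightarrow> topspace (realization X)"
  proof
    fix p assume p: "p \<in> topspace ?T"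
    obtain \<alpha> c where e: "p = (\<alpha>, c)" by (metis surj_pair)
    then have "cls c \<in> E" using p by (intro cls_in) auto
    moreover obtain v a b where "homeo_lift v \<alpha> a b"
      using homeo_lift_exists[of \<alpha>] p by (auto simp: topspace_Homeo e)
    ultimately show "?f p \<in> topspace (realization X)" using act_in by (simp add: e)
  qed
  fix U assume U: "openin (realization X) U"
  show "openin ?T {p \<in> topspace ?T. ?f p \<in> U}"
    unfolding openin_prod_topology_alt
  proof (intro allI impI)
    fix \<alpha> c assume "(\<alpha>, c) \<in> {p \<in> topspace ?T. ?f p \<in> U}"
    moreover obtain n x z where c: "c = (n, x, z)" by (metis surj_pair)
    ultimately have \<alpha>: "\<alpha> \<in> homeos" "x \<in> Set_at X (ncyc n)" "z \<in> standard_simplex n"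
        "act X Xt \<alpha> (cls (n, x, z)) \<in> U"
      by (auto simp: topspace_Homeo topspace_cells)
    let ?S = "prod_topology Homeo_topology (simplex_space n)"
    have "openin ?S {p \<in> topspace ?S. act X Xt (fst p) (cls (n, x, snd p)) \<in> U}"
      by (rule openin_continuous_map_preimage[OF continuous_act_cell[OF \<alpha>(2)] U])
    moreover have "(\<alpha>, z) \<in> {p \<in> topspace ?S. act X Xt (fst p) (cls (n, x, snd p)) \<in> U}"
      using \<alpha> by (simp add: topspace_Homeo)
    ultimately obtain V W where VW: "openin Homeo_topology V" "openin (simplex_space n) W" "\<alpha> \<in> V" "z \<in> W"
      "V \<times> W \<subseteq> {p \<in> topspace ?S. act X Xt (fst p) (cls (n, x, snd p)) \<in> U}"
      unfolding openin_prod_topology_alt by meson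
    have W: "W \<subseteq> standard_simplex n" "V \<subseteq> homeos"
      using openin_subset[OF VW(2)] openin_subset[OF VW(1)] by (auto simp: topspace_Homeo)
    have "openin (cells X) ({n} \<times> {x} \<times> W)"
      unfolding cells_def openin_sum_topology
    proof (intro conjI ballI)
      show "{n} \<times> {x} \<times> W \<subseteq> Sigma UNIV (topspace \<circ> (\<lambda>n. prod_topology (discrete_topology (Set_at X (ncyc n)))
          (subtopology (powertop_real UNIV) (standard_simplex n))))"
        using \<alpha>(2) W by auto
      fix m
      have "{p. (m, p) \<in> {n} \<times> {x} \<times> W} = (if m = n then {x} \<times> W else {})" by auto
      moreover have "openin (prod_topology (discrete_topology (Set_at X (ncyc n)))
          (subtopology (powertop_real UNIV) (standard_simplex n))) ({x} \<times> W)"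
        using VW(2) \<alpha>(2) by (simp add: openin_prod_Times_iff simplex_space_def)
      ultimately show "openin (prod_topology (discrete_topology (Set_at X (ncyc m)))
          (subtopology (powertop_real UNIV) (standard_simplex m))) {p. (m, p) \<in> {n} \<times> {x} \<times> W}"
        by simp
    qed
    moreover have "V \<times> ({n} \<times> {x} \<times> W) \<subseteq> {p \<in> topspace ?T. ?f p \<in> U}"
      using VW(5) W \<alpha>(2) by (auto simp: topspace_Homeo topspace_cells)
    ultimately show "\<exists>V' W'. openin Homeo_topology V' \<and> openin (cells X) W' \<and> \<alpha> \<in> V' \<and> c \<in> W' \<and>
        V' \<times> W' \<subseteq> {p \<in> topspace ?T. ?f p \<in> U}"
      using VW(1,3,4) by (intro exI[of _ V] exI[of _ "{n} \<times> {x} \<times> W"]) (simp add: c)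
  qed
qed

lemma k_space_realization: "k_space (realization X)"
proof -
  have "locally_compact_space (prod_topology (discrete_topology (Set_at X (ncyc n)))
      (subtopology (powertop_real UNIV) (standard_simplex n)))" for n
    using compact_imp_locally_compact_space[OF compact_simplex_space[of n]]
    by (simp add: locally_compact_space_prod_topology simplex_space_def locally_compact_space_discrete_topology)
  then have "locally_compact_space (cells X)" by (simp add: cells_def locally_compact_space_sum_topology)
  then show ?thesis
    using k_space_quotient_map_image[OF quotient_map_cls] locally_compact_imp_k_space by blast
qed

text \<open>Over a compact set of homeomorphisms, which is a locally compact Hausdorff space, the product
  with the quotient map of the realization is a quotient map.\<close>

lemma k_continuous_act:
  "k_continuous (k_prod Homeo_topology (realization X)) (realization X) (\<lambda>(\<alpha>, p). act X Xt \<alpha> p)"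
  unfolding k_continuous_def
proof (intro conjI)
  let ?P = "prod_topology Homeo_topology (realization X)"
  let ?F = "\<lambda>(\<alpha>, p). act X Xt \<alpha> p"
  show "k_space (k_prod Homeo_topology (realization X))" by (simp add: k_prod_def k_space_kification)
  show "k_space (realization X)" by (rule k_space_realization)
  show "continuous_map (k_prod Homeo_topology (realization X)) (realization X) ?F"
    unfolding k_prod_def
  proof (rule continuous_map_from_k_space)
    show "k_space (kification ?P)" by (rule k_space_kification)
    fix K assume "compactin (kification ?P) K"
    then have K: "compactin ?P K" by simp
    define L where "L = fst ` K"
    have "compactin Homeo_topology L"
      unfolding L_def by (rule image_compactin[OF K continuous_map_fst])
    then have "compact_space (subtopology Homeo_topology L)" by (simp add: compactin_subspace)
    then have lc: "locally_compact_space (subtopology Homeo_topology L)"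
      by (rule compact_imp_locally_compact_space)
    have H: "Hausdorff_space (subtopology Homeo_topology L)"
      by (rule Hausdorff_space_subtopology[OF Hausdorff_Homeo])
    have q: "quotient_map (prod_topology (subtopology Homeo_topology L) (cells X))
        (prod_topology (subtopology Homeo_topology L) (realization X)) (\<lambda>(x, y). (x, cls y))"
      using quotient_map_prod_right[OF lc _ quotient_map_cls] H by blast
    have "continuous_map (prod_topology (subtopology Homeo_topology L) (cells X)) (realization X)
        (\<lambda>(\<alpha>, c). act X Xt \<alpha> (cls c))"
      unfolding prod_topology_subtopology by (rule continuous_map_from_subtopology[OF continuous_act_cells])
    moreover have "?F \<circ> (\<lambda>(x, y). (x, cls y)) = (\<lambda>(\<alpha>, c). act X Xt \<alpha> (cls c))" by (auto simp: fun_eq_iff)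
    ultimately have "continuous_map (prod_topology (subtopology Homeo_topology L) (realization X)) (realization X) ?F"
      by (intro continuous_compose_quotient_map[OF q]) simp
    then have "continuous_map (subtopology ?P (L \<times> topspace (realization X))) (realization X) ?F"
      by (simp only: prod_topology_subtopology)
    moreover have "K \<subseteq> L \<times> topspace (realization X)"
      using compactin_subset_topspace[OF K] by (force simp: L_def)
    ultimately have "continuous_map (subtopology ?P K) (realization X) ?F"
      by (rule continuous_map_from_subtopology_mono)
    then show "continuous_map (subtopology (kification ?P) K) (realization X) ?F"
      by (simp only: subtopology_kification_compact[OF K])
  qed
qed

end

theorem theorem1p4:
  fixes X Xt :: "'x zpresheaf"
  assumes "dihedral_set X"
    and "dihedral_extension X Xt"
  shows "filtered_diagram Xt \<and>
    canonical_rep Xt respects glue X \<and>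
    bij_betw (canonical_map Xt) (topspace (realization X)) (colim Xt) \<and>
    (\<forall>\<alpha>\<in>homeos. \<exists>!\<rho>. is_rho Xt \<alpha> \<rho>) \<and>
    group_action Homeo (topspace (realization X)) (act X Xt) \<and>
    k_continuous (k_prod Homeo_topology (realization X)) (realization X)
      (\<lambda>(\<alpha>, p). act X Xt \<alpha> p)"
proof -
  interpret dihedral X Xt by unfold_locales fact+
  have "\<forall>\<alpha>\<in>homeos. \<exists>!\<rho>. is_rho Xt \<alpha> \<rho>" using homeo_lift_exists rho_ex1 by metis
  then show ?thesis
    using filtered respects canonical_bij group_action_act k_continuous_act by blast
qed

end
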